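(* The image of $\Gamma \to (\mathbb{P}^3)^\vee$ is a non-singular quadric surface, and is dual to one of the quadrics in the pencil defining $C^\dagger$.
   Context: Let $E/K$ be an elliptic curve with a fixed rational $2$-torsion point $T$. Let $C, C^\dagger \subset \mathbb{P}^3$ be companion quadric intersections with respect to $T$: they are non-singular quadric intersections, isomorphic as curves with Jacobian $E$, the difference of their hyperplane sections represents $T$ in $\operatorname{Pic}^0(C) \cong E$, and we have a change of co-ordinates on $\mathbb{P}^7$ identifying their $2$-uple embeddings, under which the square of a linear form on $C^\dagger$ corresponds to a pushout form on $C$ (a quadratic form $f$ with $\operatorname{div}(f/x_1^2) = 2\mathfrak{b}$ for a divisor $\mathfrak{b}$ representing the class of $T$). The four singular quadrics in the pencil defining $C$ are cones over conics $\Gamma_1,\ldots,\Gamma_4$; projecting from the vertex gives $\nu_i : C \to \Gamma_i$ with fibre $\mathfrak{a}_i$, and the $\Gamma_i$ are ordered so that $\mathfrak{a}_1 - \mathfrak{a}_2 \sim \mathfrak{a}_3 - \mathfrak{a}_4$ represents $T$. Assume the non-split case: $\Gamma_1$ and $\Gamma_2$ are defined over a quadratic extension $L/K$ and are $\operatorname{Gal}(L/K)$-conjugates. Let $\Gamma = \operatorname{Res}_{L/K}\Gamma_1$. A point of $\Gamma$ gives conjugate points $P_1 \in \Gamma_1$, $P_2 \in \Gamma_2$; the tangent planes at these points on the cones over $\Gamma_1,\Gamma_2$ are given by conjugate linear forms $\ell_1,\ell_2$, and $\ell_1\ell_2$ is a pushout form on $C$. Via the companion identification this corresponds to (the square of)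 a linear form on $C^\dagger$, giving a natural map $\Gamma \to (\mathbb{P}^3)^\vee$, where $(\mathbb{P}^3)^\vee$ is the dual of the ambient space of $C^\dagger$. For a non-singular quadric $\{Q=0\}\subset\mathbb{P}^3$, its dual quadric $\{Q'=0\} \subset (\mathbb{P}^3)^\vee$ consists of its tangent planes; the matrix of $Q'$ is the inverse of that of $Q$. *)

theory Defs
  imports "HOL-Analysis.Analysis" "HOL-Algebra.Algebraic_Closure_Type"
begin

unbundle no fps_syntax

text \<open>
  The ground field is a type \<open>'k\<close>, embedded by \<open>to_ac\<close> in its algebraic closure
  \<open>'k alg_closure\<close>.  Varieties over the ground field are represented by their sets of geometric
  points, together with the field over which the equations have coefficients.  Since the
  algebraic closure is infinite, polynomials are identified with polynomial functions.
\<close>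

section \<open>Projective points, forms and morphisms\<close>

text \<open>The point with homogeneous coordinates \<open>x\<close> is the set of all its coordinate vectors.\<close>

definition proj :: "'a::field ^ 'n \<Rightarrow> ('a ^ 'n) set" where
  "proj x = {c *s x | c. c \<noteq> 0}"

definition hform :: "'a::field set \<Rightarrow> nat \<Rightarrow> ('a ^ 'n \<Rightarrow> 'a) \<Rightarrow> bool" where
  "hform S d F \<longleftrightarrow> (\<exists>c. range c \<subseteq> S \<and>
     F = (\<lambda>x. \<Sum>m | sum m UNIV = d. c m * (\<Prod>i\<in>UNIV. (x $ i) ^ (m i :: nat))))"

definition vanishes_on :: "('a ^ 'n \<Rightarrow> 'a::field) \<Rightarrow> ('a ^ 'n) set set \<Rightarrow> bool" where
  "vanishes_on F V \<longleftrightarrow> (\<forall>p\<in>V. \<forall>x\<in>p. F x = 0)"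

definition regular_map ::
  "'a::field set \<Rightarrow> ('a ^ 'n) set set \<Rightarrow> ('a ^ 'm) set set \<Rightarrow> (('a ^ 'n) set \<Rightarrow> ('a ^ 'm) set) \<Rightarrow> bool"
where
  "regular_map S V Y \<phi> \<longleftrightarrow> \<phi> ` V \<subseteq> Y \<and>
     (\<forall>p\<in>V. \<exists>d F. (\<forall>i. hform S d (\<lambda>x. F x $ i)) \<and> (\<forall>x\<in>p. F x \<noteq> 0) \<and>
        (\<forall>q\<in>V. \<forall>x\<in>q. F x \<noteq> 0 \<longrightarrow> \<phi> q = proj (F x)))"

definition iso_over ::
  "'a::field set \<Rightarrow> ('a ^ 'n) set set \<Rightarrow> ('a ^ 'm) set set \<Rightarrow> (('a ^ 'n) set \<Rightarrow> ('a ^ 'm) set) \<Rightarrow> bool"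
where
  "iso_over S V Y \<phi> \<longleftrightarrow>
     bij_betw \<phi> V Y \<and> regular_map S V Y \<phi> \<and> regular_map S Y V (inv_into V \<phi>)"

section \<open>Divisors on curves\<close>

text \<open>
  \<open>ideal_pow p n d H\<close>: the form \<open>H\<close> of degree \<open>d\<close> lies in the \<open>n\<close>-th power of the homogeneous
  ideal of the point \<open>p\<close>; this ideal is generated by linear forms.
\<close>

inductive ideal_pow :: "('a::field ^ 'n) set \<Rightarrow> nat \<Rightarrow> nat \<Rightarrow> ('a ^ 'n \<Rightarrow> 'a) \<Rightarrow> bool" for p where
  "hform UNIV d F \<Longrightarrow> ideal_pow p 0 d F"
| "ideal_pow p n d F \<Longrightarrow> hform UNIV 1 h \<Longrightarrow> (\<forall>x\<in>p. h x = 0) \<Longrightarrow>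
     ideal_pow p (Suc n) (Suc d) (\<lambda>x. h x * F x)"
| "ideal_pow p n d F \<Longrightarrow> ideal_pow p n d G \<Longrightarrow> ideal_pow p n d (\<lambda>x. F x + G x)"

text \<open>
  The germ of \<open>F\<close> at \<open>p\<close> lies in the \<open>n\<close>-th power of the maximal ideal of the local ring of
  \<open>V\<close> at \<open>p\<close>; the form \<open>G\<close> clears the denominators.
\<close>

definition order_ge :: "('a::field ^ 'n) set set \<Rightarrow> ('a ^ 'n \<Rightarrow> 'a) \<Rightarrow> ('a ^ 'n) set \<Rightarrow> nat \<Rightarrow> bool" where
  "order_ge V F p n \<longleftrightarrow> (\<exists>e G k H. hform UNIV e G \<and> (\<forall>x\<in>p. G x \<noteq> 0) \<and> ideal_pow p n k H \<and>
     (\<forall>q\<in>V. \<forall>x\<in>q. G x * F x = H x))"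

text \<open>The divisor cut out on a smooth irreducible curve \<open>V\<close> by a form not vanishing on it.\<close>

definition form_div :: "('a::field ^ 'n) set set \<Rightarrow> ('a ^ 'n \<Rightarrow> 'a) \<Rightarrow> ('a ^ 'n) set \<Rightarrow> int" where
  "form_div V F p = (if p \<in> V then int (GREATEST n. order_ge V F p n) else 0)"

definition lin_equiv ::
  "('a::field ^ 'n) set set \<Rightarrow> (('a ^ 'n) set \<Rightarrow> int) \<Rightarrow> (('a ^ 'n) set \<Rightarrow> int) \<Rightarrow> bool" where
  "lin_equiv V D D' \<longleftrightarrow> (\<exists>d F G. hform UNIV d F \<and> hform UNIV d G \<and>
     \<not> vanishes_on F V \<and> \<not> vanishes_on G V \<and>
     (\<forall>p. D p - D' p = form_div V F p - form_div V G p))"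

definition pt_div :: "'p \<Rightarrow> 'p \<Rightarrow> int" where
  "pt_div p q = (if q = p then 1 else 0)"

definition hyperplane_section :: "('a::field ^ 'n) set set \<Rightarrow> (('a ^ 'n) set \<Rightarrow> int) \<Rightarrow> bool" where
  "hyperplane_section V D \<longleftrightarrow> (\<exists>h. hform UNIV 1 h \<and> \<not> vanishes_on h V \<and> D = form_div V h)"

text \<open>Transport of divisors along a bijection \<open>\<phi>\<close> from \<open>V\<close> to \<open>Y\<close>.\<close>

definition pull_div :: "'p set \<Rightarrow> ('p \<Rightarrow> 'q) \<Rightarrow> ('q \<Rightarrow> int) \<Rightarrow> 'p \<Rightarrow> int" where
  "pull_div V \<phi> D p = (if p \<in> V then D (\<phi> p) else 0)"

definition push_div :: "'p set \<Rightarrow> 'q set \<Rightarrow> ('p \<Rightarrow> 'q) \<Rightarrow> ('p \<Rightarrow> int) \<Rightarrow> 'q \<Rightarrow> int" where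
  "push_div V Y \<phi> D q = (if q \<in> Y then D (inv_into V \<phi> q) else 0)"

section \<open>Elliptic curves and Jacobians\<close>

definition rational_pt :: "('k::field alg_closure ^ 'n) set \<Rightarrow> bool" where
  "rational_pt p \<longleftrightarrow> (\<exists>x. x \<noteq> 0 \<and> p = proj (\<chi> i. to_ac (x $ i)))"

text \<open>
  Smooth projective Weierstrass cubics with coefficients in the ground field.  The second
  conjunct is the Jacobian criterion (the three partial derivatives have no common zero on
  the curve).
\<close>

definition elliptic_curve :: "('k::field alg_closure ^ 3) set set \<Rightarrow> bool" where
  "elliptic_curve E \<longleftrightarrow> (\<exists>a1 a2 a3 a4 a6 :: 'k.
     let b1 = to_ac a1; b2 = to_ac a2; b3 = to_ac a3; b4 = to_ac a4; b6 = to_ac a6;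
         W = (\<lambda>v :: 'k alg_closure ^ 3. let x = v $ 1; y = v $ 2; z = v $ 3 in
               y^2 * z + b1 * x * y * z + b3 * y * z^2
               - (x^3 + b2 * x^2 * z + b4 * x * z^2 + b6 * z^3));
         Wx = (\<lambda>v :: 'k alg_closure ^ 3. let x = v $ 1; y = v $ 2; z = v $ 3 in
               b1 * y * z - (3 * x^2 + 2 * b2 * x * z + b4 * z^2));
         Wy = (\<lambda>v :: 'k alg_closure ^ 3. let x = v $ 1; y = v $ 2; z = v $ 3 in
               2 * y * z + b1 * x * z + b3 * z^2);
         Wz = (\<lambda>v :: 'k alg_closure ^ 3. let x = v $ 1; y = v $ 2; z = v $ 3 in
               y^2 + b1 * x * y + 2 * b3 * y * z
               - (b2 * x^2 + 2 * b4 * x * z + 3 * b6 * z^2))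
     in E = {proj v | v. v \<noteq> 0 \<and> W v = 0} \<and>
        (\<forall>v. v \<noteq> 0 \<longrightarrow> W v = 0 \<longrightarrow> \<not> (Wx v = 0 \<and> Wy v = 0 \<and> Wz v = 0)))"

definition origin :: "('k::field alg_closure ^ 3) set" where
  "origin = proj (vector [0, 1, 0])"

text \<open>The condition \<open>2 T = 0\<close> in the group law is expressed in the Picard group of \<open>E\<close>.\<close>

definition rational_two_torsion_pt ::
  "('k::field alg_closure ^ 3) set set \<Rightarrow> ('k alg_closure ^ 3) set \<Rightarrow> bool" where
  "rational_two_torsion_pt E T \<longleftrightarrow> T \<in> E \<and> rational_pt T \<and> T \<noteq> origin \<and>
     lin_equiv E (\<lambda>p. 2 * pt_div T p) (\<lambda>p. 2 * pt_div origin p)"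

definition galois :: "('k::field alg_closure \<Rightarrow> 'k alg_closure) \<Rightarrow> bool" where
  "galois \<tau> \<longleftrightarrow> bij \<tau> \<and> (\<forall>x y. \<tau> (x + y) = \<tau> x + \<tau> y) \<and> (\<forall>x y. \<tau> (x * y) = \<tau> x * \<tau> y) \<and>
     (\<forall>a. \<tau> (to_ac a) = to_ac a)"

definition act :: "('a \<Rightarrow> 'a) \<Rightarrow> ('a ^ 'n) set \<Rightarrow> ('a ^ 'n) set" where
  "act \<tau> p = (\<lambda>x. \<chi> i. \<tau> (x $ i)) ` p"

text \<open>
  \<open>\<psi>\<close> is a geometric isomorphism from \<open>V\<close> to \<open>E\<close> all of whose Galois twists differ from \<open>\<psi>\<close> by
  translations of \<open>E\<close>.  This identifies the Jacobian of \<open>V\<close> with \<open>E\<close>: the induced isomorphism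
  from the degree \<open>0\<close> divisor classes on \<open>V\<close> to those on \<open>E\<close>, the latter being \<open>E\<close> itself by
  \<open>P \<mapsto> (P) - (origin)\<close>, is Galois equivariant.
\<close>

definition has_jacobian ::
  "('k::field alg_closure ^ 'n) set set \<Rightarrow> ('k alg_closure ^ 3) set set \<Rightarrow>
   (('k alg_closure ^ 'n) set \<Rightarrow> ('k alg_closure ^ 3) set) \<Rightarrow> bool" where
  "has_jacobian V E \<psi> \<longleftrightarrow> iso_over UNIV V E \<psi> \<and>
     (\<forall>\<tau>. galois \<tau> \<longrightarrow> (\<forall>p\<in>V. \<forall>q\<in>V.
        let \<psi>' = act \<tau> \<circ> \<psi> \<circ> act (inv_into UNIV \<tau>)
        in lin_equiv E (\<lambda>r. pt_div (\<psi>' p) r - pt_div (\<psi> p) r)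
                       (\<lambda>r. pt_div (\<psi>' q) r - pt_div (\<psi> q) r)))"

definition represents ::
  "('k::field alg_closure ^ 'n) set set \<Rightarrow> ('k alg_closure ^ 3) set set \<Rightarrow>
   (('k alg_closure ^ 'n) set \<Rightarrow> ('k alg_closure ^ 3) set) \<Rightarrow>
   (('k alg_closure ^ 'n) set \<Rightarrow> int) \<Rightarrow> ('k alg_closure ^ 3) set \<Rightarrow> bool" where
  "represents V E \<psi> D T \<longleftrightarrow>
     lin_equiv E (push_div V E \<psi> D) (\<lambda>p. pt_div T p - pt_div origin p)"

section \<open>Quadrics and quadric intersections\<close>

text \<open>
  The characteristic is not \<open>2\<close> in what follows, and quadrics are given by symmetric matrices.
\<close>

definition qform :: "'a::field ^ 'n ^ 'n \<Rightarrow> 'a ^ 'n \<Rightarrow> 'a" where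
  "qform M x = scalar_product x (M *v x)"

definition quadric :: "'a::field ^ 'n ^ 'n \<Rightarrow> ('a ^ 'n) set set" where
  "quadric M = {proj x | x. x \<noteq> 0 \<and> qform M x = 0}"

text \<open>
  The set of tangent planes, in the dual projective space: \<open>proj \<xi>\<close> stands for the plane on
  which the linear form with coefficient vector \<open>\<xi>\<close> vanishes.
\<close>

definition dual_quadric :: "'a::field ^ 'n ^ 'n \<Rightarrow> ('a ^ 'n) set set" where
  "dual_quadric M = {proj (M *v x) | x. x \<noteq> 0 \<and> qform M x = 0}"

lemma dual_quadric_eq_quadric_inverse:
  fixes M :: "'a::field ^ 'n ^ 'n"
  assumes sym: "transpose M = M" and inv: "invertible M"
  shows "dual_quadric M = quadric (matrix_inv M)"
proof -
  have i: "M ** matrix_inv M = mat 1 \<and> matrix_inv M ** M = mat 1"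
    unfolding matrix_inv_def by (rule someI_ex) (use inv in \<open>simp add: invertible_def\<close>)
  have l: "matrix_inv M *v (M *v x) = x" for x
    using i by (simp add: matrix_vector_mul_assoc)
  have r: "M *v (matrix_inv M *v x) = x" for x
    using i by (simp add: matrix_vector_mul_assoc)
  have q: "qform (matrix_inv M) (M *v x) = qform M x" for x
    by (simp add: qform_def l scalar_product_def mult.commute)
  have "\<exists>y. proj x = proj (M *v y) \<and> y \<noteq> 0 \<and> qform M y = 0"
    if "x \<noteq> 0" "qform (matrix_inv M) x = 0" for x
    using that q[of "matrix_inv M *v x"] r[of x]
    by (intro exI[of _ "matrix_inv M *v x"]) auto
  moreover have "M *v x \<noteq> 0" if "x \<noteq> 0" for x
    using that l[of x] by auto
  ultimately show ?thesis
    unfolding dual_quadric_def quadric_def using q by fastforce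
qed

definition mat_scale :: "'a::field \<Rightarrow> 'a ^ 'n ^ 'm \<Rightarrow> 'a ^ 'n ^ 'm" (infixl "*k" 75) where
  "c *k M = (\<chi> i j. c * M $ i $ j)"

definition pencil :: "'a::field ^ 'n ^ 'n \<Rightarrow> 'a ^ 'n ^ 'n \<Rightarrow> ('a ^ 'n ^ 'n) set" where
  "pencil A B = {s *k A + t *k B | s t. (s, t) \<noteq> (0, 0)}"

definition ac_mat :: "'k::field ^ 'n ^ 'm \<Rightarrow> 'k alg_closure ^ 'n ^ 'm" where
  "ac_mat = map_matrix to_ac"

definition qi_curve :: "'k::field ^ 4 ^ 4 \<Rightarrow> 'k ^ 4 ^ 4 \<Rightarrow> ('k alg_closure ^ 4) set set" where
  "qi_curve A B = quadric (ac_mat A) \<inter> quadric (ac_mat B)"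

text \<open>Non-singularity is the Jacobian criterion at every geometric point.\<close>

definition nonsingular_qi :: "'k::field ^ 4 ^ 4 \<Rightarrow> 'k ^ 4 ^ 4 \<Rightarrow> bool" where
  "nonsingular_qi A B \<longleftrightarrow> transpose A = A \<and> transpose B = B \<and>
     (\<forall>x. x \<noteq> 0 \<longrightarrow> qform (ac_mat A) x = 0 \<longrightarrow> qform (ac_mat B) x = 0 \<longrightarrow>
        (\<forall>a b. a *s (ac_mat A *v x) + b *s (ac_mat B *v x) = 0 \<longrightarrow> a = 0 \<and> b = 0))"

section \<open>The conics\<close>

text \<open>
  Let \<open>M\<close> be a symmetric \<open>4 \<times> 4\<close> matrix of rank \<open>3\<close>.  The vertex of the cone it defines is the
  kernel of \<open>M\<close>.  A point of the projective plane of lines through the vertex is represented by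
  the corresponding \<open>2\<close>-dimensional linear subspace, and the base conic of the cone is the set
  of lines through the vertex contained in the cone.
\<close>

definition from_vertex :: "'a::field ^ 4 ^ 4 \<Rightarrow> ('a ^ 4) set \<Rightarrow> ('a ^ 4) set" where
  "from_vertex M p = vec.span (p \<union> {v. M *v v = 0})"

definition base_conic :: "'a::field ^ 4 ^ 4 \<Rightarrow> ('a ^ 4) set set" where
  "base_conic M = {from_vertex M (proj x) | x. M *v x \<noteq> 0 \<and> qform M x = 0}"

text \<open>
  The pullback of the point \<open>P\<close> of the conic under the projection from the vertex, as a divisor
  on \<open>V\<close>.  The maximal ideal of \<open>P\<close> is generated by the linear forms vanishing on the line \<open>P\<close>,
  so the multiplicity of a point in the fibre is the least order of such a form.
\<close>

definition fibre :: "('a::field ^ 4) set set \<Rightarrow> 'a ^ 4 ^ 4 \<Rightarrow> ('a ^ 4) set \<Rightarrow> ('a ^ 4) set \<Rightarrow> int" where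
  "fibre V M P p = (if p \<in> V \<and> from_vertex M p = P
     then (LEAST n. \<exists>h. hform UNIV 1 h \<and> \<not> vanishes_on h V \<and> (\<forall>x\<in>P. h x = 0) \<and>
                        n = form_div V h p)
     else 0)"

text \<open>
  \<open>l\<close> is the coefficient vector of a linear form defining the tangent plane to the cone along
  the line \<open>P\<close>.
\<close>

definition tangent_form :: "'a::field ^ 4 ^ 4 \<Rightarrow> ('a ^ 4) set \<Rightarrow> 'a ^ 4 \<Rightarrow> bool" where
  "tangent_form M P l \<longleftrightarrow> (\<exists>x\<in>P. M *v x \<noteq> 0 \<and> l = M *v x)"

definition quadratic_extension :: "'k::field alg_closure set \<Rightarrow> bool" where
  "quadratic_extension L \<longleftrightarrow>
     (\<exists>r. r \<notin> range to_ac \<and> L = {to_ac a + to_ac b * r | a b. True}) \<and>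
     (\<forall>x\<in>L. \<forall>y\<in>L. x * y \<in> L) \<and> (\<forall>x\<in>L. inverse x \<in> L)"

definition galois_conjugation ::
  "'k::field alg_closure set \<Rightarrow> ('k alg_closure \<Rightarrow> 'k alg_closure) \<Rightarrow> bool" where
  "galois_conjugation L \<sigma> \<longleftrightarrow> bij_betw \<sigma> L L \<and>
     (\<forall>x\<in>L. \<forall>y\<in>L. \<sigma> (x + y) = \<sigma> x + \<sigma> y \<and> \<sigma> (x * y) = \<sigma> x * \<sigma> y) \<and>
     (\<forall>a. \<sigma> (to_ac a) = to_ac a) \<and> (\<exists>x\<in>L. \<sigma> x \<noteq> x)"

text \<open>
  The geometric points of the restriction of scalars, from \<open>L\<close> to the ground field, of the conic
  over \<open>L\<close> defined by \<open>M\<close>.  After base change to the algebraic closure a restriction of scalars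
  becomes the product of the variety and its conjugate; the points rational over the ground
  field are the pairs of conjugate \<open>L\<close>-points.
\<close>

definition weil_res_conic ::
  "('a::field \<Rightarrow> 'a) \<Rightarrow> 'a ^ 4 ^ 4 \<Rightarrow> (('a ^ 4) set \<times> ('a ^ 4) set) set" where
  "weil_res_conic \<sigma> M = base_conic M \<times> base_conic (map_matrix \<sigma> M)"

section \<open>Companion quadric intersections\<close>

text \<open>
  \<open>outer a b\<close> is a matrix of the quadratic form \<open>(a \<bullet> x) (b \<bullet> x)\<close>, and \<open>outer x x\<close> is the image
  of \<open>x\<close> under the \<open>2\<close>-uple embedding, with values in the symmetric matrices.  The value at \<open>x\<close>
  of the quadratic form with matrix \<open>M\<close> is \<open>pairing M (outer x x)\<close>.
\<close>

definition outer :: "'a::field ^ 'n \<Rightarrow> 'a ^ 'n \<Rightarrow> 'a ^ 'n ^ 'n" where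
  "outer a b = (\<chi> i j. a $ i * b $ j)"

definition pairing :: "'a::field ^ 'n ^ 'n \<Rightarrow> 'a ^ 'n ^ 'n \<Rightarrow> 'a" where
  "pairing M S = (\<Sum>i\<in>UNIV. \<Sum>j\<in>UNIV. M $ i $ j * S $ i $ j)"

text \<open>
  The \<open>8\<close>-dimensional space whose projectivisation is the ambient space of the \<open>2\<close>-uple embedding
  of a quadric intersection: the hyperplanes containing the image of the curve are the quadratic
  forms in the pencil.
\<close>

definition two_uple_space :: "'k::field ^ 4 ^ 4 \<Rightarrow> 'k ^ 4 ^ 4 \<Rightarrow> ('k alg_closure ^ 4 ^ 4) set" where
  "two_uple_space A B =
     {S. transpose S = S \<and> pairing (ac_mat A) S = 0 \<and> pairing (ac_mat B) S = 0}"

text \<open>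
  The quadratic forms with matrices \<open>M\<close> on the first curve and \<open>M'\<close> on the second curve, viewed
  as linear forms on the ambient spaces of the \<open>2\<close>-uple embeddings, are identified up to a
  scalar by the change of coordinates \<open>\<Phi>\<close>.
\<close>

definition corresponds ::
  "'k::field ^ 4 ^ 4 \<Rightarrow> 'k ^ 4 ^ 4 \<Rightarrow> ('k alg_closure ^ 4 ^ 4 \<Rightarrow> 'k alg_closure ^ 4 ^ 4) \<Rightarrow>
   'k alg_closure ^ 4 ^ 4 \<Rightarrow> 'k alg_closure ^ 4 ^ 4 \<Rightarrow> bool" where
  "corresponds A B \<Phi> M M' \<longleftrightarrow>
     (\<exists>c. c \<noteq> 0 \<and> (\<forall>S \<in> two_uple_space A B. pairing M S = c * pairing M' (\<Phi> S)))"

definition pushout_form ::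
  "('k::field alg_closure ^ 4) set set \<Rightarrow> ('k alg_closure ^ 3) set set \<Rightarrow>
   (('k alg_closure ^ 4) set \<Rightarrow> ('k alg_closure ^ 3) set) \<Rightarrow> ('k alg_closure ^ 3) set \<Rightarrow>
   'k alg_closure ^ 4 ^ 4 \<Rightarrow> bool" where
  "pushout_form C E \<psi> T M \<longleftrightarrow> \<not> vanishes_on (qform M) C \<and>
     (\<exists>\<bb>. (\<forall>p. form_div C (qform M) p - 2 * form_div C (\<lambda>x. x $ 1) p = 2 * \<bb> p) \<and>
          represents C E \<psi> \<bb> T)"

definition companions ::
  "('k::field alg_closure ^ 3) set set \<Rightarrow> ('k alg_closure ^ 3) set \<Rightarrow>
   'k ^ 4 ^ 4 \<Rightarrow> 'k ^ 4 ^ 4 \<Rightarrow> (('k alg_closure ^ 4) set \<Rightarrow> ('k alg_closure ^ 3) set) \<Rightarrow>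
   'k ^ 4 ^ 4 \<Rightarrow> 'k ^ 4 ^ 4 \<Rightarrow> (('k alg_closure ^ 4) set \<Rightarrow> ('k alg_closure ^ 4) set) \<Rightarrow>
   ('k alg_closure ^ 4 ^ 4 \<Rightarrow> 'k alg_closure ^ 4 ^ 4) \<Rightarrow> bool" where
  "companions E T A B \<psi> A' B' \<phi> \<Phi> \<longleftrightarrow>
     (let C = qi_curve A B; C' = qi_curve A' B';
          W = two_uple_space A B; W' = two_uple_space A' B'
      in nonsingular_qi A B \<and> nonsingular_qi A' B' \<and>
         has_jacobian C E \<psi> \<and> iso_over (range to_ac) C C' \<phi> \<and>
         \<comment> \<open>the difference of the hyperplane sections represents \<open>T\<close>\<close>
         (\<exists>H H'. hyperplane_section C H \<and> hyperplane_section C' H' \<and>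
            represents C E \<psi> (\<lambda>p. pull_div C \<phi> H' p - H p) T) \<and>
         \<comment> \<open>\<open>\<Phi>\<close> is a change of coordinates over the ground field\<close>
         bij_betw \<Phi> W W' \<and>
         (\<forall>S\<in>W. \<forall>S'\<in>W. \<Phi> (S + S') = \<Phi> S + \<Phi> S') \<and> (\<forall>c. \<forall>S\<in>W. \<Phi> (c *k S) = c *k \<Phi> S) \<and>
         (\<forall>S. ac_mat S \<in> W \<longrightarrow> \<Phi> (ac_mat S) \<in> range ac_mat) \<and>
         \<comment> \<open>\<open>\<Phi>\<close> identifies the \<open>2\<close>-uple embeddings, compatibly with \<open>\<phi>\<close>\<close>
         (\<forall>p\<in>C. \<forall>x\<in>p. \<forall>y\<in>\<phi> p. \<exists>c. c \<noteq> 0 \<and> \<Phi> (outer x x) = c *k outer y y) \<and>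
         \<comment> \<open>squares of linear forms correspond to pushout forms\<close>
         (\<forall>\<xi>. \<xi> \<noteq> 0 \<longrightarrow>
            (\<exists>M. pushout_form C E \<psi> T M \<and> corresponds A B \<Phi> M (outer \<xi> \<xi>))))"

text \<open>
  The natural map from the restriction of scalars to the dual of the ambient space of the second
  curve; \<open>M1\<close> and \<open>M2\<close> are the matrices of the two conjugate cones.
\<close>

definition natural_map ::
  "'k::field ^ 4 ^ 4 \<Rightarrow> 'k ^ 4 ^ 4 \<Rightarrow> ('k alg_closure ^ 4 ^ 4 \<Rightarrow> 'k alg_closure ^ 4 ^ 4) \<Rightarrow>
   'k alg_closure ^ 4 ^ 4 \<Rightarrow> 'k alg_closure ^ 4 ^ 4 \<Rightarrow>
   ('k alg_closure ^ 4) set \<times> ('k alg_closure ^ 4) set \<Rightarrow> ('k alg_closure ^ 4) set" where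
  "natural_map A B \<Phi> M1 M2 = (\<lambda>(P1, P2). THE p. \<exists>\<xi> l1 l2. \<xi> \<noteq> 0 \<and> p = proj \<xi> \<and>
     tangent_form M1 P1 l1 \<and> tangent_form M2 P2 l2 \<and>
     corresponds A B \<Phi> (outer l1 l2) (outer \<xi> \<xi>))"

end

theory Submission
  imports Defs
begin

no_notation fps_nth (infixl "$" 75)

text \<open>
  Diagonalising the pencil over the algebraic closure, one finds coordinates in which the cones over
  the first two conics are \<open>Y\<^sup>2 = (Z - \<alpha> W) (Z - \<beta> W)\<close> and \<open>X\<^sup>2 = Z W\<close>.  A form on the curve is
  uniquely \<open>a + b X + c Y + d X Y\<close> with binary forms \<open>a, b, c, d\<close> in \<open>Z, W\<close>, and the norm to the
  functions of \<open>Z / W\<close> shows that a quotient of forms without poles is a form.  The tangents \<open>Z - \<alpha> W\<close>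
  and \<open>Z\<close> cut out twice a fibre of each of the two projections, so a form \<open>m\<close> whose divisor is twice
  one in the class of \<open>T\<close> has \<open>m (Z - \<alpha> W) Z = N\<^sup>2\<close> for a quadratic form \<open>N\<close>, necessarily in the span of
  \<open>X Y, Y Z, X (Z - \<alpha> W), Z (Z - \<alpha> W)\<close>, that is, in \<open>\<langle>Y, Z - \<alpha> W\<rangle> \<otimes> \<langle>X, Z\<rangle>\<close>.  The choice of square roots
  for the pushout forms of the \<open>\<xi>\<^sup>2\<close> can be made linear in \<open>\<xi>\<close>, and the products of tangents
  \<open>l1 l2\<close> correspond to the pure tensors: the image is a Segre quadric in the dual space.

  Its dual annihilates the images of the points of \<open>C'\<close>, so it is a member of the pencil over the
  algebraic closure.  The two cones have conjugate vertices, whose symmetric product is a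
  rational point of the ambient space of the two-uple embedding of \<open>C\<close>.  Its image \<open>S\<close> is a rational
  quadric in the dual space, and the member is singled out by \<open>(S N)\<^sup>2\<close> being scalar, hence rational.
\<close>

section \<open>Forms\<close>

text \<open>The hypotheses measure orders by powers of ideals of points and compare classes on
  \<open>E\<close>, while the argument needs identities between forms on \<open>C\<close>. Two
  explicit tools bridge this: norms down to binary forms give every form an order at every point,
  and local representations of \<open>\<psi>\<close> carry principal divisors back from
  \<open>E\<close> to \<open>C\<close>. That \<open>m (Z - \<alpha> W) Z\<close> is a square for
  each single \<open>\<xi>\<close> leaves one sign per \<open>\<xi>\<close>; the signs can be
  aligned because the bilinear values \<open>T \<xi> \<eta>\<close> have rank one at every point of
  the curve. The obstacle in the descent is that the ground field may be imperfect, so an element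
  fixed by all automorphisms of the closure need not be rational. Linear retractions of the closure
  onto the ground field are used instead. They do not respect products, which is why
  \<open>\<rho>\<close> and its square are treated as unrelated unknowns. The condition that the
  square of \<open>S N\<close> be scalar isolates one member of the pencil because the antidiagonal
  matrix \<open>Jp D2\<close> has the square diag(\<alpha>, \<beta>, \<beta>, \<alpha>), which is
  not scalar as \<alpha> and \<beta> differ.\<close>

lemma finite_exponents: "finite {m :: 'n::finite \<Rightarrow> nat. sum m UNIV = d}"
proof (rule finite_subset)
  show "{m :: 'n \<Rightarrow> nat. sum m UNIV = d} \<subseteq> PiE UNIV (\<lambda>_. {..d})"
    by (auto simp: PiE_def extensional_def) (metis finite iso_tuple_UNIV_I member_le_sum zero_le)
  show "finite (PiE (UNIV :: 'n set) (\<lambda>_. {..d}))" by (intro finite_PiE) auto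
qed

lemma hform_UNIV_mono: "hform S d F \<Longrightarrow> hform UNIV d F"
  unfolding hform_def by auto

lemma hform_monomial:
  fixes m :: "'n::finite \<Rightarrow> nat"
  assumes "sum m UNIV = d"
  shows "hform UNIV d (\<lambda>x :: 'a::field ^ 'n. c * (\<Prod>i\<in>UNIV. (x $ i) ^ m i))"
  unfolding hform_def
proof (intro exI[of _ "\<lambda>m'. if m' = m then c else 0"] conjI ext)
  fix x :: "'a ^ 'n"
  show "c * (\<Prod>i\<in>UNIV. (x $ i) ^ m i) = (\<Sum>m' | sum m' UNIV = d.
          (if m' = m then c else 0) * (\<Prod>i\<in>UNIV. (x $ i) ^ m' i))"
    using assms by (subst sum.remove[OF finite_exponents, of m]) (auto intro!: sum.neutral)
qed auto

lemma hform_add: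
  assumes "hform UNIV d F" "hform UNIV d G"
  shows "hform UNIV d (\<lambda>x. F x + G x)"
proof -
  obtain c c' where "F = (\<lambda>x. \<Sum>m | sum m UNIV = d. c m * (\<Prod>i\<in>UNIV. (x $ i) ^ m i))"
    "G = (\<lambda>x. \<Sum>m | sum m UNIV = d. c' m * (\<Prod>i\<in>UNIV. (x $ i) ^ m i))"
    using assms unfolding hform_def by auto
  then show ?thesis unfolding hform_def
    by (intro exI[of _ "\<lambda>m. c m + c' m"]) (auto simp: sum.distrib algebra_simps)
qed

lemma hform_zero: "hform UNIV d (\<lambda>x. 0)"
  unfolding hform_def by (rule exI[of _ "\<lambda>_. 0"]) auto

lemma hform_sum: "(\<And>a. a \<in> A \<Longrightarrow> hform UNIV d (F a)) \<Longrightarrow> hform UNIV d (\<lambda>x. \<Sum>a\<in>A. F a x)"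
  by (induction A rule: infinite_finite_induct) (auto intro: hform_zero hform_add)

lemma hform_const: "hform UNIV 0 (\<lambda>x. c)"
  using hform_monomial[of "\<lambda>_. 0" 0 c] by simp

lemma hform_coord_mult:
  fixes F :: "'a::field ^ 'n \<Rightarrow> 'a"
  assumes "hform UNIV d F" shows "hform UNIV (Suc d) (\<lambda>x. x $ i * F x)"
proof -
  obtain c where F: "F = (\<lambda>x. \<Sum>m | sum m UNIV = d. c m * (\<Prod>i\<in>UNIV. (x $ i) ^ m i))"
    using assms unfolding hform_def by auto
  have "x $ i * (c m * (\<Prod>j\<in>UNIV. (x $ j) ^ m j)) = c m * (\<Prod>j\<in>UNIV. (x $ j) ^ (m(i := Suc (m i))) j)"
    for x :: "'a ^ 'n" and m
    by (simp add: prod.remove[of UNIV i])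
  moreover have "sum (m(i := Suc (m i))) UNIV = Suc (sum m UNIV)" for m
    by (simp add: sum.remove[of UNIV i])
  ultimately show ?thesis
    unfolding F sum_distrib_left by (intro hform_sum) (simp only: mem_Collect_eq, intro hform_monomial, simp)
qed

text \<open>Replaces multi-indices by multiplication with one coordinate at a time: every monomial
  of positive degree is reached by restoring a variable that occurs in it.\<close>

lemma hform_induct [consumes 1, case_names const mult add]:
  fixes F :: "'a::field ^ 'n \<Rightarrow> 'a"
  assumes "hform UNIV d F"
    and const: "\<And>c. P 0 (\<lambda>_. c)"
    and mult: "\<And>d F i. hform UNIV d F \<Longrightarrow> P d F \<Longrightarrow> P (Suc d) (\<lambda>x. x $ i * F x)"
    and add: "\<And>d F G. hform UNIV d F \<Longrightarrow> hform UNIV d G \<Longrightarrow> P d F \<Longrightarrow> P d G \<Longrightarrow> P d (\<lambda>x. F x + G x)"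
  shows "P d F"
proof -
  obtain c where F: "F = (\<lambda>x. \<Sum>m | sum m UNIV = d. c m * (\<Prod>i\<in>UNIV. (x $ i) ^ m i))"
    using assms(1) unfolding hform_def by auto
  have mono: "P d (\<lambda>x. c * (\<Prod>i\<in>UNIV. (x $ i) ^ m i))" if "sum m UNIV = d" for m c d
    using that
  proof (induction d arbitrary: m)
    case 0
    then show ?case using const[of c] by simp
  next
    case (Suc d)
    then obtain i where i: "m i > 0" by (metis Zero_not_Suc gr0I sum.neutral)
    define m' where "m' = m(i := m i - 1)"
    have m: "m i = Suc (m' i)" "\<And>j. j \<noteq> i \<Longrightarrow> m j = m' j" using i by (auto simp: m'_def)
    have "sum m' UNIV = d" using Suc.prems m by (simp add: sum.remove[of UNIV i])
    note IH = Suc.IH[OF this]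
    have eq: "c * (\<Prod>i\<in>UNIV. (x $ i) ^ m i) = x $ i * (c * (\<Prod>i\<in>UNIV. (x $ i) ^ m' i))"
      for x :: "'a ^ 'n"
      using m by (simp add: prod.remove[of UNIV i])
    show ?case unfolding eq using mult[OF hform_monomial IH] \<open>sum m' UNIV = d\<close> by simp
  qed
  \<comment> \<open>The empty sum must be available in every degree; it is the constant zero
    multiplied repeatedly by a coordinate.\<close>
  have zero: "P d (\<lambda>_. 0)" for d
    using mult[OF hform_zero] const[of 0] by (induction d) auto
  have "P d (\<lambda>x. \<Sum>m\<in>A. c m * (\<Prod>i\<in>UNIV. (x $ i) ^ m i))" if "A \<subseteq> {m. sum m UNIV = d}" for A
    using finite_subset[OF that finite_exponents] that
  proof (induction A rule: finite_induct)
    case empty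
    then show ?case using zero by simp
  next
    case (insert m A)
    have "hform UNIV d (\<lambda>x. \<Sum>m\<in>A. c m * (\<Prod>i\<in>UNIV. (x $ i) ^ m i))"
      using insert.prems by (intro hform_sum hform_monomial) auto
    then show ?case using insert add[OF hform_monomial _ mono, of m d] by simp
  qed
  then show ?thesis unfolding F by blast
qed

lemma hform_mult:
  fixes F G :: "'a::field ^ 'n \<Rightarrow> 'a"
  assumes "hform UNIV d F" "hform UNIV e G"
  shows "hform UNIV (d + e) (\<lambda>x. F x * G x)"
proof -
  have scale: "hform UNIV e (\<lambda>x. c * G x)" if "hform UNIV e G" for c e and G :: "'a ^ 'n \<Rightarrow> 'a"
    using that
  proof (induction rule: hform_induct)
    case (mult d F i)
    then show ?case using hform_coord_mult[of d "\<lambda>x. c * F x" i] by (simp add: mult_ac)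
  qed (auto simp: algebra_simps intro: hform_const hform_add)
  from assms(1) show ?thesis
  proof (induction rule: hform_induct)
    case (const c)
    then show ?case using scale assms(2) by simp
  next
    case (mult d F i)
    then show ?case using hform_coord_mult[of "d+e" "\<lambda>x. F x * G x" i] by (simp add: mult_ac)
  next
    case (add d F G')
    then show ?case using hform_add by (simp add: distrib_right)
  qed
qed

lemma hform_scale: "hform UNIV d F \<Longrightarrow> hform UNIV d (\<lambda>x. c * F x)"
  using hform_mult[OF hform_const] by fastforce

lemma hform_minus: "hform UNIV d F \<Longrightarrow> hform UNIV d (\<lambda>x. - F x)"
  using hform_scale[of d F "-1"] by simp

lemma hform_diff: "hform UNIV d F \<Longrightarrow> hform UNIV d G \<Longrightarrow> hform UNIV d (\<lambda>x. F x - G x)"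
  using hform_add[OF _ hform_minus] by fastforce

lemma hform_power: "hform UNIV d F \<Longrightarrow> hform UNIV (n * d) (\<lambda>x. F x ^ n)"
  by (induction n) (auto intro: hform_const hform_mult)

lemma hform_coord: "hform UNIV 1 (\<lambda>x. x $ i)"
  using hform_coord_mult[OF hform_const[of 1]] by simp

lemma hform_0D: "hform UNIV 0 F \<Longrightarrow> \<exists>c. F = (\<lambda>_. c)"
proof -
  have "hform UNIV d F \<Longrightarrow> d = 0 \<Longrightarrow> \<exists>c. F = (\<lambda>_. c)" for d
    by (induction rule: hform_induct) auto
  then show "hform UNIV 0 F \<Longrightarrow> \<exists>c. F = (\<lambda>_. c)" by blast
qed

lemma hform_1D:
  fixes F :: "'a::field ^ 'n \<Rightarrow> 'a"
  assumes "hform UNIV 1 F" shows "\<exists>a. F = scalar_product a"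
proof -
  have "hform UNIV d F \<Longrightarrow> d = 1 \<Longrightarrow> \<exists>a. F = scalar_product a" for d
  proof (induction rule: hform_induct)
    case (mult d F i)
    then obtain c where "F = (\<lambda>_. c)" using hform_0D by auto
    then show ?case
      by (intro exI[of _ "c *s axis i 1"])
        (auto simp: scalar_product_def axis_def if_distrib if_distribR mult_ac cong: if_cong)
  next
    case (add d F G)
    then obtain a b where "F = scalar_product a" "G = scalar_product b" by auto
    then show ?case
      by (intro exI[of _ "a + b"]) (auto simp: scalar_product_def algebra_simps sum.distrib)
  qed auto
  with assms show ?thesis by blast
qed

lemma hform_compose:
  fixes F :: "'a::field ^ 'n \<Rightarrow> 'a" and \<Psi> :: "'a ^ 'm \<Rightarrow> 'a ^ 'n"
  assumes "hform UNIV d F" "\<And>i. hform UNIV e (\<lambda>x. \<Psi> x $ i)"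
  shows "hform UNIV (d * e) (\<lambda>x. F (\<Psi> x))"
  using assms(1)
proof (induction rule: hform_induct)
  case (mult d F i)
  then show ?case using hform_mult[OF assms(2)] by fastforce
qed (auto intro: hform_const hform_add)

lemma hform_homogeneous:
  assumes "hform UNIV d F" shows "F (c *s x) = c ^ d * F x"
  using assms by (induction rule: hform_induct) (auto simp: algebra_simps)

lemma hform_qform: "hform UNIV 2 (qform M)"
proof -
  have "hform UNIV (1 + 1) (\<lambda>x. \<Sum>i\<in>UNIV. x $ i * (\<Sum>j\<in>UNIV. M $ i $ j * x $ j))"
    by (intro hform_sum hform_mult[OF hform_coord] hform_scale hform_coord)
  then show ?thesis
    by (simp add: qform_def[abs_def] scalar_product_def matrix_vector_mult_def numeral_2_eq_2)
qed

section \<open>Powers of the ideal of a point\<close>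

lemma ideal_pow_hform: "ideal_pow p n d F \<Longrightarrow> hform UNIV d F"
proof (induction rule: ideal_pow.induct)
  case (2 n d F h)
  then show ?case using hform_mult[of 1 h d F] by simp
qed (auto intro: hform_add)

lemma ideal_pow_form_mult:
  assumes "ideal_pow p n d F" "hform UNIV e G"
  shows "ideal_pow p n (d + e) (\<lambda>x. F x * G x)"
  using assms(1)
proof (induction rule: ideal_pow.induct)
  case (1 d F)
  then show ?case using assms(2) by (intro ideal_pow.intros hform_mult)
next
  case (2 n d F h)
  then show ?case using ideal_pow.intros(2)[of p n "d + e" "\<lambda>x. F x * G x" h] by (simp add: mult_ac)
next
  case (3 n d F G)
  then show ?case using ideal_pow.intros(3)[of p n "d+e"] by (simp add: algebra_simps)
qed

lemma ideal_pow_mult: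
  assumes "ideal_pow p n d F" "ideal_pow p m e G"
  shows "ideal_pow p (n + m) (d + e) (\<lambda>x. F x * G x)"
  using assms(1)
proof (induction rule: ideal_pow.induct)
  case (1 d F)
  then show ?case using ideal_pow_form_mult[OF assms(2) 1] by (simp add: mult.commute add.commute)
next
  case (2 n d F h)
  then show ?case using ideal_pow.intros(2)[of p "n + m" "d + e" "\<lambda>x. F x * G x" h] by (simp add: mult_ac)
next
  case (3 n d F G)
  then show ?case using ideal_pow.intros(3)[of p "n + m" "d+e"] by (simp add: algebra_simps)
qed

text \<open>Zero lies in every power, but each linear factor raises the degree, so the degree has to
  be at least the exponent.\<close>

lemma ideal_pow_zero: "ideal_pow p n (n + d) (\<lambda>_. 0)"
proof (induction n)
  case 0
  then show ?case by (simp add: ideal_pow.intros hform_zero)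
next
  case (Suc n)
  have "hform UNIV 1 (\<lambda>_. 0)" by (rule hform_zero)
  from ideal_pow.intros(2)[OF Suc this] show ?case by simp
qed

lemma proj_eqI:
  assumes "c \<noteq> 0" shows "proj (c *s x) = proj x"
proof -
  have "\<exists>e. d *s (c *s x) = e *s x \<and> e \<noteq> 0" if "d \<noteq> 0" for d
    using that assms by (intro exI[of _ "d * c"]) (simp add: vec_eq_iff)
  moreover have "\<exists>e. d *s x = e *s (c *s x) \<and> e \<noteq> 0" if "d \<noteq> 0" for d
    using that assms by (intro exI[of _ "d / c"]) (simp add: vec_eq_iff)
  ultimately show ?thesis unfolding proj_def by blast
qed

lemma proj_self: "x \<in> proj x"
  unfolding proj_def by (rule CollectI, rule exI[of _ 1]) simp

lemma proj_eq_iff: "proj x = proj y \<longleftrightarrow> (\<exists>c. c \<noteq> 0 \<and> x = c *s y)"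
proof
  assume "proj x = proj y"
  then have "x \<in> proj y" using proj_self by blast
  then show "\<exists>c. c \<noteq> 0 \<and> x = c *s y" unfolding proj_def by blast
qed (auto simp: proj_eqI)

lemma mem_proj_iff: "y \<in> proj x \<longleftrightarrow> (\<exists>c. c \<noteq> 0 \<and> y = c *s x)"
  unfolding proj_def by blast

text \<open>Modulo the ideal of the point, every coordinate is a multiple of the \<open>i\<close>-th one.\<close>

lemma ideal_pow_vanishing:
  fixes F :: "'a::field ^ 'n \<Rightarrow> 'a"
  assumes F: "hform UNIV d F" and "F x = 0" and "x \<noteq> 0"
  shows "d > 0 \<and> ideal_pow (proj x) 1 d F \<or> F = (\<lambda>_. 0)"
proof -
  obtain i where i: "x $ i \<noteq> 0" using \<open>x \<noteq> 0\<close> by (metis vec_eq_iff zero_index)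
  \<comment> \<open>The difference between \<open>F y\<close> and the constant \<open>F x\<close>,
    homogenised with powers of the i-th coordinates so that both terms have degree
    \<open>d\<close>.\<close>
  have "d = 0 \<or> ideal_pow (proj x) 1 d (\<lambda>y. x $ i ^ d * F y - F x * y $ i ^ d)"
    using F
  proof (induction rule: hform_induct)
    case (mult d F j)
    have h: "hform UNIV 1 (\<lambda>y :: 'a ^ 'n. x $ i * y $ j - x $ j * y $ i)"
      by (intro hform_diff hform_scale hform_coord)
    have v: "\<forall>y\<in>proj x. x $ i * y $ j - x $ j * y $ i = 0" by (auto simp: proj_def)
    have "ideal_pow (proj x) 0 d (\<lambda>y. F x * y $ i ^ d)"
      using hform_power[OF hform_coord, of d i] by (auto intro!: ideal_pow.intros hform_scale)
    then have 1: "ideal_pow (proj x) 1 (Suc d)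
        (\<lambda>y. (x $ i * y $ j - x $ j * y $ i) * (F x * y $ i ^ d))"
      using ideal_pow.intros(2)[of "proj x" 0 d, OF _ h v] by simp
    have eq: "x $ i ^ Suc d * (y $ j * F y) - x $ j * F x * y $ i ^ Suc d =
       (x $ i * y $ j - x $ j * y $ i) * (F x * y $ i ^ d) +
       (x $ i ^ d * F y - F x * y $ i ^ d) * (x $ i * y $ j)" for y
      by (simp add: algebra_simps)
    show ?case
    proof (cases "d = 0")
      case True
      then obtain c where "F = (\<lambda>_. c)" using hform_0D mult by auto
      then show ?thesis using 1 True by (simp add: algebra_simps)
    next
      case False
      have l: "hform UNIV 1 (\<lambda>y. x $ i * y $ j)" by (intro hform_scale hform_coord)
      have "ideal_pow (proj x) 1 (d + 1)
         (\<lambda>y. (x $ i ^ d * F y - F x * y $ i ^ d) * (x $ i * y $ j))"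
        using ideal_pow_form_mult[OF _ l] mult False by auto
      then have "ideal_pow (proj x) 1 (Suc d) (\<lambda>y. x $ i ^ Suc d * (y $ j * F y) - x $ j * F x * y $ i ^ Suc d)"
        unfolding eq using 1 by (intro ideal_pow.intros(3)) auto
      then show ?thesis by blast
    qed
  next
    case (add d F G)
    have "x $ i ^ d * (F y + G y) - (F x + G x) * y $ i ^ d =
      (x $ i ^ d * F y - F x * y $ i ^ d) + (x $ i ^ d * G y - G x * y $ i ^ d)" for y
      by (simp add: algebra_simps)
    then show ?case using add by (auto intro: ideal_pow.intros(3))
  qed auto
  then show ?thesis
  proof
    assume "d = 0"
    then show ?thesis using hform_0D F assms by auto
  next
    assume "ideal_pow (proj x) 1 d (\<lambda>y. x $ i ^ d * F y - F x * y $ i ^ d)"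
    then have "ideal_pow (proj x) 1 d (\<lambda>y. x $ i ^ d * F y)" using assms by simp
    from ideal_pow_form_mult[OF this hform_const[of "1 / x $ i ^ d"]]
    have *: "ideal_pow (proj x) 1 d F" using i by simp
    have "n \<le> d'" if "ideal_pow p n d' H" for p n d' and H :: "'a ^ 'n \<Rightarrow> 'a"
      using that by (induction rule: ideal_pow.induct) auto
    then show ?thesis using * by fastforce
  qed
qed

section \<open>Binary forms\<close>

text \<open>The splitting into a multiple of \<open>z\<close> and a multiple of \<open>w\<close> is
  far from unique. Only the function counts, so this does no harm and gives an induction without
  coefficients.\<close>

inductive bform :: "nat \<Rightarrow> ('a::field \<Rightarrow> 'a \<Rightarrow> 'a) \<Rightarrow> bool" where
  bform_const: "bform 0 (\<lambda>z w. c)"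
| bform_Suc: "bform n a \<Longrightarrow> bform n b \<Longrightarrow> bform (Suc n) (\<lambda>z w. z * a z w + w * b z w)"

lemma bform_zero: "bform n (\<lambda>z w. 0)"
proof (induction n)
  case (Suc n)
  show ?case using bform_Suc[OF Suc Suc] by simp
qed (rule bform_const)

lemma bform_scale: "bform n a \<Longrightarrow> bform n (\<lambda>z w. c * a z w)"
proof (induction rule: bform.induct)
  case (bform_Suc n a b)
  show ?case using bform.bform_Suc[OF bform_Suc.IH] by (simp add: algebra_simps)
qed (rule bform_const)

lemma bform_add: "bform n a \<Longrightarrow> bform n b \<Longrightarrow> bform n (\<lambda>z w. a z w + b z w)"
proof (induction arbitrary: b rule: bform.induct)
  case (bform_const c)
  then show ?case by (cases rule: bform.cases) (auto intro: bform.bform_const)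
next
  case (bform_Suc n a b d)
  from bform_Suc.prems obtain e f where d: "d = (\<lambda>z w. z * e z w + w * f z w)" "bform n e" "bform n f"
    by (cases rule: bform.cases) auto
  show ?case using bform.bform_Suc[OF bform_Suc.IH(1)[OF d(2)] bform_Suc.IH(2)[OF d(3)]]
    by (simp add: d(1) algebra_simps)
qed

lemma bform_z: "bform n a \<Longrightarrow> bform (Suc n) (\<lambda>z w. z * a z w)"
  using bform_Suc[OF _ bform_zero] by fastforce

lemma bform_w: "bform n a \<Longrightarrow> bform (Suc n) (\<lambda>z w. w * a z w)"
  using bform_Suc[OF bform_zero] by fastforce

lemma bform_mult: "bform n a \<Longrightarrow> bform m b \<Longrightarrow> bform (n + m) (\<lambda>z w. a z w * b z w)"
proof (induction rule: bform.induct)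
  case (bform_const c)
  then show ?case using bform_scale by simp
next
  case (bform_Suc n a b)
  show ?case using bform.bform_Suc[OF bform_Suc.IH[OF bform_Suc.prems]]
    by (simp add: algebra_simps)
qed

lemma bform_homogeneous: "bform n a \<Longrightarrow> a (c * z) (c * w) = c ^ n * a z w"
  by (induction rule: bform.induct) (auto simp: algebra_simps)

text \<open>Dehomogenisation at \<open>w = 1\<close>. The degree of the polynomial drops exactly
  when the form vanishes at infinity, and the coefficient in degree \<open>n\<close> records the
  value there.\<close>

lemma bform_poly:
  assumes "bform n a"
  shows "\<exists>P. Polynomial.degree P \<le> n \<and> (\<forall>z. a z 1 = poly P z) \<and> a 1 0 = Polynomial.coeff P n"
  using assms
proof (induction rule: bform.induct)
  case (bform_const c)
  show ?case by (rule exI[of _ "[:c:]"]) auto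
next
  case (bform_Suc n a b)
  then obtain P Q where P: "Polynomial.degree P \<le> n" "\<forall>z. a z 1 = poly P z" "a 1 0 = Polynomial.coeff P n"
    and Q: "Polynomial.degree Q \<le> n" "\<forall>z. b z 1 = poly Q z" "b 1 0 = Polynomial.coeff Q n" by blast
  have "Polynomial.degree (pCons 0 P + Q) \<le> Suc n"
    using P(1) Q(1) by (intro degree_add_le) (auto intro: order.trans[OF degree_pCons_le])
  moreover have "Polynomial.coeff Q (Suc n) = 0" using Q(1) by (intro coeff_eq_0) auto
  ultimately show ?case using P Q by (intro exI[of _ "pCons 0 P + Q"]) auto
qed

text \<open>Division with remainder by the linear form that vanishes at \<open>(z0, w0)\<close>. The
  remainder is a multiple of a power of a coordinate which is non-zero at that point, so it
  disappears as soon as the form vanishes there. The clause for \<open>n = 0\<close> stands for the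
  degree -1, which \<open>n - 1\<close> cannot express.\<close>

lemma bform_divide:
  assumes "bform n a" and nz: "z0 \<noteq> 0 \<or> w0 \<noteq> 0"
  shows "\<exists>b c. (n = 0 \<longrightarrow> b = (\<lambda>z w. 0)) \<and> bform (n - 1) b \<and>
           (\<forall>z w. a z w = (w0 * z - z0 * w) * b z w + c * (if w0 \<noteq> 0 then w else z) ^ n)"
  using assms(1)
proof (induction rule: bform.induct)
  case (bform_const c)
  then show ?case
    by (intro exI[of _ "\<lambda>z w. 0"] exI[of _ c]) (auto intro: bform.bform_const)
next
  case (bform_Suc n a b)
  obtain a' s where a: "n = 0 \<longrightarrow> a' = (\<lambda>z w. 0)" "bform (n - 1) a'"
      "\<And>z w. a z w = (w0 * z - z0 * w) * a' z w + s * (if w0 \<noteq> 0 then w else z) ^ n"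
    using bform_Suc.IH(1) by auto
  obtain b' t where b: "n = 0 \<longrightarrow> b' = (\<lambda>z w. 0)" "bform (n - 1) b'"
      "\<And>z w. b z w = (w0 * z - z0 * w) * b' z w + t * (if w0 \<noteq> 0 then w else z) ^ n"
    using bform_Suc.IH(2) by auto
  have za: "bform n (\<lambda>z w. z * a' z w)" using a(1,2) bform_z[of "n - 1" a'] bform_zero[of n] by (cases n) auto
  have wb: "bform n (\<lambda>z w. w * b' z w)" using b(1,2) bform_w[of "n - 1" b'] bform_zero[of n] by (cases n) auto
  have wa: "bform n (\<lambda>z w. w * a' z w)" using a(1,2) bform_w[of "n - 1" a'] bform_zero[of n] by (cases n) auto
  have zb: "bform n (\<lambda>z w. z * b' z w)" using b(1,2) bform_z[of "n - 1" b'] bform_zero[of n] by (cases n) auto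
  show ?case
  proof (cases "w0 = 0")
    case False
    have "bform n (\<lambda>z w. (1 / w0) * a z w + (z0 / w0 * (w * a' z w) + w * b' z w))"
      by (intro bform_add bform_scale wa wb bform_Suc.hyps)
    moreover have "z * a z w + w * b z w = (w0 * z - z0 * w) *
        ((1 / w0) * a z w + (z0 / w0 * (w * a' z w) + w * b' z w)) + (z0 / w0 * s + t) * w ^ Suc n" for z w
    proof -
      \<comment> \<open>Modulo \<open>w0 * z - z0 * w\<close>, the variable \<open>z\<close> becomes
        \<open>r * w\<close>.\<close>
      define r where "r = z0 / w0"
      have z0: "z0 = r * w0" using False by (simp add: r_def)
      have 1: "z * a z w = (w0 * z - z0 * w) * ((1 / w0) * a z w) + r * w * a z w"
        using False by (simp add: field_simps z0)
      have 2: "r * w * a z w = r * w * ((w0 * z - z0 * w) * a' z w + s * w ^ n)"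
        using a(3) False by simp
      have 3: "w * b z w = w * ((w0 * z - z0 * w) * b' z w + t * w ^ n)"
        using b(3) False by simp
      show ?thesis using 1 unfolding r_def[symmetric] 2 3 by (simp add: algebra_simps)
    qed
    ultimately show ?thesis using False
      by (intro exI[of _ "\<lambda>z w. (1 / w0) * a z w + (z0 / w0 * (w * a' z w) + w * b' z w)"]
         exI[of _ "z0 / w0 * s + t"]) auto
  next
    case True
    then have z0: "z0 \<noteq> 0" using nz by simp
    have "bform n (\<lambda>z w. (- 1 / z0) * b z w + z * a' z w)"
      by (intro bform_add bform_scale za bform_Suc.hyps)
    moreover have "z * a z w + w * b z w = (w0 * z - z0 * w) *
        ((- 1 / z0) * b z w + z * a' z w) + s * z ^ Suc n" for z w
    proof -
      have "z * a z w = z * (- (z0 * w) * a' z w + s * z ^ n)" using a(3)[of z w] True by simp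
      then show ?thesis using z0 True by (simp add: algebra_simps)
    qed
    ultimately show ?thesis using True
      by (intro exI[of _ "\<lambda>z w. (- 1 / z0) * b z w + z * a' z w"] exI[of _ s]) auto
  qed
qed

text \<open>Integer degrees save case distinctions: the only binary form of negative degree is zero.\<close>

definition bf :: "int \<Rightarrow> ('a::field \<Rightarrow> 'a \<Rightarrow> 'a) \<Rightarrow> bool" where
  "bf n a \<longleftrightarrow> a = (\<lambda>z w. 0) \<or> (n \<ge> 0 \<and> bform (nat n) a)"

lemma bf_zero: "bf n (\<lambda>z w. 0)" by (simp add: bf_def)

lemma bf_scale: "bf n a \<Longrightarrow> bf n (\<lambda>z w. c * a z w)"
  by (auto simp: bf_def bform_scale)

lemma bf_add: "bf n a \<Longrightarrow> bf n b \<Longrightarrow> bf n (\<lambda>z w. a z w + b z w)"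
  unfolding bf_def using bform_add by auto

lemma bf_diff: "bf n a \<Longrightarrow> bf n b \<Longrightarrow> bf n (\<lambda>z w. a z w - b z w)"
  using bf_add[OF _ bf_scale[where c = "-1"]] by fastforce

lemma bf_mult: "bf n a \<Longrightarrow> bf m b \<Longrightarrow> n + m = k \<Longrightarrow> bf k (\<lambda>z w. a z w * b z w)"
  unfolding bf_def using bform_mult[of "nat n" a "nat m" b] by (auto simp: nat_add_distrib)

lemma bf_const: "bf 0 (\<lambda>z w. c)"
  by (simp add: bf_def bform_const)

lemma bf_linear: "bf 1 (\<lambda>z w. s * z + t * w)"
  using bform_Suc[OF bform_const[of s] bform_const[of t]] by (simp add: bf_def mult.commute)

lemma bf_z: "bf 1 (\<lambda>z w. z)" and bf_w: "bf 1 (\<lambda>z w. w)"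
  using bf_linear[of 1 0] bf_linear[of 0 1] by simp_all

lemma infinite_alg_closed: "infinite (UNIV :: 'a::alg_closed_field set)"
proof
  assume f: "finite (UNIV :: 'a set)"
  define p :: "'a poly" where "p = (\<Prod>a\<in>UNIV. [:- a, 1:]) + 1"
  have "Polynomial.degree (\<Prod>a\<in>(UNIV :: 'a set). [:- a, 1:]) = card (UNIV :: 'a set)"
    by (simp add: degree_prod_sum_eq)
  moreover have "card (UNIV :: 'a set) > 0" using f by (simp add: card_gt_0_iff)
  ultimately have "Polynomial.degree p > 0" unfolding p_def by (subst degree_add_eq_left) auto
  then obtain x where "poly p x = 0" using alg_closed_imp_poly_has_root by blast
  moreover have "poly (\<Prod>a\<in>(UNIV :: 'a set). [:- a, 1:]) x = 0"
    using f by (simp add: poly_prod)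
  ultimately show False by (simp add: p_def)
qed

lemma poly_all_0:
  fixes P :: "'a::alg_closed_field poly"
  assumes "\<And>z. poly P z = 0" shows "P = 0"
proof (rule ccontr)
  assume "P \<noteq> 0"
  then have "finite {z. poly P z = 0}" by (rule poly_roots_finite)
  then show False using assms infinite_alg_closed[where 'a = 'a] by simp
qed

text \<open>The dehomogenised polynomial has infinitely many roots, hence is zero, and its
  coefficient in the top degree is the value at infinity.\<close>

lemma bf_eq_0:
  fixes a :: "'a::alg_closed_field \<Rightarrow> 'a \<Rightarrow> 'a"
  assumes a: "bf n a" and 0: "\<And>z. a z 1 = 0"
  shows "a = (\<lambda>z w. 0)"
proof (cases "a = (\<lambda>z w. 0)")
  case False
  then have b: "bform (nat n) a" using a by (auto simp: bf_def)
  obtain P where P: "Polynomial.degree P \<le> nat n" "\<forall>z. a z 1 = poly P z" "a 1 0 = Polynomial.coeff P (nat n)"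
    using bform_poly[OF b] by blast
  have "P = 0" using P(2) 0 by (intro poly_all_0) auto
  then have 10: "a 1 0 = 0" using P by simp
  have "a z w = 0" for z w
  proof (cases "w = 0")
    case True
    then show ?thesis using 10 bform_homogeneous[OF b, of z 1 0] by simp
  next
    case False
    then show ?thesis using 0[of "z/w"] bform_homogeneous[OF b, of w "z / w" 1] by simp
  qed
  then show ?thesis by blast
qed

lemma bf_integral:
  fixes a b :: "'a::alg_closed_field \<Rightarrow> 'a \<Rightarrow> 'a"
  assumes a: "bf n a" and b: "bf m b" and 0: "\<And>z w. a z w * b z w = 0"
  shows "a = (\<lambda>z w. 0) \<or> b = (\<lambda>z w. 0)"
proof (rule ccontr)
  assume *: "\<not> ?thesis"
  then have "bform (nat n) a" "bform (nat m) b" using a b by (auto simp: bf_def)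
  then obtain P Q where P: "\<forall>z. a z 1 = poly P z" and Q: "\<forall>z. b z 1 = poly Q z"
    using bform_poly by meson
  have "P * Q = 0" using 0[of _ 1] P Q by (intro poly_all_0) auto
  then have "P = 0 \<or> Q = 0" by simp
  then show False using * P Q bf_eq_0[OF a] bf_eq_0[OF b] by auto
qed

lemma bf_cancel:
  fixes a b c :: "'a::alg_closed_field \<Rightarrow> 'a \<Rightarrow> 'a"
  assumes "bf n a" "bf m b" "bf m c" "a \<noteq> (\<lambda>z w. 0)" "\<And>z w. a z w * b z w = a z w * c z w"
  shows "b = c"
proof -
  have "(\<lambda>z w. b z w - c z w) = (\<lambda>z w. 0)"
    using bf_integral[OF assms(1) bf_diff[OF assms(2,3)]] assms(4,5) by (auto simp: algebra_simps)
  then show ?thesis by (metis (no_types, opaque_lifting) eq_iff_diff_eq_0 ext)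
qed

lemma bf_linear_divide:
  assumes a: "bf n a" and 0: "a z0 w0 = 0" and nz: "z0 \<noteq> 0 \<or> w0 \<noteq> 0"
  obtains b where "bf (n - 1) b" "\<And>z w. a z w = (w0 * z - z0 * w) * b z w"
proof (cases "a = (\<lambda>z w. 0)")
  case True
  then show ?thesis using that[OF bf_zero] by simp
next
  case False
  then have n: "n \<ge> 0" "bform (nat n) a" using a by (auto simp: bf_def)
  obtain b c where b: "nat n = 0 \<longrightarrow> b = (\<lambda>z w. 0)" "bform (nat n - 1) b"
     "\<And>z w. a z w = (w0 * z - z0 * w) * b z w + c * (if w0 \<noteq> 0 then w else z) ^ nat n"
    using bform_divide[OF n(2) nz] by auto
  have "c = 0" using b(3)[of z0 w0] 0 nz by (auto split: if_splits)
  moreover have "bf (n - 1) b"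
    using b(1,2) n(1) by (cases "n = 0") (auto simp: bf_def nat_diff_distrib)
  ultimately show ?thesis using that[of b] b(3) by simp
qed

text \<open>Infinity is a root if the coefficient in the top degree vanishes; otherwise the
  dehomogenised polynomial keeps its positive degree and has a root in the closed field.\<close>

lemma bf_root:
  fixes a :: "'a::alg_closed_field \<Rightarrow> 'a \<Rightarrow> 'a"
  assumes a: "bf n a" and "n > 0"
  obtains z0 w0 where "z0 \<noteq> 0 \<or> w0 \<noteq> 0" "a z0 w0 = 0"
proof (cases "a = (\<lambda>z w. 0)")
  case True
  then show ?thesis using that[of 1 0] by simp
next
  case False
  then have b: "bform (nat n) a" using a by (auto simp: bf_def)
  obtain P where P: "Polynomial.degree P \<le> nat n" "\<forall>z. a z 1 = poly P z" "a 1 0 = Polynomial.coeff P (nat n)"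
    using bform_poly[OF b] by blast
  show ?thesis
  proof (cases "Polynomial.coeff P (nat n) = 0")
    case True
    then show ?thesis using that[of 1 0] P by simp
  next
    case False
    then have "Polynomial.degree P \<ge> nat n" by (rule le_degree)
    then have "Polynomial.degree P > 0" using \<open>n > 0\<close> by simp
    then obtain z where "poly P z = 0" using alg_closed_imp_poly_has_root by blast
    then show ?thesis using that[of z 1] P by simp
  qed
qed

lemma bf_degree_0: "bf 0 a \<Longrightarrow> \<exists>c. a = (\<lambda>z w. c)"
  by (auto simp: bf_def elim: bform.cases)

lemma bf_neg: "bf n a \<Longrightarrow> n < 0 \<Longrightarrow> a = (\<lambda>z w. 0)"
  by (auto simp: bf_def)

text \<open>By infinite descent: the linear factor \<open>w0 z - z0 w\<close> divides \<open>a\<close>, hence \<open>b\<close>.\<close>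

lemma bf_nonsquare:
  fixes a b m :: "'a::alg_closed_field \<Rightarrow> 'a \<Rightarrow> 'a"
  assumes nz: "z0 \<noteq> 0 \<or> w0 \<noteq> 0" and m: "bf k m" and m0: "m z0 w0 \<noteq> 0"
    and "bf n a" "bf n' b" "2 * n = 1 + k + 2 * n'"
    and "\<And>z w. a z w ^ 2 = (w0 * z - z0 * w) * m z w * b z w ^ 2"
  shows "a = (\<lambda>z w. 0) \<and> b = (\<lambda>z w. 0)"
  using assms(4-)
\<comment> \<open>The measure is shifted by one because the descent has to pass from degree 0 to
  degree -1, where only the zero form is left.\<close>
proof (induction "nat (n + 1)" arbitrary: n n' a b rule: less_induct)
  case less
  define l where "l = (\<lambda>z w. w0 * z - z0 * w)"
  have l: "bf 1 l" using bf_linear[of w0 "- z0"] by (simp add: l_def)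
  have "l (if w0 = 0 then 0 else 1) (if w0 = 0 then 1 else 0) \<noteq> 0" using nz by (auto simp: l_def)
  then have lnz: "l \<noteq> (\<lambda>z w. 0)" by metis
  have mnz: "m \<noteq> (\<lambda>z w. 0)" using m0 by metis

  have b0: "b = (\<lambda>z w. 0)" if "a = (\<lambda>z w. 0)"
  proof -
    have "l z w * m z w * (b z w * b z w) = 0" for z w
      using less.prems(4)[of z w] that by (simp add: l_def power2_eq_square)
    then have "(\<lambda>z w. l z w * m z w) = (\<lambda>z w. 0) \<or> (\<lambda>z w. b z w * b z w) = (\<lambda>z w. 0)"
      by (intro bf_integral[OF bf_mult[OF l m refl] bf_mult[OF less.prems(2,2) refl]])
    moreover have "(\<lambda>z w. l z w * m z w) \<noteq> (\<lambda>z w. 0)"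
      using bf_integral[OF l m] lnz mnz by metis
    ultimately show ?thesis by (metis (no_types, opaque_lifting) ext mult_eq_0_iff)
  qed
  show ?case
  proof (cases "n < 0")
    case True
    then show ?thesis using b0 bf_neg less.prems(1) by blast
  next
    case False
    have "a z0 w0 ^ 2 = 0" using less.prems(4)[of z0 w0] by simp
    then obtain a' where a': "bf (n - 1) a'" "\<And>z w. a z w = l z w * a' z w"
      using bf_linear_divide[OF less.prems(1) _ nz] unfolding l_def by (metis power_eq_0_iff)
    have "(\<lambda>z w. l z w * (a' z w * a' z w)) = (\<lambda>z w. m z w * (b z w * b z w))"
    proof (rule bf_cancel[OF l _ _ lnz])
      show "bf (2 * n - 1) (\<lambda>z w. l z w * (a' z w * a' z w))"
        by (rule bf_mult[OF l bf_mult[OF a'(1) a'(1) refl]]) simp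
      show "bf (2 * n - 1) (\<lambda>z w. m z w * (b z w * b z w))"
        using less.prems(3) by (intro bf_mult[OF m bf_mult[OF less.prems(2,2) refl]]) simp
      show "l z w * (l z w * (a' z w * a' z w)) = l z w * (m z w * (b z w * b z w))" for z w
        using less.prems(4)[of z w] a'(2)[of z w] by (simp add: l_def power2_eq_square mult_ac)
    qed
    then have eq1: "l z w * (a' z w * a' z w) = m z w * (b z w * b z w)" for z w by metis
    have "b z0 w0 = 0" using eq1[of z0 w0] m0 by (simp add: l_def)
    then obtain b' where b': "bf (n' - 1) b'" "\<And>z w. b z w = l z w * b' z w"
      using bf_linear_divide[OF less.prems(2) _ nz] unfolding l_def by metis
    have "(\<lambda>z w. a' z w * a' z w) = (\<lambda>z w. l z w * m z w * (b' z w * b' z w))"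
    proof (rule bf_cancel[OF l _ _ lnz])
      show "bf (2 * n - 2) (\<lambda>z w. a' z w * a' z w)"
        by (rule bf_mult[OF a'(1) a'(1)]) simp
      show "bf (2 * n - 2) (\<lambda>z w. l z w * m z w * (b' z w * b' z w))"
        using less.prems(3) by (intro bf_mult[OF bf_mult[OF l m refl] bf_mult[OF b'(1,1) refl]]) simp
      show "l z w * (a' z w * a' z w) = l z w * (l z w * m z w * (b' z w * b' z w))" for z w
        using eq1[of z w] b'(2)[of z w] by (simp add: mult_ac)
    qed
    then have eq2: "a' z w ^ 2 = (w0 * z - z0 * w) * m z w * b' z w ^ 2" for z w
      unfolding l_def power2_eq_square by metis
    have "a' = (\<lambda>z w. 0) \<and> b' = (\<lambda>z w. 0)"
      using less.hyps[of "n - 1" a' "n' - 1" b'] a'(1) b'(1) less.prems(3) eq2 False by auto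
    then show ?thesis using a'(2) b'(2) by (auto intro!: ext)
  qed
qed

section \<open>Quadric intersections in normal form\<close>

lemma four_signs:
  fixes a b c d :: "'a::field"
  assumes two: "(2 :: 'a) \<noteq> 0"
    and e: "a + b + c + d = 0" "a - b + c - d = 0" "a + b - c - d = 0" "a - b - c + d = 0"
  shows "a = 0 \<and> b = 0 \<and> c = 0 \<and> d = 0"
proof -
  have "2 * (2 * a) = (a + b + c + d) + (a - b + c - d) + (a + b - c - d) + (a - b - c + d)"
    "2 * (2 * b) = (a + b + c + d) - (a - b + c - d) + (a + b - c - d) - (a - b - c + d)"
    "2 * (2 * c) = (a + b + c + d) + (a - b + c - d) - (a + b - c - d) - (a - b - c + d)"
    "2 * (2 * d) = (a + b + c + d) - (a - b + c - d) - (a + b - c - d) + (a - b - c + d)"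
    by (simp_all add: algebra_simps)
  moreover have "2 * 2 \<noteq> (0 :: 'a)" using two by (simp only: mult_eq_0_iff) simp
  ultimately show ?thesis unfolding e by simp
qed

text \<open>The curve is a cover of the line with coordinate \<open>Z : W\<close>, with group
  generated by the sign changes of \<open>X\<close> and \<open>Y\<close>. The conditions on \<alpha>
  and \<beta> say that the four branch points 0, infinity, \<alpha> and \<beta> are
  distinct.\<close>

locale normal_curve =
  fixes \<alpha> \<beta> :: "'a::alg_closed_field" and cX cY cZ cW :: "'a ^ 4 \<Rightarrow> 'a" and ex ey ez ew :: "'a ^ 4"
  assumes two: "(2 :: 'a) \<noteq> 0" and \<alpha>0: "\<alpha> \<noteq> 0" and \<beta>0: "\<beta> \<noteq> 0" and \<alpha>\<beta>: "\<alpha> \<noteq> \<beta>"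
    and lin: "hform UNIV 1 cX" "hform UNIV 1 cY" "hform UNIV 1 cZ" "hform UNIV 1 cW"
    and coords: "cX (x *s ex + y *s ey + z *s ez + w *s ew) = x"
      "cY (x *s ex + y *s ey + z *s ez + w *s ew) = y"
      "cZ (x *s ex + y *s ey + z *s ez + w *s ew) = z"
      "cW (x *s ex + y *s ey + z *s ez + w *s ew) = w"
    and basis: "cX p *s ex + cY p *s ey + cZ p *s ez + cW p *s ew = p"
begin

definition q :: "'a \<Rightarrow> 'a \<Rightarrow> 'a" where "q z w = (z - \<alpha> * w) * (z - \<beta> * w)"

definition V :: "('a ^ 4) set" where
  "V = {p. p \<noteq> 0 \<and> cX p ^ 2 = cZ p * cW p \<and> cY p ^ 2 = q (cZ p) (cW p)}"

definition pt :: "'a \<Rightarrow> 'a \<Rightarrow> 'a \<Rightarrow> 'a \<Rightarrow> 'a ^ 4" where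
  "pt x y z w = x *s ex + y *s ey + z *s ez + w *s ew"

lemma pt_coords [simp]: "cX (pt x y z w) = x" "cY (pt x y z w) = y" "cZ (pt x y z w) = z" "cW (pt x y z w) = w"
  by (simp_all add: pt_def coords)

lemma pt_basis: "pt (cX p) (cY p) (cZ p) (cW p) = p"
  by (simp add: pt_def basis)

lemma coords_zero [simp]: "cX 0 = 0" "cY 0 = 0" "cZ 0 = 0" "cW 0 = 0"
  using lin[THEN hform_homogeneous, where c = 0] by auto

lemma coords_smult: "cX (c *s p) = c * cX p" "cY (c *s p) = c * cY p" "cZ (c *s p) = c * cZ p" "cW (c *s p) = c * cW p"
  using lin[THEN hform_homogeneous] by auto

lemma pt_eq_0_iff: "pt x y z w = 0 \<longleftrightarrow> x = 0 \<and> y = 0 \<and> z = 0 \<and> w = 0"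
proof
  assume "pt x y z w = 0"
  then show "x = 0 \<and> y = 0 \<and> z = 0 \<and> w = 0" by (metis pt_coords coords_zero)
qed (simp add: pt_def)

lemma V_iff: "p \<in> V \<longleftrightarrow> (cZ p \<noteq> 0 \<or> cW p \<noteq> 0) \<and> cX p ^ 2 = cZ p * cW p \<and> cY p ^ 2 = q (cZ p) (cW p)"
proof -
  have "p \<noteq> 0" if "cZ p \<noteq> 0 \<or> cW p \<noteq> 0" using that by auto
  moreover have "cZ p \<noteq> 0 \<or> cW p \<noteq> 0" if "p \<noteq> 0" "cX p ^ 2 = cZ p * cW p" "cY p ^ 2 = q (cZ p) (cW p)"
    using that pt_basis[of p] pt_eq_0_iff[of "cX p" "cY p" "cZ p" "cW p"] by (auto simp: q_def)
  ultimately show ?thesis unfolding V_def by blast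
qed

lemma pt_in_V: "pt x y z w \<in> V \<longleftrightarrow> (z \<noteq> 0 \<or> w \<noteq> 0) \<and> x ^ 2 = z * w \<and> y ^ 2 = q z w"
  by (simp add: V_iff)

lemma sqrt_exists: "\<exists>x :: 'a. x ^ 2 = c"
  using nth_root_exists[of 2 c] by auto

lemma V_nonempty_over:
  assumes "z \<noteq> 0 \<or> w \<noteq> 0"
  obtains x y where "pt x y z w \<in> V" "pt (- x) y z w \<in> V" "pt x (- y) z w \<in> V" "pt (- x) (- y) z w \<in> V"
    "x ^ 2 = z * w" "y ^ 2 = q z w"
proof -
  obtain x where "x ^ 2 = z * w" using sqrt_exists by blast
  moreover obtain y where "y ^ 2 = q z w" using sqrt_exists by blast
  ultimately show ?thesis using that assms by (simp add: pt_in_V)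
qed

lemma q_homogeneous: "q (c * z) (c * w) = c ^ 2 * q z w"
  by (simp add: q_def power2_eq_square algebra_simps)

lemma V_smult: "c \<noteq> 0 \<Longrightarrow> p \<in> V \<Longrightarrow> c *s p \<in> V"
  unfolding V_iff coords_smult by (auto simp: q_homogeneous power2_eq_square)

lemma bf_q: "bf 2 q"
proof -
  have "bf 2 (\<lambda>z w. (1 * z + - \<alpha> * w) * (1 * z + - \<beta> * w))"
    by (rule bf_mult[OF bf_linear bf_linear]) simp
  then show ?thesis by (simp add: q_def[abs_def])
qed

lemma bf_zw: "bf 2 (\<lambda>z w. z * w)"
  by (rule bf_mult[OF bf_z bf_w]) simp

text \<open>The coordinate ring is free over the binary forms in \<open>Z, W\<close> on the basis 1,
  X, Y, XY, which spans the four eigenspaces of the sign changes. In \<open>has_nf\<close> the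
  degrees are lowered by those of the basis elements; a negative degree forces the coefficient to be
  zero.\<close>

definition nf :: "('a \<Rightarrow> 'a \<Rightarrow> 'a) \<Rightarrow> ('a \<Rightarrow> 'a \<Rightarrow> 'a) \<Rightarrow> ('a \<Rightarrow> 'a \<Rightarrow> 'a) \<Rightarrow> ('a \<Rightarrow> 'a \<Rightarrow> 'a) \<Rightarrow> 'a ^ 4 \<Rightarrow> 'a" where
  "nf a b c d p = a (cZ p) (cW p) + b (cZ p) (cW p) * cX p + c (cZ p) (cW p) * cY p + d (cZ p) (cW p) * cX p * cY p"

definition has_nf :: "int \<Rightarrow> ('a ^ 4 \<Rightarrow> 'a) \<Rightarrow> bool" where
  "has_nf n F \<longleftrightarrow> (\<exists>a b c d. bf n a \<and> bf (n - 1) b \<and> bf (n - 1) c \<and> bf (n - 2) d \<and> (\<forall>p\<in>V. F p = nf a b c d p))"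

lemma has_nfI:
  "bf n a \<Longrightarrow> bf (n - 1) b \<Longrightarrow> bf (n - 1) c \<Longrightarrow> bf (n - 2) d \<Longrightarrow> (\<And>p. p \<in> V \<Longrightarrow> F p = nf a b c d p) \<Longrightarrow> has_nf n F"
  unfolding has_nf_def by blast

lemma has_nf_add: "has_nf n F \<Longrightarrow> has_nf n G \<Longrightarrow> has_nf n (\<lambda>p. F p + G p)"
proof -
  assume "has_nf n F" "has_nf n G"
  then obtain a b c d a' b' c' d' where
    F: "bf n a" "bf (n - 1) b" "bf (n - 1) c" "bf (n - 2) d" "\<forall>p\<in>V. F p = nf a b c d p" and
    G: "bf n a'" "bf (n - 1) b'" "bf (n - 1) c'" "bf (n - 2) d'" "\<forall>p\<in>V. G p = nf a' b' c' d' p"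
    unfolding has_nf_def by blast
  show ?thesis
    by (rule has_nfI[OF bf_add[OF F(1) G(1)] bf_add[OF F(2) G(2)] bf_add[OF F(3) G(3)] bf_add[OF F(4) G(4)]])
      (use F(5) G(5) in \<open>auto simp: nf_def algebra_simps\<close>)
qed

lemma has_nf_scale: "has_nf n F \<Longrightarrow> has_nf n (\<lambda>p. t * F p)"
proof -
  assume "has_nf n F"
  then obtain a b c d where
    F: "bf n a" "bf (n - 1) b" "bf (n - 1) c" "bf (n - 2) d" "\<forall>p\<in>V. F p = nf a b c d p"
    unfolding has_nf_def by blast
  show ?thesis
    by (rule has_nfI[OF bf_scale[OF F(1), of t] bf_scale[OF F(2), of t] bf_scale[OF F(3), of t] bf_scale[OF F(4), of t]])
      (use F(5) in \<open>auto simp: nf_def algebra_simps\<close>)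
qed

lemma has_nf_coords:
  assumes "has_nf n F"
  shows "has_nf (n + 1) (\<lambda>p. cX p * F p)" "has_nf (n + 1) (\<lambda>p. cY p * F p)"
    "has_nf (n + 1) (\<lambda>p. cZ p * F p)" "has_nf (n + 1) (\<lambda>p. cW p * F p)"
proof -
  obtain a b c d where
    F: "bf n a" "bf (n - 1) b" "bf (n - 1) c" "bf (n - 2) d" "\<And>p. p \<in> V \<Longrightarrow> F p = nf a b c d p"
    using assms unfolding has_nf_def by blast
  have n: "n + 1 - 1 = n" "n + 1 - 2 = n - 1" by simp_all
  show "has_nf (n + 1) (\<lambda>p. cX p * F p)"
  proof (rule has_nfI[of _ "\<lambda>z w. z * w * b z w" a "\<lambda>z w. z * w * d z w" c])
    fix p assume p: "p \<in> V"
    then have x: "cX p * cX p = cZ p * cW p" by (simp add: V_iff power2_eq_square)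
    show "cX p * F p = nf (\<lambda>z w. z * w * b z w) a (\<lambda>z w. z * w * d z w) c p"
      unfolding F(5)[OF p] nf_def x[symmetric] by (simp add: algebra_simps)
  qed (use F bf_mult[OF bf_zw F(2), of "n + 1"] bf_mult[OF bf_zw F(4), of n] n in auto)
  show "has_nf (n + 1) (\<lambda>p. cY p * F p)"
  proof (rule has_nfI[of _ "\<lambda>z w. q z w * c z w" "\<lambda>z w. q z w * d z w" a b])
    fix p assume p: "p \<in> V"
    then have y: "q (cZ p) (cW p) = cY p * cY p" by (simp add: V_iff power2_eq_square)
    show "cY p * F p = nf (\<lambda>z w. q z w * c z w) (\<lambda>z w. q z w * d z w) a b p"
      unfolding F(5)[OF p] nf_def y by (simp add: algebra_simps)
  qed (use F bf_mult[OF bf_q F(3), of "n + 1"] bf_mult[OF bf_q F(4), of n] n in auto)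
  show "has_nf (n + 1) (\<lambda>p. cZ p * F p)"
    by (rule has_nfI[OF F(1)[THEN bf_mult[OF bf_z]] F(2)[THEN bf_mult[OF bf_z]]
          F(3)[THEN bf_mult[OF bf_z]] F(4)[THEN bf_mult[OF bf_z]]])
      (use F(5) in \<open>auto simp: nf_def algebra_simps\<close>)
  show "has_nf (n + 1) (\<lambda>p. cW p * F p)"
    by (rule has_nfI[OF F(1)[THEN bf_mult[OF bf_w]] F(2)[THEN bf_mult[OF bf_w]]
          F(3)[THEN bf_mult[OF bf_w]] F(4)[THEN bf_mult[OF bf_w]]])
      (use F(5) in \<open>auto simp: nf_def algebra_simps\<close>)
qed

lemma coord_combination: "p $ i = ex $ i * cX p + ey $ i * cY p + ez $ i * cZ p + ew $ i * cW p"
  by (subst (1) basis[of p, symmetric]) (simp add: mult.commute)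

lemma hform_has_nf: "hform UNIV n F \<Longrightarrow> has_nf (int n) F"
proof (induction rule: hform_induct)
  case (const c)
  show ?case by (rule has_nfI[of _ "\<lambda>_ _. c" "\<lambda>_ _. 0" "\<lambda>_ _. 0" "\<lambda>_ _. 0"])
    (auto simp: nf_def bf_zero bf_const)
next
  case (mult n F i)
  have "has_nf (int n + 1) (\<lambda>p. ex $ i * (cX p * F p) + ey $ i * (cY p * F p) + ez $ i * (cZ p * F p) + ew $ i * (cW p * F p))"
    by (intro has_nf_add has_nf_scale has_nf_coords mult)
  moreover have "p $ i * F p = ex $ i * (cX p * F p) + ey $ i * (cY p * F p) + ez $ i * (cZ p * F p) + ew $ i * (cW p * F p)" for p
    by (subst coord_combination) (simp add: algebra_simps)
  ultimately show ?case by (simp add: add.commute)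
qed (rule has_nf_add)

lemma hform_bf:
  assumes "bf (int n - int k) a" "hform UNIV k G"
  shows "hform UNIV n (\<lambda>p. a (cZ p) (cW p) * G p)"
proof (cases "a = (\<lambda>z w. 0)")
  case True
  then show ?thesis by (simp add: hform_zero)
next
  case False
  then have *: "n \<ge> k" "bform (n - k) a" using assms(1) by (auto simp: bf_def nat_diff_distrib)
  have "bform m a \<Longrightarrow> hform UNIV m (\<lambda>p. a (cZ p) (cW p))" for m
  proof (induction rule: bform.induct)
    case (bform_Suc n a b)
    then show ?case using hform_mult[OF lin(3)] hform_mult[OF lin(4)] by (auto intro: hform_add)
  qed (rule hform_const)
  from hform_mult[OF this[OF *(2)] assms(2)] show ?thesis using *(1) by simp
qed

lemma hform_nf:
  assumes "bf (int n) a" "bf (int n - 1) b" "bf (int n - 1) c" "bf (int n - 2) d"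
  shows "hform UNIV n (nf a b c d)"
proof -
  have "hform UNIV 2 (\<lambda>p. cX p * cY p)" using hform_mult[OF lin(1,2)] by (simp add: numeral_2_eq_2)
  then have "hform UNIV n (\<lambda>p. a (cZ p) (cW p) * 1 + b (cZ p) (cW p) * cX p + c (cZ p) (cW p) * cY p
      + d (cZ p) (cW p) * (cX p * cY p))"
    using assms by (intro hform_add hform_bf[OF _ hform_const] hform_bf[OF _ lin(1)] hform_bf[OF _ lin(2)]
        hform_bf[of n 2]) auto
  then show ?thesis by (simp add: nf_def[abs_def] mult.assoc)
qed

lemma bf_zero_onI:
  fixes a :: "'a \<Rightarrow> 'a \<Rightarrow> 'a"
  assumes "bf n a" "\<And>z w. z \<noteq> 0 \<or> w \<noteq> 0 \<Longrightarrow> a z w = 0"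
  shows "a = (\<lambda>z w. 0)"
  using assms by (intro bf_eq_0) auto

lemma q_nonzero: "q \<noteq> (\<lambda>z w. 0)"
proof
  assume "q = (\<lambda>z w. 0)"
  then have "q 1 0 = 0" by metis
  then show False by (simp add: q_def)
qed

lemma zw_nonzero: "(\<lambda>z w. z * w) \<noteq> (\<lambda>z w. 0 :: 'a)"
proof
  assume "(\<lambda>z w. z * w) = (\<lambda>z w. 0 :: 'a)"
  then have "(1 :: 'a) * 1 = 0" by metis
  then show False by simp
qed

text \<open>The sign changes of \<open>X\<close> and \<open>Y\<close> over a fixed point of the line
  separate the four summands. Each coefficient is first seen to vanish after multiplication by the
  square of its basis element, that is by \<open>z w\<close>, \<open>q\<close> or both, and these
  factors are cancelled in the domain of binary forms.\<close>

lemma nf_eq_0: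
  assumes bfs: "bf n a" "bf m b" "bf k c" "bf l d" and 0: "\<And>p. p \<in> V \<Longrightarrow> nf a b c d p = 0"
  shows "a = (\<lambda>z w. 0)" "b = (\<lambda>z w. 0)" "c = (\<lambda>z w. 0)" "d = (\<lambda>z w. 0)"
proof -
  have *: "a z w = 0 \<and> z * w * b z w = 0 \<and> q z w * c z w = 0 \<and> z * w * q z w * d z w = 0"
    if zw: "z \<noteq> 0 \<or> w \<noteq> 0" for z w
  proof -
    obtain x y where xy: "pt x y z w \<in> V" "pt (- x) y z w \<in> V" "pt x (- y) z w \<in> V" "pt (- x) (- y) z w \<in> V"
      "x ^ 2 = z * w" "y ^ 2 = q z w"
      by (rule V_nonempty_over[OF zw])
    have e: "a z w + b z w * x + c z w * y + d z w * x * y = 0" "a z w - b z w * x + c z w * y - d z w * x * y = 0"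
      "a z w + b z w * x - c z w * y - d z w * x * y = 0" "a z w - b z w * x - c z w * y + d z w * x * y = 0"
      using xy(1-4)[THEN 0] by (simp_all add: nf_def)
    have "a z w = 0" "b z w * x = 0" "c z w * y = 0" "d z w * x * y = 0"
      using four_signs[OF two e] by auto
    then show ?thesis unfolding xy(5,6)[symmetric] by auto
  qed
  show "a = (\<lambda>z w. 0)" using * by (intro bf_zero_onI[OF bfs(1)]) auto
  have "(\<lambda>z w. z * w * b z w) = (\<lambda>z w. 0)"
    using * by (intro bf_zero_onI[OF bf_mult[OF bf_zw bfs(2) refl]]) auto
  then show b: "b = (\<lambda>z w. 0)" using bf_integral[OF bf_zw bfs(2)] zw_nonzero by metis
  have "(\<lambda>z w. q z w * c z w) = (\<lambda>z w. 0)"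
    using * by (intro bf_zero_onI[OF bf_mult[OF bf_q bfs(3) refl]]) auto
  then show c: "c = (\<lambda>z w. 0)" using bf_integral[OF bf_q bfs(3)] q_nonzero by metis
  have "(\<lambda>z w. (z * w) * (q z w * d z w)) = (\<lambda>z w. 0)"
    using * by (intro bf_zero_onI[OF bf_mult[OF bf_zw bf_mult[OF bf_q bfs(4) refl] refl]]) (auto simp: mult_ac)
  then have "(\<lambda>z w. q z w * d z w) = (\<lambda>z w. 0)"
    using bf_integral[OF bf_zw bf_mult[OF bf_q bfs(4) refl]] zw_nonzero by metis
  then show "d = (\<lambda>z w. 0)" using bf_integral[OF bf_q bfs(4)] q_nonzero by metis
qed

text \<open>The norm to the field of functions of \<open>cZ / cW\<close>; it vanishes only at zero because none of
  \<open>z w\<close>, \<open>q\<close> and \<open>z w q\<close> is a square.\<close>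

lemma norm_nonzero:
  assumes bfs: "bf n a" "bf (n - 1) b" "bf (n - 1) c" "bf (n - 2) d"
    and A: "A = (\<lambda>z w. a z w ^ 2 + q z w * c z w ^ 2 - z * w * (b z w ^ 2 + q z w * d z w ^ 2))"
    and B: "B = (\<lambda>z w. 2 * (a z w * c z w - z * w * (b z w * d z w)))"
    and 0: "\<And>z w. A z w ^ 2 = q z w * B z w ^ 2"
  shows "a = (\<lambda>z w. 0) \<and> b = (\<lambda>z w. 0) \<and> c = (\<lambda>z w. 0) \<and> d = (\<lambda>z w. 0)"
proof -
  have sq: "bf (2 * k) (\<lambda>z w. f z w ^ 2)" if "bf k f" for k and f :: "'a \<Rightarrow> 'a \<Rightarrow> 'a"
    using bf_mult[OF that that, of "2 * k"] by (simp add: power2_eq_square)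
  have bA: "bf (2 * n) A" unfolding A
    using bf_mult[OF bf_q sq[OF bfs(3)], of "2 * n"] bf_mult[OF bf_q sq[OF bfs(4)], of "2 * n - 2"]
      sq[OF bfs(2)] by (intro bf_diff bf_add sq bfs bf_mult[OF bf_zw]) (auto simp: algebra_simps)
  have bB: "bf (2 * n - 1) B" unfolding B
    using bf_mult[OF bf_zw bf_mult[OF bfs(2,4) refl], of "2 * n - 1"]
    by (intro bf_scale bf_diff bf_mult[OF bfs(1,3)]) auto
  \<comment> \<open>The cofactor of \<open>Z - \<alpha> W\<close> in \<open>q\<close>; it is
    non-zero at the root \<alpha>.\<close>
  have m: "bf 1 (\<lambda>z w :: 'a. z - \<beta> * w)" using bf_linear[of 1 "- \<beta>"] by simp
  have "A = (\<lambda>z w. 0) \<and> B = (\<lambda>z w. 0)"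
    by (rule bf_nonsquare[of \<alpha> 1, OF _ m _ bA bB]) (use 0 \<alpha>\<beta> in \<open>auto simp: q_def\<close>)
  then have AB: "A z w = 0" "B z w = 0" for z w by auto
  have A0: "a z w ^ 2 + q z w * c z w ^ 2 = z * w * (b z w ^ 2 + q z w * d z w ^ 2)" for z w
    using AB(1)[of z w] by (simp add: A)
  have B0: "a z w * c z w = z * w * (b z w * d z w)" for z w
    using AB(2)[of z w] two by (simp add: B)
  have ab: "bf (2 * n) (\<lambda>z w. a z w ^ 2 - z * w * b z w ^ 2)"
    using bf_mult[OF bf_zw sq[OF bfs(2)], of "2 * n"] by (intro bf_diff sq bfs) auto
  have ad: "bf (2 * n) (\<lambda>z w. a z w ^ 2 - z * w * (q z w * d z w ^ 2))"
    using bf_mult[OF bf_zw bf_mult[OF bf_q sq[OF bfs(4)] refl], of "2 * n"] by (intro bf_diff sq bfs) auto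
  \<comment> \<open>Eliminating \<open>c\<close> from the two relations \<open>A = 0\<close> and
    \<open>B = 0\<close>: multiply the first by the square of \<open>a\<close> and insert the second
    for the product \<open>a c\<close>.\<close>
  have prod0: "(a z w ^ 2 - z * w * b z w ^ 2) * (a z w ^ 2 - z * w * (q z w * d z w ^ 2)) = 0" for z w
  proof -
    have "(a z w ^ 2 - z * w * b z w ^ 2) * (a z w ^ 2 - z * w * (q z w * d z w ^ 2)) =
      a z w ^ 2 * (a z w ^ 2 - z * w * (b z w ^ 2 + q z w * d z w ^ 2)) + q z w * (z * w * (b z w * d z w)) ^ 2"
      by (simp add: power2_eq_square algebra_simps)
    also have "\<dots> = 0"
      unfolding A0[symmetric] B0[symmetric] by (simp add: power2_eq_square algebra_simps)
    finally show ?thesis .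
  qed
  \<comment> \<open>The product \<open>z w\<close> is read as \<open>(- z) * (- w)\<close>: at the
    point \<open>(0, -1)\<close> the linear factor in the criterion for non-squares is
    \<open>- z\<close>, and \<open>- w\<close> is the cofactor.\<close>
  have neq: "bf 1 (\<lambda>z w :: 'a. - w)" using bf_linear[of 0 "- 1"] by simp
  have *: "a = (\<lambda>z w. 0) \<and> (b = (\<lambda>z w. 0) \<or> d = (\<lambda>z w. 0))"
    using bf_integral[OF ab ad prod0]
  proof
    assume "(\<lambda>z w. a z w ^ 2 - z * w * b z w ^ 2) = (\<lambda>z w. 0)"
    then have "a z w ^ 2 = (- 1 * z - 0 * w) * (- w) * b z w ^ 2" for z w
      by (metis (no_types, lifting) diff_zero eq_iff_diff_eq_0 minus_mult_minus mult_zero_left mult_1 mult_minus_left)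
    from bf_nonsquare[of 0 "- 1", OF _ neq _ bfs(1,2) _ this] show ?thesis by auto
  next
    assume "(\<lambda>z w. a z w ^ 2 - z * w * (q z w * d z w ^ 2)) = (\<lambda>z w. 0)"
    then have "a z w ^ 2 = z * w * (q z w * d z w ^ 2)" for z w by (metis eq_iff_diff_eq_0)
    then have eq: "a z w ^ 2 = (- 1 * z - 0 * w) * (- w * q z w) * d z w ^ 2" for z w by (simp add: mult_ac)
    from bf_nonsquare[of 0 "- 1", OF _ bf_mult[OF neq bf_q refl] _ bfs(1,4) _ eq] show ?thesis
      using \<alpha>0 \<beta>0 by (auto simp: q_def)
  qed
  have q2: "bf 2 (\<lambda>z w. q z w)" using bf_q by simp
  from * show ?thesis
  proof (elim conjE disjE)
    assume a: "a = (\<lambda>z w. 0)" and b: "b = (\<lambda>z w. 0)"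
    have "q z w * c z w ^ 2 = q z w * (z * w * d z w ^ 2)" for z w using A0[of z w] a b by (simp add: mult.assoc)
    moreover have "bf (2 * n - 2) (\<lambda>z w. z * w * d z w ^ 2)" "bf (2 * n - 2) (\<lambda>z w. c z w ^ 2)"
      using bf_mult[OF bf_zw sq[OF bfs(4)], of "2 * n - 2"] sq[OF bfs(3)] by (auto simp: algebra_simps)
    ultimately have "(\<lambda>z w. c z w ^ 2) = (\<lambda>z w. z * w * d z w ^ 2)"
      by (intro bf_cancel[OF bf_q _ _ q_nonzero])
    then have "c z w ^ 2 = (- 1 * z - 0 * w) * (- w) * d z w ^ 2" for z w
      by (metis (no_types, lifting) diff_zero minus_mult_minus mult_zero_left mult_1 mult_minus_left)
    from bf_nonsquare[of 0 "- 1", OF _ neq _ bfs(3,4) _ this] show ?thesis using a b by auto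
  next
    assume a: "a = (\<lambda>z w. 0)" and d: "d = (\<lambda>z w. 0)"
    have "(q z w * c z w) ^ 2 = (- 1 * z - 0 * w) * (- w * q z w) * b z w ^ 2" for z w
      using A0[of z w] a d by (simp add: power2_eq_square algebra_simps)
    from bf_nonsquare[of 0 "- 1", OF _ bf_mult[OF neq bf_q refl] _ bf_mult[OF bf_q bfs(3) refl] bfs(2) _ this]
    have "(\<lambda>z w. q z w * c z w) = (\<lambda>z w. 0)" "b = (\<lambda>z w. 0)"
      using \<alpha>0 \<beta>0 by (auto simp: q_def)
    then show ?thesis using bf_integral[OF bf_q bfs(3)] q_nonzero a d by metis
  qed
qed

text \<open>The cofactor is the product of the three other conjugates of \<open>F\<close> under the
  sign changes, which explains the degrees \<open>3 * n\<close> and \<open>4 * n\<close>. Changing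
  the sign of \<open>X\<close> leads to \<open>A + B Y\<close>; changing the sign of
  \<open>Y\<close> then leads to a binary form.\<close>

lemma norm_exists:
  assumes F: "hform UNIV n F" and nv: "\<exists>p\<in>V. F p \<noteq> 0"
  obtains G N where "hform UNIV (3 * n) G" "bf (int (4 * n)) N" "N \<noteq> (\<lambda>z w. 0)"
    "\<And>p. p \<in> V \<Longrightarrow> F p * G p = N (cZ p) (cW p)"
proof -
  obtain a b c d where bfs: "bf (int n) a" "bf (int n - 1) b" "bf (int n - 1) c" "bf (int n - 2) d"
    and Fp: "\<And>p. p \<in> V \<Longrightarrow> F p = nf a b c d p"
    using hform_has_nf[OF F] unfolding has_nf_def by blast
  define A where "A = (\<lambda>z w. a z w ^ 2 + q z w * c z w ^ 2 - z * w * (b z w ^ 2 + q z w * d z w ^ 2))"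
  define B where "B = (\<lambda>z w. 2 * (a z w * c z w - z * w * (b z w * d z w)))"
  define N where "N = (\<lambda>z w. A z w ^ 2 - q z w * B z w ^ 2)"
  have sq: "bf (2 * k) (\<lambda>z w. f z w ^ 2)" if "bf k f" for k and f :: "'a \<Rightarrow> 'a \<Rightarrow> 'a"
    using bf_mult[OF that that, of "2 * k"] by (simp add: power2_eq_square)
  have bA: "bf (2 * int n) A" unfolding A_def
    using bf_mult[OF bf_q sq[OF bfs(3)], of "2 * int n"] bf_mult[OF bf_q sq[OF bfs(4)], of "2 * int n - 2"]
      sq[OF bfs(2)] by (intro bf_diff bf_add sq bfs bf_mult[OF bf_zw]) (auto simp: algebra_simps)
  have bB: "bf (2 * int n - 1) B" unfolding B_def
    using bf_mult[OF bf_zw bf_mult[OF bfs(2,4) refl], of "2 * int n - 1"]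
    by (intro bf_scale bf_diff bf_mult[OF bfs(1,3)]) auto
  have bN: "bf (int (4 * n)) N" unfolding N_def
    using sq[OF bA] bf_mult[OF bf_q sq[OF bB], of "4 * int n"] by (intro bf_diff) auto
  have b0: "bf k (\<lambda>z w. - f z w)" if "bf k f" for k and f :: "'a \<Rightarrow> 'a \<Rightarrow> 'a"
    using bf_scale[OF that, of "- 1"] by simp
  have "hform UNIV n (nf a (\<lambda>z w. - b z w) c (\<lambda>z w. - d z w))"
    using bfs by (intro hform_nf b0) auto
  moreover have "hform UNIV (2 * n) (nf A (\<lambda>z w. 0) (\<lambda>z w. - B z w) (\<lambda>z w. 0))"
    using bA bB by (intro hform_nf b0 bf_zero) auto
  ultimately have "hform UNIV (3 * n) (\<lambda>p. nf a (\<lambda>z w. - b z w) c (\<lambda>z w. - d z w) p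
      * nf A (\<lambda>z w. 0) (\<lambda>z w. - B z w) (\<lambda>z w. 0) p)"
    using hform_mult by fastforce
  moreover have "F p * (nf a (\<lambda>z w. - b z w) c (\<lambda>z w. - d z w) p
      * nf A (\<lambda>z w. 0) (\<lambda>z w. - B z w) (\<lambda>z w. 0) p) = N (cZ p) (cW p)" if "p \<in> V" for p
  proof -
    have x: "cX p ^ 2 = cZ p * cW p" and y: "cY p ^ 2 = q (cZ p) (cW p)" using that by (auto simp: V_iff)
    have 1: "nf a b c d p * nf a (\<lambda>z w. - b z w) c (\<lambda>z w. - d z w) p = A (cZ p) (cW p) + B (cZ p) (cW p) * cY p"
      unfolding nf_def A_def B_def y[symmetric] x[symmetric] by (simp add: power2_eq_square algebra_simps)
    have 2: "(A (cZ p) (cW p) + B (cZ p) (cW p) * cY p) * nf A (\<lambda>z w. 0) (\<lambda>z w. - B z w) (\<lambda>z w. 0) p = N (cZ p) (cW p)"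
      unfolding nf_def N_def y[symmetric] by (simp add: power2_eq_square algebra_simps)
    show ?thesis unfolding Fp[OF that] mult.assoc[symmetric] 1 2 ..
  qed
  moreover have "N \<noteq> (\<lambda>z w. 0)"
  proof
    assume "N = (\<lambda>z w. 0)"
    then have "A z w ^ 2 = q z w * B z w ^ 2" for z w unfolding N_def by (metis eq_iff_diff_eq_0)
    from norm_nonzero[OF bfs A_def B_def this] have "\<forall>p\<in>V. F p = 0" by (simp add: Fp nf_def)
    then show False using nv by blast
  qed
  ultimately show ?thesis using that bN by blast
qed

text \<open>Irreducibility of the curve. If neither factor vanished on it, both norms would be
  non-zero binary forms with product zero.\<close>

lemma V_integral:
  assumes F: "hform UNIV n F" and G: "hform UNIV m G" and 0: "\<And>p. p \<in> V \<Longrightarrow> F p * G p = 0"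
  shows "(\<forall>p\<in>V. F p = 0) \<or> (\<forall>p\<in>V. G p = 0)"
proof (rule ccontr)
  assume *: "\<not> ?thesis"
  obtain F' N where N: "bf (int (4 * n)) N" "N \<noteq> (\<lambda>z w. 0)"
    "\<And>p. p \<in> V \<Longrightarrow> F p * F' p = N (cZ p) (cW p)"
    using norm_exists[OF F] * by metis
  obtain G' M where M: "bf (int (4 * m)) M" "M \<noteq> (\<lambda>z w. 0)"
    "\<And>p. p \<in> V \<Longrightarrow> G p * G' p = M (cZ p) (cW p)"
    using norm_exists[OF G] * by metis
  have "(\<lambda>z w. N z w * M z w) = (\<lambda>z w. 0)"
  proof (rule bf_zero_onI[OF bf_mult[OF N(1) M(1) refl]])
    fix z w :: 'a assume "z \<noteq> 0 \<or> w \<noteq> 0"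
    then obtain x y where p: "pt x y z w \<in> V" using V_nonempty_over by metis
    have "N z w * M z w = F (pt x y z w) * G (pt x y z w) * (F' (pt x y z w) * G' (pt x y z w))"
      using N(3)[OF p] M(3)[OF p] by (simp add: mult_ac)
    then show "N z w * M z w = 0" using 0[OF p] by simp
  qed
  then show False using bf_integral[OF N(1) M(1)] N(2) M(2) by metis
qed

lemma V_cancel_same_degree:
  assumes "hform UNIV n F" "hform UNIV m G" "hform UNIV m H" "\<exists>p\<in>V. F p \<noteq> 0"
    "\<And>p. p \<in> V \<Longrightarrow> F p * G p = F p * H p" "p \<in> V"
  shows "G p = H p"
proof -
  have "F p * (G p - H p) = 0" if "p \<in> V" for p using assms(5)[OF that] by (simp add: right_diff_distrib)
  then have "\<forall>p\<in>V. G p - H p = 0" using V_integral[OF assms(1) hform_diff[OF assms(2,3)]] assms(4) by blast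
  then show ?thesis using assms(6) by simp
qed

end

section \<open>Orders of vanishing\<close>

context normal_curve
begin

text \<open>A local parameter at \<open>p\<close>. The projection to \<open>Z : W\<close> is
  ramified where \<open>X\<close> or \<open>Y\<close> vanishes, which never happens for both at
  once, and there the vanishing coordinate is a parameter; elsewhere the parameter of the line
  serves.\<close>

definition unif :: "'a ^ 4 \<Rightarrow> 'a ^ 4 \<Rightarrow> 'a" where
  "unif p = (if cX p = 0 then cX else if cY p = 0 then cY else (\<lambda>r. cW p * cZ r - cZ p * cW r))"

text \<open>Divisibility in the local ring, with a denominator \<open>D\<close> that is a unit at
  \<open>p\<close>. The degree equation is carried along so that the cofactors of two forms can be
  added after their denominators are cleared.\<close>

definition divisible :: "'a ^ 4 \<Rightarrow> nat \<Rightarrow> nat \<Rightarrow> ('a ^ 4 \<Rightarrow> 'a) \<Rightarrow> bool" where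
  "divisible p k n F \<longleftrightarrow> (\<exists>e D m G. hform UNIV e D \<and> D p \<noteq> 0 \<and> hform UNIV m G \<and> e + n = k + m \<and>
     (\<forall>r\<in>V. D r * F r = unif p r ^ k * G r))"

definition has_ord :: "'a ^ 4 \<Rightarrow> nat \<Rightarrow> ('a ^ 4 \<Rightarrow> 'a) \<Rightarrow> nat \<Rightarrow> bool" where
  "has_ord p n F k \<longleftrightarrow> (\<exists>e D m G. hform UNIV e D \<and> D p \<noteq> 0 \<and> hform UNIV m G \<and> G p \<noteq> 0 \<and> e + n = k + m \<and>
     (\<forall>r\<in>V. D r * F r = unif p r ^ k * G r))"

lemma divisibleI:
  "hform UNIV e D \<Longrightarrow> D p \<noteq> 0 \<Longrightarrow> hform UNIV m G \<Longrightarrow> e + n = k + m \<Longrightarrow>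
     (\<And>r. r \<in> V \<Longrightarrow> D r * F r = unif p r ^ k * G r) \<Longrightarrow> divisible p k n F"
  unfolding divisible_def by blast

lemma has_ordI:
  "hform UNIV e D \<Longrightarrow> D p \<noteq> 0 \<Longrightarrow> hform UNIV m G \<Longrightarrow> G p \<noteq> 0 \<Longrightarrow> e + n = k + m \<Longrightarrow>
     (\<And>r. r \<in> V \<Longrightarrow> D r * F r = unif p r ^ k * G r) \<Longrightarrow> has_ord p n F k"
  unfolding has_ord_def by blast

lemma has_ord_divisible: "has_ord p n F k \<Longrightarrow> divisible p k n F"
  unfolding divisible_def has_ord_def by blast

lemma divisible_form: "hform UNIV n F \<Longrightarrow> divisible p 0 n F"
  by (rule divisibleI[OF hform_const[of 1]]) auto

lemma divisible_add:
  assumes "divisible p k n F" "divisible p k n G"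
  shows "divisible p k n (\<lambda>r. F r + G r)"
proof -
  obtain e D m A where F: "hform UNIV e D" "D p \<noteq> 0" "hform UNIV m A" "e + n = k + m"
    "\<And>r. r \<in> V \<Longrightarrow> D r * F r = unif p r ^ k * A r" using assms(1) unfolding divisible_def by blast
  obtain e' D' m' B where G: "hform UNIV e' D'" "D' p \<noteq> 0" "hform UNIV m' B" "e' + n = k + m'"
    "\<And>r. r \<in> V \<Longrightarrow> D' r * G r = unif p r ^ k * B r" using assms(2) unfolding divisible_def by blast
  have "e + m' = e' + m" using F(4) G(4) by linarith
  then have "hform UNIV (e' + m) (\<lambda>r. D' r * A r + D r * B r)"
    using hform_mult[OF G(1) F(3)] hform_mult[OF F(1) G(3)] by (intro hform_add) auto
  moreover have "D r * D' r * (F r + G r) = unif p r ^ k * (D' r * A r + D r * B r)" if "r \<in> V" for r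
  proof -
    have "D r * D' r * (F r + G r) = D' r * (D r * F r) + D r * (D' r * G r)"
      by (simp add: algebra_simps)
    then show ?thesis unfolding F(5)[OF that] G(5)[OF that] by (simp add: algebra_simps)
  qed
  ultimately show ?thesis
    by (intro divisibleI[OF hform_mult[OF F(1) G(1)]]) (use F(2,4) G(2) in auto)
qed

lemma divisible_mult:
  assumes "divisible p k n F" "divisible p k' n' G"
  shows "divisible p (k + k') (n + n') (\<lambda>r. F r * G r)"
proof -
  obtain e D m A where F: "hform UNIV e D" "D p \<noteq> 0" "hform UNIV m A" "e + n = k + m"
    "\<And>r. r \<in> V \<Longrightarrow> D r * F r = unif p r ^ k * A r" using assms(1) unfolding divisible_def by blast
  obtain e' D' m' B where G: "hform UNIV e' D'" "D' p \<noteq> 0" "hform UNIV m' B" "e' + n' = k' + m'"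
    "\<And>r. r \<in> V \<Longrightarrow> D' r * G r = unif p r ^ k' * B r" using assms(2) unfolding divisible_def by blast
  show ?thesis
  proof (rule divisibleI[OF hform_mult[OF F(1) G(1)] _ hform_mult[OF F(3) G(3)]])
    fix r assume "r \<in> V"
    have "D r * D' r * (F r * G r) = (D r * F r) * (D' r * G r)" by simp
    then show "D r * D' r * (F r * G r) = unif p r ^ (k + k') * (A r * B r)"
      unfolding F(5)[OF \<open>r \<in> V\<close>] G(5)[OF \<open>r \<in> V\<close>] by (simp add: power_add)
  qed (use F(2,4) G(2,4) in auto)
qed

lemma has_ord_mult:
  assumes "has_ord p n F k" "has_ord p n' G k'"
  shows "has_ord p (n + n') (\<lambda>r. F r * G r) (k + k')"
proof -
  obtain e D m A where F: "hform UNIV e D" "D p \<noteq> 0" "hform UNIV m A" "A p \<noteq> 0" "e + n = k + m"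
    "\<And>r. r \<in> V \<Longrightarrow> D r * F r = unif p r ^ k * A r" using assms(1) unfolding has_ord_def by blast
  obtain e' D' m' B where G: "hform UNIV e' D'" "D' p \<noteq> 0" "hform UNIV m' B" "B p \<noteq> 0" "e' + n' = k' + m'"
    "\<And>r. r \<in> V \<Longrightarrow> D' r * G r = unif p r ^ k' * B r" using assms(2) unfolding has_ord_def by blast
  show ?thesis
  proof (rule has_ordI[OF hform_mult[OF F(1) G(1)] _ hform_mult[OF F(3) G(3)]])
    fix r assume "r \<in> V"
    have "D r * D' r * (F r * G r) = (D r * F r) * (D' r * G r)" by simp
    then show "D r * D' r * (F r * G r) = unif p r ^ (k + k') * (A r * B r)"
      unfolding F(6)[OF \<open>r \<in> V\<close>] G(6)[OF \<open>r \<in> V\<close>] by (simp add: power_add)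
  qed (use F(2,4,5) G(2,4,5) in auto)
qed

lemma divisible_scale: "divisible p k n F \<Longrightarrow> divisible p k n (\<lambda>r. c * F r)"
  using divisible_mult[OF divisible_form[OF hform_const]] by fastforce

lemma divisible_form_mult: "divisible p k n F \<Longrightarrow> hform UNIV m G \<Longrightarrow> divisible p k (n + m) (\<lambda>r. F r * G r)"
  using divisible_mult[OF _ divisible_form] by fastforce

lemma divisible_cong: "divisible p k n F \<Longrightarrow> (\<And>r. r \<in> V \<Longrightarrow> F r = G r) \<Longrightarrow> divisible p k n G"
  unfolding divisible_def by fastforce

text \<open>With \<open>m\<close> as a unit of degree one at \<open>p\<close>, a form equals a
  constant times a power of \<open>m\<close> up to multiples of the differences between the
  coordinates and their values. A form vanishing at \<open>p\<close> is thus handled by treating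
  four linear forms.\<close>

lemma divisible_vanishing:
  assumes m: "hform UNIV 1 m" "m p \<noteq> 0"
    and d: "divisible p 1 1 (\<lambda>r. m p * cX r - cX p * m r)" "divisible p 1 1 (\<lambda>r. m p * cY r - cY p * m r)"
       "divisible p 1 1 (\<lambda>r. m p * cZ r - cZ p * m r)" "divisible p 1 1 (\<lambda>r. m p * cW r - cW p * m r)"
    and F: "hform UNIV n F" "F p = 0"
  shows "divisible p 1 n F"
proof -
  have z: "divisible p 1 n (\<lambda>_. 0)" for n
    by (rule divisibleI[OF m hform_zero[of n]]) auto
  have "divisible p 1 n (\<lambda>r. m p ^ n * F r - F p * m r ^ n)"
    using F(1)
  proof (induction rule: hform_induct)
    case (const c)
    then show ?case using z by simp
  next
    case (mult n F i)
    have "divisible p 1 1 (\<lambda>r. ex $ i * (m p * cX r - cX p * m r) + ey $ i * (m p * cY r - cY p * m r)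
      + ez $ i * (m p * cZ r - cZ p * m r) + ew $ i * (m p * cW r - cW p * m r))"
      by (intro divisible_add divisible_scale d)
    moreover have "ex $ i * (m p * cX r - cX p * m r) + ey $ i * (m p * cY r - cY p * m r)
      + ez $ i * (m p * cZ r - cZ p * m r) + ew $ i * (m p * cW r - cW p * m r) = m p * r $ i - p $ i * m r" for r
      by (subst coord_combination[of p], subst coord_combination[of r]) (simp add: algebra_simps)
    ultimately have di: "divisible p 1 1 (\<lambda>r. m p * r $ i - p $ i * m r)" by simp
    have mn: "hform UNIV n (\<lambda>r. F p * m r ^ n)" using hform_scale[OF hform_power[OF m(1), of n]] by simp
    have mi: "hform UNIV 1 (\<lambda>r. m p * r $ i)" by (intro hform_scale hform_coord)
    from divisible_add[OF divisible_form_mult[OF mult.IH mi] divisible_form_mult[OF di mn, unfolded add.commute[of 1 n]]]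
    show ?case by (simp add: algebra_simps)
  next
    case (add n F G)
    from divisible_add[OF add.IH] show ?case by (simp add: algebra_simps)
  qed
  from divisible_scale[OF this, of "1 / m p ^ n"] show ?thesis using F(2) m(2) by simp
qed

lemma q_expand: "q z w = z * z - (\<alpha> + \<beta>) * z * w + \<alpha> * \<beta> * w * w"
  by (simp add: q_def algebra_simps)

lemma hform2: "hform UNIV 1 f \<Longrightarrow> hform UNIV 1 g \<Longrightarrow> hform UNIV 2 (\<lambda>r. f r * g r)"
  using hform_mult[of 1 f 1 g] by (simp add: numeral_2_eq_2)

text \<open>The maximal ideal at \<open>p\<close> is principal. A difference of coordinates is
  multiplied by its conjugate under a sign change where this is a unit at \<open>p\<close>; the
  difference of squares is then rewritten by the equations of the curve.\<close>

lemma unif_divides: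
  assumes p: "p \<in> V" and F: "hform UNIV n F" "F p = 0"
  shows "divisible p 1 n F"
proof -
  define x0 y0 z0 w0 where d0: "x0 = cX p" "y0 = cY p" "z0 = cZ p" "w0 = cW p"
  have zw: "z0 \<noteq> 0 \<or> w0 \<noteq> 0" and x0: "x0 * x0 = z0 * w0" and y0: "y0 * y0 = q z0 w0"
    using p by (auto simp: V_iff d0 power2_eq_square)
  have V: "cX r * cX r = cZ r * cW r" "cY r * cY r = q (cZ r) (cW r)" if "r \<in> V" for r
    using that by (auto simp: V_iff power2_eq_square)
  have self: "divisible p 1 1 (\<lambda>r. c * cX r - c * cX r)" "divisible p 1 1 (\<lambda>r. c * cY r - c * cY r)" 
     "divisible p 1 1 (\<lambda>r. c * cZ r - c * cZ r)" "divisible p 1 1 (\<lambda>r. c * cW r - c * cW r)" for c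
    by (rule divisibleI[OF hform_const[of 1] _ hform_zero[of 0]]; simp)+
  have own: "divisible p 1 1 (\<lambda>r. c * unif p r)" for c
    by (rule divisibleI[OF hform_const[of 1] _ hform_const[of c]]) auto
  note lins = hform_add hform_scale hform_diff lin hform2
  consider (X1) "x0 = 0" "w0 \<noteq> 0" | (X2) "x0 = 0" "w0 = 0" | (Y) "x0 \<noteq> 0" "y0 = 0" | (gen) "x0 \<noteq> 0" "y0 \<noteq> 0" by blast
  then show ?thesis
  proof cases
    case X1
    then have u: "unif p = cX" by (simp add: unif_def d0)
    have z0: "z0 = 0" using X1 x0 by simp
    have y0': "y0 * y0 = \<alpha> * \<beta> * w0 * w0" using y0 z0 by (simp add: q_expand)
    then have ynz: "y0 \<noteq> 0" using \<alpha>0 \<beta>0 X1 by auto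
    show ?thesis
    proof (rule divisible_vanishing[OF lin(4) _ _ _ _ _ F]; (fold d0)?)
      show "divisible p 1 1 (\<lambda>r. w0 * cX r - x0 * cW r)" using own[of w0] u X1 by simp
      \<comment> \<open>Here \<open>z0 = 0\<close>, and multiplying \<open>Z\<close> by the unit
        \<open>W\<close> gives the square of \<open>X\<close>.\<close>
      show "divisible p 1 1 (\<lambda>r. w0 * cZ r - z0 * cW r)"
        by (rule divisibleI[OF lin(4) _ hform_scale[OF lin(1), of w0]])
          (use X1 V z0 u d0 in \<open>auto simp: algebra_simps\<close>)
      show "divisible p 1 1 (\<lambda>r. w0 * cY r - y0 * cW r)"
      proof (rule divisibleI[of 2 "\<lambda>r. cW r * (w0 * cY r + y0 * cW r)" _ 2 "\<lambda>r. cX r * (w0 * w0 * cZ r - w0 * w0 * (\<alpha> + \<beta>) * cW r)"])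
        show "cW p * (w0 * cY p + y0 * cW p) \<noteq> 0" using X1 ynz two by (simp add: d0[symmetric] mult.commute)
        fix r assume r: "r \<in> V"
        have "cW r * (w0 * cY r + y0 * cW r) * (w0 * cY r - y0 * cW r) =
          cW r * (w0 * w0 * (cY r * cY r) - (y0 * y0) * cW r * cW r)" by (simp add: algebra_simps)
        also have "\<dots> = w0 * w0 * (cZ r * cW r) * (cZ r - (\<alpha> + \<beta>) * cW r)"
          unfolding V(2)[OF r] y0' q_expand by (simp add: algebra_simps)
        finally show "cW r * (w0 * cY r + y0 * cW r) * (w0 * cY r - y0 * cW r) =
          unif p r ^ 1 * (cX r * (w0 * w0 * cZ r - w0 * w0 * (\<alpha> + \<beta>) * cW r))"
          unfolding V(1)[OF r, symmetric] u by (simp add: algebra_simps)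
      qed (intro lins | simp)+
    qed (use self X1 in auto)
  next
    case X2
    then have u: "unif p = cX" by (simp add: unif_def d0)
    have z0: "z0 \<noteq> 0" using X2 zw by simp
    have y0': "y0 * y0 = z0 * z0" using y0 X2 by (simp add: q_expand)
    then have ynz: "y0 \<noteq> 0" using z0 by auto
    show ?thesis
    proof (rule divisible_vanishing[OF lin(3) _ _ _ _ _ F]; (fold d0)?)
      show "divisible p 1 1 (\<lambda>r. z0 * cX r - x0 * cZ r)" using own[of z0] u X2 by simp
      show "divisible p 1 1 (\<lambda>r. z0 * cW r - w0 * cZ r)"
        by (rule divisibleI[OF lin(3) _ hform_scale[OF lin(1), of z0]])
          (use X2 V z0 u d0 in \<open>auto simp: algebra_simps\<close>)
      show "divisible p 1 1 (\<lambda>r. z0 * cY r - y0 * cZ r)"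
      proof (rule divisibleI[of 2 "\<lambda>r. cZ r * (z0 * cY r + y0 * cZ r)" _ 2 "\<lambda>r. cX r * (z0 * z0 * (\<alpha> * \<beta>) * cW r - z0 * z0 * (\<alpha> + \<beta>) * cZ r)"])
        show "cZ p * (z0 * cY p + y0 * cZ p) \<noteq> 0" using z0 ynz two by (simp add: d0[symmetric] mult.commute)
        fix r assume r: "r \<in> V"
        have "cZ r * (z0 * cY r + y0 * cZ r) * (z0 * cY r - y0 * cZ r) =
          cZ r * (z0 * z0 * (cY r * cY r) - (y0 * y0) * cZ r * cZ r)" by (simp add: algebra_simps)
        also have "\<dots> = z0 * z0 * (cZ r * cW r) * (\<alpha> * \<beta> * cW r - (\<alpha> + \<beta>) * cZ r)"
          unfolding V(2)[OF r] y0' q_expand by (simp add: algebra_simps)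
        finally show "cZ r * (z0 * cY r + y0 * cZ r) * (z0 * cY r - y0 * cZ r) =
          unif p r ^ 1 * (cX r * (z0 * z0 * (\<alpha> * \<beta>) * cW r - z0 * z0 * (\<alpha> + \<beta>) * cZ r))"
          unfolding V(1)[OF r, symmetric] u by (simp add: algebra_simps)
      qed (intro lins | simp)+
    qed (use self z0 in auto)
  next
    case Y
    then have u: "unif p = cY" by (simp add: unif_def d0)
    \<comment> \<open>\<gamma> is the root of \<open>q\<close> below \<open>p\<close> and \<delta>
      the other one, so that \<open>Z - \<delta> W\<close> is a unit at \<open>p\<close>.\<close>
    obtain \<gamma> \<delta> where gd: "z0 = \<gamma> * w0" "\<gamma> \<noteq> \<delta>" "\<gamma> \<noteq> 0" and q': "\<And>z w. q z w = (z - \<gamma> * w) * (z - \<delta> * w)"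
    proof -
      have "z0 = \<alpha> * w0 \<or> z0 = \<beta> * w0" using y0 Y by (auto simp: q_def)
      then show ?thesis using that[of \<alpha> \<beta>] that[of \<beta> \<alpha>] \<alpha>\<beta> \<alpha>0 \<beta>0 by (auto simp: q_def mult.commute)
    qed
    have w0: "w0 \<noteq> 0" using gd(1) zw by auto
    have Dp: "cZ p - \<delta> * cW p \<noteq> 0" using gd w0 by (simp add: d0[symmetric])
    show ?thesis
    proof (rule divisible_vanishing[OF lin(4) _ _ _ _ _ F]; (fold d0)?)
      show "divisible p 1 1 (\<lambda>r. w0 * cY r - y0 * cW r)" using own[of w0] u Y by simp
      show "divisible p 1 1 (\<lambda>r. w0 * cZ r - z0 * cW r)"
      proof (rule divisibleI[of 1 "\<lambda>r. cZ r - \<delta> * cW r", OF _ Dp hform_scale[OF lin(2), of w0]])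
        fix r assume r: "r \<in> V"
        have "(cZ r - \<delta> * cW r) * (w0 * cZ r - z0 * cW r) = w0 * q (cZ r) (cW r)"
          unfolding q' gd(1) by (simp add: algebra_simps)
        then show "(cZ r - \<delta> * cW r) * (w0 * cZ r - z0 * cW r) = unif p r ^ 1 * (w0 * cY r)"
          unfolding V(2)[OF r, symmetric] u by simp
      qed (intro lins | simp)+
      show "divisible p 1 1 (\<lambda>r. w0 * cX r - x0 * cW r)"
      proof (rule divisibleI[of 2 "\<lambda>r. (w0 * cX r + x0 * cW r) * (cZ r - \<delta> * cW r)" _ 2 "\<lambda>r. w0 * w0 * (cW r * cY r)"])
        show "(w0 * cX p + x0 * cW p) * (cZ p - \<delta> * cW p) \<noteq> 0"
          using Dp Y w0 two by (simp add: d0[symmetric] mult.commute)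
        fix r assume r: "r \<in> V"
        have "(w0 * cX r + x0 * cW r) * (cZ r - \<delta> * cW r) * (w0 * cX r - x0 * cW r) =
          (w0 * w0 * (cX r * cX r) - (x0 * x0) * cW r * cW r) * (cZ r - \<delta> * cW r)" by (simp add: algebra_simps)
        also have "\<dots> = w0 * w0 * cW r * q (cZ r) (cW r)"
          unfolding V(1)[OF r] x0 q' gd(1) by (simp add: algebra_simps)
        finally show "(w0 * cX r + x0 * cW r) * (cZ r - \<delta> * cW r) * (w0 * cX r - x0 * cW r) =
          unif p r ^ 1 * (w0 * w0 * (cW r * cY r))"
          unfolding V(2)[OF r, symmetric] u by (simp add: algebra_simps)
      qed (intro lins | simp)+
    qed (use self w0 in auto)
  next
    case gen
    then have u: "unif p = (\<lambda>r. w0 * cZ r - z0 * cW r)" by (simp add: unif_def d0)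
    have w0: "w0 \<noteq> 0" using gen x0 by auto
    show ?thesis
    proof (rule divisible_vanishing[OF lin(4) _ _ _ _ _ F]; (fold d0)?)
      show "divisible p 1 1 (\<lambda>r. w0 * cZ r - z0 * cW r)" using own[of 1] u by simp
      show "divisible p 1 1 (\<lambda>r. w0 * cX r - x0 * cW r)"
      proof (rule divisibleI[of 1 "\<lambda>r. w0 * cX r + x0 * cW r" _ 1 "\<lambda>r. w0 * cW r"])
        show "w0 * cX p + x0 * cW p \<noteq> 0" using gen w0 two by (simp add: d0[symmetric] mult.commute)
        fix r assume r: "r \<in> V"
        have "(w0 * cX r + x0 * cW r) * (w0 * cX r - x0 * cW r) =
          w0 * w0 * (cX r * cX r) - (x0 * x0) * cW r * cW r" by (simp add: algebra_simps)
        then show "(w0 * cX r + x0 * cW r) * (w0 * cX r - x0 * cW r) = unif p r ^ 1 * (w0 * cW r)"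
          unfolding V(1)[OF r] x0 u by (simp add: algebra_simps)
      qed (intro lins | simp)+
      show "divisible p 1 1 (\<lambda>r. w0 * cY r - y0 * cW r)"
      proof (rule divisibleI[of 1 "\<lambda>r. w0 * cY r + y0 * cW r" _ 1 "\<lambda>r. w0 * cZ r + z0 * cW r - (\<alpha> + \<beta>) * w0 * cW r"])
        show "w0 * cY p + y0 * cW p \<noteq> 0" using gen w0 two by (simp add: d0[symmetric] mult.commute)
        fix r assume r: "r \<in> V"
        have "(w0 * cY r + y0 * cW r) * (w0 * cY r - y0 * cW r) =
          w0 * w0 * (cY r * cY r) - (y0 * y0) * cW r * cW r" by (simp add: algebra_simps)
        then show "(w0 * cY r + y0 * cW r) * (w0 * cY r - y0 * cW r) =
          unif p r ^ 1 * (w0 * cZ r + z0 * cW r - (\<alpha> + \<beta>) * w0 * cW r)"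
          unfolding V(2)[OF r] y0 u q_expand by (simp add: algebra_simps)
      qed (intro lins | simp)+
    qed (use self w0 in auto)
  qed
qed

end

lemma power_separates:
  fixes dummy :: "'a::alg_closed_field"
  assumes "n \<noteq> m"
  obtains c :: 'a where "c \<noteq> 0" "c ^ n \<noteq> c ^ m"
proof (rule ccontr)
  assume *: "\<not> thesis"
  \<comment> \<open>The factor of degree one makes 0 a root as well, so only a non-zero argument has
    to be discussed.\<close>
  define P :: "'a poly" where "P = Polynomial.monom 1 1 * (Polynomial.monom 1 n - Polynomial.monom 1 m)"
  have "poly P c = 0" for c
    using * that[of c] by (cases "c = 0") (auto simp: P_def poly_monom)
  then have "P = 0" by (rule poly_all_0)
  then have "(Polynomial.monom 1 n - Polynomial.monom 1 m :: 'a poly) = 0"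
    unfolding P_def by (simp add: monom_eq_0_iff)
  then have "Polynomial.coeff (Polynomial.monom 1 n - Polynomial.monom 1 m :: 'a poly) n = 0" by simp
  then show False using assms by simp
qed

section \<open>Existence and uniqueness of orders\<close>

context normal_curve
begin

definition nv :: "('a ^ 4 \<Rightarrow> 'a) \<Rightarrow> bool" where "nv F \<longleftrightarrow> (\<exists>p\<in>V. F p \<noteq> 0)"

lemma nvI: "p \<in> V \<Longrightarrow> F p \<noteq> 0 \<Longrightarrow> nv F"
  unfolding nv_def by blast

text \<open>\<open>V\<close> is stable under scalars, so a function on it that does not vanish
  identically is homogeneous of at most one degree; some scalar has different \<open>n\<close>-th
  and \<open>m\<close>-th powers.\<close>

lemma degree_unique:
  assumes F: "hform UNIV n F" and G: "hform UNIV m G" and eq: "\<And>r. r \<in> V \<Longrightarrow> F r = G r" and "nv F"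
  shows "n = m"
proof (rule ccontr)
  assume "n \<noteq> m"
  then obtain c :: 'a where c: "c \<noteq> 0" "c ^ n \<noteq> c ^ m" by (rule power_separates)
  obtain r where r: "r \<in> V" "F r \<noteq> 0" using \<open>nv F\<close> unfolding nv_def by blast
  have "c ^ n * F r = c ^ m * F r"
    using eq[OF V_smult[OF c(1) r(1)]] eq[OF r(1)] hform_homogeneous[OF F, of c r] hform_homogeneous[OF G, of c r] by simp
  then show False using c r by simp
qed

lemma nv_mult: "hform UNIV n F \<Longrightarrow> hform UNIV m G \<Longrightarrow> nv F \<Longrightarrow> nv G \<Longrightarrow> nv (\<lambda>r. F r * G r)"
  using V_integral unfolding nv_def by blast

lemma nv_multD: "nv (\<lambda>r. F r * G r) \<Longrightarrow> nv F \<and> nv G"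
  unfolding nv_def by auto

lemma nv_power: "hform UNIV n F \<Longrightarrow> nv F \<Longrightarrow> nv (\<lambda>r. F r ^ k)"
  unfolding nv_def by auto

lemma nv_cong: "nv F \<Longrightarrow> (\<And>r. r \<in> V \<Longrightarrow> F r = G r) \<Longrightarrow> nv G"
  unfolding nv_def by auto

lemma V_cancel:
  assumes F: "hform UNIV n F" and G: "hform UNIV m G" and H: "hform UNIV k H" and "nv F"
    and eq: "\<And>r. r \<in> V \<Longrightarrow> F r * G r = F r * H r" and "p \<in> V"
  shows "G p = H p"
proof (cases "nv (\<lambda>r. F r * G r)")
  case True
  then have "n + m = n + k"
    using degree_unique[OF hform_mult[OF F G] hform_mult[OF F H]] eq by blast
  then show ?thesis using V_cancel_same_degree[OF F G _ _ eq \<open>p \<in> V\<close>] H \<open>nv F\<close> by (auto simp: nv_def)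
next
  case False
  then have "\<not> nv G" "\<not> nv H"
    using nv_mult[OF F G \<open>nv F\<close>] nv_mult[OF F H \<open>nv F\<close>] nv_cong[of "\<lambda>r. F r * H r" "\<lambda>r. F r * G r"] eq by auto
  then show ?thesis using \<open>p \<in> V\<close> unfolding nv_def by auto
qed

lemma hform_unif: "hform UNIV 1 (unif p)"
  using lin hform_diff[OF hform_scale[OF lin(3)] hform_scale[OF lin(4)]] by (simp add: unif_def)

lemma unif_self: "unif p p = 0"
  by (simp add: unif_def)

lemma nv_coords: "nv cX" "nv cY"
proof -
  obtain x y where "pt x y 1 1 \<in> V" "x ^ 2 = 1 * 1" using V_nonempty_over[of 1 1] by (metis zero_neq_one)
  then show "nv cX" by (intro nvI[of "pt x y 1 1"]) auto
  obtain x y where "pt x y 1 0 \<in> V" "y ^ 2 = q 1 0" using V_nonempty_over[of 1 0] by (metis zero_neq_one)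
  then show "nv cY" by (intro nvI[of "pt x y 1 0"]) (auto simp: q_def)
qed

lemma nv_line: "z0 \<noteq> 0 \<or> w0 \<noteq> 0 \<Longrightarrow> nv (\<lambda>r. w0 * cZ r - z0 * cW r)"
proof -
  assume nz: "z0 \<noteq> 0 \<or> w0 \<noteq> 0"
  define z w :: 'a where "z = (if w0 = 0 then 0 else 1)" "w = (if w0 = 0 then 1 else 0)"
  have "z \<noteq> 0 \<or> w \<noteq> 0" by (simp add: z_w_def)
  then obtain x y where "pt x y z w \<in> V" using V_nonempty_over by metis
  then show ?thesis using nz by (intro nvI[of "pt x y z w"]) (auto simp: z_w_def)
qed

lemma nv_unif: "p \<in> V \<Longrightarrow> nv (unif p)"
  unfolding unif_def using nv_coords nv_line[of "cZ p" "cW p"] by (auto simp: V_iff)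

text \<open>Otherwise cancelling the smaller power of the parameter leaves an identity in which one
  side is a unit at \<open>p\<close> and the other still contains the parameter.\<close>

lemma divisible_le:
  assumes p: "p \<in> V" and o: "has_ord p n F k" and d: "divisible p j n F"
  shows "j \<le> k"
proof (rule ccontr)
  assume jk: "\<not> j \<le> k"
  obtain e D m G where F: "hform UNIV e D" "D p \<noteq> 0" "hform UNIV m G" "G p \<noteq> 0" "e + n = k + m"
    "\<And>r. r \<in> V \<Longrightarrow> D r * F r = unif p r ^ k * G r" using o unfolding has_ord_def by blast
  obtain e' D' m' H where H: "hform UNIV e' D'" "D' p \<noteq> 0" "hform UNIV m' H" "e' + n = j + m'"
    "\<And>r. r \<in> V \<Longrightarrow> D' r * F r = unif p r ^ j * H r" using d unfolding divisible_def by blast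
  have u: "hform UNIV (i * 1) (\<lambda>r. unif p r ^ i)" for i by (rule hform_power[OF hform_unif])
  have "D' p * G p = D p * (unif p p ^ (j - k) * H p)"
  proof (rule V_cancel[OF u[of k] hform_mult[OF H(1) F(3)] hform_mult[OF F(1) hform_mult[OF u H(3)]] _ _ p])
    fix r assume r: "r \<in> V"
    have "unif p r ^ k * (D' r * G r) = D' r * (D r * F r)" using F(6)[OF r] by simp
    also have "\<dots> = D r * (D' r * F r)" by simp
    also have "\<dots> = D r * (unif p r ^ j * H r)" using H(5)[OF r] by simp
    also have "unif p r ^ j = unif p r ^ k * unif p r ^ (j - k)" using jk by (simp add: power_add[symmetric])
    finally show "unif p r ^ k * (D' r * G r) = unif p r ^ k * (D r * (unif p r ^ (j - k) * H r))" by simp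
  qed (use nv_power[OF hform_unif nv_unif[OF p]] in auto)
  then show False using jk F H unif_self by (simp add: power_0_left)
qed

lemma divisible_mono:
  assumes "divisible p k n F" "j \<le> k" shows "divisible p j n F"
proof -
  obtain e D m G where F: "hform UNIV e D" "D p \<noteq> 0" "hform UNIV m G" "e + n = k + m"
    "\<And>r. r \<in> V \<Longrightarrow> D r * F r = unif p r ^ k * G r" using assms(1) unfolding divisible_def by blast
  show ?thesis
  proof (rule divisibleI[OF F(1,2) hform_mult[OF hform_power[OF hform_unif] F(3)]])
    fix r assume r: "r \<in> V"
    have "unif p r ^ k = unif p r ^ j * unif p r ^ (k - j)" using assms(2) by (simp add: power_add[symmetric])
    then show "D r * F r = unif p r ^ j * (unif p r ^ (k - j) * G r)" using F(5)[OF r] by simp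
  qed (use F(4) assms(2) in auto)
qed

lemma has_ord_0: "hform UNIV n F \<Longrightarrow> F p \<noteq> 0 \<Longrightarrow> has_ord p n F 0"
  by (rule has_ordI[OF hform_const[of 1]]) auto

text \<open>The order of the multiple \<open>N\<close> bounds the divisibility of \<open>F\<close>,
  so there is a largest exponent. If its cofactor vanished at \<open>p\<close>, it would contain one
  more factor of the parameter.\<close>

lemma has_ord_of_dividing:
  assumes p: "p \<in> V" and F: "hform UNIV n F"
    and FG: "has_ord p m N k" "hform UNIV i G" "n + i = m" "\<And>r. r \<in> V \<Longrightarrow> F r * G r = N r"
  shows "\<exists>j. has_ord p n F j"
proof -
  have bound: "j \<le> k" if "divisible p j n F" for j
    using divisible_le[OF p FG(1)] divisible_cong[OF divisible_form_mult[OF that FG(2)] FG(4)] FG(3) by auto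
  define j where "j = (GREATEST j. divisible p j n F)"
  have j: "divisible p j n F" unfolding j_def
    by (rule GreatestI_nat[of _ 0 k]) (use divisible_form[OF F] bound in auto)
  then obtain e D m H where H: "hform UNIV e D" "D p \<noteq> 0" "hform UNIV m H" "e + n = j + m"
    "\<And>r. r \<in> V \<Longrightarrow> D r * F r = unif p r ^ j * H r" unfolding divisible_def by blast
  show ?thesis
  proof (cases "H p = 0")
    case False
    then show ?thesis using has_ordI[OF H(1,2,3) False H(4,5)] by blast
  next
    case True
    from unif_divides[OF p H(3) this] obtain e' D' m' G' where
      G: "hform UNIV e' D'" "D' p \<noteq> 0" "hform UNIV m' G'" "e' + m = 1 + m'"
      "\<And>r. r \<in> V \<Longrightarrow> D' r * H r = unif p r ^ 1 * G' r" unfolding divisible_def by blast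
    have "divisible p (Suc j) n F"
    proof (rule divisibleI[OF hform_mult[OF G(1) H(1)] _ G(3)])
      fix r assume r: "r \<in> V"
      have "D' r * D r * F r = unif p r ^ j * (D' r * H r)" using H(5)[OF r] by simp
      then show "D' r * D r * F r = unif p r ^ Suc j * G' r" unfolding G(5)[OF r] by simp
    qed (use G(2,4) H(2,4) in auto)
    then have "Suc j \<le> j" unfolding j_def
      by (rule Greatest_le_nat[of _ _ k]) (use bound in auto)
    then show ?thesis by simp
  qed
qed

lemma has_ord_scale: "has_ord p n F k \<Longrightarrow> c \<noteq> 0 \<Longrightarrow> has_ord p n (\<lambda>r. c * F r) k"
  using has_ord_mult[OF has_ord_0[OF hform_const[of c], of p]] by fastforce

lemma has_ord_X: "cX p = 0 \<Longrightarrow> has_ord p 1 cX 1"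
  by (rule has_ordI[OF hform_const[of 1] _ hform_const[of 1]]) (auto simp: unif_def)

lemma has_ord_Y: "cX p \<noteq> 0 \<Longrightarrow> cY p = 0 \<Longrightarrow> has_ord p 1 cY 1"
  by (rule has_ordI[OF hform_const[of 1] _ hform_const[of 1]]) (auto simp: unif_def)

lemma not_XY: "p \<in> V \<Longrightarrow> cX p = 0 \<Longrightarrow> cY p \<noteq> 0"
  using \<alpha>0 \<beta>0 by (auto simp: V_iff q_def)

text \<open>The order is the ramification index of the projection to \<open>Z : W\<close> at
  \<open>p\<close>.\<close>

lemma has_ord_line:
  assumes p: "p \<in> V" and nz: "z0 \<noteq> 0 \<or> w0 \<noteq> 0" and 0: "w0 * cZ p - z0 * cW p = 0"
  shows "has_ord p 1 (\<lambda>r. w0 * cZ r - z0 * cW r) (if cX p = 0 \<or> cY p = 0 then 2 else 1)"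
proof -
  obtain c where c: "c \<noteq> 0" "z0 = c * cZ p" "w0 = c * cW p"
  proof -
    have "cZ p \<noteq> 0 \<or> cW p \<noteq> 0" using p by (simp add: V_iff)
    then show ?thesis
    proof
      assume "cZ p \<noteq> 0"
      moreover from this have "w0 = z0 / cZ p * cW p" using 0 by (simp add: field_simps)
      ultimately show ?thesis using that[of "z0 / cZ p"] nz by auto
    next
      assume "cW p \<noteq> 0"
      moreover from this have "z0 = w0 / cW p * cZ p" using 0 by (simp add: field_simps)
      ultimately show ?thesis using that[of "w0 / cW p"] nz by auto
    qed
  qed
  have "has_ord p 1 (\<lambda>r. cW p * cZ r - cZ p * cW r) (if cX p = 0 \<or> cY p = 0 then 2 else 1)"
  proof (cases "cX p = 0 \<or> cY p = 0")
    case False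
    show ?thesis using False
      by (intro has_ordI[OF hform_const[of 1] _ hform_const[of 1]]) (auto simp: unif_def)
  next
    case True
    show ?thesis
    proof (cases "cX p = 0")
      case X: True
      then have zw: "cZ p * cW p = 0" using p by (simp add: V_iff)
      have "has_ord p 1 (\<lambda>r. cW p * cZ r - cZ p * cW r) 2"
      \<comment> \<open>One choice of unit covers both points of the line below
        \<open>X = 0\<close>: as either \<open>cZ p\<close> or \<open>cW p\<close> is zero, the
        product of this unit with the line is a constant times \<open>Z W\<close>.\<close>
      proof (rule has_ordI[of 1 "\<lambda>r. cW p * cW r - cZ p * cZ r" _ 0 "\<lambda>r. cW p ^ 2 + cZ p ^ 2"])
        show "cW p * cW p - cZ p * cZ p \<noteq> 0" "cW p ^ 2 + cZ p ^ 2 \<noteq> 0"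
          using zw p by (auto simp: V_iff)
        fix r assume "r \<in> V"
        then have "cX r ^ 2 = cZ r * cW r" by (simp add: V_iff)
        moreover have "(cW p * cW r - cZ p * cZ r) * (cW p * cZ r - cZ p * cW r) =
           cZ r * cW r * (cW p ^ 2 + cZ p ^ 2) - (cZ p * cW p) * (cW r * cW r + cZ r * cZ r)"
          by (simp add: algebra_simps power2_eq_square)
        ultimately show "(cW p * cW r - cZ p * cZ r) * (cW p * cZ r - cZ p * cW r) = unif p r ^ 2 * (cW p ^ 2 + cZ p ^ 2)"
          using zw X by (simp add: unif_def)
      qed (intro hform_diff hform_scale lin hform_const | simp)+
      then show ?thesis using X by simp
    next
      case X: False
      then have Y: "cY p = 0" using True by simp
      then have "cZ p = \<alpha> * cW p \<or> cZ p = \<beta> * cW p" using p by (auto simp: V_iff q_def)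
      then obtain \<gamma> \<delta> where gd: "cZ p = \<gamma> * cW p" "\<gamma> \<noteq> \<delta>" "\<And>z w. q z w = (z - \<gamma> * w) * (z - \<delta> * w)"
        using \<alpha>\<beta> by (metis mult.commute q_def)
      have w0: "cW p \<noteq> 0" using X p by (auto simp: V_iff)
      have "has_ord p 1 (\<lambda>r. cW p * cZ r - cZ p * cW r) 2"
      proof (rule has_ordI[of 1 "\<lambda>r. cZ r - \<delta> * cW r" _ 0 "\<lambda>r. cW p"])
        show "cZ p - \<delta> * cW p \<noteq> 0" "cW p \<noteq> 0" using w0 gd by auto
        fix r assume "r \<in> V"
        then have "cY r ^ 2 = (cZ r - \<gamma> * cW r) * (cZ r - \<delta> * cW r)" by (simp add: V_iff gd(3))
        moreover have "(cZ r - \<delta> * cW r) * (cW p * cZ r - cZ p * cW r) =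
          ((cZ r - \<gamma> * cW r) * (cZ r - \<delta> * cW r)) * cW p" by (simp add: gd(1) algebra_simps)
        ultimately show "(cZ r - \<delta> * cW r) * (cW p * cZ r - cZ p * cW r) = unif p r ^ 2 * cW p"
          using X Y by (simp add: unif_def)
      qed (intro hform_diff hform_scale lin hform_const | simp)+
      then show ?thesis using Y by simp
    qed
  qed
  from has_ord_scale[OF this c(1)] show ?thesis unfolding c(2,3) by (simp add: algebra_simps)
qed

lemma hform_line: "hform UNIV 1 (\<lambda>r. w0 * cZ r - z0 * cW r)"
  by (intro hform_diff hform_scale lin)

lemma hform_bf0: "bf (int n) N \<Longrightarrow> hform UNIV n (\<lambda>r. N (cZ r) (cW r))"
  using hform_bf[OF _ hform_const[of 1], of n N] by simp

lemma has_ord_bf: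
  assumes p: "p \<in> V" and "bf (int n) N" "N \<noteq> (\<lambda>z w. 0)"
  shows "\<exists>k. has_ord p n (\<lambda>r. N (cZ r) (cW r)) k"
  using assms(2,3)
proof (induction n arbitrary: N)
  case 0
  then obtain c where c: "N = (\<lambda>z w. c)" using bf_degree_0 by (metis of_nat_0)
  have "c \<noteq> 0" using 0 c by auto
  then have "has_ord p 0 (\<lambda>r. c) 0" using has_ord_0[OF hform_const] by blast
  then show ?case unfolding c by blast
next
  case (Suc n)
  obtain z0 w0 where nz: "z0 \<noteq> 0 \<or> w0 \<noteq> 0" and "N z0 w0 = 0"
    using bf_root[OF Suc.prems(1)] by auto
  then obtain M where M: "bf (int n) M" "\<And>z w. N z w = (w0 * z - z0 * w) * M z w"
    using bf_linear_divide[OF Suc.prems(1), of z0 w0] by auto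
  have "M \<noteq> (\<lambda>z w. 0)" using M(2) Suc.prems(2) by auto
  then obtain k where k: "has_ord p n (\<lambda>r. M (cZ r) (cW r)) k" using Suc.IH[OF M(1)] by blast
  obtain j where j: "has_ord p 1 (\<lambda>r. w0 * cZ r - z0 * cW r) j"
    using has_ord_line[OF p nz] has_ord_0[OF hform_line[of w0 z0], of p] by blast
  show ?case unfolding M(2) by (rule exI[of _ "j + k"]) (use has_ord_mult[OF j k] in simp)
qed

text \<open>The norm of \<open>F\<close> splits into linear factors in \<open>Z, W\<close>, whose
  orders are known, and \<open>F\<close> divides its norm.\<close>

lemma has_ord_exists:
  assumes p: "p \<in> V" and F: "hform UNIV n F" "nv F"
  shows "\<exists>k. has_ord p n F k"
proof -
  obtain G N where G: "hform UNIV (3 * n) G" and N: "bf (int (4 * n)) N" "N \<noteq> (\<lambda>z w. 0)"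
    "\<And>p. p \<in> V \<Longrightarrow> F p * G p = N (cZ p) (cW p)"
    using norm_exists[OF F(1)] F(2) unfolding nv_def by blast
  obtain k where "has_ord p (4 * n) (\<lambda>r. N (cZ r) (cW r)) k" using has_ord_bf[OF p N(1,2)] by blast
  from has_ord_of_dividing[OF p F(1) this G _ N(3)] show ?thesis by simp
qed

section \<open>Comparison with orders defined by powers of ideals of points\<close>

definition C :: "('a ^ 4) set set" where "C = proj ` V"

lemma ball_C: "(\<forall>q\<in>C. \<forall>x\<in>q. Q x) \<longleftrightarrow> (\<forall>x\<in>V. Q x)"
proof
  assume "\<forall>q\<in>C. \<forall>x\<in>q. Q x"
  then show "\<forall>x\<in>V. Q x" using proj_self unfolding C_def by blast
next
  assume "\<forall>x\<in>V. Q x"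
  then show "\<forall>q\<in>C. \<forall>x\<in>q. Q x" using V_smult unfolding C_def by (auto simp: mem_proj_iff)
qed

lemma proj_in_C: "proj p \<in> C \<longleftrightarrow> p \<in> V"
proof
  assume "proj p \<in> C"
  then obtain r where "r \<in> V" "proj p = proj r" unfolding C_def by blast
  then show "p \<in> V" using V_smult by (auto simp: proj_eq_iff)
qed (auto simp: C_def)

lemma ball_proj_nonzero:
  assumes "hform UNIV n G" shows "(\<forall>x\<in>proj p. G x \<noteq> 0) \<longleftrightarrow> G p \<noteq> 0"
proof
  show "G p \<noteq> 0" if "\<forall>x\<in>proj p. G x \<noteq> 0" using that proj_self by blast
qed (auto simp: mem_proj_iff hform_homogeneous[OF assms])

lemma ideal_pow_divisible:
  assumes p: "p \<in> V" and "ideal_pow (proj p) k n F" shows "divisible p k n F"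
  using assms(2)
proof (induction rule: ideal_pow.induct)
  case (1 n F)
  then show ?case by (rule divisible_form)
next
  case (2 k n F h)
  then have "divisible p 1 1 h" using unif_divides[OF p, of 1 h] proj_self by auto
  from divisible_mult[OF this 2(4)] show ?case by simp
qed (rule divisible_add)

lemma ideal_pow_unif: "ideal_pow (proj p) k k (\<lambda>r. unif p r ^ k)"
proof (induction k)
  case 0
  then show ?case by (auto intro: ideal_pow.intros hform_const)
next
  case (Suc k)
  have "\<forall>x\<in>proj p. unif p x = 0" using hform_homogeneous[OF hform_unif] unif_self by (auto simp: mem_proj_iff)
  from ideal_pow.intros(2)[OF Suc hform_unif this] show ?case by simp
qed

text \<open>The ideal of \<open>p\<close> is generated locally by the parameter, so both notions
  describe the same power of the maximal ideal. The degrees in \<open>order_ge\<close> are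
  unconstrained; they are recovered from the equation on the curve.\<close>

lemma order_ge_iff:
  assumes p: "p \<in> V" and F: "hform UNIV n F" "nv F"
  shows "order_ge C F (proj p) k \<longleftrightarrow> divisible p k n F"
proof
  assume "order_ge C F (proj p) k"
  then obtain e G m H where G: "hform UNIV e G" "G p \<noteq> 0" "ideal_pow (proj p) k m H" "\<And>r. r \<in> V \<Longrightarrow> G r * F r = H r"
    unfolding order_ge_def ball_C using proj_self by blast
  have H: "hform UNIV m H" using G(3) by (rule ideal_pow_hform)
  have "e + n = m"
    using degree_unique[OF hform_mult[OF G(1) F(1)] H G(4)] nv_mult[OF G(1) F(1) nvI[where F = G, OF p G(2)] F(2)] by blast
  moreover obtain e' D m' K where K: "hform UNIV e' D" "D p \<noteq> 0" "hform UNIV m' K" "e' + m = k + m'"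
    "\<And>r. r \<in> V \<Longrightarrow> D r * H r = unif p r ^ k * K r"
    using ideal_pow_divisible[OF p G(3)] unfolding divisible_def by blast
  ultimately show "divisible p k n F"
    by (intro divisibleI[OF hform_mult[OF K(1) G(1)] _ K(3)]) (use K G in \<open>auto simp: mult.assoc\<close>)
next
  assume "divisible p k n F"
  then obtain e D m G where G: "hform UNIV e D" "D p \<noteq> 0" "hform UNIV m G" "e + n = k + m"
    "\<And>r. r \<in> V \<Longrightarrow> D r * F r = unif p r ^ k * G r" unfolding divisible_def by blast
  have "ideal_pow (proj p) k (k + m) (\<lambda>r. unif p r ^ k * G r)"
    by (rule ideal_pow_form_mult[OF ideal_pow_unif G(3)])
  then show "order_ge C F (proj p) k" unfolding order_ge_def ball_C
    using G(1,2,5) ball_proj_nonzero[OF G(1)] by blast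
qed

definition ord :: "'a ^ 4 \<Rightarrow> ('a ^ 4 \<Rightarrow> 'a) \<Rightarrow> nat" where
  "ord p F = (GREATEST k. order_ge C F (proj p) k)"

lemma form_div_C: "form_div C F (proj p) = (if p \<in> V then int (ord p F) else 0)"
  by (simp add: form_div_def ord_def proj_in_C)

lemma vanishes_on_C: "vanishes_on F C \<longleftrightarrow> \<not> nv F"
  unfolding vanishes_on_def ball_C nv_def by blast

lemma has_ord_nv:
  assumes "p \<in> V" "has_ord p n F k" shows "nv F"
proof -
  obtain e D m G where G: "hform UNIV m G" "G p \<noteq> 0"
    "\<And>r. r \<in> V \<Longrightarrow> D r * F r = unif p r ^ k * G r" using assms unfolding has_ord_def by blast
  have "hform UNIV (k * 1) (\<lambda>r. unif p r ^ k)" by (rule hform_power[OF hform_unif])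
  from nv_mult[OF this G(1) nv_power[OF hform_unif nv_unif[OF assms(1)]] nvI[where F = G, OF assms(1) G(2)]]
  have "nv (\<lambda>r. unif p r ^ k * G r)" .
  then have "nv (\<lambda>r. D r * F r)" by (rule nv_cong) (simp add: G(3))
  then show ?thesis using nv_multD by blast
qed

lemma ord_eqI:
  assumes p: "p \<in> V" and F: "hform UNIV n F" and o: "has_ord p n F k"
  shows "ord p F = k"
  unfolding ord_def order_ge_iff[OF p F has_ord_nv[OF p o]]
  by (rule Greatest_equality) (use has_ord_divisible[OF o] divisible_le[OF p o] in auto)

lemma has_ord_ord: "p \<in> V \<Longrightarrow> hform UNIV n F \<Longrightarrow> nv F \<Longrightarrow> has_ord p n F (ord p F)"
  using has_ord_exists ord_eqI by metis

lemma divisible_iff_ord: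
  "p \<in> V \<Longrightarrow> hform UNIV n F \<Longrightarrow> nv F \<Longrightarrow> divisible p k n F \<longleftrightarrow> k \<le> ord p F"
  using divisible_le[OF _ has_ord_ord] divisible_mono[OF has_ord_divisible[OF has_ord_ord]] by blast

lemma ord_mult:
  "p \<in> V \<Longrightarrow> hform UNIV n F \<Longrightarrow> nv F \<Longrightarrow> hform UNIV m G \<Longrightarrow> nv G \<Longrightarrow> ord p (\<lambda>r. F r * G r) = ord p F + ord p G"
  by (intro ord_eqI[OF _ hform_mult] has_ord_mult has_ord_ord)

lemma ord_square:
  "p \<in> V \<Longrightarrow> hform UNIV n F \<Longrightarrow> nv F \<Longrightarrow> ord p (\<lambda>r. F r ^ 2) = 2 * ord p F"
  using ord_mult[of p n F n F] by (simp add: power2_eq_square)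

lemma ord_cong:
  assumes "\<And>r. r \<in> V \<Longrightarrow> F r = G r" shows "ord p F = ord p G"
proof -
  have "order_ge C F (proj p) k = order_ge C G (proj p) k" for k
    unfolding order_ge_def ball_C using assms by auto
  then have "order_ge C F (proj p) = order_ge C G (proj p)" by blast
  then show ?thesis unfolding ord_def by simp
qed

lemma ord_eq_0: "p \<in> V \<Longrightarrow> hform UNIV n F \<Longrightarrow> F p \<noteq> 0 \<Longrightarrow> ord p F = 0"
  using ord_eqI has_ord_0 by blast

text \<open>Divisibility by the line means that all four coefficients of the normal form vanish at
  \<open>(z0, w0)\<close>. Over an unramified point the vanishing of \<open>H\<close> on the fibre
  gives this. Over a branch point the fibre has only two points and yields half of the conditions;
  there the line has order two, and the second order of \<open>H\<close> yields the other
  half.\<close>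

lemma line_divides:
  assumes nz: "z0 \<noteq> 0 \<or> w0 \<noteq> 0" and H: "hform UNIV n H" "nv H"
    and le: "\<And>p. p \<in> V \<Longrightarrow> ord p (\<lambda>r. w0 * cZ r - z0 * cW r) \<le> ord p H"
  shows "\<exists>G. hform UNIV (n - 1) G \<and> (\<forall>r\<in>V. H r = (w0 * cZ r - z0 * cW r) * G r)"
proof -
  let ?l = "\<lambda>r. w0 * cZ r - z0 * cW r"
  obtain a b c d where bfs: "bf (int n) a" "bf (int n - 1) b" "bf (int n - 1) c" "bf (int n - 2) d"
    and Hp: "\<And>p. p \<in> V \<Longrightarrow> H p = nf a b c d p"
    using hform_has_nf[OF H(1)] unfolding has_nf_def by blast
  have ord_l: "ord p ?l = (if cX p = 0 \<or> cY p = 0 then 2 else 1)" if "p \<in> V" "?l p = 0" for p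
    using ord_eqI[OF that(1) hform_line has_ord_line[OF that(1) nz that(2)]] .
  have H0: "H p = 0" if "p \<in> V" "?l p = 0" for p
    using le[OF that(1)] ord_l[OF that] ord_eq_0[OF that(1) H(1)] by (cases "H p = 0") (auto split: if_splits)
  obtain x y where xy: "pt x y z0 w0 \<in> V" "pt (- x) y z0 w0 \<in> V" "pt x (- y) z0 w0 \<in> V" "pt (- x) (- y) z0 w0 \<in> V"
      "x ^ 2 = z0 * w0" "y ^ 2 = q z0 w0"
    using V_nonempty_over[OF nz] by metis
  have l0: "?l (pt x' y' z0 w0) = 0" for x' y' by simp
  note HH = xy(1-4)[THEN H0, OF l0]
  have e: "a z0 w0 + b z0 w0 * x + c z0 w0 * y + d z0 w0 * x * y = 0" "a z0 w0 - b z0 w0 * x + c z0 w0 * y - d z0 w0 * x * y = 0"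
      "a z0 w0 + b z0 w0 * x - c z0 w0 * y - d z0 w0 * x * y = 0" "a z0 w0 - b z0 w0 * x - c z0 w0 * y + d z0 w0 * x * y = 0"
      using HH xy(1-4)[THEN Hp] by (simp_all add: nf_def)
  have s: "a z0 w0 = 0" "b z0 w0 * x = 0" "c z0 w0 * y = 0" "d z0 w0 * x * y = 0"
      using four_signs[OF two e] by auto
  obtain a' where a': "bf (int n - 1) a'" "\<And>z w. a z w = (w0 * z - z0 * w) * a' z w"
    using bf_linear_divide[OF bfs(1) s(1) nz] by blast
  have n1: "int (n - 1) = int n - 1" if "\<not> (b = (\<lambda>z w. 0) \<and> c = (\<lambda>z w. 0) \<and> d = (\<lambda>z w. 0))"
    using bfs(2-4) that by (auto simp: bf_def)
  have hn: "hform UNIV (n - 1) (nf a1 b1 c1 d1)" if "bf (int n - 1) a1" "bf (int n - 2) b1" "bf (int n - 2) c1" "bf (int n - 3) d1"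
    for a1 b1 c1 d1
  proof (cases "n = 0")
    case True
    then have "a1 = (\<lambda>_ _. 0)" "b1 = (\<lambda>_ _. 0)" "c1 = (\<lambda>_ _. 0)" "d1 = (\<lambda>_ _. 0)"
      using bf_neg[OF that(1)] bf_neg[OF that(2)] bf_neg[OF that(3)] bf_neg[OF that(4)] by simp_all
    then show ?thesis by (simp add: nf_def[abs_def] hform_zero)
  next
    case False
    then show ?thesis using that by (intro hform_nf) auto
  qed
  have nd: "\<not> divisible p 2 n (\<lambda>r. L r * K r)" if "p \<in> V" "has_ord p 1 L 1" "hform UNIV (n - 1) K" "K p \<noteq> 0" "n \<noteq> 0" for p L K
    using divisible_le[OF that(1) has_ord_mult[OF that(2) has_ord_0[OF that(3,4)]], of 2] that(5) by auto
  have bcd: "b z0 w0 = 0 \<and> c z0 w0 = 0 \<and> d z0 w0 = 0"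
  proof (cases "n = 0")
    case True
    then have "b = (\<lambda>z w. 0)" "c = (\<lambda>z w. 0)" "d = (\<lambda>z w. 0)"
      using bf_neg[OF bfs(2)] bf_neg[OF bfs(3)] bf_neg[OF bfs(4)] by simp_all
    then show ?thesis by simp
  next
    case n: False
    have d2: "divisible p 2 n H" and dl: "hform UNIV (n - 1) K \<Longrightarrow> divisible p 2 n (\<lambda>r. - 1 * (?l r * K r))"
      if "p \<in> V" "?l p = 0" "cX p = 0 \<or> cY p = 0" for p K
    proof -
      show "divisible p 2 n H"
        unfolding divisible_iff_ord[OF that(1) H] using le[OF that(1)] ord_l[OF that(1,2)] that(3) by simp
      have "divisible p 2 1 ?l"
        unfolding divisible_iff_ord[OF that(1) hform_line nv_line[OF nz]] using ord_l[OF that(1,2)] that(3) by simp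
      from divisible_scale[OF divisible_form_mult[OF this], of "n - 1" K "- 1"]
      show "hform UNIV (n - 1) K \<Longrightarrow> divisible p 2 n (\<lambda>r. - 1 * (?l r * K r))" using n by simp
    qed
    consider "x = 0" | "x \<noteq> 0" "y = 0" | "x \<noteq> 0" "y \<noteq> 0" by blast
    then show ?thesis
    proof cases
      case 1
      then have y: "y \<noteq> 0" using not_XY[OF xy(1)] by simp
      then have c0: "c z0 w0 = 0" using s by simp
      obtain c' where c': "bf (int n - 2) c'" "\<And>z w. c z w = (w0 * z - z0 * w) * c' z w"
        using bf_linear_divide[OF bfs(3) c0 nz] by (metis diff_diff_eq one_add_one)
      define K where "K = nf a' (\<lambda>_ _. 0) c' (\<lambda>_ _. 0)"
      define J where "J = nf b (\<lambda>_ _. 0) d (\<lambda>_ _. 0)"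
      have K: "hform UNIV (n - 1) K" unfolding K_def by (intro hn a' c' bf_zero)
      have J: "hform UNIV (n - 1) J" unfolding J_def using bfs by (intro hn bf_zero) auto
      have "J p = 0" if p: "p \<in> V" "?l p = 0" "cX p = 0" for p
      proof (rule ccontr)
        assume "J p \<noteq> 0"
        from nd[OF p(1) has_ord_X[OF p(3)] J this n] show False
        proof (rule notE)
          \<comment> \<open>After the part divisible by the line is removed, \<open>X J\<close>
            remains. It has order at least two while \<open>X\<close> has order one, so
            \<open>J\<close> cannot be a unit.\<close>
          have "divisible p 2 n (\<lambda>r. H r + - 1 * (?l r * K r))"
            by (intro divisible_add d2 dl K p) (use p in auto)
          then show "divisible p 2 n (\<lambda>r. cX r * J r)"
            by (rule divisible_cong) (simp add: Hp nf_def K_def J_def a'(2) c'(2) algebra_simps)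
        qed
      qed
      from this[OF xy(1)] this[OF xy(3)] 1 have "b z0 w0 + d z0 w0 * y = 0" "b z0 w0 - d z0 w0 * y = 0"
        by (simp_all add: J_def nf_def)
      then have "b z0 w0 = 0 \<and> d z0 w0 * y = 0"
        using four_signs[OF two, of "b z0 w0" 0 "d z0 w0 * y" 0] by simp
      then show ?thesis using y c0 by simp
    next
      case 2
      then have b0: "b z0 w0 = 0" using s by simp
      obtain b' where b': "bf (int n - 2) b'" "\<And>z w. b z w = (w0 * z - z0 * w) * b' z w"
        using bf_linear_divide[OF bfs(2) b0 nz] by (metis diff_diff_eq one_add_one)
      define K where "K = nf a' b' (\<lambda>_ _. 0) (\<lambda>_ _. 0)"
      define J where "J = nf c d (\<lambda>_ _. 0) (\<lambda>_ _. 0)"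
      have K: "hform UNIV (n - 1) K" unfolding K_def by (intro hn a' b' bf_zero)
      have J: "hform UNIV (n - 1) J" unfolding J_def using bfs by (intro hn bf_zero) auto
      have "J p = 0" if p: "p \<in> V" "?l p = 0" "cX p \<noteq> 0" "cY p = 0" for p
      proof (rule ccontr)
        assume "J p \<noteq> 0"
        from nd[OF p(1) has_ord_Y[OF p(3,4)] J this n] show False
        proof (rule notE)
          \<comment> \<open>The same argument with \<open>Y\<close> as the parameter: what remains
            is \<open>Y J\<close>.\<close>
          have "divisible p 2 n (\<lambda>r. H r + - 1 * (?l r * K r))"
            by (intro divisible_add d2 dl K p) (use p in auto)
          then show "divisible p 2 n (\<lambda>r. cY r * J r)"
            by (rule divisible_cong) (simp add: Hp nf_def K_def J_def a'(2) b'(2) algebra_simps)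
        qed
      qed
      from this[OF xy(1)] this[OF xy(2)] 2 have "c z0 w0 + d z0 w0 * x = 0" "c z0 w0 - d z0 w0 * x = 0"
        by (simp_all add: J_def nf_def)
      then have "c z0 w0 = 0 \<and> d z0 w0 * x = 0"
        using four_signs[OF two, of "c z0 w0" 0 "d z0 w0 * x" 0] by simp
      then show ?thesis using 2 b0 by simp
    next
      case 3
      then show ?thesis using s by simp
    qed
  qed
  obtain b' where b': "bf (int n - 1 - 1) b'" "\<And>z w. b z w = (w0 * z - z0 * w) * b' z w"
    using bf_linear_divide[OF bfs(2) _ nz] bcd by blast
  obtain c' where c': "bf (int n - 1 - 1) c'" "\<And>z w. c z w = (w0 * z - z0 * w) * c' z w"
    using bf_linear_divide[OF bfs(3) _ nz] bcd by blast
  obtain d' where d': "bf (int n - 2 - 1) d'" "\<And>z w. d z w = (w0 * z - z0 * w) * d' z w"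
    using bf_linear_divide[OF bfs(4) _ nz] bcd by blast
  have "hform UNIV (n - 1) (nf a' b' c' d')" using a'(1) b'(1) c'(1) d'(1) by (intro hn) auto
  moreover have "H r = ?l r * nf a' b' c' d' r" if "r \<in> V" for r
    unfolding Hp[OF that] nf_def a'(2) b'(2) c'(2) d'(2) by (simp add: algebra_simps)
  ultimately show ?thesis by blast
qed

lemma bf_divides:
  assumes "bf (int d) N" "N \<noteq> (\<lambda>z w. 0)" "hform UNIV n H" "nv H"
    and "\<And>p. p \<in> V \<Longrightarrow> ord p (\<lambda>r. N (cZ r) (cW r)) \<le> ord p H"
  shows "\<exists>G. hform UNIV (n - d) G \<and> (\<forall>r\<in>V. H r = N (cZ r) (cW r) * G r)"
  using assms
proof (induction d arbitrary: N n H)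
  case 0
  then obtain c where c: "N = (\<lambda>z w. c)" using bf_degree_0 by (metis of_nat_0)
  moreover have "c \<noteq> 0" using 0 c by auto
  ultimately show ?case using hform_scale[OF 0(3), of "1 / c"] by (intro exI[of _ "\<lambda>r. 1 / c * H r"]) auto
next
  case (Suc d)
  obtain z0 w0 where nz: "z0 \<noteq> 0 \<or> w0 \<noteq> 0" and "N z0 w0 = 0"
    using bf_root[OF Suc.prems(1)] by auto
  then obtain M where M: "bf (int d) M" "\<And>z w. N z w = (w0 * z - z0 * w) * M z w"
    using bf_linear_divide[OF Suc.prems(1), of z0 w0] by auto
  have Mnz: "M \<noteq> (\<lambda>z w. 0)" using M(2) Suc.prems(2) by auto
  have nvM: "nv (\<lambda>r. M (cZ r) (cW r))"
  proof (rule ccontr)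
    assume *: "\<not> ?thesis"
    have "M z w = 0" if "z \<noteq> 0 \<or> w \<noteq> 0" for z w
      using V_nonempty_over[OF that] * nvI[of _ "\<lambda>r. M (cZ r) (cW r)"] by (metis pt_coords(3,4))
    then show False using Mnz bf_zero_onI[OF M(1)] by blast
  qed
  have oN: "ord p (\<lambda>r. N (cZ r) (cW r)) = ord p (\<lambda>r. w0 * cZ r - z0 * cW r) + ord p (\<lambda>r. M (cZ r) (cW r))"
    if "p \<in> V" for p
    unfolding M(2) by (rule ord_mult[OF that hform_line nv_line[OF nz] hform_bf0[OF M(1)] nvM])
  obtain G where G: "hform UNIV (n - 1) G" "\<And>r. r \<in> V \<Longrightarrow> H r = (w0 * cZ r - z0 * cW r) * G r"
    using line_divides[OF nz Suc.prems(3,4)] Suc.prems(5) oN by fastforce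
  have "nv (\<lambda>r. (w0 * cZ r - z0 * cW r) * G r)" by (rule nv_cong[OF Suc.prems(4)]) (rule G(2))
  then have nvG: "nv G" by (auto simp: nv_def)
  have "ord p (\<lambda>r. M (cZ r) (cW r)) \<le> ord p G" if p: "p \<in> V" for p
    using Suc.prems(5)[OF p] oN[OF p] ord_mult[OF p hform_line nv_line[OF nz] G(1) nvG] ord_cong[OF G(2), where p = p] by simp
  from Suc.IH[OF M(1) Mnz G(1) nvG this] obtain K where
    "hform UNIV (n - 1 - d) K" "\<And>r. r \<in> V \<Longrightarrow> G r = M (cZ r) (cW r) * K r" by blast
  then show ?case using G(2) by (intro exI[of _ K]) (auto simp: M(2) algebra_simps)
qed

text \<open>The homogeneous coordinate ring is integrally closed: a quotient without poles is a form.\<close>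

theorem form_divides:
  assumes H: "hform UNIV n H" "nv H" and G: "hform UNIV m G" "nv G"
    and le: "\<And>p. p \<in> V \<Longrightarrow> ord p G \<le> ord p H"
  obtains K where "hform UNIV (n - m) K" "m \<le> n" "\<And>r. r \<in> V \<Longrightarrow> H r = G r * K r"
proof -
  obtain G' N where G': "hform UNIV (3 * m) G'" and N: "bf (int (4 * m)) N" "N \<noteq> (\<lambda>z w. 0)"
    "\<And>p. p \<in> V \<Longrightarrow> G p * G' p = N (cZ p) (cW p)"
    using norm_exists[OF G(1)] G(2) unfolding nv_def by metis
  have nvG': "nv G'"
  proof (rule ccontr)
    assume *: "\<not> ?thesis"
    have "N z w = 0" if "z \<noteq> 0 \<or> w \<noteq> 0" for z w
      using V_nonempty_over[OF that] * nvI[of _ G'] N(3) by (metis mult_zero_right pt_coords(3,4))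
    then show False using N(2) bf_zero_onI[OF N(1)] by blast
  qed
  \<comment> \<open>The quotient of \<open>H\<close> by \<open>G\<close> is also that of
    \<open>H G'\<close> by the norm of \<open>G\<close>, so a binary divisor suffices.\<close>
  have "ord p (\<lambda>r. N (cZ r) (cW r)) \<le> ord p (\<lambda>r. H r * G' r)" if p: "p \<in> V" for p
    using le[OF p] ord_mult[OF p G G' nvG'] ord_mult[OF p H G' nvG'] ord_cong[OF N(3), where p = p] by simp
  from bf_divides[OF N(1,2) hform_mult[OF H(1) G'] nv_mult[OF H(1) G' H(2) nvG'] this]
  obtain K where K: "hform UNIV (n + 3 * m - 4 * m) K" "\<And>r. r \<in> V \<Longrightarrow> H r * G' r = N (cZ r) (cW r) * K r" by blast
  have eq: "H r = G r * K r" if "r \<in> V" for r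
    by (rule V_cancel[OF G' H(1) hform_mult[OF G(1) K(1)] nvG' _ that])
      (use K(2) N(3)[symmetric] in \<open>simp add: mult_ac\<close>)
  have "nv (\<lambda>r. G r * K r)" by (rule nv_cong[OF H(2)]) (rule eq)
  then have "n = m + (n + 3 * m - 4 * m)"
    using degree_unique[OF H(1) hform_mult[OF G(1) K(1)] eq H(2)] by blast
  then show ?thesis using that[of K] K(1) eq by auto
qed

text \<open>Both quotients are forms, so the degrees agree and the quotient is a constant.\<close>

lemma same_ord_proportional:
  assumes H: "hform UNIV n H" "nv H" and G: "hform UNIV m G" "nv G"
    and eq: "\<And>p. p \<in> V \<Longrightarrow> ord p G = ord p H"
  obtains c where "c \<noteq> 0" "n = m" "\<And>r. r \<in> V \<Longrightarrow> H r = c * G r"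
proof -
  obtain K where K: "hform UNIV (n - m) K" "m \<le> n" "\<And>r. r \<in> V \<Longrightarrow> H r = G r * K r"
    using form_divides[OF H G] eq by (metis order_refl)
  obtain K' where K': "n \<le> m"
    using form_divides[OF G H] eq by (metis order_refl)
  then obtain c where "K = (\<lambda>_. c)" using K(1,2) hform_0D by fastforce
  moreover have "c \<noteq> 0" using calculation K(3) H(2) unfolding nv_def by auto
  ultimately show ?thesis using that[of c] K K' by (auto simp: mult.commute)
qed

end

section \<open>Transport of divisors along isomorphisms\<close>

lemma ideal_pow_degree: "ideal_pow p n d F \<Longrightarrow> n \<le> d"
  by (induction rule: ideal_pow.induct) auto

text \<open>A linear form vanishing at \<open>\<Psi> x0\<close> pulls back to a form vanishing at
  \<open>x0\<close>, which lies in the ideal of that point. If the pullback is identically zero,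
  membership is a matter of degrees only, and positivity of \<open>d\<close> makes the degree large
  enough.\<close>

lemma ideal_pow_compose:
  fixes \<Psi> :: "'a::field ^ 'm \<Rightarrow> 'a ^ 'n"
  assumes \<Psi>: "\<And>i. hform UNIV d (\<lambda>x. \<Psi> x $ i)" and "d > 0" "x0 \<noteq> 0" "\<Psi> x0 \<in> q"
    and "ideal_pow q n k H"
  shows "ideal_pow (proj x0) n (k * d) (\<lambda>x. H (\<Psi> x))"
  using assms(5)
proof (induction rule: ideal_pow.induct)
  case (1 k F)
  then show ?case by (intro ideal_pow.intros hform_compose \<Psi>)
next
  case (2 n k F h)
  have "hform UNIV (1 * d) (\<lambda>x. h (\<Psi> x))" by (rule hform_compose[OF 2(2) \<Psi>])
  moreover have "h (\<Psi> x0) = 0" using 2(3) assms(4) by blast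
  ultimately consider "ideal_pow (proj x0) 1 d (\<lambda>x. h (\<Psi> x))" | "(\<lambda>x. h (\<Psi> x)) = (\<lambda>_. 0)"
    using ideal_pow_vanishing[of d "\<lambda>x. h (\<Psi> x)" x0] assms(3) by auto
  then show ?case
  proof cases
    case 1
    from ideal_pow_mult[OF this 2(4)] show ?thesis by simp
  next
    case z: 2
    have "Suc n \<le> Suc k * d"
      using ideal_pow_degree[OF 2(1)] assms(2) by (metis One_nat_def Suc_leI Suc_le_mono le_trans mult.right_neutral mult_le_mono2)
    then obtain j where "Suc k * d = Suc n + j" using le_Suc_ex by blast
    then show ?thesis using ideal_pow_zero[of "proj x0" "Suc n" j] fun_cong[OF z] by simp
  qed
qed (rule ideal_pow.intros(3))

lemma form_nonzero_on_proj: "hform UNIV n G \<Longrightarrow> G x0 \<noteq> 0 \<Longrightarrow> \<forall>x\<in>proj x0. G x \<noteq> 0"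
  by (auto simp: mem_proj_iff hform_homogeneous)

lemma proj_eq_of_mem: "x \<in> proj y \<Longrightarrow> proj y = proj x"
  using proj_eqI by (auto simp: mem_proj_iff)

lemma order_ge_pull:
  fixes \<Psi> :: "'a::field ^ 'm \<Rightarrow> 'a ^ 'n"
  assumes \<Psi>: "\<And>i. hform UNIV d (\<lambda>x. \<Psi> x $ i)" and "d > 0" "x0 \<noteq> 0" "\<Psi> x0 \<noteq> 0"
    and maps: "\<And>p x. p \<in> V1 \<Longrightarrow> x \<in> p \<Longrightarrow> \<Psi> x \<noteq> 0 \<Longrightarrow> proj (\<Psi> x) \<in> V2"
    and "order_ge V2 f (proj (\<Psi> x0)) n"
  shows "order_ge V1 (\<lambda>x. f (\<Psi> x)) (proj x0) n"
proof -
  obtain e G k H where G: "hform UNIV e G" "\<forall>x\<in>proj (\<Psi> x0). G x \<noteq> 0" "ideal_pow (proj (\<Psi> x0)) n k H"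
    "\<forall>q\<in>V2. \<forall>x\<in>q. G x * f x = H x" using assms(6) unfolding order_ge_def by blast
  obtain i where i: "\<Psi> x0 $ i \<noteq> 0" using assms(4) by (metis vec_eq_iff zero_index)
  \<comment> \<open>The extra coordinate of \<Psi> makes both sides vanish at the base points of
    \<Psi>, where nothing is known about the equation on \<open>V2\<close>.\<close>
  have 1: "hform UNIV (d + e * d) (\<lambda>x. \<Psi> x $ i * G (\<Psi> x))"
    by (rule hform_mult[OF \<Psi> hform_compose[OF G(1) \<Psi>]])
  have "ideal_pow (proj x0) n (k * d + d) (\<lambda>x. H (\<Psi> x) * \<Psi> x $ i)"
    by (rule ideal_pow_form_mult[OF ideal_pow_compose[OF \<Psi> assms(2,3) proj_self G(3)] \<Psi>])
  moreover have "\<forall>x\<in>proj x0. \<Psi> x $ i * G (\<Psi> x) \<noteq> 0"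
    by (rule form_nonzero_on_proj[OF 1]) (use i G(2) proj_self in auto)
  moreover have "\<Psi> x $ i * G (\<Psi> x) * f (\<Psi> x) = H (\<Psi> x) * \<Psi> x $ i" if "q \<in> V1" "x \<in> q" for q x
    using G(4) maps[OF that] proj_self by (cases "\<Psi> x = 0") auto
  ultimately show ?thesis unfolding order_ge_def using 1 by blast
qed

lemma hform_0_zero: "hform UNIV d F \<Longrightarrow> d > 0 \<Longrightarrow> F 0 = 0"
  using hform_homogeneous[of d F 0 0] by (simp add: power_0_left)

text \<open>Multiplication by a coordinate that is non-zero at \<open>x0\<close> makes the degree
  positive without changing the map near \<open>x0\<close>.\<close>

lemma regular_map_rep:
  fixes V1 :: "('a::field ^ 'm) set set" and \<phi> :: "('a ^ 'm) set \<Rightarrow> ('a ^ 'n) set"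
  assumes "regular_map S V1 V2 \<phi>" "proj x0 \<in> V1" "x0 \<noteq> 0"
  obtains d and \<Psi> :: "'a ^ 'm \<Rightarrow> 'a ^ 'n" where "d > 0" "\<And>i. hform UNIV d (\<lambda>x. \<Psi> x $ i)" "\<Psi> x0 \<noteq> 0"
    "\<And>p x. p \<in> V1 \<Longrightarrow> x \<in> p \<Longrightarrow> \<Psi> x \<noteq> 0 \<Longrightarrow> \<phi> p = proj (\<Psi> x)"
proof -
  obtain d and F :: "'a ^ 'm \<Rightarrow> 'a ^ 'n" where F: "\<forall>i. hform S d (\<lambda>x. F x $ i)" "\<forall>x\<in>proj x0. F x \<noteq> 0"
    "\<forall>p\<in>V1. \<forall>x\<in>p. F x \<noteq> 0 \<longrightarrow> \<phi> p = proj (F x)"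
    using bspec[OF conjunct2[OF assms(1)[unfolded regular_map_def]] assms(2)] by (elim exE conjE) (rule that)
  obtain i where i: "x0 $ i \<noteq> 0" using assms(3) by (metis vec_eq_iff zero_index)
  show ?thesis
  proof (rule that[of "Suc d" "\<lambda>x. x $ i *s F x"])
    show "hform UNIV (Suc d) (\<lambda>x. (x $ i *s F x) $ j)" for j
      using hform_coord_mult[OF hform_UNIV_mono[of S d "\<lambda>x. F x $ j"], of i] F(1) by simp
    show "x0 $ i *s F x0 \<noteq> 0" using i F(2) proj_self[of x0] by (metis vec.scale_eq_0_iff)
    show "\<phi> p = proj (x $ i *s F x)" if "p \<in> V1" "x \<in> p" "x $ i *s F x \<noteq> 0" for p x
      using F(3) that proj_eqI[of "x $ i" "F x"] by (metis vec.scale_eq_0_iff)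
  qed simp
qed

context normal_curve
begin

lemma ord_power:
  "p \<in> V \<Longrightarrow> hform UNIV n F \<Longrightarrow> nv F \<Longrightarrow> ord p (\<lambda>r. F r ^ k) = k * ord p F"
proof (induction k)
  case 0
  then show ?case using ord_eq_0[OF _ hform_const[of 1]] by simp
next
  case (Suc k)
  then show ?case using ord_mult[OF _ _ _ hform_power[of n F k] nv_power[of n F k], of p n F] by simp
qed

lemma V_nonzero: "p \<in> V \<Longrightarrow> p \<noteq> 0"
  unfolding V_def by blast

section \<open>Divisor classes carried from \<open>E\<close> to the curve\<close>

context
  fixes E :: "('a ^ 'm) set set" and \<psi> :: "('a ^ 4) set \<Rightarrow> ('a ^ 'm) set"
  assumes iso: "iso_over UNIV C E \<psi>" and E_points: "\<And>e. e \<in> E \<Longrightarrow> \<exists>v. v \<noteq> 0 \<and> e = proj v"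
begin

definition local_rep :: "'a ^ 4 \<Rightarrow> nat \<Rightarrow> ('a ^ 4 \<Rightarrow> 'a ^ 'm) \<Rightarrow> bool" where
  "local_rep p d \<Psi> \<longleftrightarrow> d > 0 \<and> (\<forall>i. hform UNIV d (\<lambda>x. \<Psi> x $ i)) \<and> \<Psi> p \<noteq> 0 \<and>
     (\<forall>r\<in>V. \<Psi> r \<noteq> 0 \<longrightarrow> \<psi> (proj r) = proj (\<Psi> r))"

lemma local_rep_exists: "p \<in> V \<Longrightarrow> \<exists>d \<Psi>. local_rep p d \<Psi>"
proof -
  assume p: "p \<in> V"
  have "regular_map UNIV C E \<psi>" using iso by (simp add: iso_over_def)
  from regular_map_rep[OF this _ V_nonzero[OF p]] p obtain d and \<Psi> :: "'a ^ 4 \<Rightarrow> 'a ^ 'm" where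
    "d > 0" "\<And>i. hform UNIV d (\<lambda>x. \<Psi> x $ i)" "\<Psi> p \<noteq> 0"
    "\<And>p x. p \<in> C \<Longrightarrow> x \<in> p \<Longrightarrow> \<Psi> x \<noteq> 0 \<Longrightarrow> \<psi> p = proj (\<Psi> x)" by (metis proj_in_C)
  then show ?thesis unfolding local_rep_def using proj_self proj_in_C by blast
qed

lemma \<psi>_bij: "bij_betw \<psi> C E"
  using iso by (simp add: iso_over_def)

lemma \<psi>_in: "p \<in> V \<Longrightarrow> \<psi> (proj p) \<in> E"
  using \<psi>_bij proj_in_C by (auto simp: bij_betw_def)

text \<open>Pulling back along \<Psi> gives one direction. For the other, the pullback along a
  representation \<rho> of the inverse speaks of \<open>f (\<Psi> (\<rho> y))\<close>; here
  \<open>\<Psi> (\<rho> y)\<close> is a multiple of \<open>y\<close> by a factor varying with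
  \<open>y\<close>, and homogeneity of \<open>f\<close> turns it into a power of that factor, a unit
  at the point.\<close>

lemma order_ge_transport:
  assumes p: "p \<in> V" and rep: "local_rep p d \<Psi>" and f: "hform UNIV e f"
  shows "order_ge E f (\<psi> (proj p)) n \<longleftrightarrow> order_ge C (\<lambda>x. f (\<Psi> x)) (proj p) n"
proof -
  have \<Psi>: "\<And>i. hform UNIV d (\<lambda>x. \<Psi> x $ i)" "d > 0" "\<Psi> p \<noteq> 0"
    "\<And>r. r \<in> V \<Longrightarrow> \<Psi> r \<noteq> 0 \<Longrightarrow> \<psi> (proj r) = proj (\<Psi> r)"
    using rep unfolding local_rep_def by blast+
  have C_rep: "q = proj x \<and> x \<in> V" if "q \<in> C" "x \<in> q" for q x
  proof -
    obtain r where r: "r \<in> V" "q = proj r" using \<open>q \<in> C\<close> unfolding C_def by blast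
    then have "q = proj x" using proj_eq_of_mem \<open>x \<in> q\<close> by blast
    then show ?thesis using \<open>q \<in> C\<close> proj_in_C by blast
  qed
  have E_rep: "q = proj x \<and> x \<noteq> 0" if "q \<in> E" "x \<in> q" for q x
  proof -
    obtain v where v: "v \<noteq> 0" "q = proj v" using E_points[OF \<open>q \<in> E\<close>] by blast
    then show ?thesis using proj_eq_of_mem \<open>x \<in> q\<close> by (auto simp: mem_proj_iff)
  qed
  define v where "v = \<Psi> p"
  have v: "v \<noteq> 0" "\<psi> (proj p) = proj v" using \<Psi>(3,4) p by (auto simp: v_def)
  have vE: "proj v \<in> E" using \<psi>_in[OF p] v by simp
  have "order_ge C (\<lambda>x. f (\<Psi> x)) (proj p) n" if "order_ge E f (proj v) n"
  proof (rule order_ge_pull[OF \<Psi>(1,2) V_nonzero[OF p] \<Psi>(3) _ that[unfolded v_def]])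
    fix q x assume "q \<in> C" "x \<in> q" "\<Psi> x \<noteq> 0"
    then show "proj (\<Psi> x) \<in> E" using C_rep \<Psi>(4) \<psi>_in by metis
  qed
  moreover have "order_ge E f (proj v) n" if o: "order_ge C (\<lambda>x. f (\<Psi> x)) (proj p) n"
  proof -
    have inv: "inv_into C \<psi> (\<psi> q) = q" if "q \<in> C" for q
      using \<psi>_bij that by (auto simp: bij_betw_def)
    have "regular_map UNIV E C (inv_into C \<psi>)" using iso by (simp add: iso_over_def)
    from regular_map_rep[OF this vE v(1)] obtain k and \<rho> :: "'a ^ 'm \<Rightarrow> 'a ^ 4" where
      \<rho>: "k > 0" "\<And>i. hform UNIV k (\<lambda>x. \<rho> x $ i)" "\<rho> v \<noteq> 0"
      "\<And>q x. q \<in> E \<Longrightarrow> x \<in> q \<Longrightarrow> \<rho> x \<noteq> 0 \<Longrightarrow> inv_into C \<psi> q = proj (\<rho> x)" by metis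
    have \<rho>V: "proj (\<rho> x) \<in> C" "\<psi> (proj (\<rho> x)) = q" if "q \<in> E" "x \<in> q" "\<rho> x \<noteq> 0" for q x
      using \<rho>(4)[OF that, symmetric] that(1) \<psi>_bij
      by (auto simp: bij_betw_def inv_into_into f_inv_into_f)
    have pv: "proj (\<rho> v) = proj p" using \<rho>(4)[OF vE proj_self \<rho>(3)] inv[of "proj p"] p v(2) proj_in_C by metis
    have o': "order_ge C (\<lambda>x. f (\<Psi> x)) (proj (\<rho> v)) n" using o pv by simp
    have o2: "order_ge E (\<lambda>y. f (\<Psi> (\<rho> y))) (proj v) n"
      by (rule order_ge_pull[OF \<rho>(2,1) v(1) \<rho>(3) _ o']) (use \<rho>V in blast)
    have mult: "\<exists>\<mu>. \<Psi> (\<rho> y) = \<mu> *s y" if q: "q \<in> E" "y \<in> q" for q y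
    proof (cases "\<Psi> (\<rho> y) = 0")
      case True
      then show ?thesis by (intro exI[of _ 0]) simp
    next
      case False
      have "\<Psi> 0 $ i = 0" for i using hform_0_zero[OF \<Psi>(1,2)] by blast
      then have "\<Psi> 0 = 0" by (simp add: vec_eq_iff)
      with False have c: "\<rho> y \<noteq> 0" by auto
      have "proj (\<Psi> (\<rho> y)) = proj y"
        using \<Psi>(4)[OF _ False] \<rho>V[OF q c] proj_in_C E_rep[OF q] by metis
      then show ?thesis by (auto simp: proj_eq_iff)
    qed
    obtain i where i: "v $ i \<noteq> 0" using v(1) by (metis vec_eq_iff zero_index)
    have "\<Psi> (\<rho> v) \<noteq> 0"
    proof -
      obtain c where c: "c \<noteq> 0" "\<rho> v = c *s p" using pv by (auto simp: proj_eq_iff)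
      then have "\<Psi> (\<rho> v) $ j = c ^ d * \<Psi> p $ j" for j using hform_homogeneous[OF \<Psi>(1)] by simp
      moreover obtain j where "\<Psi> p $ j \<noteq> 0" using \<Psi>(3) by (metis vec_eq_iff zero_index)
      ultimately have "\<Psi> (\<rho> v) $ j \<noteq> 0" using c(1) by simp
      then show ?thesis by auto
    qed
    then have Pi: "\<Psi> (\<rho> v) $ i \<noteq> 0" using mult[OF vE proj_self] i by fastforce
    obtain m G l H where G: "hform UNIV m G" "\<forall>x\<in>proj v. G x \<noteq> 0" "ideal_pow (proj v) n l H"
      "\<forall>q\<in>E. \<forall>x\<in>q. G x * f (\<Psi> (\<rho> x)) = H x" using o2 unfolding order_ge_def by blast
    \<comment> \<open>The varying factor is the quotient of the i-th coordinates of
      \<open>\<Psi> (\<rho> y)\<close> and \<open>y\<close>; its \<open>e\<close>-th power is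
      cleared with these two coordinates.\<close>
    have G2: "hform UNIV (m + e * (d * k)) (\<lambda>y. G y * (\<Psi> (\<rho> y) $ i) ^ e)"
      by (intro hform_mult[OF G(1)] hform_power hform_compose[OF \<Psi>(1)] \<rho>(2))
    have "ideal_pow (proj v) n (l + e * 1) (\<lambda>y. H y * (y $ i) ^ e)"
      by (intro ideal_pow_form_mult[OF G(3)] hform_power hform_coord)
    moreover have "\<forall>x\<in>proj v. G x * (\<Psi> (\<rho> x) $ i) ^ e \<noteq> 0"
      by (rule form_nonzero_on_proj[OF G2]) (use G(2) Pi proj_self in auto)
    moreover have "G y * (\<Psi> (\<rho> y) $ i) ^ e * f y = H y * (y $ i) ^ e" if q: "q \<in> E" "y \<in> q" for q y
    proof -
      obtain \<mu> where \<mu>: "\<Psi> (\<rho> y) = \<mu> *s y" using mult[OF q] by blast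
      have "G y * f (\<Psi> (\<rho> y)) = H y" using G(4) q by blast
      then have "H y = G y * (\<mu> ^ e * f y)" unfolding \<mu> hform_homogeneous[OF f] by simp
      then show ?thesis unfolding \<mu> by (simp add: power_mult_distrib algebra_simps)
    qed
    ultimately show ?thesis unfolding order_ge_def using G2 by blast
  qed
  ultimately show ?thesis unfolding v(2) by blast
qed

lemma form_div_transport:
  assumes "p \<in> V" "local_rep p d \<Psi>" "hform UNIV e f"
  shows "form_div E f (\<psi> (proj p)) = int (ord p (\<lambda>x. f (\<Psi> x)))"
  unfolding form_div_def ord_def order_ge_transport[OF assms] using \<psi>_in[OF assms(1)] by simp

text \<open>Two local representations are proportional, so a single one computes principal divisors globally.\<close>

lemma global_rep:
  obtains d and \<Psi> :: "'a ^ 4 \<Rightarrow> 'a ^ 'm" where "\<And>i. hform UNIV d (\<lambda>x. \<Psi> x $ i)"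
    "\<And>e f. hform UNIV e f \<Longrightarrow> \<not> vanishes_on f E \<Longrightarrow> nv (\<lambda>x. f (\<Psi> x))"
    "\<And>e f g p. hform UNIV e f \<Longrightarrow> hform UNIV e g \<Longrightarrow> \<not> vanishes_on f E \<Longrightarrow> \<not> vanishes_on g E \<Longrightarrow> p \<in> V \<Longrightarrow>
       form_div E f (\<psi> (proj p)) - form_div E g (\<psi> (proj p)) = int (ord p (\<lambda>x. f (\<Psi> x))) - int (ord p (\<lambda>x. g (\<Psi> x)))"
proof -
  obtain p0 where p0: "p0 \<in> V" using V_nonempty_over[of 1 0] by auto
  obtain d \<Psi> where rep0: "local_rep p0 d \<Psi>" using local_rep_exists[OF p0] by blast
  have \<Psi>: "\<And>i. hform UNIV d (\<lambda>x. \<Psi> x $ i)" using rep0 unfolding local_rep_def by blast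
  have proportional: "\<Psi> r $ i * \<Psi>' r $ j = \<Psi> r $ j * \<Psi>' r $ i" if "local_rep p d' \<Psi>'" "r \<in> V" for p d' \<Psi>' r i j
  proof (cases "\<Psi> r = 0 \<or> \<Psi>' r = 0")
    case False
    then have "proj (\<Psi> r) = proj (\<Psi>' r)" using rep0 that unfolding local_rep_def by metis
    then obtain c where "\<Psi> r = c *s \<Psi>' r" by (auto simp: proj_eq_iff)
    then show ?thesis by simp
  qed auto
  have main: "\<exists>j. \<Psi>' p $ j \<noteq> 0 \<and> nv (\<lambda>r. \<Psi> r $ j) \<and> (\<forall>e f. hform UNIV e f \<longrightarrow>
     (\<forall>r\<in>V. f (\<Psi> r) * (\<Psi>' r $ j) ^ e = f (\<Psi>' r) * (\<Psi> r $ j) ^ e))" 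
    if p: "p \<in> V" and rep: "local_rep p d' \<Psi>'" for p d' \<Psi>'
  proof -
    have \<Psi>': "\<And>i. hform UNIV d' (\<lambda>x. \<Psi>' x $ i)" "\<Psi>' p \<noteq> 0" using rep unfolding local_rep_def by blast+
    obtain j where j: "\<Psi>' p $ j \<noteq> 0" using \<Psi>'(2) by (metis vec_eq_iff zero_index)
    obtain i where i: "\<Psi> p0 $ i \<noteq> 0" using rep0 unfolding local_rep_def by (metis vec_eq_iff zero_index)
    have "nv (\<lambda>r. \<Psi> r $ i * \<Psi>' r $ j)" by (rule nv_mult[OF \<Psi> \<Psi>'(1)]) (use nvI p p0 i j in auto)
    then have "nv (\<lambda>r. \<Psi> r $ j * \<Psi>' r $ i)" by (rule nv_cong) (rule proportional[OF rep])
    then have nvj: "nv (\<lambda>r. \<Psi> r $ j)" by (auto simp: nv_def)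
    have "f (\<Psi> r) * (\<Psi>' r $ j) ^ e = f (\<Psi>' r) * (\<Psi> r $ j) ^ e" if f: "hform UNIV e f" and r: "r \<in> V" for f e r
    proof -
      have "\<Psi>' r $ j *s \<Psi> r = \<Psi> r $ j *s \<Psi>' r" using proportional[OF rep r] by (simp add: vec_eq_iff mult.commute)
      then have "f (\<Psi>' r $ j *s \<Psi> r) = f (\<Psi> r $ j *s \<Psi>' r)" by simp
      then show ?thesis by (simp add: hform_homogeneous[OF f] mult.commute)
    qed
    then show ?thesis using j nvj by blast
  qed
  have nvf: "nv (\<lambda>x. f (\<Psi> x))" if f: "hform UNIV e f" and nvE: "\<not> vanishes_on f E" for e f
  proof -
    obtain q y where q: "q \<in> E" "y \<in> q" "f y \<noteq> 0" using nvE unfolding vanishes_on_def by blast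
    obtain p where p: "p \<in> V" "\<psi> (proj p) = q" using q(1) \<psi>_bij unfolding bij_betw_def C_def by blast
    obtain d' \<Psi>' where rep: "local_rep p d' \<Psi>'" using local_rep_exists[OF p(1)] by blast
    then have pr: "q = proj (\<Psi>' p)" using p unfolding local_rep_def by metis
    then obtain c where c: "c \<noteq> 0" "y = c *s \<Psi>' p" using q(2) by (auto simp: mem_proj_iff)
    then have "f (\<Psi>' p) \<noteq> 0" using q(3) hform_homogeneous[OF f] by auto
    then have n1: "nv (\<lambda>r. f (\<Psi>' r))" using p(1) by (intro nvI[of p]) auto
    obtain j where j: "nv (\<lambda>r. \<Psi> r $ j)" "\<forall>r\<in>V. f (\<Psi> r) * (\<Psi>' r $ j) ^ e = f (\<Psi>' r) * (\<Psi> r $ j) ^ e"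
      using main[OF p(1) rep] f by blast
    have "\<And>i. hform UNIV d' (\<lambda>x. \<Psi>' x $ i)" using rep unfolding local_rep_def by blast
    from nv_mult[OF hform_compose[OF f this] hform_power[OF \<Psi>] n1 nv_power[OF \<Psi> j(1)], of e]
    have "nv (\<lambda>r. f (\<Psi>' r) * (\<Psi> r $ j) ^ e)" .
    then have "nv (\<lambda>r. f (\<Psi> r) * (\<Psi>' r $ j) ^ e)" by (rule nv_cong) (use j(2) in auto)
    then show ?thesis by (auto simp: nv_def)
  qed
  \<comment> \<open>The correction depends on \<open>p\<close> and linearly on the degree, but not
    on the form, so it cancels between two forms of equal degree.\<close>
  have ords: "\<exists>k. \<forall>e f. hform UNIV e f \<longrightarrow> \<not> vanishes_on f E \<longrightarrow>
       int (ord p (\<lambda>x. f (\<Psi> x))) = form_div E f (\<psi> (proj p)) + int e * k" if p: "p \<in> V" for p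
  proof -
    obtain d' \<Psi>' where rep: "local_rep p d' \<Psi>'" using local_rep_exists[OF p(1)] by blast
    have \<Psi>': "\<And>i. hform UNIV d' (\<lambda>x. \<Psi>' x $ i)" using rep unfolding local_rep_def by blast
    obtain j where j: "\<Psi>' p $ j \<noteq> 0" "nv (\<lambda>r. \<Psi> r $ j)" "\<And>e f r. hform UNIV e f \<Longrightarrow> r \<in> V \<Longrightarrow>
       f (\<Psi> r) * (\<Psi>' r $ j) ^ e = f (\<Psi>' r) * (\<Psi> r $ j) ^ e"
      using main[OF p rep] by blast
    have nj: "nv (\<lambda>r. \<Psi>' r $ j)" using j(1) p by (intro nvI[of p]) auto
    have "int (ord p (\<lambda>x. f (\<Psi> x))) = form_div E f (\<psi> (proj p)) + int e * int (ord p (\<lambda>r. \<Psi> r $ j))"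
      if f: "hform UNIV e f" and nvE: "\<not> vanishes_on f E" for e f
    proof -
      have n0: "nv (\<lambda>r. f (\<Psi> r))" by (rule nvf[OF f nvE])
      have "nv (\<lambda>r. f (\<Psi> r) * (\<Psi>' r $ j) ^ e)"
        by (rule nv_mult[OF hform_compose[OF f \<Psi>] hform_power[OF \<Psi>'] n0 nv_power[OF \<Psi>' nj]])
      then have "nv (\<lambda>r. f (\<Psi>' r) * (\<Psi> r $ j) ^ e)" by (rule nv_cong) (rule j(3)[OF f])
      then have n1: "nv (\<lambda>r. f (\<Psi>' r))" by (auto simp: nv_def)
      have "ord p (\<lambda>r. f (\<Psi> r) * (\<Psi>' r $ j) ^ e) = ord p (\<lambda>r. f (\<Psi>' r) * (\<Psi> r $ j) ^ e)"
        by (rule ord_cong) (rule j(3)[OF f])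
      moreover have "ord p (\<lambda>r. f (\<Psi> r) * (\<Psi>' r $ j) ^ e) = ord p (\<lambda>r. f (\<Psi> r)) + e * ord p (\<lambda>r. \<Psi>' r $ j)"
        using ord_mult[OF p hform_compose[OF f \<Psi>] n0 hform_power[OF \<Psi>'] nv_power[OF \<Psi>' nj], of e]
          ord_power[OF p \<Psi>' nj, of e] by simp
      moreover have "ord p (\<lambda>r. f (\<Psi>' r) * (\<Psi> r $ j) ^ e) = ord p (\<lambda>r. f (\<Psi>' r)) + e * ord p (\<lambda>r. \<Psi> r $ j)"
        using ord_mult[OF p hform_compose[OF f \<Psi>'] n1 hform_power[OF \<Psi>] nv_power[OF \<Psi> j(2)], of e]
          ord_power[OF p \<Psi> j(2), of e] by simp
      moreover have "ord p (\<lambda>r. \<Psi>' r $ j) = 0" by (rule ord_eq_0[OF p \<Psi>' j(1)])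
      ultimately show ?thesis using form_div_transport[OF p rep f] by simp
    qed
    then show ?thesis by blast
  qed
  show ?thesis
  proof (rule that[OF \<Psi> nvf])
    fix e f g p
    assume *: "hform UNIV e f" "hform UNIV e g" "\<not> vanishes_on f E" "\<not> vanishes_on g E" "p \<in> V"
    from ords[OF *(5)] obtain k where "\<And>e f. hform UNIV e f \<Longrightarrow> \<not> vanishes_on f E \<Longrightarrow>
       int (ord p (\<lambda>x. f (\<Psi> x))) = form_div E f (\<psi> (proj p)) + int e * k" by blast
    from this[OF *(1,3)] this[OF *(2,4)]
    show "form_div E f (\<psi> (proj p)) - form_div E g (\<psi> (proj p)) = int (ord p (\<lambda>x. f (\<Psi> x))) - int (ord p (\<lambda>x. g (\<Psi> x)))"
      by simp
  qed
qed

text \<open>Equivalence of \<open>D1\<close> and \<open>D2\<close> is pulled back to the curve: the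
  two rational functions on \<open>E\<close> are composed with one global representation and
  cross-multiplied, which yields a quotient of two forms of the same degree.\<close>

lemma equivalent_pushforwards:
  assumes 1: "lin_equiv E (push_div C E \<psi> D1) D" and 2: "lin_equiv E (push_div C E \<psi> D2) D"
  obtains n F G where "hform UNIV n F" "hform UNIV n G" "nv F" "nv G"
    "\<And>p. p \<in> V \<Longrightarrow> D1 (proj p) - D2 (proj p) = int (ord p F) - int (ord p G)"
proof -
  obtain d1 F1 G1 where F1: "hform UNIV d1 F1" "hform UNIV d1 G1" "\<not> vanishes_on F1 E" "\<not> vanishes_on G1 E"
    "\<And>p. push_div C E \<psi> D1 p - D p = form_div E F1 p - form_div E G1 p"
    using 1 unfolding lin_equiv_def by blast
  obtain d2 F2 G2 where F2: "hform UNIV d2 F2" "hform UNIV d2 G2" "\<not> vanishes_on F2 E" "\<not> vanishes_on G2 E"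
    "\<And>p. push_div C E \<psi> D2 p - D p = form_div E F2 p - form_div E G2 p"
    using 2 unfolding lin_equiv_def by blast
  obtain d and \<Psi> :: "'a ^ 4 \<Rightarrow> 'a ^ 'm" where \<Psi>: "\<And>i. hform UNIV d (\<lambda>x. \<Psi> x $ i)"
    "\<And>e f. hform UNIV e f \<Longrightarrow> \<not> vanishes_on f E \<Longrightarrow> nv (\<lambda>x. f (\<Psi> x))"
    "\<And>e f g p. hform UNIV e f \<Longrightarrow> hform UNIV e g \<Longrightarrow> \<not> vanishes_on f E \<Longrightarrow> \<not> vanishes_on g E \<Longrightarrow> p \<in> V \<Longrightarrow>
       form_div E f (\<psi> (proj p)) - form_div E g (\<psi> (proj p)) = int (ord p (\<lambda>x. f (\<Psi> x))) - int (ord p (\<lambda>x. g (\<Psi> x)))"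
    by (rule global_rep) blast
  note c = hform_compose[OF _ \<Psi>(1)]
  have push: "push_div C E \<psi> D' (\<psi> (proj p)) = D' (proj p)" if "p \<in> V" for D' p
    using \<psi>_bij \<psi>_in[OF that] that proj_in_C by (simp add: push_div_def bij_betw_def)
  show ?thesis
  proof (rule that[OF hform_mult[OF c[OF F1(1)] c[OF F2(2)]] hform_mult[OF c[OF F1(2)] c[OF F2(1)]]
        nv_mult[OF c[OF F1(1)] c[OF F2(2)] \<Psi>(2)[OF F1(1,3)] \<Psi>(2)[OF F2(2,4)]]
        nv_mult[OF c[OF F1(2)] c[OF F2(1)] \<Psi>(2)[OF F1(2,4)] \<Psi>(2)[OF F2(1,3)]]])
    fix p assume p: "p \<in> V"
    have "D1 (proj p) - D2 (proj p) = (form_div E F1 (\<psi> (proj p)) - form_div E G1 (\<psi> (proj p)))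
       - (form_div E F2 (\<psi> (proj p)) - form_div E G2 (\<psi> (proj p)))"
      using F1(5)[of "\<psi> (proj p)"] F2(5)[of "\<psi> (proj p)"] push[OF p] by simp
    also have "\<dots> = int (ord p (\<lambda>x. F1 (\<Psi> x) * G2 (\<Psi> x))) - int (ord p (\<lambda>x. G1 (\<Psi> x) * F2 (\<Psi> x)))"
      unfolding \<Psi>(3)[OF F1(1-4) p] \<Psi>(3)[OF F2(1-4) p]
      using ord_mult[OF p c[OF F1(1)] \<Psi>(2)[OF F1(1,3)] c[OF F2(2)] \<Psi>(2)[OF F2(2,4)]]
        ord_mult[OF p c[OF F1(2)] \<Psi>(2)[OF F1(2,4)] c[OF F2(1)] \<Psi>(2)[OF F2(1,3)]] by simp
    finally show "D1 (proj p) - D2 (proj p) =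
      int (ord p (\<lambda>x. F1 (\<Psi> x) * G2 (\<Psi> x))) - int (ord p (\<lambda>x. G1 (\<Psi> x) * F2 (\<Psi> x)))" .
  qed
qed

end

end

section \<open>Cones over conics\<close>

lemma scalar_product_linear:
  "scalar_product (a + b) y = scalar_product a y + scalar_product b y"
  "scalar_product y (a + b) = scalar_product y a + scalar_product y b"
  "scalar_product (c *s a) y = c * scalar_product a y"
  "scalar_product y (c *s a) = c * scalar_product y a"
  for a b y :: "'a::field ^ 'n"
  by (simp_all add: scalar_product_def sum.distrib sum_distrib_left algebra_simps)

lemma scalar_product_commute: "scalar_product a b = scalar_product b (a :: 'a::field ^ 'n)"
  by (simp add: scalar_product_def mult.commute)

lemma scalar_product_axis: "scalar_product a (axis i 1) = a $ i" for a :: "'a::field ^ 'n"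
  by (simp add: scalar_product_def axis_def if_distrib cong: if_cong)

lemma scalar_product_eqI: "(\<And>r. scalar_product a r = scalar_product b r) \<Longrightarrow> a = b" for a b :: "'a::field ^ 'n"
  by (metis scalar_product_axis vec_eq_iff)

lemma hform_1_linear:
  assumes "hform UNIV 1 h" shows "h (x + y) = h x + h y" "h (c *s x) = c * h x"
  using hform_1D[OF assms] by (auto simp: scalar_product_linear)

lemma subspace_line:
  assumes "hform UNIV 1 f" "hform UNIV 1 u" "hform UNIV 1 v"
  shows "vec.subspace {y :: 'a::field ^ 'n. \<exists>a. f y = a * b \<and> u y = a * c \<and> v y = a * d}"
proof -
  note l = assms[THEN hform_1_linear(1)] assms[THEN hform_1_linear(2)]
  show ?thesis
  proof (rule vec.subspaceI)
    show "0 \<in> {y. \<exists>a. f y = a * b \<and> u y = a * c \<and> v y = a * d}"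
      using assms[THEN hform_0_zero] by (auto intro: exI[of _ 0])
  next
    fix x y
    assume "x \<in> {y. \<exists>a. f y = a * b \<and> u y = a * c \<and> v y = a * d}" "y \<in> {y. \<exists>a. f y = a * b \<and> u y = a * c \<and> v y = a * d}"
    then obtain a a' where "f x = a * b" "u x = a * c" "v x = a * d" "f y = a' * b" "u y = a' * c" "v y = a' * d" by auto
    then show "x + y \<in> {y. \<exists>a. f y = a * b \<and> u y = a * c \<and> v y = a * d}"
      by (auto simp: l algebra_simps intro!: exI[of _ "a + a'"])
  next
    fix e x
    assume "x \<in> {y. \<exists>a. f y = a * b \<and> u y = a * c \<and> v y = a * d}"
    then obtain a where "f x = a * b" "u x = a * c" "v x = a * d" by auto
    then show "e *s x \<in> {y. \<exists>a. f y = a * b \<and> u y = a * c \<and> v y = a * d}"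
      by (auto simp: l intro!: exI[of _ "e * a"])
  qed
qed

text \<open>The base conic in the shape \<open>f^2 = u v\<close>, parametrised by
  \<open>(s : t)\<close> through \<open>(f, u, v) = (s t, s^2, t^2)\<close>; \<open>e0\<close> spans
  the vertex. On the curve, \<open>u : v\<close> takes every value, so no tangent vanishes
  identically.\<close>

locale cone = normal_curve +
  fixes M :: "'a ^ 4 ^ 4" and k :: 'a and f u v :: "'a ^ 4 \<Rightarrow> 'a" and e0 :: "'a ^ 4"
  assumes forms: "hform UNIV 1 f" "hform UNIV 1 u" "hform UNIV 1 v"
    and k0: "k \<noteq> 0"
    and polar: "scalar_product (M *v y) r = k * (2 * f y * f r - u y * v r - u r * v y)"
    and on_V: "r \<in> V \<Longrightarrow> f r ^ 2 = u r * v r"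
    and V_uv: "r \<in> V \<Longrightarrow> u r \<noteq> 0 \<or> v r \<noteq> 0"
    and V_ex: "a \<noteq> 0 \<or> b \<noteq> 0 \<Longrightarrow> \<exists>r\<in>V. u r = a \<and> v r = b"
    and vertex: "f e0 = 0" "u e0 = 0" "v e0 = 0"
    and kernel: "f y = 0 \<Longrightarrow> u y = 0 \<Longrightarrow> v y = 0 \<Longrightarrow> \<exists>c. y = c *s e0"
    and surj: "\<exists>y. f y = a \<and> u y = b \<and> v y = c"
begin

definition line :: "'a \<Rightarrow> 'a \<Rightarrow> ('a ^ 4) set" where
  "line s t = {y. \<exists>a. f y = a * (s * t) \<and> u y = a * s ^ 2 \<and> v y = a * t ^ 2}"

text \<open>The tangent at the parameter \<open>(s : t)\<close>: at the parameter
  \<open>(s0 : t0)\<close> it takes the value \<open>(s t0 - t s0)^2\<close>. The form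
  \<open>chord\<close> is its polarisation, with value \<open>(s t0 - t s0) (s' t0 - t' s0)\<close>,
  whence the relation \<open>tl_chord\<close>.\<close>

definition tl :: "'a \<Rightarrow> 'a \<Rightarrow> 'a ^ 4 \<Rightarrow> 'a" where
  "tl s t r = s ^ 2 * v r - 2 * s * t * f r + t ^ 2 * u r"

definition chord :: "'a \<Rightarrow> 'a \<Rightarrow> 'a \<Rightarrow> 'a \<Rightarrow> 'a ^ 4 \<Rightarrow> 'a" where
  "chord s t s' t' r = s * s' * v r - (s * t' + s' * t) * f r + t * t' * u r"

lemmas linear = forms[THEN hform_1_linear(1)] forms[THEN hform_1_linear(2)]

lemma hform_tl: "hform UNIV 1 (tl s t)"
  unfolding tl_def[abs_def] by (intro hform_add hform_diff hform_scale forms)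

lemma hform_chord: "hform UNIV 1 (chord s t s' t')"
  unfolding chord_def[abs_def] by (intro hform_add hform_diff hform_scale forms)

lemma tl_chord: "r \<in> V \<Longrightarrow> tl s t r * tl s' t' r = chord s t s' t' r ^ 2"
proof -
  assume "r \<in> V"
  have "tl s t r * tl s' t' r = chord s t s' t' r ^ 2 + (s * t' - s' * t) ^ 2 * (u r * v r - f r ^ 2)"
    unfolding tl_def chord_def by (simp add: power2_eq_square algebra_simps)
  then show ?thesis using on_V[OF \<open>r \<in> V\<close>] by simp
qed

lemma nv_tl: "s \<noteq> 0 \<or> t \<noteq> 0 \<Longrightarrow> nv (tl s t)"
proof -
  assume st: "s \<noteq> 0 \<or> t \<noteq> 0"
  obtain r where r: "r \<in> V" "u r = (if s = 0 then 1 else 0)" "v r = (if s = 0 then 0 else 1)"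
    using V_ex[of 1 0] V_ex[of 0 1] by (cases "s = 0") auto
  then have "f r = 0" using on_V[OF r(1)] by (auto split: if_splits)
  then have "tl s t r \<noteq> 0" using r st by (auto simp: tl_def)
  then show ?thesis using nvI r(1) by blast
qed

lemma nv_chord:
  assumes "s \<noteq> 0 \<or> t \<noteq> 0" "s' \<noteq> 0 \<or> t' \<noteq> 0" shows "nv (chord s t s' t')"
proof -
  have "nv (\<lambda>r. tl s t r * tl s' t' r)" using assms by (intro nv_mult[OF hform_tl hform_tl] nv_tl)
  then have "nv (\<lambda>r. chord s t s' t' r ^ 2)" by (rule nv_cong) (rule tl_chord)
  then show ?thesis by (auto simp: nv_def)
qed

lemma kernel_iff: "M *v y = 0 \<longleftrightarrow> f y = 0 \<and> u y = 0 \<and> v y = 0"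
proof
  assume "M *v y = 0"
  then have z: "k * (2 * f y * f r - u y * v r - u r * v y) = 0" for r
    using polar[of y r] by (simp add: scalar_product_def)
  obtain r1 r2 r3 where "f r1 = 1 \<and> u r1 = 0 \<and> v r1 = 0" "f r2 = 0 \<and> u r2 = 1 \<and> v r2 = 0" "f r3 = 0 \<and> u r3 = 0 \<and> v r3 = 1"
    using surj by meson
  then show "f y = 0 \<and> u y = 0 \<and> v y = 0" using z[of r1] z[of r2] z[of r3] k0 two by auto
next
  assume "f y = 0 \<and> u y = 0 \<and> v y = 0"
  then have "scalar_product (M *v y) r = scalar_product 0 r" for r
    unfolding polar by (simp add: scalar_product_def)
  then show "M *v y = 0" by (rule scalar_product_eqI)
qed

lemma qform_eq: "qform M y = 2 * k * (f y ^ 2 - u y * v y)"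
  unfolding qform_def by (subst scalar_product_commute) (simp add: polar power2_eq_square algebra_simps)

lemma from_vertex_eq:
  assumes "f x = s * t" "u x = s ^ 2" "v x = t ^ 2"
  shows "from_vertex M (proj x) = line s t"
proof
  have sub: "vec.subspace (line s t)" unfolding line_def by (rule subspace_line[OF forms])
  show "from_vertex M (proj x) \<subseteq> line s t" unfolding from_vertex_def
  proof (rule vec.span_minimal[OF _ sub], safe)
    fix y assume "y \<in> proj x"
    then show "y \<in> line s t" using assms by (auto simp: mem_proj_iff line_def linear)
  next
    fix y assume "M *v y = 0"
    then show "y \<in> line s t" by (auto simp: kernel_iff line_def intro: exI[of _ 0])
  qed
  show "line s t \<subseteq> from_vertex M (proj x)"
  proof
    fix y assume "y \<in> line s t"
    then obtain a where a: "f y = a * (s * t)" "u y = a * s ^ 2" "v y = a * t ^ 2" unfolding line_def by blast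
    have "M *v (y + (- a) *s x) = 0" unfolding kernel_iff linear using a assms by simp
    then have "a *s x + (y + (- a) *s x) \<in> from_vertex M (proj x)" unfolding from_vertex_def
      by (intro vec.span_add vec.span_scale vec.span_base) (auto simp: proj_self)
    then show "y \<in> from_vertex M (proj x)" by (simp add: vec_eq_iff)
  qed
qed

lemma parametrize:
  assumes "b ^ 2 = (c :: 'a) * d"
  obtains s t where "b = s * t" "c = s ^ 2" "d = t ^ 2"
proof (cases "c = 0")
  case True
  obtain t where "t ^ 2 = d" using sqrt_exists by blast
  then show ?thesis using that[of 0 t] True assms by auto
next
  case False
  obtain s where s: "s ^ 2 = c" using sqrt_exists by blast
  then have "s \<noteq> 0" using False by auto
  moreover have "d = (b / s) ^ 2" using assms False s by (simp add: power_divide)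
  ultimately show ?thesis using that[of s "b / s"] s by auto
qed

lemma base_conic_eq: "base_conic M = {line s t | s t. s \<noteq> 0 \<or> t \<noteq> 0}"
proof (intro subset_antisym subsetI)
  fix P assume "P \<in> base_conic M"
  then obtain x where x: "P = from_vertex M (proj x)" "M *v x \<noteq> 0" "qform M x = 0" unfolding base_conic_def by blast
  then have "f x ^ 2 = u x * v x" using two k0 by (simp add: qform_eq)
  then obtain s t where st: "f x = s * t" "u x = s ^ 2" "v x = t ^ 2" by (rule parametrize)
  then have "s \<noteq> 0 \<or> t \<noteq> 0" using x(2) unfolding kernel_iff st by auto
  then show "P \<in> {line s t | s t. s \<noteq> 0 \<or> t \<noteq> 0}"
    using x(1) from_vertex_eq[OF st] by blast
next
  fix P assume "P \<in> {line s t | s t. s \<noteq> 0 \<or> t \<noteq> 0}"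
  then obtain s t where st: "s \<noteq> 0 \<or> t \<noteq> 0" and P: "P = line s t" by blast
  obtain x where x: "f x = s * t" "u x = s ^ 2" "v x = t ^ 2" using surj by blast
  show "P \<in> base_conic M" unfolding base_conic_def P
    using from_vertex_eq[OF x, symmetric] st x by (auto simp: kernel_iff qform_eq power_mult_distrib intro!: exI[of _ x])
qed

lemma tangent_form_line:
  assumes "s \<noteq> 0 \<or> t \<noteq> 0"
  shows "tangent_form M (line s t) l \<longleftrightarrow> (\<exists>c. c \<noteq> 0 \<and> (\<forall>r. scalar_product l r = c * tl s t r))"
proof
  assume "tangent_form M (line s t) l"
  then obtain x a where x: "M *v x \<noteq> 0" "l = M *v x" "f x = a * (s * t)" "u x = a * s ^ 2" "v x = a * t ^ 2"
    unfolding tangent_form_def line_def by blast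
  have "a \<noteq> 0" using x by (auto simp: kernel_iff)
  moreover have "scalar_product l r = - (k * a) * tl s t r" for r
    unfolding x(2) polar x(3-5) tl_def by (simp add: algebra_simps)
  ultimately show "\<exists>c. c \<noteq> 0 \<and> (\<forall>r. scalar_product l r = c * tl s t r)" using k0 by (metis mult_eq_0_iff neg_equal_0_iff_equal)
next
  assume "\<exists>c. c \<noteq> 0 \<and> (\<forall>r. scalar_product l r = c * tl s t r)"
  then obtain c where c: "c \<noteq> 0" "\<And>r. scalar_product l r = c * tl s t r" by blast
  define a where "a = - c / k"
  obtain x where x: "f x = a * (s * t)" "u x = a * s ^ 2" "v x = a * t ^ 2" using surj by blast
  have "a \<noteq> 0" "c = - (k * a)" using c k0 by (simp_all add: a_def)
  have "l = M *v x"
    by (rule scalar_product_eqI) (unfold c(2) polar x tl_def \<open>c = - (k * a)\<close>, simp add: algebra_simps)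
  moreover have "M *v x \<noteq> 0" using assms \<open>a \<noteq> 0\<close> x by (auto simp: kernel_iff)
  ultimately show "tangent_form M (line s t) l" unfolding tangent_form_def line_def using x by blast
qed

text \<open>A linear form vanishing on the line is a combination of the tangent \<open>tl s t\<close> and of a chord \<open>n\<close>.
  Since \<open>tl s t\<close> is a unit times \<open>n\<^sup>2\<close> on the curve, the chord has the least order.\<close>

lemma fibre_ord:
  assumes st: "s \<noteq> 0 \<or> t \<noteq> 0" and p: "p \<in> V"
  shows "2 * fibre C M (line s t) (proj p) = int (ord p (tl s t))"
proof -
  obtain s0 t0 where 0: "f p = s0 * t0" "u p = s0 ^ 2" "v p = t0 ^ 2" using on_V[OF p] by (rule parametrize)
  have tlp: "tl a b p = (a * t0 - b * s0) ^ 2" for a b unfolding tl_def 0 by (simp add: power2_eq_square algebra_simps)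
  have fv: "from_vertex M (proj p) = line s0 t0" by (rule from_vertex_eq[OF 0])
  have nz0: "s0 \<noteq> 0 \<or> t0 \<noteq> 0" using V_uv[OF p] 0 by auto
  show ?thesis
  proof (cases "tl s t p = 0")
    case False
    have "line s0 t0 \<noteq> line s t"
    proof
      assume "line s0 t0 = line s t"
      then have "p \<in> line s t" using fv proj_self[of p] unfolding from_vertex_def by (auto intro: vec.span_base)
      then show False using False unfolding line_def tl_def by (auto simp: power2_eq_square algebra_simps)
    qed
    then show ?thesis using fv ord_eq_0[OF p hform_tl False] by (simp add: fibre_def)
  next
    case True
    then have eq: "s * t0 = t * s0" by (simp add: tlp)
    obtain c where c: "c \<noteq> 0" "s0 = c * s" "t0 = c * t"
    proof (cases "s = 0")
      case True
      then show ?thesis using that[of "t0 / t"] st eq nz0 by auto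
    next
      case False
      then have "t0 = s0 / s * t" using eq by (simp add: field_simps)
      then show ?thesis using that[of "s0 / s"] False nz0 by auto
    qed
    have lines: "line s0 t0 = line s t"
    proof -
      have "(\<exists>a. b = a * (s0 * t0) \<and> d = a * s0 ^ 2 \<and> e = a * t0 ^ 2) \<longleftrightarrow> (\<exists>a. b = a * (s * t) \<and> d = a * s ^ 2 \<and> e = a * t ^ 2)" for b d e
        unfolding c(2,3) using c(1)
        by (intro iffI; elim exE conjE)
          (rule_tac x = "a * c ^ 2" in exI, simp add: power2_eq_square algebra_simps,
           rule_tac x = "a / c ^ 2" in exI, simp add: power2_eq_square)
      then show ?thesis unfolding line_def by simp
    qed
    \<comment> \<open>A second point of the conic, different from \<open>(s : t)\<close>; its
      tangent is the unit at \<open>p\<close> that relates \<open>tl s t\<close> to the square of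
      the chord.\<close>
    define s' t' :: 'a where "s' = (if s = 0 then 1 else 0)" "t' = (if s = 0 then 0 else 1)"
    define n where "n = chord s t s' t'"
    have st': "s' \<noteq> 0 \<or> t' \<noteq> 0" by (simp add: s'_t'_def)
    have n: "hform UNIV 1 n" "nv n" unfolding n_def using hform_chord nv_chord[OF st st'] by auto
    have "tl s' t' p \<noteq> 0" unfolding tlp c(2,3) using c(1) st by (auto simp: s'_t'_def)
    then have "ord p (tl s' t') = 0" by (rule ord_eq_0[OF p hform_tl])
    then have ord_tl: "ord p (tl s t) = 2 * ord p n"
      using ord_mult[OF p hform_tl nv_tl[OF st] hform_tl nv_tl[OF st']] ord_square[OF p n]
        ord_cong[where p = p and F = "\<lambda>r. tl s t r * tl s' t' r" and G = "\<lambda>r. n r ^ 2"] tl_chord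
      by (simp add: n_def)
    have n_line: "n x = 0" if "x \<in> line s t" for x
      using that unfolding n_def chord_def line_def by (auto simp: power2_eq_square algebra_simps)
    have least: "ord p n \<le> ord p h" if h: "hform UNIV 1 h" "nv h" "\<And>x. x \<in> line s t \<Longrightarrow> h x = 0" for h
    proof -
      obtain r1 r2 r3 where r: "f r1 = 1 \<and> u r1 = 0 \<and> v r1 = 0" "f r2 = 0 \<and> u r2 = 1 \<and> v r2 = 0" "f r3 = 0 \<and> u r3 = 0 \<and> v r3 = 1"
        using surj by meson
      have he0: "h e0 = 0" using vertex by (intro h(3)) (auto simp: line_def intro: exI[of _ 0])
      have hy: "h y = h r1 * f y + h r2 * u y + h r3 * v y" for y
      proof -
        obtain b where "y + (- f y *s r1 + - u y *s r2 + - v y *s r3) = b *s e0"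
          using kernel[of "y + (- f y *s r1 + - u y *s r2 + - v y *s r3)"] r unfolding linear by auto
        then have "h (y + (- f y *s r1 + - u y *s r2 + - v y *s r3)) = 0"
          using he0 hform_1_linear[OF h(1)] by simp
        then show ?thesis unfolding hform_1_linear[OF h(1)] by (simp add: algebra_simps)
      qed
      obtain x where x: "f x = s * t" "u x = s ^ 2" "v x = t ^ 2" using surj by blast
      then have "h x = 0" by (intro h(3)) (auto simp: line_def intro: exI[of _ 1])
      then have rel: "h r1 * (s * t) + h r2 * s ^ 2 + h r3 * t ^ 2 = 0" unfolding hy[of x] x .
      have "\<exists>a b. \<forall>y. h y = a * n y + b * tl s t y"
      proof (cases "s = 0")
        case True
        then have "t \<noteq> 0" "h r3 = 0" using st rel by auto
        then show ?thesis using True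
          by (intro exI[of _ "- h r1 / t"] exI[of _ "h r2 / t ^ 2"] allI, subst hy)
            (simp add: n_def chord_def tl_def s'_t'_def)
      next
        case False
        \<comment> \<open>Comparing the coefficients of \<open>v\<close> and then of
          \<open>f\<close> forces \<open>b\<close> and \<open>a\<close>; the coefficient of
          \<open>u\<close> agrees because of \<open>rel\<close>.\<close>
        define b where "b = h r3 / s ^ 2"
        define a where "a = - (h r1 + 2 * b * s * t) / s"
        have r3: "h r3 = b * s ^ 2" using False by (simp add: b_def)
        have r1: "h r1 = - a * s - 2 * b * s * t" using False by (simp add: a_def)
        have "s * (s * (h r2 - a * t - b * t ^ 2) - 2 * 0) = 0"
          using rel unfolding r1 r3 by (simp add: power2_eq_square algebra_simps)
        then have "h r2 - a * t - b * t ^ 2 = 0" using False by simp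
        then have r2: "h r2 = a * t + b * t ^ 2" by (simp add: algebra_simps)
        show ?thesis
          by (intro exI[of _ a] exI[of _ b] allI, subst hy, unfold r1 r2 r3 n_def chord_def tl_def s'_t'_def)
            (use False in \<open>simp add: algebra_simps\<close>)
      qed
      then obtain a b where ab: "\<And>y. h y = a * n y + b * tl s t y" by blast
      have "divisible p (ord p n) 1 n" using divisible_iff_ord[OF p n] by simp
      moreover have "divisible p (ord p n) 1 (tl s t)"
        using divisible_iff_ord[OF p hform_tl nv_tl[OF st]] ord_tl by simp
      ultimately have "divisible p (ord p n) 1 (\<lambda>y. a * n y + b * tl s t y)" by (intro divisible_add divisible_scale)
      then have "divisible p (ord p n) 1 h" by (rule divisible_cong) (simp add: ab)
      then show ?thesis using divisible_iff_ord[OF p h(1,2)] by simp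
    qed
    have "(LEAST m. \<exists>h. hform UNIV 1 h \<and> \<not> vanishes_on h C \<and> (\<forall>x\<in>line s t. h x = 0) \<and> m = form_div C h (proj p))
       = int (ord p n)"
      by (rule Least_equality) (use n n_line least p in \<open>auto simp: form_div_C vanishes_on_C\<close>)
    then show ?thesis using p fv lines ord_tl by (simp add: fibre_def proj_in_C)
  qed
qed

lemma tl_01: "tl 0 1 = u"
  by (auto simp: tl_def)

end

section \<open>Square roots of pushout forms\<close>

context normal_curve
begin

definition u1 :: "'a ^ 4 \<Rightarrow> 'a" where "u1 r = cZ r - \<alpha> * cW r"

lemma hform_u1: "hform UNIV 1 u1"
  unfolding u1_def[abs_def] by (intro hform_diff hform_scale lin)

lemma nv_u1: "nv u1" and nv_Z: "nv cZ"
  using nv_line[of \<alpha> 1] nv_line[of 0 1] by (simp_all add: u1_def[abs_def])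

lemma order_count:
  fixes a b c d e :: nat
  assumes "int m - 2 * int x - int s + int t = 2 * (int f - int h)" "a = t + h" "b = x + f + (c + d)" "e = u + z"
    "s + u = 2 * c" "t + z = 2 * d"
  shows "m + e + 2 * a = 2 * b"
proof -
  have "int s + int u = 2 * int c" "int t + int z = 2 * int d"
    using arg_cong[OF assms(5), of int] arg_cong[OF assms(6), of int] by simp_all
  then have "int (m + e + 2 * a) = int (2 * b)" using assms(1) unfolding assms(2-4) by simp
  then show ?thesis by (simp only: of_nat_eq_iff)
qed

text \<open>Modulo doubled divisors, \<open>m\<close> has the divisor of \<open>t1\<close> minus
  that of \<open>t2\<close>, and the squares of \<open>c1\<close> and \<open>c2\<close> allow
  \<open>t1\<close> and \<open>t2\<close> to be replaced by \<open>u1\<close> and \<open>Z\<close>.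
  Thus \<open>m u1 Z\<close> has the divisor of the square of \<open>B / A\<close>. As twice the
  divisor of \<open>B / A\<close> is effective, so is the divisor itself, and the quotient is a
  form.\<close>

lemma sqrt_from_orders:
  assumes m: "hform UNIV 2 m" "nv m" and x1: "hform UNIV 1 x1" "nv x1"
    and t1: "hform UNIV 1 t1" "nv t1" and t2: "hform UNIV 1 t2" "nv t2"
    and c1: "hform UNIV 1 c1" "nv c1" "\<And>r. r \<in> V \<Longrightarrow> t1 r * u1 r = c1 r ^ 2"
    and c2: "hform UNIV 1 c2" "nv c2" "\<And>r. r \<in> V \<Longrightarrow> t2 r * cZ r = c2 r ^ 2"
    and F: "hform UNIV n F" "nv F" and G: "hform UNIV n' G" "nv G"
    and ords: "\<And>p. p \<in> V \<Longrightarrow> int (ord p m) - 2 * int (ord p x1) - int (ord p t1) + int (ord p t2)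
       = 2 * (int (ord p F) - int (ord p G))"
  obtains N where "hform UNIV 2 N" "\<And>r. r \<in> V \<Longrightarrow> m r * (u1 r * cZ r) = N r ^ 2"
proof -
  define A where "A = (\<lambda>r. t2 r * G r)"
  define B where "B = (\<lambda>r. (x1 r * F r) * (c1 r * c2 r))"
  define U where "U = (\<lambda>r. u1 r * cZ r)"
  have A: "hform UNIV (1 + n') A" "nv A" unfolding A_def using hform_mult nv_mult t2 G by blast+
  have xF: "hform UNIV (1 + n) (\<lambda>r. x1 r * F r)" "nv (\<lambda>r. x1 r * F r)" using hform_mult nv_mult x1 F by blast+
  have cc: "hform UNIV (1 + 1) (\<lambda>r. c1 r * c2 r)" "nv (\<lambda>r. c1 r * c2 r)" using hform_mult nv_mult c1 c2 by blast+
  have B: "hform UNIV ((1 + n) + (1 + 1)) B" "nv B" unfolding B_def using hform_mult nv_mult xF cc by blast+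
  have U: "hform UNIV (1 + 1) U" "nv U" unfolding U_def using hform_mult nv_mult hform_u1 nv_u1 lin(3) nv_Z by blast+
  have mU: "hform UNIV (2 + (1 + 1)) (\<lambda>r. m r * U r)" "nv (\<lambda>r. m r * U r)" using hform_mult nv_mult m U by blast+
  have sqA: "hform UNIV (2 * (1 + n')) (\<lambda>r. A r ^ 2)" "nv (\<lambda>r. A r ^ 2)" using hform_power[OF A(1), of 2] nv_power[OF A] by auto
  have sqB: "hform UNIV (2 * (1 + n + (1 + 1))) (\<lambda>r. B r ^ 2)" "nv (\<lambda>r. B r ^ 2)" using hform_power[OF B(1), of 2] nv_power[OF B] by auto
  have L: "hform UNIV (2 + (1 + 1) + 2 * (1 + n')) (\<lambda>r. m r * U r * A r ^ 2)" "nv (\<lambda>r. m r * U r * A r ^ 2)"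
    using hform_mult[OF mU(1) sqA(1)] nv_mult[OF mU(1) sqA(1) mU(2) sqA(2)] by auto
  have ordA: "ord p A = ord p t2 + ord p G" if "p \<in> V" for p unfolding A_def by (rule ord_mult[OF that t2 G])
  have ordB: "ord p B = ord p x1 + ord p F + (ord p c1 + ord p c2)" if "p \<in> V" for p
    unfolding B_def ord_mult[OF that xF cc] ord_mult[OF that x1 F] ord_mult[OF that c1(1,2) c2(1,2)] ..
  have ordU: "ord p U = ord p u1 + ord p cZ" if "p \<in> V" for p
    unfolding U_def by (rule ord_mult[OF that hform_u1 nv_u1 lin(3) nv_Z])
  have o1: "ord p t1 + ord p u1 = 2 * ord p c1" if "p \<in> V" for p
    using ord_mult[OF that t1 hform_u1 nv_u1] ord_square[OF that c1(1,2)] ord_cong[OF c1(3), where p = p] by simp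
  have o2: "ord p t2 + ord p cZ = 2 * ord p c2" if "p \<in> V" for p
    using ord_mult[OF that t2 lin(3) nv_Z] ord_square[OF that c2(1,2)] ord_cong[OF c2(3), where p = p] by simp
  have ordL: "ord p (\<lambda>r. m r * U r * A r ^ 2) = ord p m + ord p U + 2 * ord p A" if "p \<in> V" for p
    unfolding ord_mult[OF that mU sqA] ord_mult[OF that m U] ord_square[OF that A] ..
  have key: "ord p m + ord p U + 2 * ord p A = 2 * ord p B" if "p \<in> V" for p
    using ords[OF that] ordA[OF that] ordB[OF that] ordU[OF that] o1[OF that] o2[OF that] by (rule order_count[of "ord p m" "ord p x1" "ord p t1" "ord p t2" "ord p F" "ord p G" "ord p A" "ord p B" "ord p c1" "ord p c2" "ord p U" "ord p u1" "ord p cZ"])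
  obtain c where c: "c \<noteq> 0" "\<And>r. r \<in> V \<Longrightarrow> m r * U r * A r ^ 2 = c * B r ^ 2"
  proof (rule same_ord_proportional[OF L sqB, of thesis])
    show "ord p (\<lambda>r. B r ^ 2) = ord p (\<lambda>r. m r * U r * A r ^ 2)" if "p \<in> V" for p
      using ordL[OF that] ord_square[OF that B] key[OF that] by simp
  qed (rule that)
  obtain K where K: "hform UNIV ((1 + n + (1 + 1)) - (1 + n')) K" "\<And>r. r \<in> V \<Longrightarrow> B r = A r * K r"
  proof (rule form_divides[OF B A, of thesis])
    show "ord p A \<le> ord p B" if "p \<in> V" for p using key[OF that] by linarith
  qed (rule that)
  have sqK: "hform UNIV (2 * ((1 + n + (1 + 1)) - (1 + n'))) (\<lambda>r. c * K r ^ 2)"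
    by (rule hform_scale[OF hform_power[OF K(1)]])
  have mUK: "m r * U r = c * K r ^ 2" if r: "r \<in> V" for r
  proof (rule V_cancel[OF sqA(1) mU(1) sqK sqA(2) _ r])
    show "A r ^ 2 * (m r * U r) = A r ^ 2 * (c * K r ^ 2)" if "r \<in> V" for r
      using c(2)[OF that] unfolding K(2)[OF that] by (simp add: power_mult_distrib mult_ac)
  qed
  have "2 + (1 + 1) = 2 * ((1 + n + (1 + 1)) - (1 + n'))"
    by (rule degree_unique[OF mU(1) sqK mUK mU(2)])
  then have "(1 + n + (1 + 1)) - (1 + n') = 2" by simp
  then have K2: "hform UNIV 2 K" using K(1) by (simp only:)
  obtain d where d: "d ^ 2 = c" using sqrt_exists by blast
  show ?thesis
  proof (rule that[OF hform_scale[OF K2, of d]])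
    show "m r * (u1 r * cZ r) = (d * K r) ^ 2" if "r \<in> V" for r
      using mUK[OF that] d unfolding U_def by (simp add: power_mult_distrib)
  qed
qed

text \<open>The signs are such that the product of the chords \<open>- s Y + t u1\<close> and
  \<open>- p X + r Z\<close> has the coordinates \<open>seg s t p r\<close> with respect to these
  four forms.\<close>

definition g :: "4 \<Rightarrow> 'a ^ 4 \<Rightarrow> 'a" where
  "g i r = (if i = 1 then cX r * cY r else if i = 2 then - (cY r * cZ r) else if i = 3 then - (u1 r * cX r) else u1 r * cZ r)"

lemma UNIV_4_cases: fixes i :: 4 obtains "i = 1" | "i = 2" | "i = 3" | "i = 4"
  using exhaust_4 by blast

lemma hform_g: "hform UNIV 2 (g i)"
  using hform2[OF lin(1,2)] hform_minus[OF hform2[OF lin(2,3)]] hform_minus[OF hform2[OF hform_u1 lin(1)]] hform2[OF hform_u1 lin(3)]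
  by (cases i rule: UNIV_4_cases) (auto simp: g_def[abs_def])

lemma sum_g: "(\<Sum>i\<in>UNIV. c $ i * g i r) =
    nf (\<lambda>z w. c $ 4 * (z * (z - \<alpha> * w))) (\<lambda>z w. - (c $ 3 * (z - \<alpha> * w))) (\<lambda>z w. - (c $ 2 * z)) (\<lambda>z w. c $ 1) r"
  by (simp add: sum_4 g_def nf_def u1_def algebra_simps)

lemma g_independent:
  assumes "\<And>r. r \<in> V \<Longrightarrow> (\<Sum>i\<in>UNIV. c $ i * g i r) = 0" shows "c = 0"
proof -
  have l: "bf 1 (\<lambda>z w :: 'a. z - \<alpha> * w)" using bf_linear[of 1 "- \<alpha>"] by simp
  have 1: "bf 2 (\<lambda>z w. c $ 4 * (z * (z - \<alpha> * w)))" by (intro bf_scale bf_mult[OF bf_z l]) simp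
  have 2: "bf 1 (\<lambda>z w. - (c $ 3 * (z - \<alpha> * w)))" using bf_scale[OF l, of "- c $ 3"] by simp
  have 3: "bf 1 (\<lambda>z w. - (c $ 2 * z))" using bf_scale[OF bf_z, of "- c $ 2"] by simp
  have 4: "nf (\<lambda>z w. c $ 4 * (z * (z - \<alpha> * w))) (\<lambda>z w. - (c $ 3 * (z - \<alpha> * w))) (\<lambda>z w. - (c $ 2 * z)) (\<lambda>z w. c $ 1) r = 0"
    if "r \<in> V" for r using assms[OF that] unfolding sum_g .
  have *: "(\<lambda>z w. c $ 4 * (z * (z - \<alpha> * w))) = (\<lambda>z w. 0)" "(\<lambda>z w. - (c $ 3 * (z - \<alpha> * w))) = (\<lambda>z w. 0)"
     "(\<lambda>z w :: 'a. - (c $ 2 * z)) = (\<lambda>z w. 0)" "(\<lambda>(z :: 'a) (w :: 'a). c $ 1) = (\<lambda>z w. 0)"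
  proof -
    note z = nf_eq_0[OF 1 2 3 bf_const[where c = "c $ 1"]]
    show "(\<lambda>z w. c $ 4 * (z * (z - \<alpha> * w))) = (\<lambda>z w. 0)" by (rule z(1)) (rule 4)
    show "(\<lambda>z w. - (c $ 3 * (z - \<alpha> * w))) = (\<lambda>z w. 0)" by (rule z(2)) (rule 4)
    show "(\<lambda>z w :: 'a. - (c $ 2 * z)) = (\<lambda>z w. 0)" by (rule z(3)) (rule 4)
    show "(\<lambda>(z :: 'a) (w :: 'a). c $ 1) = (\<lambda>z w. 0)" by (rule z(4)) (rule 4)
  qed
  have f: "F 1 0 = 0" if "F = (\<lambda>z w. 0)" for F :: "'a \<Rightarrow> 'a \<Rightarrow> 'a" using that by simp
  from *[THEN f] show ?thesis by (simp add: vec_eq_iff forall_4)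
qed

text \<open>A square root of a multiple of \<open>u1 Z\<close> vanishes where \<open>u1\<close> or \<open>Z\<close> does; this cuts the eight-dimensional
  space of quadratic forms on the curve down to the span of the \<open>g i\<close>.\<close>

lemma sqrt_shape:
  assumes N: "hform UNIV 2 N" and eq: "\<And>r. r \<in> V \<Longrightarrow> m r * (u1 r * cZ r) = N r ^ 2"
  obtains c where "\<And>r. r \<in> V \<Longrightarrow> N r = (\<Sum>i\<in>UNIV. c $ i * g i r)"
proof -
  obtain a b c d where bfs: "bf 2 a" "bf (2 - 1) b" "bf (2 - 1) c" "bf (2 - 2) d" and Np: "\<And>p. p \<in> V \<Longrightarrow> N p = nf a b c d p"
    using hform_has_nf[OF N] unfolding has_nf_def by auto
  have zero: "N r = 0" if "r \<in> V" "u1 r * cZ r = 0" for r using eq[OF that(1)] that(2) by simp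
  \<comment> \<open>Over the root of \<open>Z\<close> the coordinate \<open>X\<close> vanishes, and
    the two signs of \<open>y\<close> give separate conditions on \<open>a\<close> and
    \<open>c\<close>.\<close>
  obtain x y where xy: "pt x y 0 1 \<in> V" "pt x (- y) 0 1 \<in> V" "x ^ 2 = 0 * 1" "y ^ 2 = q 0 1"
    using V_nonempty_over[of 0 1] by auto
  then have x: "x = 0" and y: "y \<noteq> 0" using \<alpha>0 \<beta>0 by (auto simp: q_def)
  have e: "a 0 1 + c 0 1 * y = 0" "a 0 1 - c 0 1 * y = 0"
    using zero[OF xy(1)] zero[OF xy(2)] Np[OF xy(1)] Np[OF xy(2)] x by (auto simp: nf_def)
  have "a 0 1 = 0 \<and> c 0 1 * y = 0" using four_signs[OF two, of "a 0 1" 0 "c 0 1 * y" 0] e by simp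
  then have a0: "a 0 1 = 0" and c0: "c 0 1 = 0" using y by auto
  \<comment> \<open>Over the root of \<open>u1\<close> it is \<open>Y\<close> that vanishes, and the
    conditions concern \<open>a\<close> and \<open>b\<close>.\<close>
  obtain x' y' where xy': "pt x' y' \<alpha> 1 \<in> V" "pt (- x') y' \<alpha> 1 \<in> V" "x' ^ 2 = \<alpha> * 1" "y' ^ 2 = q \<alpha> 1"
    using V_nonempty_over[of \<alpha> 1] zero_neq_one by metis
  then have y': "y' = 0" and x': "x' \<noteq> 0" using \<alpha>0 by (auto simp: q_def)
  have e': "a \<alpha> 1 + b \<alpha> 1 * x' = 0" "a \<alpha> 1 - b \<alpha> 1 * x' = 0"
    using zero[OF xy'(1)] zero[OF xy'(2)] Np[OF xy'(1)] Np[OF xy'(2)] y' by (auto simp: nf_def u1_def)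
  have "a \<alpha> 1 = 0 \<and> b \<alpha> 1 * x' = 0" using four_signs[OF two, of "a \<alpha> 1" "b \<alpha> 1 * x'" 0 0] e' by simp
  then have a1: "a \<alpha> 1 = 0" and b0: "b \<alpha> 1 = 0" using x' by auto
  obtain a' where a': "bf (2 - 1) a'" "\<And>z w. a z w = (1 * z - 0 * w) * a' z w"
    using bf_linear_divide[OF bfs(1) a0] by auto
  have "a' \<alpha> 1 = 0" using a1 a'(2)[of \<alpha> 1] \<alpha>0 by simp
  then obtain a'' where a'': "bf (2 - 1 - 1) a''" "\<And>z w. a' z w = (1 * z - \<alpha> * w) * a'' z w"
    using bf_linear_divide[OF a'(1), of \<alpha> 1] by auto
  obtain b' where b': "bf (2 - 1 - 1) b'" "\<And>z w. b z w = (1 * z - \<alpha> * w) * b' z w"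
    using bf_linear_divide[OF bfs(2) b0] by auto
  obtain c' where c': "bf (2 - 1 - 1) c'" "\<And>z w. c z w = (1 * z - 0 * w) * c' z w"
    using bf_linear_divide[OF bfs(3) c0] by auto
  obtain A B C D where ABCD: "a'' = (\<lambda>z w. A)" "b' = (\<lambda>z w. B)" "c' = (\<lambda>z w. C)" "d = (\<lambda>z w. D)"
    using bf_degree_0[of a''] bf_degree_0[of b'] bf_degree_0[of c'] bf_degree_0[of d] a''(1) b'(1) c'(1) bfs(4) by auto
  show ?thesis
  proof (rule that[of "\<chi> i. if i = 1 then D else if i = 2 then - C else if i = 3 then - B else A"])
    fix r assume "r \<in> V"
    then show "N r = (\<Sum>i\<in>UNIV. (\<chi> i. if i = 1 then D else if i = 2 then - C else if i = 3 then - B else A) $ i * g i r)"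
      unfolding Np[OF \<open>r \<in> V\<close>] sum_g by (simp add: nf_def a'(2) a''(2) b'(2) c'(2) ABCD algebra_simps)
  qed
qed

end

section \<open>Linear algebra of the two-uple embedding\<close>

lemma pairing_outer: "pairing M (outer a b) = scalar_product a (M *v b)"
  by (simp add: pairing_def outer_def scalar_product_def matrix_vector_mult_def sum_distrib_left mult_ac)

lemma outer_pairing: "pairing (outer a b) S = scalar_product a (S *v b)"
  by (simp add: pairing_def outer_def scalar_product_def matrix_vector_mult_def sum_distrib_left mult_ac)

lemma qform_pairing: "qform M r = pairing M (outer r r)"
  by (simp add: pairing_outer qform_def)

lemma pairing_linear:
  "pairing (M + N) S = pairing M S + pairing N S" "pairing M (S + S') = pairing M S + pairing M S'"
  "pairing (c *k M) S = c * pairing M S" "pairing M (c *k S) = c * pairing M S"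
  "pairing (M - N) S = pairing M S - pairing N S"
  by (simp_all add: pairing_def mat_scale_def sum.distrib sum_subtractf sum_distrib_left algebra_simps)

lemma pairing_congruence:
  fixes D S P :: "'a::field ^ 'n ^ 'n"
  shows "pairing D (P ** S ** transpose P) = pairing (transpose P ** D ** P) S"
proof -
  have tr: "pairing M N = trace (transpose M ** N)" for M N :: "'a ^ 'n ^ 'n"
    unfolding pairing_def trace_def matrix_matrix_mult_def transpose_def by (subst sum.swap) simp
  show ?thesis unfolding tr matrix_transpose_mul transpose_transpose
    by (metis matrix_mul_assoc trace_mul_sym)
qed

lemma outer_transpose: "transpose (outer a b) = outer b a"
  by (simp add: outer_def transpose_def vec_eq_iff mult.commute)

lemma scalar_product_matrix: "scalar_product a (M *v b) = scalar_product (transpose M *v a) b"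
  for M :: "'a::field ^ 'n ^ 'm"
  unfolding scalar_product_def matrix_vector_mult_def transpose_def
  by (simp add: sum_distrib_left sum_distrib_right, subst sum.swap) (simp add: mult_ac)

lemma matrix_axis: "(N *v axis j 1) $ i = N $ i $ j" for N :: "'a::field ^ 'n ^ 'm"
  by (simp add: matrix_vector_mult_def axis_def if_distrib cong: if_cong)

lemma symmetric_entry:
  fixes s :: "'a ^ 'n ^ 'n"
  assumes "transpose s = s" shows "s $ j $ i = s $ i $ j"
proof -
  have "transpose s $ i $ j = s $ j $ i" by (simp add: transpose_def)
  with assms show ?thesis by simp
qed

lemma invertible_of_injective:
  fixes K :: "'a::field ^ 'n ^ 'n"
  assumes "\<And>x. K *v x = 0 \<Longrightarrow> x = 0" shows "invertible K"
proof -
  have "inj ((*v) K)"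
  proof (rule injI)
    fix x y assume "K *v x = K *v y"
    then have "K *v (x - y) = 0" by (simp add: matrix_vector_mult_diff_distrib)
    then show "x = y" using assms[of "x - y"] by simp
  qed
  then show ?thesis
    using matrix_left_invertible_injective invertible_def matrix_left_right_inverse by metis
qed

lemma matrix_inv_mult:
  assumes "invertible (K :: 'a::field ^ 'n ^ 'n)"
  shows "K ** matrix_inv K = mat 1" "matrix_inv K ** K = mat 1"
    "K *v (matrix_inv K *v x) = x" "matrix_inv K *v (K *v x) = x"
proof -
  have i: "K ** matrix_inv K = mat 1 \<and> matrix_inv K ** K = mat 1"
    unfolding matrix_inv_def by (rule someI_ex) (use assms in \<open>simp add: invertible_def\<close>)
  then show "K ** matrix_inv K = mat 1" "matrix_inv K ** K = mat 1" by auto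
  show "K *v (matrix_inv K *v x) = x" "matrix_inv K *v (K *v x) = x"
    using i by (simp_all add: matrix_vector_mul_assoc)
qed

section \<open>A choice of the square roots that is linear in \<xi>\<close>

context normal_curve
begin

definition gcomb :: "'a ^ 4 \<Rightarrow> 'a ^ 4 \<Rightarrow> 'a" where
  "gcomb c r = (\<Sum>i\<in>UNIV. c $ i * g i r)"

lemma gcomb_linear: "gcomb (c + d) r = gcomb c r + gcomb d r" "gcomb (a *s c) r = a * gcomb c r" "gcomb (- c) r = - gcomb c r"
  by (simp_all add: gcomb_def sum_4 algebra_simps)

lemma hform_gcomb: "hform UNIV 2 (gcomb c)"
  unfolding gcomb_def[abs_def] by (intro hform_sum hform_scale hform_g)

lemma gcomb_eq_0: "(\<And>r. r \<in> V \<Longrightarrow> gcomb c r = 0) \<Longrightarrow> c = 0"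
  unfolding gcomb_def by (rule g_independent)

lemma gcomb_eqD:
  assumes "\<And>r. r \<in> V \<Longrightarrow> gcomb c r = gcomb d r" shows "c = d"
proof -
  have "c + - d = 0" by (rule gcomb_eq_0) (unfold gcomb_linear, simp add: assms)
  then show ?thesis by simp
qed

definition U :: "'a ^ 4 \<Rightarrow> 'a" where "U r = u1 r * cZ r"

lemma hform_U: "hform UNIV 2 U" and nv_U: "nv U"
  using hform2[OF hform_u1 lin(3)] nv_mult[OF hform_u1 lin(3) nv_u1 nv_Z] by (simp_all add: U_def[abs_def])

lemma equal_squares:
  assumes "hform UNIV n F" "hform UNIV n G" "\<And>r. r \<in> V \<Longrightarrow> F r ^ 2 = G r ^ 2"
  shows "(\<forall>r\<in>V. F r = G r) \<or> (\<forall>r\<in>V. F r = - G r)"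
proof -
  have "(F r - G r) * (F r + G r) = 0" if "r \<in> V" for r
    using assms(3)[OF that] by (simp add: power2_eq_square algebra_simps)
  from V_integral[OF hform_diff[OF assms(1,2)] hform_add[OF assms(1,2)] this]
  show ?thesis by (auto simp: add_eq_0_iff2)
qed

text \<open>The square roots of the forms \<open>T \<xi> \<xi> * U\<close> are determined up to signs; fixing the sign for one
  basis vector, the mixed values \<open>T \<xi> \<eta>\<close> determine the others, consistently.\<close>

lemma pushout_basis:
  fixes T :: "'a ^ 4 \<Rightarrow> 'a ^ 4 \<Rightarrow> 'a ^ 4 \<Rightarrow> 'a"
  assumes T_add: "\<And>\<xi> \<eta> \<zeta> r. T \<xi> (\<eta> + \<zeta>) r = T \<xi> \<eta> r + T \<xi> \<zeta> r"
    and T_scale: "\<And>\<xi> \<eta> c r. T \<xi> (c *s \<eta>) r = c * T \<xi> \<eta> r"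
    and T_sym: "\<And>\<xi> \<eta> r. r \<in> V \<Longrightarrow> T \<xi> \<eta> r = T \<eta> \<xi> r"
    and T_form: "\<And>\<xi> \<eta>. \<exists>F. hform UNIV 2 F \<and> (\<forall>r\<in>V. T \<xi> \<eta> r = F r)"
    and rank1: "\<And>\<xi> \<eta> r. r \<in> V \<Longrightarrow> T \<xi> \<eta> r ^ 2 = T \<xi> \<xi> r * T \<eta> \<eta> r"
    and nvT: "\<And>\<xi>. \<xi> \<noteq> 0 \<Longrightarrow> nv (T \<xi> \<xi>)"
    and root: "\<And>\<xi>. \<xi> \<noteq> 0 \<Longrightarrow> \<exists>c. \<forall>r\<in>V. T \<xi> \<xi> r * U r = gcomb c r ^ 2"
  obtains K where "invertible K" "\<And>\<xi> \<eta> r. r \<in> V \<Longrightarrow> T \<xi> \<eta> r * U r = gcomb (K *v \<xi>) r * gcomb (K *v \<eta>) r"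
proof -
  define e :: "4 \<Rightarrow> 'a ^ 4" where "e = (\<lambda>i. axis i 1)"
  have e0: "e i \<noteq> 0" for i by (simp add: e_def axis_eq_0_iff)
  obtain n where n: "\<And>i r. r \<in> V \<Longrightarrow> T (e i) (e i) r * U r = gcomb (n i) r ^ 2"
    using root[OF e0] by metis
  have TU: "\<exists>F. hform UNIV 4 F \<and> (\<forall>r\<in>V. T \<xi> \<eta> r * U r = F r)" for \<xi> \<eta>
  proof -
    obtain F where "hform UNIV 2 F" "\<forall>r\<in>V. T \<xi> \<eta> r = F r" using T_form by blast
    then show ?thesis using hform_mult[OF _ hform_U, of 2 F] by (intro exI[of _ "\<lambda>r. F r * U r"]) auto
  qed
  have gg: "hform UNIV 4 (\<lambda>r. gcomb c r * gcomb d r)" for c d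
    using hform_mult[OF hform_gcomb hform_gcomb, of c d] by simp
  have sign: "\<exists>m. \<forall>r\<in>V. T (e 1) (e i) r * U r = gcomb (n 1) r * gcomb m r" for i
  proof -
    obtain F where F: "hform UNIV 4 F" "\<And>r. r \<in> V \<Longrightarrow> T (e 1) (e i) r * U r = F r" using TU by blast
    have "F r ^ 2 = (gcomb (n 1) r * gcomb (n i) r) ^ 2" if "r \<in> V" for r
    proof -
      have "F r ^ 2 = (T (e 1) (e 1) r * U r) * (T (e i) (e i) r * U r)"
        unfolding F(2)[OF that, symmetric] power_mult_distrib rank1[OF that] by (simp add: power2_eq_square)
      then show ?thesis unfolding n[OF that] by (simp add: power_mult_distrib)
    qed
    from equal_squares[OF F(1) gg this] show ?thesis
    proof
      assume "\<forall>r\<in>V. F r = gcomb (n 1) r * gcomb (n i) r"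
      then show ?thesis using F(2) by metis
    next
      assume "\<forall>r\<in>V. F r = - (gcomb (n 1) r * gcomb (n i) r)"
      then show ?thesis using F(2) by (intro exI[of _ "- n i"]) (simp add: gcomb_linear)
    qed
  qed
  then obtain m where m: "\<And>i r. r \<in> V \<Longrightarrow> T (e 1) (e i) r * U r = gcomb (n 1) r * gcomb (m i) r" by metis
  define K :: "'a ^ 4 ^ 4" where "K = (\<chi> i j. m j $ i)"
  have GK: "gcomb (K *v \<xi>) r = (\<Sum>j\<in>UNIV. \<xi> $ j * gcomb (m j) r)" for \<xi> r
    unfolding gcomb_def K_def by (simp add: matrix_vector_mult_def sum_4 algebra_simps)
  have T1: "T (e 1) \<xi> r * U r = gcomb (n 1) r * gcomb (K *v \<xi>) r" if "r \<in> V" for \<xi> r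
  proof -
    have "\<xi> = \<xi> $ 1 *s e 1 + (\<xi> $ 2 *s e 2 + (\<xi> $ 3 *s e 3 + \<xi> $ 4 *s e 4))"
      by (simp add: vec_eq_iff forall_4 e_def axis_def)
    then have "T (e 1) \<xi> r = T (e 1) (\<xi> $ 1 *s e 1 + (\<xi> $ 2 *s e 2 + (\<xi> $ 3 *s e 3 + \<xi> $ 4 *s e 4))) r" by (rule arg_cong)
    then show ?thesis unfolding T_add T_scale GK sum_4 using m[OF that] by (simp add: algebra_simps)
  qed
  have nv1: "nv (\<lambda>r. gcomb (n 1) r ^ 2)"
  proof -
    obtain F where F: "hform UNIV 2 F" "\<forall>r\<in>V. T (e 1) (e 1) r = F r" using T_form by blast
    then have "nv F" using nv_cong[OF nvT[OF e0[of 1]]] by blast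
    from nv_mult[OF F(1) hform_U this nv_U] show ?thesis by (rule nv_cong) (use F(2) n[of _ 1] in simp)
  qed
  have sq: "T \<xi> \<xi> r * U r = gcomb (K *v \<xi>) r ^ 2" if r: "r \<in> V" for \<xi> r
  proof -
    obtain F where F: "hform UNIV 4 F" "\<And>r. r \<in> V \<Longrightarrow> T \<xi> \<xi> r * U r = F r" using TU by blast
    have "F r = gcomb (K *v \<xi>) r ^ 2"
    \<comment> \<open>The square of the first root is multiplied in. By rank one, the product of two
      diagonal values is the square of a mixed value, whose factorisation is already linear in
      \<xi>; then the square is cancelled.\<close>
    proof (rule V_cancel[OF _ F(1) _ nv1 _ r])
      show "hform UNIV 4 (\<lambda>r. gcomb (n 1) r ^ 2)" "hform UNIV 4 (\<lambda>r. gcomb (K *v \<xi>) r ^ 2)"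
        using gg by (simp_all add: power2_eq_square)
      fix r assume r: "r \<in> V"
      have "gcomb (n 1) r ^ 2 * F r = (T (e 1) (e 1) r * U r) * (T \<xi> \<xi> r * U r)" using F(2)[OF r] n[OF r] by simp
      also have "\<dots> = (T (e 1) \<xi> r * U r) ^ 2" unfolding power_mult_distrib rank1[OF r] by (simp add: power2_eq_square)
      finally show "gcomb (n 1) r ^ 2 * F r = gcomb (n 1) r ^ 2 * gcomb (K *v \<xi>) r ^ 2"
        unfolding T1[OF r] by (simp add: power_mult_distrib)
    qed
    then show ?thesis using F(2)[OF r] by simp
  qed
  show ?thesis
  proof (rule that[of K])
    show "invertible K"
    \<comment> \<open>A kernel vector would have the root zero, although the corresponding form does
      not vanish on the curve.\<close>
    proof (rule invertible_of_injective, rule ccontr)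
      fix \<xi> assume \<xi>: "K *v \<xi> = 0" "\<xi> \<noteq> 0"
      obtain F where F: "hform UNIV 2 F" "\<forall>r\<in>V. T \<xi> \<xi> r = F r" using T_form by blast
      then have "nv F" using nv_cong[OF nvT[OF \<xi>(2)]] by blast
      from nv_mult[OF F(1) hform_U this nv_U] obtain r where "r \<in> V" "F r * U r \<noteq> 0" unfolding nv_def by blast
      then show False using F(2) sq[of r \<xi>] \<xi>(1) by (simp add: gcomb_def)
    qed
    fix \<xi> \<eta> r assume r: "r \<in> V"
    have "T (\<xi> + \<eta>) (\<xi> + \<eta>) r = T \<xi> \<xi> r + 2 * T \<xi> \<eta> r + T \<eta> \<eta> r"
      unfolding T_add using T_sym[OF r, of "\<xi> + \<eta>"] T_sym[OF r, of \<eta> \<xi>] by (simp add: T_add)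
    then have "2 * (T \<xi> \<eta> r * U r) = T (\<xi> + \<eta>) (\<xi> + \<eta>) r * U r - T \<xi> \<xi> r * U r - T \<eta> \<eta> r * U r" by (simp add: algebra_simps)
    also have "\<dots> = 2 * (gcomb (K *v \<xi>) r * gcomb (K *v \<eta>) r)"
      unfolding sq[OF r] matrix_vector_right_distrib gcomb_linear by (simp add: power2_eq_square algebra_simps)
    finally show "T \<xi> \<eta> r * U r = gcomb (K *v \<xi>) r * gcomb (K *v \<eta>) r" using two by simp
  qed
qed

definition v1 :: "'a ^ 4 \<Rightarrow> 'a" where "v1 r = cZ r - \<beta> * cW r"

lemma hform_v1: "hform UNIV 1 v1"
  unfolding v1_def[abs_def] by (intro hform_diff hform_scale lin)

lemma basis_vectors:
  "cX ex = 1" "cY ex = 0" "cZ ex = 0" "cW ex = 0" "cX ey = 0" "cY ey = 1" "cZ ey = 0" "cW ey = 0"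
  "cX ez = 0" "cY ez = 0" "cZ ez = 1" "cW ez = 0" "cX ew = 0" "cY ew = 0" "cZ ew = 0" "cW ew = 1"
  using pt_coords[of 1 0 0 0] pt_coords[of 0 1 0 0] pt_coords[of 0 0 1 0] pt_coords[of 0 0 0 1]
  by (simp_all add: pt_def)

end

text \<open>The matrices are, up to scalars, the polar forms of the two equations of
  \<open>V\<close>. The first does not involve \<open>X\<close> and the second does not involve
  \<open>Y\<close>, so \<open>ex\<close> and \<open>ey\<close> are the vertices of the two
  cones.\<close>

locale biquadratic = normal_curve +
  fixes M1 M2 :: "'a ^ 4 ^ 4" and k1 k2 :: 'a
  assumes k1: "k1 \<noteq> 0" and k2: "k2 \<noteq> 0"
    and polar1: "scalar_product (M1 *v y) r = k1 * (2 * cY y * cY r - u1 y * v1 r - u1 r * v1 y)"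
    and polar2: "scalar_product (M2 *v y) r = k2 * (2 * cX y * cX r - cZ y * cW r - cZ r * cW y)"
begin

sublocale c1: cone \<alpha> \<beta> cX cY cZ cW ex ey ez ew M1 k1 cY u1 v1 ex
proof unfold_locales
  show "hform UNIV 1 cY" "hform UNIV 1 u1" "hform UNIV 1 v1" using lin hform_u1 hform_v1 by auto
  show "k1 \<noteq> 0" by (rule k1)
  show "scalar_product (M1 *v y) r = k1 * (2 * cY y * cY r - u1 y * v1 r - u1 r * v1 y)" for y r by (rule polar1)
  show "cY r ^ 2 = u1 r * v1 r" if "r \<in> V" for r using that by (simp add: V_iff q_def u1_def v1_def)
  show "u1 r \<noteq> 0 \<or> v1 r \<noteq> 0" if "r \<in> V" for r
  proof (rule ccontr)
    assume *: "\<not> ?thesis"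
    then have "(\<alpha> - \<beta>) * cW r = 0" by (simp add: u1_def v1_def algebra_simps)
    then have "cW r = 0" using \<alpha>\<beta> by simp
    then show False using * that by (simp add: u1_def V_iff)
  qed
  have solve: "\<exists>z w. z - \<alpha> * w = a \<and> z - \<beta> * w = b" for a b
  proof -
    define w where "w = (b - a) / (\<alpha> - \<beta>)"
    have "(\<alpha> - \<beta>) * w = b - a" using \<alpha>\<beta> by (simp add: w_def)
    then show ?thesis by (intro exI[of _ "a + \<alpha> * w"] exI[of _ w]) (simp add: algebra_simps)
  qed
  show "\<exists>r\<in>V. u1 r = a \<and> v1 r = b" if "a \<noteq> 0 \<or> b \<noteq> 0" for a b
  proof -
    obtain z w where zw: "z - \<alpha> * w = a" "z - \<beta> * w = b" using solve by blast
    then have "z \<noteq> 0 \<or> w \<noteq> 0" using that by auto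
    then obtain x y where "pt x y z w \<in> V" using V_nonempty_over by metis
    then show ?thesis using zw by (intro bexI[of _ "pt x y z w"]) (auto simp: u1_def v1_def)
  qed
  show "cY ex = 0" "u1 ex = 0" "v1 ex = 0" by (simp_all add: basis_vectors u1_def v1_def)
  show "\<exists>c. y = c *s ex" if "cY y = 0" "u1 y = 0" "v1 y = 0" for y
  proof -
    have "(\<alpha> - \<beta>) * cW y = 0" using that by (simp add: u1_def v1_def algebra_simps)
    then have "cW y = 0" using \<alpha>\<beta> by simp
    moreover from this have "cZ y = 0" using that by (simp add: u1_def)
    ultimately show ?thesis using basis[of y] that(1) by (intro exI[of _ "cX y"]) simp
  qed
  show "\<exists>y. cY y = a \<and> u1 y = b \<and> v1 y = c" for a b c
  proof -
    obtain z w where "z - \<alpha> * w = b" "z - \<beta> * w = c" using solve by blast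
    then show ?thesis by (intro exI[of _ "pt 0 a z w"]) (simp add: u1_def v1_def)
  qed
qed

sublocale c2: cone \<alpha> \<beta> cX cY cZ cW ex ey ez ew M2 k2 cX cZ cW ey
proof unfold_locales
  show "hform UNIV 1 cX" "hform UNIV 1 cZ" "hform UNIV 1 cW" using lin by auto
  show "k2 \<noteq> 0" by (rule k2)
  show "scalar_product (M2 *v y) r = k2 * (2 * cX y * cX r - cZ y * cW r - cZ r * cW y)" for y r by (rule polar2)
  show "cX r ^ 2 = cZ r * cW r" "cZ r \<noteq> 0 \<or> cW r \<noteq> 0" if "r \<in> V" for r using that by (auto simp: V_iff)
  show "\<exists>r\<in>V. cZ r = a \<and> cW r = b" if ab: "a \<noteq> 0 \<or> b \<noteq> 0" for a b
  proof -
    obtain x y where "pt x y a b \<in> V" using V_nonempty_over[OF ab] by metis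
    then show ?thesis by (intro bexI[of _ "pt x y a b"]) auto
  qed
  show "cX ey = 0" "cZ ey = 0" "cW ey = 0" by (simp_all add: basis_vectors)
  show "\<exists>c. y = c *s ey" if "cX y = 0" "cZ y = 0" "cW y = 0" for y
    using basis[of y] that by (intro exI[of _ "cY y"]) simp
  show "\<exists>y. cX y = a \<and> cZ y = b \<and> cW y = c" for a b c
    by (intro exI[of _ "pt a 0 b c"]) simp
qed

lemma binary_quadratic_eq_0:
  assumes "(\<lambda>z w :: 'a. A * (z * z) + B * (z * w) + E * (w * w)) = (\<lambda>z w. 0)"
  shows "A = 0" "B = 0" "E = 0"
proof -
  have e: "A * (z * z) + B * (z * w) + E * (w * w) = 0" for z w using assms by metis
  show "A = 0" "E = 0" using e[of 1 0] e[of 0 1] by simp_all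
  then show "B = 0" using e[of 1 1] by simp
qed

lemma binary_const_eq_0: "(\<lambda>(z :: 'a) (w :: 'a). A :: 'a) = (\<lambda>z w. 0) \<Longrightarrow> A = 0"
  by metis

lemma binary_linear_eq_0:
  assumes "(\<lambda>z w :: 'a. A * z + B * w) = (\<lambda>z w. 0)"
  shows "A = 0" "B = 0"
proof -
  have e: "A * z + B * w = 0" for z w using assms by metis
  show "A = 0" "B = 0" using e[of 1 0] e[of 0 1] by simp_all
qed

text \<open>Dually: the image of the curve under the two-uple embedding spans the space cut out by the two quadrics.\<close>

lemma pairing_span:
  assumes S: "transpose S = S" "pairing M1 S = 0" "pairing M2 S = 0"
    and D: "\<And>r. r \<in> V \<Longrightarrow> pairing D (outer r r) = 0"
  shows "pairing D S = 0"
proof -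
  define e where "e = (\<lambda>i :: 4. if i = 1 then ex else if i = 2 then ey else if i = 3 then ez else ew)"
  define P :: "'a ^ 4 ^ 4" where "P = (\<chi> i j. e j $ i)"
  have Pv: "P *v c = pt (c $ 1) (c $ 2) (c $ 3) (c $ 4)" for c
    by (simp add: P_def pt_def vec_eq_iff matrix_vector_mult_def sum_4 e_def mult.commute)
  have "invertible P"
    by (rule invertible_of_injective) (unfold Pv pt_eq_0_iff, simp add: vec_eq_iff forall_4)
  note inv = matrix_inv_mult[OF this]
  \<comment> \<open>The matrix of \<open>S\<close> in the new coordinates: pairing a matrix
    \<open>N\<close> with \<open>S\<close> becomes pairing the values of \<open>N\<close> on the
    basis vectors with the entries of \<open>s\<close>.\<close>
  define s where "s = matrix_inv P ** S ** transpose (matrix_inv P)"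
  have "transpose (matrix_inv P) ** transpose P = mat 1"
    using inv(1) by (metis matrix_transpose_mul transpose_mat)
  then have Ss: "S = P ** s ** transpose P"
    unfolding s_def using inv(1) by (metis matrix_mul_assoc matrix_mul_lid matrix_mul_rid)
  have s_sym: "transpose s = s" unfolding s_def by (simp add: matrix_transpose_mul S(1) matrix_mul_assoc)
  then have sym: "s $ j $ i = s $ i $ j" for i j by (rule symmetric_entry)
  have Pa: "P *v axis k 1 = e k" for k by (simp add: vec_eq_iff matrix_axis P_def)
  have entry: "(transpose P ** N ** P) $ i $ j = scalar_product (e i) (N *v e j)" for N :: "'a ^ 4 ^ 4" and i j
  proof -
    have "(transpose P ** N ** P) $ i $ j = scalar_product (axis i 1) ((transpose P ** N ** P) *v axis j 1)"
      by (subst scalar_product_commute) (simp add: scalar_product_axis matrix_axis)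
    also have "\<dots> = scalar_product (P *v axis i 1) (N *v (P *v axis j 1))"
      unfolding matrix_vector_mul_assoc[symmetric] by (subst scalar_product_matrix) (simp only: transpose_transpose)
    finally show ?thesis unfolding Pa .
  qed
  have pS: "pairing N S = (\<Sum>i\<in>UNIV. \<Sum>j\<in>UNIV. scalar_product (e i) (N *v e j) * s $ i $ j)" for N :: "'a ^ 4 ^ 4"
    unfolding Ss pairing_congruence by (simp add: pairing_def entry)
  have ev: "e 1 = ex" "e 2 = ey" "e 3 = ez" "e 4 = ew" by (simp_all add: e_def)
  have q1: "scalar_product (e i) (M1 *v e j) = k1 * (2 * cY (e j) * cY (e i) - u1 (e j) * v1 (e i) - u1 (e i) * v1 (e j))" for i j
    by (subst scalar_product_commute) (rule polar1)
  have q2: "scalar_product (e i) (M2 *v e j) = k2 * (2 * cX (e j) * cX (e i) - cZ (e j) * cW (e i) - cZ (e i) * cW (e j))" for i j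
    by (subst scalar_product_commute) (rule polar2)
  \<comment> \<open>The conditions on \<open>S\<close> are the two equations of the curve with each
    product of coordinates replaced by an entry of \<open>s\<close>.\<close>
  have "2 * k2 * (s $ 1 $ 1 - s $ 3 $ 4) = 0"
    using S(3) unfolding pS q2 sum_4 ev basis_vectors sym[of 3 4] by (simp add: algebra_simps)
  then have w2: "s $ 1 $ 1 = s $ 3 $ 4" using k2 two by simp
  have "2 * k1 * (s $ 2 $ 2 - s $ 3 $ 3 - \<alpha> * \<beta> * s $ 4 $ 4 + (\<alpha> + \<beta>) * s $ 3 $ 4) = 0"
    using S(2) unfolding pS q1 sum_4 ev u1_def v1_def basis_vectors sym[of 3 4] by (simp add: algebra_simps)
  then have "s $ 2 $ 2 - s $ 3 $ 3 - \<alpha> * \<beta> * s $ 4 $ 4 + (\<alpha> + \<beta>) * s $ 3 $ 4 = 0"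
    using k1 two by (simp only: mult_eq_0_iff) simp
  then have w1: "s $ 2 $ 2 = s $ 3 $ 3 + \<alpha> * \<beta> * s $ 4 $ 4 - (\<alpha> + \<beta>) * s $ 3 $ 4"
    by (simp add: algebra_simps)
  define d where "d = (\<lambda>i j. scalar_product (e i) (D *v e j))"
  have expand: "pairing D (outer r r) = nf (\<lambda>z w. (d 2 2 + d 3 3) * (z * z) + (d 1 1 - (\<alpha> + \<beta>) * d 2 2 + d 3 4 + d 4 3) * (z * w) + (\<alpha> * \<beta> * d 2 2 + d 4 4) * (w * w))
     (\<lambda>z w. (d 1 3 + d 3 1) * z + (d 1 4 + d 4 1) * w) (\<lambda>z w. (d 2 3 + d 3 2) * z + (d 2 4 + d 4 2) * w) (\<lambda>z w. d 1 2 + d 2 1) r" if "r \<in> V" for r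
  proof -
    have r: "r = cX r *s e 1 + cY r *s e 2 + cZ r *s e 3 + cW r *s e 4" unfolding ev by (rule basis[symmetric])
    have x: "cX r * cX r = cZ r * cW r" and y: "cY r * cY r = cZ r * cZ r - (\<alpha> + \<beta>) * cZ r * cW r + \<alpha> * \<beta> * cW r * cW r"
      using that by (auto simp: V_iff power2_eq_square q_expand)
    have "pairing D (outer r r) = scalar_product (cX r *s e 1 + cY r *s e 2 + cZ r *s e 3 + cW r *s e 4)
       (D *v (cX r *s e 1 + cY r *s e 2 + cZ r *s e 3 + cW r *s e 4))"
      unfolding pairing_outer using r by metis
    also have "\<dots> = d 1 1 * (cX r * cX r) + d 2 2 * (cY r * cY r) + d 3 3 * (cZ r * cZ r) + d 4 4 * (cW r * cW r)
      + (d 1 2 + d 2 1) * cX r * cY r + (d 1 3 + d 3 1) * cX r * cZ r + (d 1 4 + d 4 1) * cX r * cW r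
      + (d 2 3 + d 3 2) * cY r * cZ r + (d 2 4 + d 4 2) * cY r * cW r + (d 3 4 + d 4 3) * cZ r * cW r"
      unfolding d_def by (simp add: matrix_vector_right_distrib vector_scalar_commute scalar_product_linear algebra_simps)
    finally show ?thesis unfolding x y nf_def by (simp add: algebra_simps)
  qed
  have zz: "bf 2 (\<lambda>z w :: 'a. z * z)" "bf 2 (\<lambda>z w :: 'a. w * w)"
    using bf_mult[OF bf_z bf_z, of 2] bf_mult[OF bf_w bf_w, of 2] by simp_all
  have ba: "bf 2 (\<lambda>z w. A * (z * z) + B * (z * w) + E * (w * w))" for A B E :: 'a
    by (intro bf_add bf_scale zz bf_zw)
  have D0: "nf (\<lambda>z w. (d 2 2 + d 3 3) * (z * z) + (d 1 1 - (\<alpha> + \<beta>) * d 2 2 + d 3 4 + d 4 3) * (z * w) + (\<alpha> * \<beta> * d 2 2 + d 4 4) * (w * w))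
     (\<lambda>z w. (d 1 3 + d 3 1) * z + (d 1 4 + d 4 1) * w) (\<lambda>z w. (d 2 3 + d 3 2) * z + (d 2 4 + d 4 2) * w) (\<lambda>z w. d 1 2 + d 2 1) r = 0" if "r \<in> V" for r
    using D[OF that] expand[OF that] by simp
  note z = nf_eq_0[OF ba bf_linear bf_linear bf_const D0]
  have z1: "(\<lambda>z w. (d 2 2 + d 3 3) * (z * z) + (d 1 1 - (\<alpha> + \<beta>) * d 2 2 + d 3 4 + d 4 3) * (z * w) + (\<alpha> * \<beta> * d 2 2 + d 4 4) * (w * w)) = (\<lambda>z w. 0)"
    and z2: "(\<lambda>z w. (d 1 3 + d 3 1) * z + (d 1 4 + d 4 1) * w) = (\<lambda>z w. 0)"
    and z3: "(\<lambda>z w. (d 2 3 + d 3 2) * z + (d 2 4 + d 4 2) * w) = (\<lambda>z w. 0)"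
    and z4: "(\<lambda>(z :: 'a) (w :: 'a). d 1 2 + d 2 1) = (\<lambda>z w. 0)"
    using z by blast+
  note e = binary_quadratic_eq_0[OF z1] binary_linear_eq_0[OF z2] binary_linear_eq_0[OF z3] binary_const_eq_0[OF z4]
  have "pairing D S = d 1 1 * s $ 1 $ 1 + d 2 2 * s $ 2 $ 2 + d 3 3 * s $ 3 $ 3 + d 4 4 * s $ 4 $ 4
     + (d 1 2 + d 2 1) * s $ 1 $ 2 + (d 1 3 + d 3 1) * s $ 1 $ 3 + (d 1 4 + d 4 1) * s $ 1 $ 4
     + (d 2 3 + d 3 2) * s $ 2 $ 3 + (d 2 4 + d 4 2) * s $ 2 $ 4 + (d 3 4 + d 4 3) * s $ 3 $ 4"
    unfolding pS d_def sum_4 sym[of 1 2] sym[of 1 3] sym[of 1 4] sym[of 2 3] sym[of 2 4] sym[of 3 4] by (simp add: algebra_simps)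
  also have "d 3 4 + d 4 3 = - (d 1 1 - (\<alpha> + \<beta>) * d 2 2)" using e(2) by (simp add: algebra_simps add_eq_0_iff2)
  also have "d 3 3 = - d 2 2" using e(1) by (simp add: add_eq_0_iff2)
  also have "d 4 4 = - (\<alpha> * \<beta> * d 2 2)" using e(3) by (simp add: add_eq_0_iff2)
  finally show ?thesis unfolding e w1 w2 by (simp add: algebra_simps)
qed

end

section \<open>Existence of the normal form\<close>

lemma mat_scale_vector: "(c *k M) *v x = c *s (M *v x)"
  by (simp add: mat_scale_def matrix_vector_mult_def vec_eq_iff sum_distrib_left mult_ac)

lemma scalar_product_symmetric:
  fixes M :: "'a::field ^ 'n ^ 'n"
  assumes "transpose M = M" shows "scalar_product x (M *v y) = scalar_product y (M *v x)"
  by (subst scalar_product_matrix) (simp only: assms scalar_product_commute)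

lemma pencil_entry:
  "scalar_product x ((s *k A + t *k B) *v y) = s * scalar_product x (A *v y) + t * scalar_product x (B *v y)"
  for A B :: "'a::field ^ 'n ^ 'n"
  by (simp add: matrix_vector_mult_add_rdistrib mat_scale_vector scalar_product_linear)

lemma transpose_pencil:
  assumes "transpose A = A" "transpose B = B"
  shows "transpose (s *k A + t *k B) = s *k A + t *k (B :: 'a::field ^ 'n ^ 'n)"
  using symmetric_entry[OF assms(1)] symmetric_entry[OF assms(2)]
  by (simp add: transpose_def mat_scale_def vec_eq_iff)

lemma kernel_vector:
  fixes M :: "'a::field ^ 'n ^ 'n"
  assumes "det M = 0" obtains x where "x \<noteq> 0" "M *v x = 0"
  using invertible_of_injective[of M] assms invertible_det_nz[of M] by blast

text \<open>\<open>Z\<close> and \<open>W\<close> are the linear factors of the part of \<open>M2\<close> not involving the first coordinate.\<close>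

lemma normal_form_of_diagonal:
  fixes x1 x2 x3 x4 :: "'a::alg_closed_field ^ 4 \<Rightarrow> 'a" and M1 M2 :: "'a ^ 4 ^ 4"
  assumes two: "(2 :: 'a) \<noteq> 0"
    and lin: "hform UNIV 1 x1" "hform UNIV 1 x2" "hform UNIV 1 x3" "hform UNIV 1 x4"
    and co: "\<And>a b c d. x1 (a *s e1 + b *s e2 + c *s e3 + d *s e4) = a" "\<And>a b c d. x2 (a *s e1 + b *s e2 + c *s e3 + d *s e4) = b"
      "\<And>a b c d. x3 (a *s e1 + b *s e2 + c *s e3 + d *s e4) = c" "\<And>a b c d. x4 (a *s e1 + b *s e2 + c *s e3 + d *s e4) = d"
    and ba: "\<And>p. x1 p *s e1 + x2 p *s e2 + x3 p *s e3 + x4 p *s e4 = p"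
    and M1: "\<And>y r. scalar_product (M1 *v y) r = d12 * x2 y * x2 r + d13 * x3 y * x3 r + d14 * x4 y * x4 r"
    and M2: "\<And>y r. scalar_product (M2 *v y) r = d21 * x1 y * x1 r + d23 * x3 y * x3 r + d24 * x4 y * x4 r"
    and nz: "d12 \<noteq> 0" "d13 \<noteq> 0" "d14 \<noteq> 0" "d21 \<noteq> 0" "d23 \<noteq> 0" "d24 \<noteq> 0" and indep: "d13 * d24 \<noteq> d14 * d23"
  obtains \<alpha> \<beta> cX cY cZ cW ex ey ez ew k1 k2 where "biquadratic \<alpha> \<beta> cX cY cZ cW ex ey ez ew M1 M2 k1 k2"
proof -
  have sq: "\<exists>x :: 'a. x ^ 2 = c" for c using nth_root_exists[of 2 c] by auto
  \<comment> \<open>With these constants \<open>Z W\<close> equals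
    \<open>a^2 x3^2 - b^2 x4^2\<close>, and the quadratic form of \<open>M2\<close> becomes
    \<open>d21 (X^2 - Z W)\<close>.\<close>
  obtain a where a: "a ^ 2 = - d23 / d21" using sq by blast
  obtain b where b: "b ^ 2 = d24 / d21" using sq by blast
  have ab: "a \<noteq> 0" "b \<noteq> 0" using a b nz by auto
  have four: "(4 :: 'a) \<noteq> 0"
  proof -
    have "(4 :: 'a) = 2 * 2" by simp
    then show ?thesis using two by (metis mult_eq_0_iff)
  qed
  \<comment> \<open>Since \<open>x3 = (Z + W) / (2 a)\<close> and
    \<open>x4 = (Z - W) / (2 b)\<close>, the part of \<open>M1\<close> without \<open>x2\<close> is
    \<open>m (Z + W)^2 + n (Z - W)^2\<close>.\<close>
  define m n where "m = d13 / (4 * a ^ 2)" and "n = d14 / (4 * b ^ 2)"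
  have mn: "m \<noteq> 0" "n \<noteq> 0" using nz ab four by (simp_all add: m_def n_def)
  have d13: "d13 = 4 * m * a ^ 2" and d14: "d14 = 4 * n * b ^ 2" using ab four by (simp_all add: m_def n_def)
  have d23: "d23 = - d21 * a ^ 2" and d24: "d24 = d21 * b ^ 2" using a b nz by simp_all
  have "m + n \<noteq> 0"
  proof
    assume "m + n = 0"
    then have "n = - m" by (simp add: add_eq_0_iff)
    then show False using indep unfolding d13 d14 d23 d24 by simp
  qed
  define A where "A = m + n"
  have A: "A \<noteq> 0" using \<open>m + n \<noteq> 0\<close> by (simp add: A_def)
  \<comment> \<open>That part is \<open>A (Z^2 + c Z W + W^2)\<close>. Its roots \<alpha> and
    \<beta> have product 1, and they are distinct because
    \<open>A^2 (c^2 - 4) = - 16 m n\<close>.\<close>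
  define c where "c = 2 * (m - n) / A"
  obtain d where d: "d ^ 2 = c ^ 2 - 4" using sq by blast
  define \<alpha> \<beta> where "\<alpha> = (- c + d) / 2" and "\<beta> = (- c - d) / 2"
  have s: "\<alpha> + \<beta> = - c" and p: "\<alpha> * \<beta> = 1" and df: "\<alpha> - \<beta> = d"
  proof -
    have h: "t / 2 + t / 2 = t" for t :: 'a using two by (simp add: field_simps)
    show "\<alpha> + \<beta> = - c" "\<alpha> - \<beta> = d"
      using h[of "- c"] h[of d] by (simp_all add: \<alpha>_def \<beta>_def diff_divide_distrib add_divide_distrib algebra_simps)
    have "4 * (\<alpha> * \<beta>) = (- c + d) * (- c - d)" using two four by (simp add: \<alpha>_def \<beta>_def)
    also have "\<dots> = c ^ 2 - d ^ 2" by (simp add: power2_eq_square algebra_simps)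
    also have "\<dots> = 4 * 1" unfolding d by simp
    finally show "\<alpha> * \<beta> = 1" using mult_left_cancel[OF four] by blast
  qed
  have cA: "A * c = 2 * (m - n)" using A by (simp add: c_def)
  have "d \<noteq> 0"
  proof
    assume "d = 0"
    then have "c ^ 2 = 4" using d by simp
    then have "(A * c) ^ 2 = 4 * A ^ 2" by (simp add: power_mult_distrib mult.commute)
    then have "(2 * (m - n)) ^ 2 = 4 * A ^ 2" unfolding cA .
    then have "(2 * (m - n)) ^ 2 = 4 * (m + n) ^ 2" unfolding A_def .
    moreover have "4 * (4 * (m * n)) = 4 * (m + n) ^ 2 - (2 * (m - n)) ^ 2" by (simp add: power2_eq_square algebra_simps)
    ultimately have "4 * (4 * (m * n)) = 0" by (simp only: diff_self)
    then show False using mn four by (simp only: mult_eq_0_iff) simp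
  qed
  have \<alpha>\<beta>: "\<alpha> \<noteq> \<beta>" "\<alpha> \<noteq> 0" "\<beta> \<noteq> 0" using df \<open>d \<noteq> 0\<close> p by auto
  \<comment> \<open>Scales \<open>Y\<close> so that \<open>d12 x2^2 = - A Y^2\<close>.\<close>
  obtain f where f: "f ^ 2 = - d12 / A" using sq by blast
  have f0: "f \<noteq> 0" using f nz A by auto
  define cY where "cY = (\<lambda>p. f * x2 p)"
  define cZ where "cZ = (\<lambda>p. a * x3 p + b * x4 p)"
  define cW where "cW = (\<lambda>p. a * x3 p - b * x4 p)"
  define ey where "ey = (1 / f) *s e2"
  define ez where "ez = (1 / (2 * a)) *s e3 + (1 / (2 * b)) *s e4"
  define ew where "ew = (1 / (2 * a)) *s e3 + (- 1 / (2 * b)) *s e4"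
  have comb: "x *s e1 + y *s ey + z *s ez + w *s ew
     = x *s e1 + (y / f) *s e2 + ((z + w) / (2 * a)) *s e3 + ((z - w) / (2 * b)) *s e4" for x y z w
    unfolding ey_def ez_def ew_def by (simp add: vec_eq_iff add_divide_distrib diff_divide_distrib algebra_simps)
  have nc: "normal_curve \<alpha> \<beta> x1 cY cZ cW e1 ey ez ew"
  proof unfold_locales
    show "hform UNIV 1 x1" "hform UNIV 1 cY" "hform UNIV 1 cZ" "hform UNIV 1 cW"
      unfolding cY_def cZ_def cW_def by (intro lin hform_add hform_diff hform_scale)+
    have ca: "a * (t / (2 * a)) = t / 2" "b * (t / (2 * b)) = t / 2" for t using ab by simp_all
    have half: "(z + w) / 2 + (z - w) / 2 = z" "(z + w) / 2 - (z - w) / 2 = w" for z w :: 'a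
      using two four by (simp_all add: field_simps)
    show "x1 (x *s e1 + y *s ey + z *s ez + w *s ew) = x" "cY (x *s e1 + y *s ey + z *s ez + w *s ew) = y" 
       for x y z w unfolding comb cY_def co using f0 by simp_all
    show "cZ (x *s e1 + y *s ey + z *s ez + w *s ew) = z" "cW (x *s e1 + y *s ey + z *s ez + w *s ew) = w"
       for x y z w unfolding comb cZ_def cW_def co ca by (rule half)+
    show "x1 p *s e1 + cY p *s ey + cZ p *s ez + cW p *s ew = p" for p
    proof -
      have "cZ p + cW p = 2 * a * x3 p" "cZ p - cW p = 2 * b * x4 p" by (simp_all add: cZ_def cW_def)
      then show ?thesis unfolding comb using f0 ab two ba[of p] by (simp add: cY_def)
    qed
  qed (use two \<alpha>\<beta> in auto)
  have h2: "t = 2 * (t / 2)" for t :: 'a using two by simp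
  have "biquadratic \<alpha> \<beta> x1 cY cZ cW e1 ey ez ew M1 M2 (- A / 2) (d21 / 2)"
  proof (rule biquadratic.intro[OF nc], unfold_locales)
    show "- A / 2 \<noteq> 0" "d21 / 2 \<noteq> 0" using A two nz by auto
    fix y r
    have f': "d12 = - A * f ^ 2" using f A by simp
    have "- A / 2 * (2 * cY y * cY r - normal_curve.u1 \<alpha> cZ cW y * normal_curve.v1 \<beta> cZ cW r - normal_curve.u1 \<alpha> cZ cW r * normal_curve.v1 \<beta> cZ cW y)
      = - A * (cY y * cY r) + A * (cZ y * cZ r + (\<alpha> * \<beta>) * (cW y * cW r)) - (A / 2) * (\<alpha> + \<beta>) * (cZ y * cW r + cZ r * cW y)"
      unfolding normal_curve.u1_def[OF nc] normal_curve.v1_def[OF nc] using two by (simp add: field_simps)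
    also have "(A / 2) * (\<alpha> + \<beta>) = - (A * c / 2)" unfolding s by simp
    also have "A * c / 2 = m - n" unfolding cA by (rule nonzero_mult_div_cancel_left[OF two])
    also have "- A * (cY y * cY r) + A * (cZ y * cZ r + \<alpha> * \<beta> * (cW y * cW r)) - - (m - n) * (cZ y * cW r + cZ r * cW y)
      = scalar_product (M1 *v y) r"
      unfolding M1 p f' d13 d14 A_def cY_def cZ_def cW_def by (simp add: power2_eq_square algebra_simps)
    finally show "scalar_product (M1 *v y) r = - A / 2 * (2 * cY y * cY r - normal_curve.u1 \<alpha> cZ cW y * normal_curve.v1 \<beta> cZ cW r - normal_curve.u1 \<alpha> cZ cW r * normal_curve.v1 \<beta> cZ cW y)"
      by (rule sym)
    have "d21 / 2 * (2 * x1 y * x1 r - cZ y * cW r - cZ r * cW y) = d21 * (x1 y * x1 r) - d21 * ((cZ y * cW r + cZ r * cW y) / 2)"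
      using two by (simp add: field_simps)
    also have "cZ y * cW r + cZ r * cW y = 2 * (a ^ 2 * x3 y * x3 r - b ^ 2 * x4 y * x4 r)"
      unfolding cZ_def cW_def by (simp add: power2_eq_square algebra_simps)
    also have "2 * (a ^ 2 * x3 y * x3 r - b ^ 2 * x4 y * x4 r) / 2 = a ^ 2 * x3 y * x3 r - b ^ 2 * x4 y * x4 r"
      by (rule nonzero_mult_div_cancel_left[OF two])
    also have "d21 * (x1 y * x1 r) - d21 * (a ^ 2 * x3 y * x3 r - b ^ 2 * x4 y * x4 r) = scalar_product (M2 *v y) r"
      unfolding M2 d23 d24 by (simp add: algebra_simps)
    finally show "scalar_product (M2 *v y) r = d21 / 2 * (2 * x1 y * x1 r - cZ y * cW r - cZ r * cW y)"
      by (rule sym)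
  qed
  then show ?thesis by (rule that)
qed

lemma pencil_independent:
  fixes A B :: "'a::field ^ 'n ^ 'n"
  assumes "(s, t) \<noteq> (0, 0)" "(s', t') \<noteq> (0, 0)" "\<And>c. s *k A + t *k B \<noteq> c *k (s' *k A + t' *k B)"
  shows "s * t' - s' * t \<noteq> 0"
proof
  assume "s * t' - s' * t = 0"
  then have eq: "s * t' = s' * t" by simp
  obtain c where "s = c * s'" "t = c * t'"
  proof (cases "s' = 0")
    case True
    then have "t' \<noteq> 0" "s = 0" using assms(2) eq by auto
    then show ?thesis using that[of "t / t'"] True by auto
  next
    case False
    then show ?thesis using that[of "s / s'"] eq by (auto simp: field_simps)
  qed
  then have "s *k A + t *k B = c *k (s' *k A + t' *k B)" by (simp add: mat_scale_def vec_eq_iff algebra_simps)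
  then show False using assms(3) by blast
qed

text \<open>Vectors in the kernels of two different singular members are orthogonal for two
  independent members, hence for the whole pencil. The four kernel vectors therefore diagonalise it,
  and the Jacobian criterion keeps both diagonal values at one of them from vanishing.\<close>

lemma normal_form_exists:
  fixes A B :: "'a::alg_closed_field ^ 4 ^ 4" and Q :: "nat \<Rightarrow> 'a ^ 4 ^ 4"
  assumes two: "(2 :: 'a) \<noteq> 0" and sym: "transpose A = A" "transpose B = B"
    and smooth: "\<And>x a b. x \<noteq> 0 \<Longrightarrow> qform A x = 0 \<Longrightarrow> qform B x = 0 \<Longrightarrow> a *s (A *v x) + b *s (B *v x) = 0 \<Longrightarrow> a = 0 \<and> b = 0"
    and singular: "\<And>i. i \<in> {1..4} \<Longrightarrow> Q i \<in> pencil A B \<and> det (Q i) = 0"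
    and distinct: "\<And>i j c. i \<in> {1..4} \<Longrightarrow> j \<in> {1..4} \<Longrightarrow> i \<noteq> j \<Longrightarrow> Q i \<noteq> c *k Q j"
  obtains \<alpha> \<beta> cX cY cZ cW ex ey ez ew k1 k2 where "biquadratic \<alpha> \<beta> cX cY cZ cW ex ey ez ew (Q 1) (Q 2) k1 k2"
proof -
  have "\<exists>s t. (s, t) \<noteq> (0, 0) \<and> Q i = s *k A + t *k B" if "i \<in> {1..4}" for i
    using singular[OF that] unfolding pencil_def by blast
  then obtain s t where st: "\<And>i. i \<in> {1..4} \<Longrightarrow> (s i, t i) \<noteq> (0, 0)" "\<And>i. i \<in> {1..4} \<Longrightarrow> Q i = s i *k A + t i *k B"
    by metis
  have "\<exists>x. x \<noteq> 0 \<and> Q i *v x = 0" if "i \<in> {1..4}" for i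
    using kernel_vector singular[OF that] by metis
  then obtain e where e: "\<And>i. i \<in> {1..4} \<Longrightarrow> e i \<noteq> 0" "\<And>i. i \<in> {1..4} \<Longrightarrow> Q i *v e i = 0" by metis
  define \<delta> where "\<delta> = (\<lambda>i j. s i * t j - s j * t i)"
  have \<delta>: "\<delta> i j \<noteq> 0" if ij: "i \<in> {1..4}" "j \<in> {1..4}" "i \<noteq> j" for i j
    unfolding \<delta>_def by (rule pencil_independent[OF st(1)[OF ij(1)] st(1)[OF ij(2)], of A B])
      (fold st(2)[OF ij(1)] st(2)[OF ij(2)], rule distinct[OF ij])
  define bA where "bA = (\<lambda>x y. scalar_product x (A *v y))"
  define bB where "bB = (\<lambda>x y. scalar_product x (B *v y))"
  have Qe: "scalar_product x (Q i *v y) = s i * bA x y + t i * bB x y" if "i \<in> {1..4}" for i x y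
    unfolding st(2)[OF that] pencil_entry bA_def bB_def ..
  have symAB: "bA x y = bA y x" "bB x y = bB y x" for x y
    unfolding bA_def bB_def by (rule scalar_product_symmetric[OF sym(1)], rule scalar_product_symmetric[OF sym(2)])
  have k: "s i * bA x (e i) + t i * bB x (e i) = 0" if "i \<in> {1..4}" for i x
    using Qe[OF that, of x "e i"] e(2)[OF that] by (simp add: scalar_product_def)
  have orth: "bA (e i) (e j) = 0 \<and> bB (e i) (e j) = 0" if ij: "i \<in> {1..4}" "j \<in> {1..4}" "i \<noteq> j" for i j
  proof -
    define a b where "a = bA (e i) (e j)" and "b = bB (e i) (e j)"
    have 1: "s j * a + t j * b = 0" using k[OF ij(2), of "e i"] by (simp add: a_def b_def)
    have 2: "s i * a + t i * b = 0" using k[OF ij(1), of "e j"] symAB by (simp add: a_def b_def)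
    have "\<delta> i j * a = t j * (s i * a + t i * b) - t i * (s j * a + t j * b)" unfolding \<delta>_def by (simp add: algebra_simps)
    moreover have "\<delta> i j * b = s i * (s j * a + t j * b) - s j * (s i * a + t i * b)" unfolding \<delta>_def by (simp add: algebra_simps)
    ultimately show ?thesis using \<delta>[OF ij] unfolding 1 2 a_def[symmetric] b_def[symmetric] by simp
  qed
  \<comment> \<open>The pair of values at \<open>e i\<close> is annihilated by
    \<open>(s i, t i)\<close>, so it is a multiple of \<open>(t i, - s i)\<close>; the diagonal
    entry of the j-th member then is \<open>\<gamma> i * \<delta> j i\<close>.\<close>
  have "\<exists>\<gamma>. \<gamma> \<noteq> 0 \<and> bA (e i) (e i) = \<gamma> * t i \<and> bB (e i) (e i) = - (\<gamma> * s i)" if i: "i \<in> {1..4}" for i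
  proof -
    have nz: "\<not> (bA (e i) (e i) = 0 \<and> bB (e i) (e i) = 0)"
    proof
      assume "bA (e i) (e i) = 0 \<and> bB (e i) (e i) = 0"
      moreover have "s i *s (A *v e i) + t i *s (B *v e i) = 0"
        using e(2)[OF i] unfolding st(2)[OF i] by (simp add: matrix_vector_mult_add_rdistrib mat_scale_vector)
      ultimately show False using smooth[OF e(1)[OF i]] st(1)[OF i] unfolding bA_def bB_def qform_def by blast
    qed
    have eq: "s i * bA (e i) (e i) + t i * bB (e i) (e i) = 0" using k[OF i] .
    show ?thesis
    proof (cases "t i = 0")
      case True
      then have "s i \<noteq> 0" "bA (e i) (e i) = 0" using st(1)[OF i] eq by auto
      then show ?thesis using nz True by (intro exI[of _ "- bB (e i) (e i) / s i"]) auto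
    next
      case False
      have "bB (e i) (e i) = - (bA (e i) (e i) / t i * s i)"
        using eq False by (simp add: field_simps add_eq_0_iff)
      then show ?thesis using nz False by (intro exI[of _ "bA (e i) (e i) / t i"]) auto
    qed
  qed
  then obtain \<gamma> where \<gamma>: "\<And>i. i \<in> {1..4} \<Longrightarrow> \<gamma> i \<noteq> 0" "\<And>i. i \<in> {1..4} \<Longrightarrow> bA (e i) (e i) = \<gamma> i * t i"
     "\<And>i. i \<in> {1..4} \<Longrightarrow> bB (e i) (e i) = - (\<gamma> i * s i)" by metis
  have diag: "s j * bA (e i) (e i) + t j * bB (e i) (e i) = \<gamma> i * \<delta> j i" if "i \<in> {1..4}" for i j
    unfolding \<gamma>(2,3)[OF that] \<delta>_def by (simp add: algebra_simps)
  have I: "1 \<in> {1..4::nat}" "2 \<in> {1..4::nat}" "3 \<in> {1..4::nat}" "4 \<in> {1..4::nat}" by auto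
  define E where "E = (\<lambda>c :: 'a ^ 4. c $ 1 *s e 1 + c $ 2 *s e 2 + c $ 3 *s e 3 + c $ 4 *s e 4)"
  have QE: "scalar_product (E c) (Q j *v E d) = \<gamma> 1 * \<delta> j 1 * (c $ 1 * d $ 1) + \<gamma> 2 * \<delta> j 2 * (c $ 2 * d $ 2)
      + \<gamma> 3 * \<delta> j 3 * (c $ 3 * d $ 3) + \<gamma> 4 * \<delta> j 4 * (c $ 4 * d $ 4)" if j: "j \<in> {1..4}" for j c d
  proof -
    define N where "N = (\<lambda>x y. s j * bA x y + t j * bB x y)"
    have Nlin: "N (x + x') y = N x y + N x' y" "N x (y + y') = N x y + N x y'" "N (a *s x) y = a * N x y" "N x (a *s y) = a * N x y"
      for x x' y y' a
      unfolding N_def bA_def bB_def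
      by (simp_all add: scalar_product_linear matrix_vector_right_distrib vector_scalar_commute algebra_simps)
    have N0: "N (e i) (e l) = 0" if "i \<in> {1..4}" "l \<in> {1..4}" "i \<noteq> l" for i l using orth[OF that] by (simp add: N_def)
    have N1: "N (e i) (e i) = \<gamma> i * \<delta> j i" if "i \<in> {1..4}" for i using diag[OF that] by (simp add: N_def)
    have "scalar_product (E c) (Q j *v E d) = N (E c) (E d)" unfolding Qe[OF j] N_def ..
    then show ?thesis unfolding E_def Nlin
      using N0[OF I(1) I(2)] N0[OF I(1) I(3)] N0[OF I(1) I(4)] N0[OF I(2) I(1)] N0[OF I(2) I(3)] N0[OF I(2) I(4)]
        N0[OF I(3) I(1)] N0[OF I(3) I(2)] N0[OF I(3) I(4)] N0[OF I(4) I(1)] N0[OF I(4) I(2)] N0[OF I(4) I(3)]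
        N1[OF I(1)] N1[OF I(2)] N1[OF I(3)] N1[OF I(4)] by simp
  qed
  define P :: "'a ^ 4 ^ 4" where "P = (\<chi> i j. (if j = 1 then e 1 else if j = 2 then e 2 else if j = 3 then e 3 else e 4) $ i)"
  have PE: "P *v c = E c" for c
    by (simp add: P_def E_def vec_eq_iff matrix_vector_mult_def sum_4 mult.commute)
  have d0: "\<delta> i i = 0" for i by (simp add: \<delta>_def)
  have "invertible P"
  proof (rule invertible_of_injective)
    fix c assume "P *v c = 0"
    then have z: "E c = 0" by (simp add: PE)
    have z': "scalar_product (E c) (Q j *v E d) = 0" for j d unfolding z by (simp add: scalar_product_def)
    have "\<gamma> 1 * \<delta> 2 1 * (c $ 1 * 1) = 0" using QE[OF I(2), of c "axis 1 1"] unfolding z' by (simp add: axis_def)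
    moreover have "\<gamma> 2 * \<delta> 1 2 * (c $ 2 * 1) = 0" using QE[OF I(1), of c "axis 2 1"] unfolding z' by (simp add: axis_def)
    moreover have "\<gamma> 3 * \<delta> 1 3 * (c $ 3 * 1) = 0" using QE[OF I(1), of c "axis 3 1"] unfolding z' by (simp add: axis_def)
    moreover have "\<gamma> 4 * \<delta> 1 4 * (c $ 4 * 1) = 0" using QE[OF I(1), of c "axis 4 1"] unfolding z' by (simp add: axis_def)
    ultimately show "c = 0" using \<gamma>(1) I \<delta>[OF I(2) I(1)] \<delta>[OF I(1) I(2)] \<delta>[OF I(1) I(3)] \<delta>[OF I(1) I(4)]
      by (simp add: vec_eq_iff forall_4)
  qed
  note inv = matrix_inv_mult[OF this]
  define x where "x = (\<lambda>i p. (matrix_inv P *v p) $ i)"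
  have hx: "hform UNIV 1 (x i)" for i
    unfolding x_def matrix_vector_mult_def by simp (intro hform_sum hform_scale hform_coord[unfolded One_nat_def])
  have Ex: "E (matrix_inv P *v p) = p" for p using inv(3) by (simp add: PE)
  have xE: "x i (E c) = c $ i" for i c unfolding x_def PE[symmetric] using inv(4) by simp
  have Qp: "scalar_product (Q j *v y) r = \<gamma> 1 * \<delta> j 1 * (x 1 y * x 1 r) + \<gamma> 2 * \<delta> j 2 * (x 2 y * x 2 r)
      + \<gamma> 3 * \<delta> j 3 * (x 3 y * x 3 r) + \<gamma> 4 * \<delta> j 4 * (x 4 y * x 4 r)" if "j \<in> {1..4}" for j y r
    using QE[OF that, of "matrix_inv P *v r" "matrix_inv P *v y"] unfolding Ex
    by (subst scalar_product_commute) (simp add: x_def mult.commute)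
  show ?thesis
  proof (rule normal_form_of_diagonal[OF two hx[of 1] hx[of 2] hx[of 3] hx[of 4]])
    fix a b c d :: 'a
    have "a *s e 1 + b *s e 2 + c *s e 3 + d *s e 4 = E (\<chi> i. if i = 1 then a else if i = 2 then b else if i = 3 then c else d)"
      by (simp add: E_def)
    then show "x 1 (a *s e 1 + b *s e 2 + c *s e 3 + d *s e 4) = a" "x 2 (a *s e 1 + b *s e 2 + c *s e 3 + d *s e 4) = b"
      "x 3 (a *s e 1 + b *s e 2 + c *s e 3 + d *s e 4) = c" "x 4 (a *s e 1 + b *s e 2 + c *s e 3 + d *s e 4) = d"
      by (simp_all add: xE)
  next
    show "x 1 p *s e 1 + x 2 p *s e 2 + x 3 p *s e 3 + x 4 p *s e 4 = p" for p
      using Ex[of p] by (simp add: E_def x_def)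
    show "scalar_product (Q 1 *v y) r = \<gamma> 2 * \<delta> 1 2 * x 2 y * x 2 r + \<gamma> 3 * \<delta> 1 3 * x 3 y * x 3 r + \<gamma> 4 * \<delta> 1 4 * x 4 y * x 4 r" for y r
      unfolding Qp[OF I(1)] d0 by simp
    show "scalar_product (Q 2 *v y) r = \<gamma> 1 * \<delta> 2 1 * x 1 y * x 1 r + \<gamma> 3 * \<delta> 2 3 * x 3 y * x 3 r + \<gamma> 4 * \<delta> 2 4 * x 4 y * x 4 r" for y r
      unfolding Qp[OF I(2)] d0 by simp
    show "\<gamma> 2 * \<delta> 1 2 \<noteq> 0" "\<gamma> 3 * \<delta> 1 3 \<noteq> 0" "\<gamma> 4 * \<delta> 1 4 \<noteq> 0" "\<gamma> 1 * \<delta> 2 1 \<noteq> 0" "\<gamma> 3 * \<delta> 2 3 \<noteq> 0" "\<gamma> 4 * \<delta> 2 4 \<noteq> 0"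
      using \<gamma>(1) \<delta> I by simp_all
    \<comment> \<open>The Pluecker relation between the minors of the coefficient pairs.\<close>
    have "\<delta> 1 3 * \<delta> 2 4 - \<delta> 1 4 * \<delta> 2 3 = \<delta> 1 2 * \<delta> 3 4" unfolding \<delta>_def by (simp add: algebra_simps)
    then have "\<gamma> 3 * \<gamma> 4 * (\<delta> 1 3 * \<delta> 2 4 - \<delta> 1 4 * \<delta> 2 3) \<noteq> 0" using \<gamma>(1) \<delta> I by simp
    then show "\<gamma> 3 * \<delta> 1 3 * (\<gamma> 4 * \<delta> 2 4) \<noteq> \<gamma> 4 * \<delta> 1 4 * (\<gamma> 3 * \<delta> 2 3)" by (auto simp: algebra_simps)
  qed (rule that)
qed

section \<open>The natural map\<close>

lemma covector:
  assumes "hform UNIV 1 f" obtains a where "\<And>r. f r = scalar_product a (r :: 'a::field ^ 'n)"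
  using hform_1D[OF assms] that by metis

lemma outer_outer: "pairing (outer a b) (outer x y) = scalar_product a x * scalar_product b y"
  for a b x y :: "'a::field ^ 'n"
proof -
  have "outer x y *v b = scalar_product b y *s x"
    by (simp add: vec_eq_iff outer_def matrix_vector_mult_def scalar_product_def sum_distrib_right sum_distrib_left mult_ac)
  then show ?thesis unfolding outer_pairing by (simp add: scalar_product_linear)
qed

text \<open>The Segre embedding of the product of two projective lines; its image is the quadric
  \<open>w1 w4 = w2 w3\<close>.\<close>

definition seg :: "'a::field \<Rightarrow> 'a \<Rightarrow> 'a \<Rightarrow> 'a \<Rightarrow> 'a ^ 4" where
  "seg s t p r = (\<chi> i. if i = 1 then s * p else if i = 2 then s * r else if i = 3 then t * p else t * r)"

lemma seg_nonzero: "s \<noteq> 0 \<or> t \<noteq> 0 \<Longrightarrow> p \<noteq> 0 \<or> r \<noteq> 0 \<Longrightarrow> seg s t p r \<noteq> 0"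
  by (auto simp: seg_def vec_eq_iff forall_4)

lemma seg_exists:
  fixes w :: "'a::field ^ 4"
  assumes "w \<noteq> 0" "w $ 1 * w $ 4 = w $ 2 * w $ 3"
  obtains s t p r where "s \<noteq> 0 \<or> t \<noteq> 0" "p \<noteq> 0 \<or> r \<noteq> 0" "w = seg s t p r"
proof (cases "w $ 1 = 0 \<and> w $ 2 = 0")
  case True
  then show ?thesis using assms by (intro that[of 0 1 "w $ 3" "w $ 4"]) (auto simp: seg_def vec_eq_iff forall_4)
next
  case False
  define c where "c = (if w $ 1 = 0 then w $ 4 / w $ 2 else w $ 3 / w $ 1)"
  have "w $ 3 = c * w $ 1" "w $ 4 = c * w $ 2"
    using assms False by (auto simp: c_def field_simps)
  then show ?thesis using False by (intro that[of 1 c "w $ 1" "w $ 2"]) (auto simp: seg_def vec_eq_iff forall_4)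
qed

text \<open>What remains of the companion hypotheses once divisors are eliminated:
  \<open>squares\<close> already contains the square root of the pushout form times
  \<open>u1 Z\<close>, and the scalar of the correspondence is absorbed into
  \<open>m\<close>.\<close>

locale companion = biquadratic +
  fixes Ws Ws' :: "('a ^ 4 ^ 4) set" and \<Phi> :: "'a ^ 4 ^ 4 \<Rightarrow> 'a ^ 4 ^ 4"
  assumes Ws: "S \<in> Ws \<longleftrightarrow> transpose S = S \<and> pairing M1 S = 0 \<and> pairing M2 S = 0"
    and \<Phi>_bij: "bij_betw \<Phi> Ws Ws'"
    and Ws'_sym: "S' \<in> Ws' \<Longrightarrow> transpose S' = S'"
    and points: "r \<in> V \<Longrightarrow> \<exists>y c. c \<noteq> 0 \<and> \<Phi> (outer r r) = c *k outer y y"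
    and squares: "\<xi> \<noteq> 0 \<Longrightarrow> \<exists>m. (\<forall>S\<in>Ws. pairing m S = pairing (outer \<xi> \<xi>) (\<Phi> S)) \<and> nv (qform m) \<and>
       (\<exists>N. hform UNIV 2 N \<and> (\<forall>r\<in>V. qform m r * (u1 r * cZ r) = N r ^ 2))"
begin

lemma outer_in_Ws: "r \<in> V \<Longrightarrow> outer r r \<in> Ws"
proof -
  assume r: "r \<in> V"
  have "pairing M1 (outer r r) = 0" "pairing M2 (outer r r) = 0"
    unfolding qform_pairing[symmetric] c1.qform_eq c2.qform_eq using c1.on_V[OF r] c2.on_V[OF r] by simp_all
  then show ?thesis by (simp add: Ws outer_transpose)
qed

lemma \<Phi>_sym: "S \<in> Ws \<Longrightarrow> transpose (\<Phi> S) = \<Phi> S"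
  using \<Phi>_bij Ws'_sym by (auto simp: bij_betw_def)

text \<open>The form on the curve that corresponds to the product of the linear forms \<xi> and
  \<eta> on the second curve. At a point with image \<open>y\<close> it is proportional to the
  product of their values at \<open>y\<close>, hence of rank one.\<close>

definition T :: "'a ^ 4 \<Rightarrow> 'a ^ 4 \<Rightarrow> 'a ^ 4 \<Rightarrow> 'a" where
  "T \<xi> \<eta> r = pairing (outer \<xi> \<eta>) (\<Phi> (outer r r))"

lemma outer_\<Phi>_sym: "S \<in> Ws \<Longrightarrow> pairing (outer \<xi> \<eta>) (\<Phi> S) = pairing (outer \<eta> \<xi>) (\<Phi> S)"
  unfolding outer_pairing by (rule scalar_product_symmetric[OF \<Phi>_sym])

lemma outer_linear:
  "outer \<xi> (\<eta> + \<zeta>) = outer \<xi> \<eta> + outer \<xi> \<zeta>" "outer (\<eta> + \<zeta>) \<xi> = outer \<eta> \<xi> + outer \<zeta> \<xi>"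
  "outer \<xi> (c *s \<eta>) = c *k outer \<xi> \<eta>" "outer (c *s \<eta>) \<xi> = c *k outer \<eta> \<xi>" for \<xi> \<eta> \<zeta> :: "'a ^ 4"
  by (simp_all add: outer_def mat_scale_def vec_eq_iff algebra_simps)

lemma square_matrix: "\<exists>m. \<forall>S\<in>Ws. pairing m S = pairing (outer \<xi> \<xi>) (\<Phi> S)"
proof (cases "\<xi> = 0")
  case True
  then show ?thesis by (intro exI[of _ 0]) (simp add: pairing_def outer_def)
qed (use squares in blast)

text \<open>Polarisation of the squares, for which representing matrices are given.\<close>

lemma mixed_matrix: "\<exists>m. \<forall>S\<in>Ws. pairing m S = pairing (outer \<xi> \<eta>) (\<Phi> S)"
proof -
  obtain m1 m2 m3 where m: "\<And>S. S \<in> Ws \<Longrightarrow> pairing m1 S = pairing (outer (\<xi> + \<eta>) (\<xi> + \<eta>)) (\<Phi> S)"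
    "\<And>S. S \<in> Ws \<Longrightarrow> pairing m2 S = pairing (outer \<xi> \<xi>) (\<Phi> S)" "\<And>S. S \<in> Ws \<Longrightarrow> pairing m3 S = pairing (outer \<eta> \<eta>) (\<Phi> S)"
    using square_matrix by metis
  have "pairing ((1 / 2) *k (m1 - m2 - m3)) S = pairing (outer \<xi> \<eta>) (\<Phi> S)" if S: "S \<in> Ws" for S
  proof -
    have "pairing (m1 - m2 - m3) S = 2 * pairing (outer \<xi> \<eta>) (\<Phi> S)"
      unfolding pairing_linear m[OF S] outer_linear outer_\<Phi>_sym[OF S, of \<eta> \<xi>] by simp
    then show ?thesis using two by (simp add: pairing_linear)
  qed
  then show ?thesis by blast
qed

definition mixed :: "'a ^ 4 \<Rightarrow> 'a ^ 4 \<Rightarrow> 'a ^ 4 ^ 4" where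
  "mixed \<xi> \<eta> = (SOME m. \<forall>S\<in>Ws. pairing m S = pairing (outer \<xi> \<eta>) (\<Phi> S))"

lemma mixed: "S \<in> Ws \<Longrightarrow> pairing (mixed \<xi> \<eta>) S = pairing (outer \<xi> \<eta>) (\<Phi> S)"
  unfolding mixed_def using someI_ex[OF mixed_matrix] by blast

lemma T_mixed: "r \<in> V \<Longrightarrow> T \<xi> \<eta> r = qform (mixed \<xi> \<eta>) r"
  unfolding T_def qform_pairing mixed[OF outer_in_Ws] ..

lemma T_points:
  assumes "r \<in> V" obtains y c where "c \<noteq> 0" "\<And>\<xi> \<eta>. T \<xi> \<eta> r = c * (scalar_product \<xi> y * scalar_product \<eta> y)"
proof -
  obtain y c where yc: "c \<noteq> 0" "\<Phi> (outer r r) = c *k outer y y" using points[OF assms] by blast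
  have "T \<xi> \<eta> r = c * (scalar_product \<xi> y * scalar_product \<eta> y)" for \<xi> \<eta>
    unfolding T_def yc(2) pairing_linear outer_outer ..
  then show ?thesis using that yc(1) by blast
qed

lemma basis_matrix:
  obtains K where "invertible K" "\<And>\<xi> \<eta> r. r \<in> V \<Longrightarrow> T \<xi> \<eta> r * U r = gcomb (K *v \<xi>) r * gcomb (K *v \<eta>) r"
proof (rule pushout_basis[of T])
  show "T \<xi> (\<eta> + \<zeta>) r = T \<xi> \<eta> r + T \<xi> \<zeta> r" "T \<xi> (c *s \<eta>) r = c * T \<xi> \<eta> r" for \<xi> \<eta> \<zeta> c r
    unfolding T_def outer_linear pairing_linear by simp_all
  show "T \<xi> \<eta> r = T \<eta> \<xi> r" if "r \<in> V" for \<xi> \<eta> r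
    unfolding T_def by (rule outer_\<Phi>_sym[OF outer_in_Ws[OF that]])
  show "\<exists>F. hform UNIV 2 F \<and> (\<forall>r\<in>V. T \<xi> \<eta> r = F r)" for \<xi> \<eta>
    using T_mixed hform_qform by blast
  show "T \<xi> \<eta> r ^ 2 = T \<xi> \<xi> r * T \<eta> \<eta> r" if "r \<in> V" for \<xi> \<eta> r
  proof -
    obtain y c where "\<And>\<xi> \<eta>. T \<xi> \<eta> r = c * (scalar_product \<xi> y * scalar_product \<eta> y)" using T_points[OF \<open>r \<in> V\<close>] by metis
    then show ?thesis by (simp add: power2_eq_square)
  qed
  fix \<xi> :: "'a ^ 4" assume "\<xi> \<noteq> 0"
  then obtain m N where m: "\<And>S. S \<in> Ws \<Longrightarrow> pairing m S = pairing (outer \<xi> \<xi>) (\<Phi> S)" "nv (qform m)"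
     "hform UNIV 2 N" "\<And>r. r \<in> V \<Longrightarrow> qform m r * (u1 r * cZ r) = N r ^ 2" using squares by blast
  have Tm: "qform m r = T \<xi> \<xi> r" if "r \<in> V" for r
    unfolding T_def qform_pairing by (rule m(1)[OF outer_in_Ws[OF that]])
  show "nv (T \<xi> \<xi>)" by (rule nv_cong[OF m(2)]) (rule Tm)
  obtain c where "\<And>r. r \<in> V \<Longrightarrow> N r = gcomb c r" using sqrt_shape[OF m(3,4)] unfolding gcomb_def by blast
  then show "\<exists>c. \<forall>r\<in>V. T \<xi> \<xi> r * U r = gcomb c r ^ 2"
    using m(4) Tm unfolding U_def by (intro exI[of _ c]) auto
qed (rule that)

text \<open>The column of \<open>K\<close> at an index holds the coordinates, in terms of the
  \<open>g i\<close>, of the root belonging to that basis vector. Its inverse \<open>H\<close> leads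
  from a root back to the linear form on the second curve.\<close>

definition K :: "'a ^ 4 ^ 4" where
  "K = (SOME K. invertible K \<and> (\<forall>\<xi> \<eta>. \<forall>r\<in>V. T \<xi> \<eta> r * U r = gcomb (K *v \<xi>) r * gcomb (K *v \<eta>) r))"

lemma K: "invertible K" "r \<in> V \<Longrightarrow> T \<xi> \<eta> r * U r = gcomb (K *v \<xi>) r * gcomb (K *v \<eta>) r"
proof -
  have "\<exists>K. invertible K \<and> (\<forall>\<xi> \<eta>. \<forall>r\<in>V. T \<xi> \<eta> r * U r = gcomb (K *v \<xi>) r * gcomb (K *v \<eta>) r)"
    using basis_matrix by metis
  from someI_ex[OF this] show "invertible K" "r \<in> V \<Longrightarrow> T \<xi> \<eta> r * U r = gcomb (K *v \<xi>) r * gcomb (K *v \<eta>) r"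
    unfolding K_def by blast+
qed

definition H :: "'a ^ 4 ^ 4" where "H = matrix_inv K"

lemma KH: "K *v (H *v x) = x" "H *v (K *v x) = x"
  unfolding H_def using matrix_inv_mult[OF K(1)] by auto

lemma H_invertible: "invertible H"
  by (rule invertible_of_injective) (metis KH(1) matrix_vector_mult_0_right)

section \<open>Products of tangents as pure tensors\<close>

lemma gcomb_seg:
  "gcomb (seg s t p r) x = c1.chord s t 0 1 x * c2.chord p r 0 1 x"
  unfolding gcomb_def sum_4 g_def seg_def c1.chord_def c2.chord_def by (simp add: u1_def algebra_simps)

text \<open>\<open>U\<close> is the product of the tangents at the parameter \<open>(0 : 1)\<close>
  of the two conics, so on each cone a product of two tangents is the square of a chord.\<close>

lemma tangents_square:
  assumes "x \<in> V"
  shows "c1.tl s t x * c2.tl p r x * U x = gcomb (seg s t p r) x ^ 2"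
proof -
  have "c1.tl s t x * c2.tl p r x * U x = (c1.tl s t x * c1.tl 0 1 x) * (c2.tl p r x * c2.tl 0 1 x)"
    unfolding U_def c1.tl_01 c2.tl_01 by simp
  then show ?thesis unfolding c1.tl_chord[OF assms] c2.tl_chord[OF assms] gcomb_seg by (simp add: power_mult_distrib)
qed

definition corr :: "'a ^ 4 ^ 4 \<Rightarrow> 'a ^ 4 ^ 4 \<Rightarrow> bool" where
  "corr D D' \<longleftrightarrow> (\<exists>c. c \<noteq> 0 \<and> (\<forall>S\<in>Ws. pairing D S = c * pairing D' (\<Phi> S)))"

lemma outer_forms: "pairing (outer l1 l2) (outer x x) = scalar_product l1 x * scalar_product l2 (x :: 'a ^ 4)"
  by (rule outer_outer)

text \<open>Both sides give square roots of the same form, so their coordinates agree up to sign and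
  a scalar, which a projective point does not see.\<close>

lemma tangent_corr_unique:
  assumes st: "s \<noteq> 0 \<or> t \<noteq> 0" and pr: "p \<noteq> 0 \<or> r \<noteq> 0" and l: "tangent_form M1 (c1.line s t) l1" "tangent_form M2 (c2.line p r) l2"
    and \<xi>: "\<xi> \<noteq> 0" "corr (outer l1 l2) (outer \<xi> \<xi>)"
  shows "proj \<xi> = proj (H *v seg s t p r)"
proof -
  obtain a b where ab: "a \<noteq> 0" "b \<noteq> 0" "\<And>x. scalar_product l1 x = a * c1.tl s t x" "\<And>x. scalar_product l2 x = b * c2.tl p r x"
    using l unfolding c1.tangent_form_line[OF st] c2.tangent_form_line[OF pr] by blast
  obtain c where c: "c \<noteq> 0" "\<And>S. S \<in> Ws \<Longrightarrow> pairing (outer l1 l2) S = c * pairing (outer \<xi> \<xi>) (\<Phi> S)"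
    using \<xi>(2) unfolding corr_def by blast
  obtain d where d: "d ^ 2 = c / (a * b)" using sqrt_exists by blast
  have d0: "d \<noteq> 0" using d c ab by auto
  have eq: "gcomb (seg s t p r) x ^ 2 = (d * gcomb (K *v \<xi>) x) ^ 2" if x: "x \<in> V" for x
  proof -
    have "a * b * (c1.tl s t x * c2.tl p r x) = c * T \<xi> \<xi> x"
      using c(2)[OF outer_in_Ws[OF x]] unfolding outer_forms ab T_def by (simp add: mult_ac)
    then have "c1.tl s t x * c2.tl p r x = d ^ 2 * T \<xi> \<xi> x" unfolding d using ab by (simp add: field_simps)
    then show ?thesis using tangents_square[OF x, of s t p r] K(2)[OF x, of \<xi> \<xi>] by (simp add: power2_eq_square mult_ac)
  qed
  have "\<exists>e. e \<noteq> 0 \<and> seg s t p r = e *s (K *v \<xi>)"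
    using equal_squares[OF hform_gcomb hform_scale[OF hform_gcomb] eq]
  proof
    assume "\<forall>x\<in>V. gcomb (seg s t p r) x = d * gcomb (K *v \<xi>) x"
    then have "seg s t p r = d *s (K *v \<xi>)" by (intro gcomb_eqD) (simp add: gcomb_linear)
    then show ?thesis using d0 by blast
  next
    assume "\<forall>x\<in>V. gcomb (seg s t p r) x = - (d * gcomb (K *v \<xi>) x)"
    then have "seg s t p r = (- d) *s (K *v \<xi>)" by (intro gcomb_eqD) (simp add: gcomb_linear)
    then show ?thesis using d0 by (intro exI[of _ "- d"]) simp
  qed
  then obtain e where "e \<noteq> 0" "H *v seg s t p r = e *s \<xi>" using KH(2) by (metis vector_scalar_commute)
  then show ?thesis using proj_eqI by metis
qed

text \<open>The required identity is first checked on the curve, after multiplication by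
  \<open>U\<close>; it extends to all of \<open>Ws\<close> because the images of the points of the
  curve span this space.\<close>

lemma tangent_corr_exists:
  assumes st: "s \<noteq> 0 \<or> t \<noteq> 0" and pr: "p \<noteq> 0 \<or> r \<noteq> 0"
  obtains l1 l2 where "tangent_form M1 (c1.line s t) l1" "tangent_form M2 (c2.line p r) l2"
    "corr (outer l1 l2) (outer (H *v seg s t p r) (H *v seg s t p r))"
proof -
  obtain l1 l2 where l: "\<And>x. c1.tl s t x = scalar_product l1 x" "\<And>x. c2.tl p r x = scalar_product l2 x"
    using covector[OF c1.hform_tl] covector[OF c2.hform_tl] by metis
  define \<xi> where "\<xi> = H *v seg s t p r"
  show ?thesis
  proof (rule that[of l1 l2])
    show "tangent_form M1 (c1.line s t) l1" unfolding c1.tangent_form_line[OF st] by (intro exI[of _ 1]) (simp add: l)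
    show "tangent_form M2 (c2.line p r) l2" unfolding c2.tangent_form_line[OF pr] by (intro exI[of _ 1]) (simp add: l)
    have "pairing (outer l1 l2 - mixed \<xi> \<xi>) S = 0" if S: "S \<in> Ws" for S
    proof (rule pairing_span)
      show "transpose S = S" "pairing M1 S = 0" "pairing M2 S = 0" using S by (auto simp: Ws)
      fix x assume x: "x \<in> V"
      have "c1.tl s t x * c2.tl p r x = qform (mixed \<xi> \<xi>) x"
      proof (rule V_cancel[OF hform_U hform_mult[OF c1.hform_tl c2.hform_tl] hform_qform nv_U _ x])
        fix x assume x: "x \<in> V"
        have "c1.tl s t x * c2.tl p r x * U x = qform (mixed \<xi> \<xi>) x * U x"
          unfolding tangents_square[OF x] T_mixed[OF x, symmetric] K(2)[OF x] \<xi>_def KH by (simp add: power2_eq_square)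
        then show "U x * (c1.tl s t x * c2.tl p r x) = U x * qform (mixed \<xi> \<xi>) x" by (simp add: mult.commute)
      qed
      then show "pairing (outer l1 l2 - mixed \<xi> \<xi>) (outer x x) = 0"
        unfolding pairing_linear outer_forms l qform_pairing by simp
    qed
    then show "corr (outer l1 l2) (outer (H *v seg s t p r) (H *v seg s t p r))"
      unfolding corr_def \<xi>_def[symmetric] by (intro exI[of _ 1]) (simp add: pairing_linear mixed)
  qed
qed

lemma H_nonzero: "w \<noteq> 0 \<Longrightarrow> H *v w \<noteq> 0"
  by (metis KH(1) matrix_vector_mult_0_right)

lemma natural_map_eq:
  assumes st: "s \<noteq> 0 \<or> t \<noteq> 0" and pr: "p \<noteq> 0 \<or> r \<noteq> 0"
  shows "(THE P. \<exists>\<xi> l1 l2. \<xi> \<noteq> 0 \<and> P = proj \<xi> \<and> tangent_form M1 (c1.line s t) l1 \<and> tangent_form M2 (c2.line p r) l2 \<and>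
     corr (outer l1 l2) (outer \<xi> \<xi>)) = proj (H *v seg s t p r)"
proof (rule the_equality)
  show "\<exists>\<xi> l1 l2. \<xi> \<noteq> 0 \<and> proj (H *v seg s t p r) = proj \<xi> \<and> tangent_form M1 (c1.line s t) l1 \<and> tangent_form M2 (c2.line p r) l2 \<and>
     corr (outer l1 l2) (outer \<xi> \<xi>)"
    using tangent_corr_exists[OF st pr] H_nonzero[OF seg_nonzero[OF st pr]] by metis
qed (use tangent_corr_unique[OF st pr] in blast)

definition image :: "('a ^ 4) set set" where
  "image = {proj (H *v w) | w. w \<noteq> 0 \<and> w $ 1 * w $ 4 = w $ 2 * w $ 3}"

lemma image_eq:
  "(\<lambda>(P1, P2). THE P. \<exists>\<xi> l1 l2. \<xi> \<noteq> 0 \<and> P = proj \<xi> \<and> tangent_form M1 P1 l1 \<and> tangent_form M2 P2 l2 \<and>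
     corr (outer l1 l2) (outer \<xi> \<xi>)) ` (base_conic M1 \<times> base_conic M2) = image" (is "?f ` _ = _")
proof (intro subset_antisym subsetI)
  fix P assume "P \<in> ?f ` (base_conic M1 \<times> base_conic M2)"
  then obtain s t p r where st: "s \<noteq> 0 \<or> t \<noteq> 0" and pr: "p \<noteq> 0 \<or> r \<noteq> 0" and P: "P = ?f (c1.line s t, c2.line p r)"
    unfolding c1.base_conic_eq c2.base_conic_eq by blast
  have "P = proj (H *v seg s t p r)" unfolding P using natural_map_eq[OF st pr] by simp
  moreover have "seg s t p r $ 1 * seg s t p r $ 4 = seg s t p r $ 2 * seg s t p r $ 3" by (simp add: seg_def)
  ultimately show "P \<in> image" using seg_nonzero[OF st pr] unfolding image_def by blast
next
  fix P assume "P \<in> image"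
  then obtain w where w: "P = proj (H *v w)" "w \<noteq> 0" "w $ 1 * w $ 4 = w $ 2 * w $ 3" unfolding image_def by blast
  obtain s t p r where st: "s \<noteq> 0 \<or> t \<noteq> 0" and pr: "p \<noteq> 0 \<or> r \<noteq> 0" and ws: "w = seg s t p r"
    by (rule seg_exists[OF w(2,3)])
  have "P = ?f (c1.line s t, c2.line p r)" unfolding w(1) ws using natural_map_eq[OF st pr] by simp
  moreover have "(c1.line s t, c2.line p r) \<in> base_conic M1 \<times> base_conic M2"
    unfolding c1.base_conic_eq c2.base_conic_eq using st pr by blast
  ultimately show "P \<in> ?f ` (base_conic M1 \<times> base_conic M2)" by blast
qed

section \<open>Quadrics annihilating the transported space\<close>

definition J :: "'a ^ 4 ^ 4" where
  "J = (\<chi> i j. if i = 1 \<and> j = 4 \<or> i = 4 \<and> j = 1 then 1 else if i = 2 \<and> j = 3 \<or> i = 3 \<and> j = 2 then - 1 else 0)"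

text \<open>The Gram matrix that \<open>\<Phi> S0\<close> turns out to have in the basis
  \<open>h\<close>; it differs from \<open>J\<close> only in the signs of the inner entries.\<close>

definition Jp :: "'a ^ 4 ^ 4" where
  "Jp = (\<chi> i j. if i = 1 \<and> j = 4 \<or> i = 4 \<and> j = 1 \<or> i = 2 \<and> j = 3 \<or> i = 3 \<and> j = 2 then 1 else 0)"

text \<open>The relation \<open>\<alpha> g1^2 - g2^2 - \<beta> g3^2 + g4^2 = 0\<close>. Together
  with \<open>g1 g4 = g2 g3\<close> it cuts out the second curve in the coordinates given by the
  \<open>g i\<close>.\<close>

definition D2 :: "'a ^ 4 ^ 4" where
  "D2 = (\<chi> i j. if i = j then (if i = 1 then \<alpha> else if i = 2 then - 1 else if i = 3 then - \<beta> else 1) else 0)"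

lemma H_entry: "(transpose H ** S ** H) $ i $ j = pairing (outer (H *v axis i 1) (H *v axis j 1)) S"
proof -
  have "(transpose H ** S ** H) $ i $ j = scalar_product (axis i 1) ((transpose H ** S ** H) *v axis j 1)"
    by (subst scalar_product_commute) (simp add: scalar_product_axis matrix_axis)
  also have "\<dots> = scalar_product (H *v axis i 1) (S *v (H *v axis j 1))"
    unfolding matrix_vector_mul_assoc[symmetric] by (subst scalar_product_matrix) (simp only: transpose_transpose)
  finally show ?thesis unfolding outer_pairing .
qed

definition h :: "4 \<Rightarrow> 'a ^ 4" where "h i = H *v axis i 1"

lemma T_h:
  assumes r: "r \<in> V"
  shows "T (h i) (h j) r * U r = g i r * g j r"
proof -
  have "gcomb (axis i 1) r = g i r" for i
    unfolding gcomb_def by (simp add: axis_def if_distrib if_distribR cong: if_cong)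
  then show ?thesis using K(2)[OF r] by (simp add: h_def KH)
qed

text \<open>The \<open>g i\<close> are the roots belonging to the linear forms \<open>h i\<close>. A
  quadratic expression in the \<open>g i\<close> is therefore \<open>U\<close> times the form on the
  curve that corresponds to the same expression in the \<open>h i\<close>; a relation between the
  \<open>g i\<close> is the case of the zero form.\<close>

lemma pairing_h:
  assumes S: "S \<in> Ws" and f: "hform UNIV 2 F" "\<And>r. r \<in> V \<Longrightarrow> F r = qform D r"
    and eq: "\<And>r. r \<in> V \<Longrightarrow> F r * U r = (\<Sum>i\<in>UNIV. \<Sum>j\<in>UNIV. c $ i $ j * (g i r * g j r))"
  shows "pairing (H ** c ** transpose H) (\<Phi> S) = pairing D S"
proof -
  define m where "m = (\<Sum>i\<in>UNIV. \<Sum>j\<in>UNIV. c $ i $ j *k mixed (h i) (h j))"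
  have p: "pairing m N = (\<Sum>i\<in>UNIV. \<Sum>j\<in>UNIV. c $ i $ j * pairing (mixed (h i) (h j)) N)" for N
    unfolding m_def sum_4 pairing_linear by simp
  have "pairing (H ** c ** transpose H) (\<Phi> S) = pairing (transpose H ** \<Phi> S ** H) c"
  proof -
    have "pairing (H ** c ** transpose H) (\<Phi> S) = pairing (\<Phi> S) (H ** c ** transpose H)"
      unfolding pairing_def by (simp add: mult.commute)
    then show ?thesis by (simp add: pairing_congruence)
  qed
  also have "\<dots> = (\<Sum>i\<in>UNIV. \<Sum>j\<in>UNIV. c $ i $ j * pairing (outer (h i) (h j)) (\<Phi> S))"
    unfolding pairing_def[of "transpose H ** \<Phi> S ** H"] H_entry h_def by (simp add: mult.commute)
  also have "\<dots> = pairing m S" unfolding p using mixed[OF S] by simp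
  also have "\<dots> = pairing D S"
  proof -
    have "pairing (m - D) S = 0"
    proof (rule pairing_span)
      show "transpose S = S" "pairing M1 S = 0" "pairing M2 S = 0" using S by (auto simp: Ws)
      fix r assume r: "r \<in> V"
      have "pairing m (outer r r) = qform m r" for r by (simp add: qform_pairing)
      have "qform m r = F r"
      proof (rule V_cancel[OF hform_U hform_qform f(1) nv_U _ r])
        fix r assume r: "r \<in> V"
        have "qform m r * U r = (\<Sum>i\<in>UNIV. \<Sum>j\<in>UNIV. c $ i $ j * (T (h i) (h j) r * U r))"
          unfolding qform_pairing p T_mixed[OF r] by (simp add: sum_distrib_right mult.assoc)
        then show "U r * qform m r = U r * F r" unfolding T_h[OF r] eq[OF r, symmetric] by (simp add: mult.commute)
      qed
      then show "pairing (m - D) (outer r r) = 0" using f(2)[OF r] by (simp add: pairing_linear qform_pairing)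
    qed
    then show ?thesis by (simp add: pairing_linear)
  qed
  finally show ?thesis .
qed

lemma qform_zero: "qform 0 r = (0 :: 'a)" for r :: "'a ^ 4"
  by (simp add: qform_def scalar_product_def)

lemma pairing_zero: "pairing 0 S = (0 :: 'a)" for S :: "'a ^ 4 ^ 4"
  by (simp add: pairing_def)

lemma J_annihilates: "S \<in> Ws \<Longrightarrow> pairing (H ** J ** transpose H) (\<Phi> S) = 0"
  using pairing_h[OF _ hform_zero, of S 0 J]
  by (simp add: qform_zero pairing_zero sum_4 J_def g_def)

lemma D2_annihilates:
  assumes "S \<in> Ws" shows "pairing (H ** D2 ** transpose H) (\<Phi> S) = 0"
proof -
  have "(\<Sum>i\<in>UNIV. \<Sum>j\<in>UNIV. D2 $ i $ j * (g i r * g j r)) = 0" if "r \<in> V" for r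
  proof -
    have x: "cX r ^ 2 = cZ r * cW r" and y: "cY r ^ 2 = (cZ r - \<alpha> * cW r) * (cZ r - \<beta> * cW r)"
      using that by (auto simp: V_iff q_def)
    have "(\<Sum>i\<in>UNIV. \<Sum>j\<in>UNIV. D2 $ i $ j * (g i r * g j r)) =
      \<alpha> * (cX r ^ 2 * cY r ^ 2) - cY r ^ 2 * cZ r ^ 2 - \<beta> * (u1 r ^ 2 * cX r ^ 2) + u1 r ^ 2 * cZ r ^ 2"
      by (simp add: sum_4 D2_def g_def power2_eq_square)
    also have "\<dots> = 0" unfolding x y u1_def by (simp add: power2_eq_square algebra_simps)
    finally show ?thesis .
  qed
  then show ?thesis using pairing_h[OF assms hform_zero, of 0 D2] by (simp add: qform_zero pairing_zero)
qed

definition S0 :: "'a ^ 4 ^ 4" where "S0 = outer ex ey + outer ey ex"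

text \<open>Each of the two matrices kills one of the vertices \<open>ex\<close> and
  \<open>ey\<close>, so both vanish on their symmetric product.\<close>

lemma S0_in_Ws: "S0 \<in> Ws"
proof -
  have "M1 *v ex = 0" "M2 *v ey = 0" using c1.kernel_iff c2.kernel_iff c1.vertex c2.vertex by blast+
  moreover have "scalar_product ex (M1 *v ey) = scalar_product ey (M1 *v ex)" "scalar_product ey (M2 *v ex) = scalar_product ex (M2 *v ey)"
    by (subst scalar_product_commute, unfold polar1, subst scalar_product_commute, unfold polar1, simp add: algebra_simps)
       (subst scalar_product_commute, unfold polar2, subst scalar_product_commute, unfold polar2, simp add: algebra_simps)
  ultimately show ?thesis
    unfolding Ws S0_def pairing_linear pairing_outer
    by (simp add: scalar_product_def outer_def transpose_def vec_eq_iff mult.commute add.commute)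
qed

text \<open>Evaluating on \<open>S0\<close> means taking the polar value at the two vertices. For a
  product of linear forms this needs only their values there.\<close>

lemma product_value:
  assumes "hform UNIV 1 a" "hform UNIV 1 b" "\<And>r. r \<in> V \<Longrightarrow> c * (a r * b r) * U r = g i r * g j r"
  shows "pairing (outer (h i) (h j)) (\<Phi> S0) = c * (a ex * b ey + a ey * b ex)"
proof -
  obtain fa fb where f: "\<And>r. a r = scalar_product fa r" "\<And>r. b r = scalar_product fb r"
    using covector[OF assms(1)] covector[OF assms(2)] by metis
  have "pairing (mixed (h i) (h j) - c *k outer fa fb) S0 = 0"
  proof (rule pairing_span)
    show "transpose S0 = S0" "pairing M1 S0 = 0" "pairing M2 S0 = 0" using S0_in_Ws by (auto simp: Ws)
    fix r assume r: "r \<in> V"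
    have "c * (a r * b r) = qform (mixed (h i) (h j)) r"
    proof (rule V_cancel[OF hform_U hform_scale[OF hform_mult[OF assms(1,2)]] hform_qform nv_U _ r])
      fix r assume r: "r \<in> V"
      show "U r * (c * (a r * b r)) = U r * qform (mixed (h i) (h j)) r"
        using assms(3)[OF r] T_h[OF r, of i j] T_mixed[OF r] by (simp add: mult.commute)
    qed
    then show "pairing (mixed (h i) (h j) - c *k outer fa fb) (outer r r) = 0"
      unfolding pairing_linear outer_forms f qform_pairing by simp
  qed
  then have "pairing (outer (h i) (h j)) (\<Phi> S0) = c * pairing (outer fa fb) S0"
    unfolding mixed[OF S0_in_Ws, symmetric] by (simp add: pairing_linear)
  moreover have "pairing (outer fa fb) (outer x y) = a x * b y" for x y
    unfolding f by (rule outer_outer)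
  ultimately show ?thesis unfolding S0_def pairing_linear by simp
qed

text \<open>The ten products of two \<open>g i\<close>, each written as \<open>U = u z\<close> times
  a product of two linear forms, where \<open>u\<close> and \<open>v\<close> are the factors of
  \<open>q\<close>.\<close>

lemma product_identities:
  fixes x y z w u v :: "'b::comm_ring_1"
  assumes x: "x * x = z * w" and y: "y * y = u * v"
  shows "1 * (w * v) * (u * z) = (x * y) * (x * y)" "- 1 * (x * v) * (u * z) = (x * y) * - (y * z)"
    "- 1 * (w * y) * (u * z) = (x * y) * - (u * x)" "1 * (x * y) * (u * z) = (x * y) * (u * z)"
    "1 * (z * v) * (u * z) = - (y * z) * - (y * z)" "1 * (x * y) * (u * z) = - (y * z) * - (u * x)"
    "- 1 * (y * z) * (u * z) = - (y * z) * (u * z)" "1 * (u * w) * (u * z) = - (u * x) * - (u * x)"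
    "- 1 * (u * x) * (u * z) = - (u * x) * (u * z)" "1 * (u * z) * (u * z) = (u * z) * (u * z)"
proof -
  have "(x * y) * (x * y) = (x * x) * (y * y)" "(x * y) * - (y * z) = - (x * z * (y * y))"
    "(x * y) * - (u * x) = - ((x * x) * (y * u))" "- (y * z) * - (y * z) = (y * y) * (z * z)"
    "- (u * x) * - (u * x) = (x * x) * (u * u)" by (simp_all add: mult_ac)
  note e = this[unfolded x y]
  show "1 * (w * v) * (u * z) = (x * y) * (x * y)" "- 1 * (x * v) * (u * z) = (x * y) * - (y * z)"
    "- 1 * (w * y) * (u * z) = (x * y) * - (u * x)" "1 * (z * v) * (u * z) = - (y * z) * - (y * z)"
    "1 * (u * w) * (u * z) = - (u * x) * - (u * x)"
    unfolding e by (simp_all add: mult_ac)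
qed (simp_all add: mult_ac)

text \<open>Among \<open>X, Y, Z, W, u1, v1\<close> only \<open>X\<close> is non-zero at
  \<open>ex\<close> and only \<open>Y\<close> at \<open>ey\<close>. So only the quotient
  \<open>X Y\<close> contributes, and it occurs for \<open>g1 g4\<close> and
  \<open>g2 g3\<close>.\<close>

lemma S0_form: "transpose H ** \<Phi> S0 ** H = Jp"
proof -
  define b where "b = (\<lambda>i j. pairing (outer (h i) (h j)) (\<Phi> S0))"
  have e: "u1 ex = 0" "u1 ey = 0" "v1 ex = 0" "v1 ey = 0" by (simp_all add: u1_def v1_def basis_vectors)
  have rel: "cX r * cX r = cZ r * cW r" "cY r * cY r = u1 r * v1 r" if "r \<in> V" for r
    using c1.on_V[OF that] c2.on_V[OF that] by (simp_all add: power2_eq_square)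
  note id = product_identities[OF rel]
  have G: "g 1 r = cX r * cY r" "g 2 r = - (cY r * cZ r)" "g 3 r = - (u1 r * cX r)" "g 4 r = u1 r * cZ r" for r
    by (simp_all add: g_def)
  have sy: "b i j = b j i" for i j unfolding b_def by (rule outer_\<Phi>_sym[OF S0_in_Ws])
  have v11: "b 1 1 = 0"
    unfolding b_def by (subst product_value[OF lin(4) hform_v1], unfold G U_def, rule id(1), assumption, assumption, simp add: e basis_vectors)
  have v12: "b 1 2 = 0"
    unfolding b_def by (subst product_value[OF lin(1) hform_v1], unfold G U_def, rule id(2), assumption, assumption, simp add: e basis_vectors)
  have v13: "b 1 3 = 0"
    unfolding b_def by (subst product_value[OF lin(4) lin(2)], unfold G U_def, rule id(3), assumption, assumption, simp add: e basis_vectors)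
  have v14: "b 1 4 = 1"
    unfolding b_def by (subst product_value[OF lin(1) lin(2)], unfold G U_def, rule id(4), assumption, assumption, simp add: e basis_vectors)
  have v22: "b 2 2 = 0"
    unfolding b_def by (subst product_value[OF lin(3) hform_v1], unfold G U_def, rule id(5), assumption, assumption, simp add: e basis_vectors)
  have v23: "b 2 3 = 1"
    unfolding b_def by (subst product_value[OF lin(1) lin(2)], unfold G U_def, rule id(6), assumption, assumption, simp add: e basis_vectors)
  have v24: "b 2 4 = 0"
    unfolding b_def by (subst product_value[OF lin(2) lin(3)], unfold G U_def, rule id(7), assumption, assumption, simp add: e basis_vectors)
  have v33: "b 3 3 = 0"
    unfolding b_def by (subst product_value[OF hform_u1 lin(4)], unfold G U_def, rule id(8), assumption, assumption, simp add: e basis_vectors)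
  have v34: "b 3 4 = 0"
    unfolding b_def by (subst product_value[OF hform_u1 lin(1)], unfold G U_def, rule id(9), assumption, assumption, simp add: e basis_vectors)
  have v44: "b 4 4 = 0"
    unfolding b_def by (subst product_value[OF hform_u1 lin(3)], unfold G U_def, rule id(10), assumption, assumption, simp add: e basis_vectors)
  note v = v11 v12 v13 v14 v22 v23 v24 v33 v34 v44
  have "(transpose H ** \<Phi> S0 ** H) $ i $ j = b i j" for i j unfolding H_entry b_def h_def ..
  then show ?thesis
    by (simp add: vec_eq_iff forall_4 Jp_def v v[THEN trans[OF sy]])
qed

end

section \<open>Descent to the ground field\<close>

lemma vector_space_pair_ac:
  "vector_space_pair (\<lambda>(a :: 'k::field) (x :: 'k alg_closure). to_ac a * x) (*)"
  by unfold_locales (simp_all add: algebra_simps)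

text \<open>The element 1 extends to a basis of the closure over the ground field. The resulting
  retraction serves to descend coefficients without any separability.\<close>

lemma rational_projection:
  obtains \<pi> :: "'k::field alg_closure \<Rightarrow> 'k" where
    "\<And>x y. \<pi> (x + y) = \<pi> x + \<pi> y" "\<And>a x. \<pi> (to_ac a * x) = a * \<pi> x" "\<pi> 1 = 1"
proof -
  interpret vp: vector_space_pair "\<lambda>(a :: 'k) (x :: 'k alg_closure). to_ac a * x" "(*)"
    by (rule vector_space_pair_ac)
  have "vp.vs1.independent {1}" by (simp add: vp.vs1.dependent_single)
  from vp.linear_independent_extend[OF this, of "\<lambda>_. 1"] obtain \<pi> where
    \<pi>: "Vector_Spaces.linear (\<lambda>(a :: 'k) (x :: 'k alg_closure). to_ac a * x) (*) \<pi>" "\<pi> 1 = 1" by auto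
  interpret l: Vector_Spaces.linear "\<lambda>(a :: 'k) (x :: 'k alg_closure). to_ac a * x" "(*)" \<pi> by (rule \<pi>(1))
  show ?thesis by (rule that[of \<pi>]) (simp_all add: l.add l.scale \<pi>(2))
qed

text \<open>A linear functional on the whole closure that extends the coordinate of \<open>r\<close>
  on the span of 1 and \<open>r\<close>.\<close>

lemma second_coordinate:
  fixes r :: "'k::field alg_closure"
  assumes "r \<notin> range to_ac"
  obtains \<pi> :: "'k alg_closure \<Rightarrow> 'k" where
    "\<And>x y. \<pi> (x + y) = \<pi> x + \<pi> y" "\<And>a x. \<pi> (to_ac a * x) = a * \<pi> x" "\<pi> 1 = 0" "\<pi> r = 1"
proof -
  interpret vp: vector_space_pair "\<lambda>(a :: 'k) (x :: 'k alg_closure). to_ac a * x" "(*)"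
    by (rule vector_space_pair_ac)
  have "r \<notin> vp.vs1.span {1}" using assms by (auto simp: vp.vs1.span_singleton)
  moreover have "vp.vs1.independent {1}" by (simp add: vp.vs1.dependent_single)
  ultimately have "vp.vs1.independent {r, 1}" by (rule vp.vs1.independent_insertI)
  from vp.linear_independent_extend[OF this, of "\<lambda>x. if x = 1 then 0 else 1"] obtain \<pi> where
    \<pi>: "Vector_Spaces.linear (\<lambda>(a :: 'k) (x :: 'k alg_closure). to_ac a * x) (*) \<pi>" "\<pi> 1 = 0" "\<pi> r = (if r = 1 then 0 else 1)" by auto
  interpret l: Vector_Spaces.linear "\<lambda>(a :: 'k) (x :: 'k alg_closure). to_ac a * x" "(*)" \<pi> by (rule \<pi>(1))
  have "r \<noteq> 1" using assms to_ac_1 by (metis rangeI)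
  then show ?thesis by (intro that[of \<pi>]) (simp_all add: l.add l.scale \<pi>)
qed

text \<open>A linear projection from the algebraic closure to \<open>L\<close> maps a suitably scaled kernel vector to
  a kernel vector over \<open>L\<close>; the symmetrised product with its conjugate is a matrix of traces.\<close>

lemma conjugate_kernel_vectors:
  fixes M :: "'k::field alg_closure ^ 4 ^ 4"
  assumes L: "quadratic_extension L" and \<sigma>: "galois_conjugation L \<sigma>"
    and M: "\<And>i j. M $ i $ j \<in> L" and v: "v \<noteq> 0" "M *v v = 0"
  obtains e e' and S :: "'k ^ 4 ^ 4" where "e \<noteq> 0" "e' \<noteq> 0" "M *v e = 0" "map_matrix \<sigma> M *v e' = 0"
    "outer e e' + outer e' e = ac_mat S"
proof -
  obtain r where r: "r \<notin> range to_ac" "L = {to_ac a + to_ac b * r | a b. True}"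
    and Lm: "\<And>x y. x \<in> L \<Longrightarrow> y \<in> L \<Longrightarrow> x * y \<in> L"
    using L unfolding quadratic_extension_def by blast
  have KL: "to_ac a \<in> L" for a unfolding r(2) by (rule CollectI, intro exI[of _ a] exI[of _ 0]) simp
  have rL: "r \<in> L" unfolding r(2) by (rule CollectI, intro exI[of _ 0] exI[of _ 1]) simp
  have La: "x + y \<in> L" if xy: "x \<in> L" "y \<in> L" for x y
  proof -
    obtain a b c d where "x = to_ac a + to_ac b * r" "y = to_ac c + to_ac d * r" using xy unfolding r(2) by blast
    then have "x + y = to_ac (a + c) + to_ac (b + d) * r" by (simp add: algebra_simps)
    then show ?thesis unfolding r(2) by blast
  qed
  have s_add: "\<sigma> (x + y) = \<sigma> x + \<sigma> y" and s_mult: "\<sigma> (x * y) = \<sigma> x * \<sigma> y" if "x \<in> L" "y \<in> L" for x y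
    using \<sigma> that unfolding galois_conjugation_def by blast+
  have s_K: "\<sigma> (to_ac a) = to_ac a" for a using \<sigma> unfolding galois_conjugation_def by blast
  have s_L: "\<sigma> x \<in> L" if "x \<in> L" for x using \<sigma> that unfolding galois_conjugation_def bij_betw_def by blast
  obtain m n where mn: "r * r = to_ac m + to_ac n * r" using Lm[OF rL rL] unfolding r(2) by blast
  have s_ab: "\<sigma> (to_ac a + to_ac b * r) = to_ac a + to_ac b * \<sigma> r" for a b
    using s_add[OF KL Lm[OF KL rL]] s_mult[OF KL rL] s_K by simp
  \<comment> \<open>The conjugate satisfies the same quadratic equation, and it differs from
    \<open>r\<close> because \<sigma> moves some element of \<open>L\<close>.\<close>
  have s_r: "\<sigma> r = to_ac n - r"
  proof -
    have "\<sigma> r * \<sigma> r = to_ac m + to_ac n * \<sigma> r" using s_mult[OF rL rL] s_ab mn by simp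
    then have "(\<sigma> r - r) * (\<sigma> r + r - to_ac n) = 0" using mn by (simp add: algebra_simps)
    moreover obtain x where "x \<in> L" "\<sigma> x \<noteq> x" using \<sigma> unfolding galois_conjugation_def by blast
    then have "\<sigma> r \<noteq> r" using s_ab unfolding r(2) by auto
    ultimately have "\<sigma> r + r - to_ac n = 0" by simp
    then show ?thesis by (simp add: algebra_simps)
  qed
  obtain \<pi> :: "'k alg_closure \<Rightarrow> 'k" where
    \<pi>: "\<And>x y. \<pi> (x + y) = \<pi> x + \<pi> y" "\<And>a x. \<pi> (to_ac a * x) = a * \<pi> x" "\<pi> 1 = 0" "\<pi> r = 1"
    using second_coordinate[OF r(1)] by blast
  \<comment> \<open>The only possible \<open>L\<close>-linear map with \<pi> as its coordinate at
    \<open>r\<close>: since \<open>r^2 = m + n r\<close>, the coordinate at \<open>r\<close> of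
    \<open>r * \<Lambda> x\<close> determines the coordinate at 1.\<close>
  define \<Lambda> where "\<Lambda> = (\<lambda>x. to_ac (\<pi> (r * x) - n * \<pi> x) + to_ac (\<pi> x) * r)"
  have \<Lambda>_L: "\<Lambda> x \<in> L" for x unfolding \<Lambda>_def r(2) by blast
  have \<Lambda>_add: "\<Lambda> (x + y) = \<Lambda> x + \<Lambda> y" for x y unfolding \<Lambda>_def by (simp add: \<pi> distrib_left algebra_simps)
  have \<Lambda>_1: "\<Lambda> 1 = 1" unfolding \<Lambda>_def by (simp add: \<pi>)
  have \<Lambda>_K: "\<Lambda> (to_ac a * x) = to_ac a * \<Lambda> x" for a x
  proof -
    have "\<pi> (r * (to_ac a * x)) = a * \<pi> (r * x)" using \<pi>(2)[of a "r * x"] by (simp only: mult.left_commute)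
    then show ?thesis unfolding \<Lambda>_def \<pi>(2) by (simp add: algebra_simps)
  qed
  have \<Lambda>_r: "\<Lambda> (r * x) = r * \<Lambda> x" for x
  proof -
    have "\<pi> (r * (r * x)) = m * \<pi> x + n * \<pi> (r * x)"
      unfolding mult.assoc[symmetric] mn by (simp add: distrib_right \<pi> mult.assoc)
    then have "\<Lambda> (r * x) = to_ac (\<pi> (r * x)) * r + to_ac (m * \<pi> x)" unfolding \<Lambda>_def by (simp add: algebra_simps)
    also have "\<dots> = to_ac (\<pi> (r * x) - n * \<pi> x) * r + to_ac (\<pi> x) * (r * r)" unfolding mn by (simp add: algebra_simps)
    finally show ?thesis unfolding \<Lambda>_def by (simp add: algebra_simps)
  qed
  have \<Lambda>_lin: "\<Lambda> (a * x) = a * \<Lambda> x" if "a \<in> L" for a x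
  proof -
    obtain b c where "a = to_ac b + to_ac c * r" using \<open>a \<in> L\<close> unfolding r(2) by blast
    then show ?thesis by (simp add: distrib_right \<Lambda>_add \<Lambda>_K \<Lambda>_r mult.assoc)
  qed
  obtain i where i: "v $ i \<noteq> 0" using v(1) by (metis vec_eq_iff zero_index)
  \<comment> \<open>One coordinate is made 1, so that the projected vector is not zero.\<close>
  define w where "w = (1 / v $ i) *s v"
  have w: "w $ i = 1" "M *v w = 0" using i v(2) by (simp_all add: w_def vector_scalar_commute)
  define e :: "'k alg_closure ^ 4" where "e = (\<chi> j. \<Lambda> (w $ j))"
  define e' :: "'k alg_closure ^ 4" where "e' = (\<chi> j. \<sigma> (e $ j))"
  have eL: "e $ j \<in> L" for j by (simp add: e_def \<Lambda>_L)
  have s_0: "\<sigma> 0 = 0" and s_1: "\<sigma> 1 = 1" using s_K[of 0] s_K[of 1] by simp_all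
  have \<Lambda>_0: "\<Lambda> 0 = 0" unfolding \<Lambda>_def using \<pi>(2)[of 0 0] by simp
  have ei: "e $ i = 1" "e' $ i = 1" by (simp_all add: e_def e'_def w(1) \<Lambda>_1 s_1)
  have Me: "M *v e = 0"
  proof -
    have "(M *v e) $ j = \<Lambda> ((M *v w) $ j)" for j
      by (simp add: matrix_vector_mult_def sum_4 \<Lambda>_add \<Lambda>_lin[OF M] e_def)
    then show ?thesis unfolding w(2) by (simp add: vec_eq_iff \<Lambda>_0)
  qed
  have Me': "map_matrix \<sigma> M *v e' = 0"
  proof -
    have "(map_matrix \<sigma> M *v e') $ j = \<sigma> ((M *v e) $ j)" for j
      by (simp add: matrix_vector_mult_def sum_4 map_matrix_def e'_def s_mult[OF M eL] s_add Lm[OF M eL] La)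
    then show ?thesis unfolding Me by (simp add: vec_eq_iff s_0)
  qed
  have trace: "\<exists>k. x * \<sigma> y + \<sigma> x * y = to_ac k" if xyL: "x \<in> L" "y \<in> L" for x y
  proof -
    obtain a b c d where xy: "x = to_ac a + to_ac b * r" "y = to_ac c + to_ac d * r" using xyL unfolding r(2) by blast
    have "x * \<sigma> y + \<sigma> x * y = to_ac (2 * a * c + n * (a * d + b * c)) + 2 * to_ac (b * d) * (r * (to_ac n - r))"
      unfolding xy s_ab s_r by (simp add: algebra_simps)
    also have "r * (to_ac n - r) = - to_ac m" using mn by (simp add: algebra_simps)
    finally have "x * \<sigma> y + \<sigma> x * y = to_ac (2 * a * c + n * (a * d + b * c) - 2 * (b * d) * m)" by simp
    then show ?thesis by blast
  qed
  have "\<forall>j l. \<exists>k. e $ j * \<sigma> (e $ l) + \<sigma> (e $ j) * e $ l = to_ac k" using trace eL by blast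
  then obtain k where k: "\<And>j l. e $ j * \<sigma> (e $ l) + \<sigma> (e $ j) * e $ l = to_ac (k j l)" by metis
  show ?thesis
  proof (rule that[of e e' "\<chi> j l. k j l"])
    show "e \<noteq> 0" "e' \<noteq> 0" using ei by auto
    show "outer e e' + outer e' e = ac_mat (\<chi> j l. k j l)"
      by (simp add: vec_eq_iff outer_def ac_mat_def map_matrix_def e'_def k)
  qed (rule Me, rule Me')
qed

section \<open>Annihilators in the space of symmetric matrices\<close>

definition sym_unit :: "'n \<Rightarrow> 'n \<Rightarrow> 'a::field ^ 'n ^ 'n" where
  "sym_unit i j = (1 / 2) *k (outer (axis i 1) (axis j 1) + outer (axis j 1) (axis i 1))"

lemma mat_scale_transpose: "transpose (c *k M) = c *k transpose M"
  by (simp add: mat_scale_def transpose_def)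

lemma transpose_add: "transpose (M + N) = transpose M + transpose (N :: 'a::ab_semigroup_add ^ 'n ^ 'm)"
  by (simp add: transpose_def vec_eq_iff)

lemma sym_unit_sym: "transpose (sym_unit i j) = sym_unit i j"
  unfolding sym_unit_def mat_scale_transpose transpose_add outer_transpose by (simp add: add.commute)

lemma pairing_sym_unit:
  fixes M :: "'a::field ^ 'n ^ 'n"
  assumes "transpose M = M" "(2 :: 'a) \<noteq> 0" shows "pairing M (sym_unit i j) = M $ i $ j"
proof -
  have "scalar_product (axis i 1) (M *v axis j 1) = M $ i $ j" for i j
    by (subst scalar_product_commute) (simp add: scalar_product_axis matrix_axis)
  then have "pairing M (sym_unit i j) = 1 / 2 * (M $ i $ j + M $ j $ i)"
    unfolding sym_unit_def pairing_linear pairing_outer by simp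
  then show ?thesis using symmetric_entry[OF assms(1), of j i] assms(2) by simp
qed

text \<open>The double annihilator of a two-dimensional space is the space itself, made explicit by
  matrices dual to \<open>A\<close> and \<open>B\<close>.\<close>

lemma annihilator_pencil:
  fixes A B N :: "'a::field ^ 'n ^ 'n"
  assumes two: "(2 :: 'a) \<noteq> 0" and sym: "transpose A = A" "transpose B = B" "transpose N = N"
    and indep: "\<And>s t. s *k A + t *k B = 0 \<Longrightarrow> s = 0 \<and> t = 0"
    and ann: "\<And>S. transpose S = S \<Longrightarrow> pairing A S = 0 \<Longrightarrow> pairing B S = 0 \<Longrightarrow> pairing N S = 0"
  obtains s t where "N = s *k A + t *k B"
proof -
  note entry = pairing_sym_unit[OF sym(1) two] pairing_sym_unit[OF sym(2) two] pairing_sym_unit[OF sym(3) two]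
  have "\<exists>i j k l. A $ i $ j * B $ k $ l \<noteq> A $ k $ l * B $ i $ j"
  proof (rule ccontr)
    assume *: "\<not> ?thesis"
    show False
    proof (cases "A = 0")
      case True
      then have "1 *k A + 0 *k B = 0" by (simp add: mat_scale_def vec_eq_iff)
      then show False using indep by fastforce
    next
      case False
      then obtain i j where ij: "A $ i $ j \<noteq> 0" by (metis vec_eq_iff zero_index)
      have "(- B $ i $ j) *k A + A $ i $ j *k B = 0"
        using * by (simp add: mat_scale_def vec_eq_iff mult.commute)
      then show False using indep ij by blast
    qed
  qed
  then obtain i j k l where ne: "A $ i $ j * B $ k $ l \<noteq> A $ k $ l * B $ i $ j" by blast
  define d where "d = A $ i $ j * B $ k $ l - A $ k $ l * B $ i $ j"
  have d: "d \<noteq> 0" using ne by (simp add: d_def)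
  \<comment> \<open>\<open>S1\<close> and \<open>S2\<close> come from inverting the non-zero minor
    of \<open>A\<close> and \<open>B\<close> in the chosen two entries.\<close>
  define S1 where "S1 = (1 / d) *k (B $ k $ l *k sym_unit i j + (- B $ i $ j) *k sym_unit k l)"
  define S2 where "S2 = (1 / d) *k (A $ i $ j *k sym_unit k l + (- A $ k $ l) *k sym_unit i j)"
  have S12: "transpose S1 = S1" "transpose S2 = S2" "pairing A S1 = 1" "pairing B S1 = 0" "pairing A S2 = 0" "pairing B S2 = 1"
    unfolding S1_def S2_def mat_scale_transpose transpose_add sym_unit_sym pairing_linear entry
    using d by (simp_all add: d_def mult.commute)
  have eq: "pairing N S = pairing N S1 * pairing A S + pairing N S2 * pairing B S" if "transpose S = S" for S
  proof -
    define R where "R = S + ((- pairing A S) *k S1 + (- pairing B S) *k S2)"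
    have "pairing N R = 0"
      by (rule ann) (unfold R_def pairing_linear transpose_add mat_scale_transpose, simp_all add: S12 that)
    then show ?thesis unfolding R_def pairing_linear by (simp add: algebra_simps)
  qed
  have "N $ a $ b = (pairing N S1 *k A + pairing N S2 *k B) $ a $ b" for a b
    using eq[OF sym_unit_sym, of a b] unfolding entry by (simp add: mat_scale_def)
  then have "N = pairing N S1 *k A + pairing N S2 *k B" by (simp add: vec_eq_iff)
  then show ?thesis by (rule that)
qed

lemma matrix_add_mult: "(M + M') ** N = M ** N + M' ** N" for M M' :: "'a::field ^ 'n ^ 'm" and N :: "'a ^ 'p ^ 'n"
  by (simp add: matrix_matrix_mult_def vec_eq_iff sum.distrib distrib_right)

lemma mat_scale_mult:
  "(c *k M) ** N = c *k (M ** N)" "M ** (c *k N) = c *k (M ** N)" "c *k (d *k M) = (c * d) *k M"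
  "c *k (M + M') = c *k M + c *k M'" "(c + d) *k M = c *k M + d *k M" "1 *k M = M" "0 *k M = 0"
  for M M' :: "'a::field ^ 'n ^ 'm" and N :: "'a ^ 'p ^ 'n"
  by (simp_all add: mat_scale_def matrix_matrix_mult_def vec_eq_iff sum_distrib_left mult_ac algebra_simps)

lemma ac_mat_mult: "ac_mat (M ** N) = ac_mat M ** ac_mat N"
  by (simp add: ac_mat_def map_matrix_def matrix_matrix_mult_def vec_eq_iff to_ac_sum)

lemma ac_mat_add: "ac_mat (M + N) = ac_mat M + ac_mat N"
  by (simp add: ac_mat_def map_matrix_def vec_eq_iff)

lemma ac_mat_scale: "ac_mat (c *k M) = to_ac c *k ac_mat M"
  by (simp add: ac_mat_def map_matrix_def vec_eq_iff mat_scale_def)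

lemma ac_mat_entry: "ac_mat M $ i $ j = to_ac (M $ i $ j)"
  by (simp add: ac_mat_def map_matrix_def)

lemma transpose_ac_mat: "transpose (ac_mat M) = ac_mat (transpose M)"
  by (simp add: ac_mat_def map_matrix_def vec_eq_iff transpose_def)

lemma det_ac_mat: "det (ac_mat M) = to_ac (det (M :: 'k::field ^ 'n ^ 'n))"
  unfolding det_def by (simp add: to_ac_sum to_ac_prod ac_mat_entry to_ac_of_int)

text \<open>Up to conjugation, the products \<open>S0' N\<close> for \<open>N\<close> in the pencil are combinations of
  \<open>Jp J = diag (1, -1, -1, 1)\<close> and the antidiagonal \<open>Jp D2\<close>.  Hence \<open>(S0' N)\<^sup>2\<close> is scalar for
  \<open>N = b0 + \<rho> a0\<close>.  Subtracting its image under \<open>pr\<close> from this equation, which is linear in \<open>\<rho>\<close> and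
  \<open>\<rho>\<^sup>2\<close>, and comparing entries gives \<open>pr \<rho> = \<rho>\<close>.\<close>

lemma (in companion) ratio_fixed:
  fixes a0 b0 S0' :: "'a ^ 4 ^ 4" and pr :: "'a \<Rightarrow> 'a"
  assumes pr_add: "\<And>x y. pr (x + y) = pr x + pr y"
    and pr_S: "\<And>x i j. pr (x * (S0' ** a0 ** (S0' ** a0)) $ i $ j) = pr x * (S0' ** a0 ** (S0' ** a0)) $ i $ j"
      "\<And>x i j. pr (x * (S0' ** a0 ** (S0' ** b0) + S0' ** b0 ** (S0' ** a0)) $ i $ j)
          = pr x * (S0' ** a0 ** (S0' ** b0) + S0' ** b0 ** (S0' ** a0)) $ i $ j"
      "\<And>i j. pr ((S0' ** b0 ** (S0' ** b0)) $ i $ j) = (S0' ** b0 ** (S0' ** b0)) $ i $ j"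
    and form: "transpose H ** S0' ** H = \<kappa> *k Jp" "\<kappa> \<noteq> 0"
    and QF: "b0 + \<rho> *k a0 = \<tau> *k (H ** J ** transpose H)" "\<tau> \<noteq> 0"
    and a0: "a0 = x *k (H ** J ** transpose H) + y *k (H ** D2 ** transpose H)" "y \<noteq> 0"
  shows "pr \<rho> = \<rho>"
proof -
  define a b where "a = S0' ** a0" and "b = S0' ** b0"
  define G where "G = transpose H"
  have Ginv: "invertible G" unfolding G_def using H_invertible by (metis invertible_det_nz det_transpose)
  note iG = matrix_inv_mult[OF Ginv]
  \<comment> \<open>This conjugation turns \<open>S0' ** (H ** N ** transpose H)\<close> into
    \<kappa> times \<open>Jp ** N\<close>, which depends only on the explicit matrices.\<close>
  define c where "c = (\<lambda>M. G ** M ** matrix_inv G)"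
  have c_mult: "c (M ** N) = c M ** c N" for M N
  proof -
    have "c M ** c N = G ** M ** (matrix_inv G ** G) ** N ** matrix_inv G" unfolding c_def by (simp only: matrix_mul_assoc)
    then show ?thesis unfolding iG(2) c_def by (simp only: matrix_mul_assoc matrix_mul_rid)
  qed
  have c_add: "c (M + N) = c M + c N" for M N unfolding c_def by (simp add: matrix_add_ldistrib matrix_add_mult)
  have c_scale: "c (k *k M) = k *k c M" for k M unfolding c_def by (simp add: mat_scale_mult)
  have c_1: "c (mat 1) = mat 1" unfolding c_def using iG(1) by simp
  have c_S: "c (S0' ** (H ** N ** transpose H)) = \<kappa> *k (Jp ** N)" for N
  proof -
    have "c (S0' ** (H ** N ** transpose H)) = (G ** S0' ** H) ** N ** (G ** matrix_inv G)"
      unfolding c_def G_def by (simp only: matrix_mul_assoc)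
    then show ?thesis unfolding iG(1) form(1)[folded G_def] by (simp add: mat_scale_mult)
  qed
  define q Yy where "q = Jp ** J" and "Yy = Jp ** D2"
  have qe: "q $ i $ j = (if i = j then (if i = 1 \<or> i = 4 then 1 else - 1) else 0)" for i j
    unfolding q_def Jp_def J_def by (cases i rule: UNIV_4_cases; cases j rule: UNIV_4_cases) (simp_all add: matrix_matrix_mult_def sum_4)
  have Ye: "Yy $ i $ j = (if i = 1 \<and> j = 4 then 1 else if i = 4 \<and> j = 1 then \<alpha> else if i = 2 \<and> j = 3 then - \<beta> else if i = 3 \<and> j = 2 then - 1 else 0)" for i j
    unfolding Yy_def Jp_def D2_def by (cases i rule: UNIV_4_cases; cases j rule: UNIV_4_cases) (simp_all add: matrix_matrix_mult_def sum_4)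
  have q2: "q ** q = mat 1"
    by (simp add: vec_eq_iff forall_4 matrix_matrix_mult_def sum_4 qe mat_def)
  have ca: "c a = \<kappa> *k (x *k q + y *k Yy)"
    unfolding a_def a0(1) matrix_add_ldistrib c_add mat_scale_mult c_scale c_S q_def Yy_def by (simp add: mult.commute)
  have ba: "b + \<rho> *k a = \<tau> *k (S0' ** (H ** J ** transpose H))"
  proof -
    have "b + \<rho> *k a = S0' ** (b0 + \<rho> *k a0)" unfolding a_def b_def by (simp only: matrix_add_ldistrib mat_scale_mult)
    then show ?thesis unfolding QF(1) by (simp only: mat_scale_mult)
  qed
  have cba: "c b + \<rho> *k c a = (\<tau> * \<kappa>) *k q"
    unfolding c_scale[symmetric] c_add[symmetric] ba unfolding c_scale c_S q_def mat_scale_mult ..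
  have sq: "(b + \<rho> *k a) ** (b + \<rho> *k a) = ((\<tau> * \<kappa>) ^ 2) *k mat 1"
  proof -
    have "c ((b + \<rho> *k a) ** (b + \<rho> *k a)) = c (((\<tau> * \<kappa>) ^ 2) *k mat 1)"
      unfolding c_mult c_add c_scale cba c_1 mat_scale_mult q2 by (simp add: power2_eq_square)
    then have "matrix_inv G ** c ((b + \<rho> *k a) ** (b + \<rho> *k a)) ** G = matrix_inv G ** c (((\<tau> * \<kappa>) ^ 2) *k mat 1) ** G" by simp
    moreover have "matrix_inv G ** c M ** G = M" for M
    proof -
      have "matrix_inv G ** c M ** G = (matrix_inv G ** G) ** M ** (matrix_inv G ** G)" unfolding c_def by (simp only: matrix_mul_assoc)
      then show ?thesis unfolding iG(2) by simp
    qed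
    ultimately show ?thesis by simp
  qed
  define m where "m = a ** b + b ** a"
  have ent: "(b ** b) $ i $ j + \<rho> * m $ i $ j + \<rho> ^ 2 * (a ** a) $ i $ j = (\<tau> * \<kappa>) ^ 2 * mat 1 $ i $ j" for i j
  proof -
    have "(b + \<rho> *k a) ** (b + \<rho> *k a) = b ** b + \<rho> *k m + (\<rho> ^ 2) *k (a ** a)"
      unfolding m_def by (simp add: matrix_add_ldistrib matrix_add_mult mat_scale_mult power2_eq_square add_ac)
    then have "(b ** b + \<rho> *k m + (\<rho> ^ 2) *k (a ** a)) $ i $ j = (((\<tau> * \<kappa>) ^ 2) *k mat 1) $ i $ j" using sq by simp
    then show ?thesis by (simp add: mat_scale_def)
  qed
  have pr0: "pr 0 = 0" using pr_add[of 0 0] by (metis add_0_right add_left_cancel)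
  \<comment> \<open>Known entries pass through \<open>pr\<close>; the image of
    \<open>\<rho> ^ 2\<close> has no relation to the square of \<open>pr \<rho>\<close> at this
    stage.\<close>
  have "(b ** b) $ i $ j + pr \<rho> * m $ i $ j + pr (\<rho> ^ 2) * (a ** a) $ i $ j = pr ((\<tau> * \<kappa>) ^ 2) * mat 1 $ i $ j" for i j
  proof -
    have "pr ((b ** b) $ i $ j + \<rho> * m $ i $ j + \<rho> ^ 2 * (a ** a) $ i $ j) = (b ** b) $ i $ j + pr \<rho> * m $ i $ j + pr (\<rho> ^ 2) * (a ** a) $ i $ j"
      unfolding pr_add m_def a_def b_def pr_S ..
    then show ?thesis unfolding ent by (simp add: mat_def pr0 split: if_splits)
  qed
  note ent' = this
  define k1 l1 e where "k1 = \<rho> - pr \<rho>" and "l1 = \<rho> ^ 2 - pr (\<rho> ^ 2)" and "e = (\<tau> * \<kappa>) ^ 2 - pr ((\<tau> * \<kappa>) ^ 2)"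
  have "k1 *k m + l1 *k (a ** a) = e *k mat 1"
  proof -
    have "k1 * m $ i $ j + l1 * (a ** a) $ i $ j = e * mat 1 $ i $ j" for i j
      using arg_cong2[OF ent[of i j] ent'[of i j], of "(-)"] unfolding k1_def l1_def e_def by (simp add: algebra_simps)
    then show ?thesis by (simp add: mat_scale_def vec_eq_iff)
  qed
  then have "c (k1 *k m + l1 *k (a ** a)) = c (e *k mat 1)" by simp
  then have E: "k1 *k (c a ** c b + c b ** c a) + l1 *k (c a ** c a) = e *k mat 1"
    unfolding m_def c_add c_scale c_mult c_1 .
  have cb: "c b = (\<tau> * \<kappa>) *k q + (- \<rho>) *k c a"
  proof -
    have "c b = (c b + \<rho> *k c a) + (- \<rho>) *k c a" by (simp add: mat_scale_def vec_eq_iff)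
    then show ?thesis unfolding cba .
  qed
  have cae: "c a $ i $ j = \<kappa> * (x * q $ i $ j + y * Yy $ i $ j)" for i j
    unfolding ca by (simp add: mat_scale_def)
  have cbe: "c b $ i $ j = \<tau> * \<kappa> * q $ i $ j - \<rho> * c a $ i $ j" for i j
    unfolding cb by (simp add: mat_scale_def)
  have Ee: "k1 * (\<Sum>l\<in>UNIV. c a $ i $ l * c b $ l $ j + c b $ i $ l * c a $ l $ j) + l1 * (\<Sum>l\<in>UNIV. c a $ i $ l * c a $ l $ j) = e * mat 1 $ i $ j" for i j
    using arg_cong[OF E, of "\<lambda>M. M $ i $ j"] by (simp add: mat_scale_def matrix_matrix_mult_def sum.distrib)
  \<comment> \<open>The first two diagonal entries differ only by \<alpha> against \<beta>, which
    kills the coefficient of the square; the entry at (1, 4) then leaves a non-zero multiple of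
    \<open>k1\<close>.\<close>
  have E11: "k1 * (2 * \<tau> * \<kappa> * \<kappa> * x) + (l1 - 2 * \<rho> * k1) * (\<kappa> * \<kappa> * (x * x + y * y * \<alpha>)) = e"
    using Ee[of 1 1] unfolding sum_4 cbe cae qe Ye by (simp add: mat_def algebra_simps)
  have E22: "k1 * (2 * \<tau> * \<kappa> * \<kappa> * x) + (l1 - 2 * \<rho> * k1) * (\<kappa> * \<kappa> * (x * x + y * y * \<beta>)) = e"
    using Ee[of 2 2] unfolding sum_4 cbe cae qe Ye by (simp add: mat_def algebra_simps)
  have E14: "k1 * (2 * \<tau> * \<kappa> * \<kappa> * y) + (l1 - 2 * \<rho> * k1) * (\<kappa> * \<kappa> * (2 * x * y)) = 0"
    using Ee[of 1 4] unfolding sum_4 cbe cae qe Ye by (simp add: mat_def algebra_simps)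
  have "(l1 - 2 * \<rho> * k1) * (\<kappa> * \<kappa> * (y * y * (\<alpha> - \<beta>))) = 0"
    using arg_cong2[OF E11 E22, of "(-)"] by (simp add: algebra_simps)
  then have z: "l1 - 2 * \<rho> * k1 = 0" using form(2) a0(2) \<alpha>\<beta> by simp
  have "k1 * (2 * \<tau> * \<kappa> * \<kappa> * y) = 0" using E14 unfolding z by simp
  then have "k1 = 0" using form(2) a0(2) QF(2) two by simp
  then show ?thesis by (simp add: k1_def)
qed

section \<open>The image as a dual quadric\<close>

context companion
begin

lemma qform_J: "qform J z = 2 * (z $ 1 * z $ 4 - z $ 2 * z $ 3)"
  by (simp add: qform_def scalar_product_def matrix_vector_mult_def sum_4 J_def algebra_simps)

text \<open>\<open>J\<close> is its own inverse, so the Segre quadric is its own dual in these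
  coordinates; \<open>H\<close> transports this to the dual of the ambient space of the second
  curve.\<close>

lemma image_dual: "image = dual_quadric (H ** J ** transpose H)"
proof -
  have Hinv: "invertible (transpose H)" using H_invertible by (metis invertible_det_nz det_transpose)
  note iH = matrix_inv_mult[OF Hinv]
  have Q: "(H ** J ** transpose H) *v x = H *v (J *v (transpose H *v x))" for x
    by (simp only: matrix_vector_mul_assoc matrix_mul_assoc)
  have q: "qform (H ** J ** transpose H) x = qform J (transpose H *v x)" for x
    unfolding qform_def Q by (subst scalar_product_matrix) simp
  have Jv: "(J *v z) $ 1 = z $ 4" "(J *v z) $ 2 = - z $ 3" "(J *v z) $ 3 = - z $ 2" "(J *v z) $ 4 = z $ 1" for z
    by (simp_all add: matrix_vector_mult_def sum_4 J_def)
  have JJ: "J *v (J *v z) = z" for z by (simp add: vec_eq_iff forall_4 Jv)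
  show ?thesis unfolding image_def dual_quadric_def
  proof (intro subset_antisym subsetI)
    fix P assume "P \<in> {proj (H *v w) |w. w \<noteq> 0 \<and> w $ 1 * w $ 4 = w $ 2 * w $ 3}"
    then obtain w where w: "P = proj (H *v w)" "w \<noteq> 0" "w $ 1 * w $ 4 = w $ 2 * w $ 3" by blast
    define x where "x = matrix_inv (transpose H) *v (J *v w)"
    have Hx: "transpose H *v x = J *v w" unfolding x_def iH ..
    have "x \<noteq> 0"
    proof
      assume "x = 0"
      then have "J *v w = 0" using Hx by (metis matrix_vector_mult_0_right)
      then show False using JJ[of w] w(2) by simp
    qed
    moreover have "qform (H ** J ** transpose H) x = 0" unfolding q Hx qform_J Jv using w(3) by (simp add: mult.commute)
    moreover have "P = proj ((H ** J ** transpose H) *v x)" unfolding Q Hx JJ w(1) ..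
    ultimately show "P \<in> {proj ((H ** J ** transpose H) *v x) |x. x \<noteq> 0 \<and> qform (H ** J ** transpose H) x = 0}" by blast
  next
    fix P assume "P \<in> {proj ((H ** J ** transpose H) *v x) |x. x \<noteq> 0 \<and> qform (H ** J ** transpose H) x = 0}"
    then obtain x where x: "P = proj ((H ** J ** transpose H) *v x)" "x \<noteq> 0" "qform (H ** J ** transpose H) x = 0" by blast
    define w where "w = J *v (transpose H *v x)"
    have "w \<noteq> 0"
    proof
      assume "w = 0"
      then have "J *v w = 0" by simp
      then have "transpose H *v x = 0" by (simp only: w_def JJ)
      then show False using iH(4)[of x] x(2) by simp
    qed
    moreover have "w $ 1 * w $ 4 = w $ 2 * w $ 3"
      using x(3) two unfolding q qform_J w_def Jv by (simp add: mult.commute)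
    moreover have "P = proj (H *v w)" unfolding x(1) Q w_def ..
    ultimately show "P \<in> {proj (H *v w) |w. w \<noteq> 0 \<and> w $ 1 * w $ 4 = w $ 2 * w $ 3}" by blast
  qed
qed

lemma QF_facts:
  "transpose (H ** J ** transpose H) = H ** J ** transpose H"
  "transpose (H ** D2 ** transpose H) = H ** D2 ** transpose H"
  "det (H ** J ** transpose H) \<noteq> 0"
  "s *k (H ** J ** transpose H) + t *k (H ** D2 ** transpose H) = 0 \<Longrightarrow> s = 0 \<and> t = 0"
proof -
  have "transpose J = J" "transpose D2 = D2" by (auto simp: J_def D2_def transpose_def vec_eq_iff)
  then show "transpose (H ** J ** transpose H) = H ** J ** transpose H" "transpose (H ** D2 ** transpose H) = H ** D2 ** transpose H"
    by (simp_all add: matrix_transpose_mul matrix_mul_assoc)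
  have "J ** J = mat 1" by (simp add: vec_eq_iff forall_4 matrix_matrix_mult_def sum_4 J_def mat_def)
  then have "invertible J" unfolding invertible_def by blast
  then have "det J \<noteq> 0" "det H \<noteq> 0" using H_invertible invertible_det_nz by blast+
  then show "det (H ** J ** transpose H) \<noteq> 0" by (simp add: det_mul)
  assume 0: "s *k (H ** J ** transpose H) + t *k (H ** D2 ** transpose H) = 0"
  have "s *k J + t *k D2 = 0"
  proof -
    have "H ** (s *k J + t *k D2) ** transpose H = 0"
      using 0 by (simp add: matrix_add_ldistrib matrix_add_mult mat_scale_mult)
    then have "K ** (H ** (s *k J + t *k D2) ** transpose H) ** transpose K = 0" by simp
    moreover have "K ** (H ** (s *k J + t *k D2) ** transpose H) ** transpose K = (K ** H) ** (s *k J + t *k D2) ** (transpose H ** transpose K)"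
      by (simp only: matrix_mul_assoc)
    moreover have "K ** H = mat 1" "transpose H ** transpose K = mat 1"
      unfolding H_def using matrix_inv_mult(1)[OF K(1)] by (simp_all add: matrix_transpose_mul[symmetric] transpose_mat)
    ultimately show ?thesis by simp
  qed
  \<comment> \<open>The entry at (1, 4) comes from \<open>J\<close> alone and the one at (4, 4) from
    \<open>D2\<close> alone.\<close>
  then have "(s *k J + t *k D2) $ 1 $ 4 = 0" "(s *k J + t *k D2) $ 4 $ 4 = 0" by simp_all
  then show "s = 0 \<and> t = 0" by (simp add: mat_scale_def J_def D2_def)
qed

end

section \<open>The quadric of the theorem\<close>

text \<open>The divisor \<open>b\<close> and the difference of the two fibres represent the same
  point, so they differ by a principal divisor on the curve. Doubling replaces the fibres by
  divisors of tangents and \<open>b\<close> by the divisor of the pushout form.\<close>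

lemma (in biquadratic) pushout_sqrt:
  fixes E :: "('a ^ 'm) set set"
  assumes iso: "iso_over UNIV C E \<psi>" and E_points: "\<And>e. e \<in> E \<Longrightarrow> \<exists>v. v \<noteq> 0 \<and> e = proj v"
    and P: "P1 \<in> base_conic M1" "P2 \<in> base_conic M2"
    and fib: "lin_equiv E (push_div C E \<psi> (\<lambda>p. fibre C M1 P1 p - fibre C M2 P2 p)) D"
    and nvM: "\<not> vanishes_on (qform M) C"
    and bM: "\<And>p. form_div C (qform M) p - 2 * form_div C (\<lambda>x. x $ 1) p = 2 * b p"
    and bD: "lin_equiv E (push_div C E \<psi> b) D"
  shows "nv (qform M) \<and> (\<exists>N. hform UNIV 2 N \<and> (\<forall>r\<in>V. qform M r * (u1 r * cZ r) = N r ^ 2))"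
proof -
  have nv: "nv (qform M)" using nvM by (simp add: vanishes_on_C)
  obtain s t where st: "s \<noteq> 0 \<or> t \<noteq> 0" "P1 = c1.line s t" using P(1) unfolding c1.base_conic_eq by blast
  obtain s' t' where st': "s' \<noteq> 0 \<or> t' \<noteq> 0" "P2 = c2.line s' t'" using P(2) unfolding c2.base_conic_eq by blast
  have 01: "0 \<noteq> (0 :: 'a) \<or> 1 \<noteq> (0 :: 'a)" by simp
  \<comment> \<open>The curve lies in no plane, so dividing by the square of this coordinate makes
    sense.\<close>
  have x1: "nv (\<lambda>x. x $ 1)"
  proof (rule ccontr)
    assume *: "\<not> ?thesis"
    have z: "nf (\<lambda>z w. ez $ 1 * z + ew $ 1 * w) (\<lambda>z w. ex $ 1) (\<lambda>z w. ey $ 1) (\<lambda>z w. 0) p = 0" if "p \<in> V" for p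
    proof -
      have "p $ 1 = 0" using * that unfolding nv_def by blast
      then show ?thesis using coord_combination[of p 1] by (simp add: nf_def algebra_simps)
    qed
    note zz = nf_eq_0[OF bf_linear bf_const bf_const bf_const z]
    have "ez $ 1 = 0" "ew $ 1 = 0" by (rule binary_linear_eq_0[OF zz(1)], assumption)+
    moreover have "ex $ 1 = 0" by (rule binary_const_eq_0[OF zz(2)])
    moreover have "ey $ 1 = 0" by (rule binary_const_eq_0[OF zz(3)])
    ultimately have "(axis 1 1 :: 'a ^ 4) $ 1 = 0" using coord_combination[of "axis 1 1" 1] by simp
    then show False by (simp add: axis_def)
  qed
  obtain n F G where FG: "hform UNIV n F" "hform UNIV n G" "nv F" "nv G"
    "\<And>p. p \<in> V \<Longrightarrow> b (proj p) - (fibre C M1 P1 (proj p) - fibre C M2 P2 (proj p)) = int (ord p F) - int (ord p G)"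
    using equivalent_pushforwards[OF iso E_points bD fib] by blast
  have "\<exists>N. hform UNIV 2 N \<and> (\<forall>r\<in>V. qform M r * (u1 r * cZ r) = N r ^ 2)"
  proof (rule sqrt_from_orders[OF hform_qform nv hform_coord x1 c1.hform_tl c1.nv_tl[OF st(1)] c2.hform_tl c2.nv_tl[OF st'(1)]
        c1.hform_chord c1.nv_chord[OF st(1) 01] _ c2.hform_chord c2.nv_chord[OF st'(1) 01] _ FG(1,3,2,4)])
    show "c1.tl s t r * u1 r = c1.chord s t 0 1 r ^ 2" "c2.tl s' t' r * cZ r = c2.chord s' t' 0 1 r ^ 2" if "r \<in> V" for r
      using c1.tl_chord[OF that, of s t 0 1] c2.tl_chord[OF that, of s' t' 0 1] by (simp_all add: c1.tl_01 c2.tl_01)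
    show "int (ord p (qform M)) - 2 * int (ord p (\<lambda>x. x $ 1)) - int (ord p (c1.tl s t)) + int (ord p (c2.tl s' t'))
       = 2 * (int (ord p F) - int (ord p G))" if p: "p \<in> V" for p
      using FG(5)[OF p] bM[of "proj p"] c1.fibre_ord[OF st(1) p] c2.fibre_ord[OF st'(1) p]
      unfolding st(2)[symmetric] st'(2)[symmetric] form_div_C using p by simp
  qed blast
  then show ?thesis using nv by blast
qed

lemma two_equations:
  fixes x y :: "'a::field"
  assumes "s * t' - s' * t \<noteq> 0"
  shows "s * x + t * y = 0 \<and> s' * x + t' * y = 0 \<longleftrightarrow> x = 0 \<and> y = 0"
proof
  assume *: "s * x + t * y = 0 \<and> s' * x + t' * y = 0"
  have "(s * t' - s' * t) * x = t' * (s * x + t * y) - t * (s' * x + t' * y)" by (simp add: algebra_simps)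
  moreover have "(s * t' - s' * t) * y = s * (s' * x + t' * y) - s' * (s * x + t * y)" by (simp add: algebra_simps)
  ultimately show "x = 0 \<and> y = 0" using * assms by simp
qed simp

lemma quadric_Int: "quadric A \<inter> quadric B = proj ` {x. x \<noteq> 0 \<and> qform A x = 0 \<and> qform B x = 0}"
proof (intro subset_antisym subsetI)
  fix p assume "p \<in> quadric A \<inter> quadric B"
  then obtain x y where x: "p = proj x" "x \<noteq> 0" "qform A x = 0" and y: "p = proj y" "qform B y = 0"
    unfolding quadric_def by blast
  obtain c where "c \<noteq> 0" "x = c *s y" using x(1) y(1) proj_eq_iff by metis
  then have "qform B x = 0" using hform_homogeneous[OF hform_qform, of B c y] y(2) by simp
  then show "p \<in> proj ` {x. x \<noteq> 0 \<and> qform A x = 0 \<and> qform B x = 0}" using x by blast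
next
  fix p assume "p \<in> proj ` {x. x \<noteq> 0 \<and> qform A x = 0 \<and> qform B x = 0}"
  then show "p \<in> quadric A \<inter> quadric B" unfolding quadric_def by blast
qed

lemma qform_pencil: "qform (s *k A + t *k B) x = s * qform A x + t * qform B x" for A B :: "'a::field ^ 'n ^ 'n"
  unfolding qform_def pencil_entry ..

lemma dual_quadric_scale: "u \<noteq> 0 \<Longrightarrow> dual_quadric (u *k M) = dual_quadric M"
proof -
  assume u: "u \<noteq> 0"
  have "qform (u *k M) x = u * qform M x" for x
    unfolding qform_def mat_scale_vector scalar_product_linear ..
  then show ?thesis unfolding dual_quadric_def mat_scale_vector proj_eqI[OF u] using u by simp
qed

lemma matrix_inv_unique: "N ** M = mat 1 \<Longrightarrow> matrix_inv M = N" for M N :: "'a::field ^ 'n ^ 'n"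
proof -
  assume *: "N ** M = mat 1"
  then have "invertible M" unfolding invertible_def using matrix_left_right_inverse by blast
  then have "M ** matrix_inv M = mat 1" by (rule matrix_inv_mult)
  then show ?thesis using * by (metis matrix_mul_assoc matrix_mul_lid matrix_mul_rid)
qed

lemma elliptic_curve_points: "elliptic_curve E \<Longrightarrow> e \<in> E \<Longrightarrow> \<exists>v. v \<noteq> 0 \<and> e = proj v"
  unfolding elliptic_curve_def Let_def by blast

lemma ac_mat_1: "ac_mat (mat 1) = mat 1"
  by (simp add: ac_mat_def map_matrix_def vec_eq_iff mat_def)

text \<open>The matrices transported from \<open>J\<close> and \<open>D2\<close> annihilate
  \<open>Ws'\<close>, so they lie in the pencil of \<open>a'\<close> and \<open>b'\<close>.
  Rationality of the member is that of a single ratio, once the coefficient of \<open>b'\<close> is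
  normalised to 1.\<close>

lemma (in companion) rational_member:
  fixes a' b' S' :: "'a ^ 4 ^ 4" and pr :: "'a \<Rightarrow> 'a"
  assumes sym: "transpose a' = a'" "transpose b' = b'"
    and indep: "\<And>s t. s *k a' + t *k b' = 0 \<Longrightarrow> s = 0 \<and> t = 0"
    and Ws': "\<And>S. S \<in> Ws' \<longleftrightarrow> transpose S = S \<and> pairing a' S = 0 \<and> pairing b' S = 0"
    and pr_add: "\<And>x y. pr (x + y) = pr x + pr y"
    and pr_S: "\<And>x i j. pr (x * (S' ** a' ** (S' ** a')) $ i $ j) = pr x * (S' ** a' ** (S' ** a')) $ i $ j"
      "\<And>x i j. pr (x * (S' ** a' ** (S' ** b') + S' ** b' ** (S' ** a')) $ i $ j)
          = pr x * (S' ** a' ** (S' ** b') + S' ** b' ** (S' ** a')) $ i $ j"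
      "\<And>i j. pr ((S' ** b' ** (S' ** b')) $ i $ j) = (S' ** b' ** (S' ** b')) $ i $ j"
    and form: "transpose H ** S' ** H = \<kappa> *k Jp" "\<kappa> \<noteq> 0"
  obtains s t u where "(s, t) \<noteq> (0, 0)" "u \<noteq> 0" "s *k a' + t *k b' = u *k (H ** J ** transpose H)" "pr s = s \<and> t = 1 \<or> s = 1 \<and> t = 0"
proof -
  have ann: "pairing (H ** J ** transpose H) S = 0" "pairing (H ** D2 ** transpose H) S = 0"
    if "transpose S = S" "pairing a' S = 0" "pairing b' S = 0" for S
  proof -
    have "S \<in> Ws'" using that by (simp add: Ws')
    then obtain S1 where "S1 \<in> Ws" "S = \<Phi> S1" using \<Phi>_bij unfolding bij_betw_def by blast
    then show "pairing (H ** J ** transpose H) S = 0" "pairing (H ** D2 ** transpose H) S = 0"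
      using J_annihilates D2_annihilates by blast+
  qed
  obtain s t where st: "H ** J ** transpose H = s *k a' + t *k b'"
    using annihilator_pencil[OF two sym QF_facts(1) indep ann(1)] by blast
  obtain s2 t2 where st2: "H ** D2 ** transpose H = s2 *k a' + t2 *k b'"
    using annihilator_pencil[OF two sym QF_facts(2) indep ann(2)] by blast
  show ?thesis
  proof (cases "t = 0")
    case True
    have "s \<noteq> 0"
    proof
      assume "s = 0"
      then have "1 *k (H ** J ** transpose H) + 0 *k (H ** D2 ** transpose H) = 0"
        using True st by (simp add: mat_scale_mult)
      then have "(1 :: 'a) = 0 \<and> (0 :: 'a) = 0" by (rule QF_facts(4))
      then show False by simp
    qed
    then show ?thesis using True by (intro that[of 1 0 "1 / s"]) (simp_all add: st mat_scale_mult)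
  next
    case False
    define d where "d = s * t2 - s2 * t"
    have d_a: "t2 *k (H ** J ** transpose H) + (- t) *k (H ** D2 ** transpose H) = d *k a'"
      unfolding st st2 d_def by (simp add: mat_scale_def vec_eq_iff algebra_simps)
    have d: "d \<noteq> 0"
    proof
      assume "d = 0"
      then have "t2 *k (H ** J ** transpose H) + (- t) *k (H ** D2 ** transpose H) = 0" using d_a by (simp add: mat_scale_mult)
      then have "t2 = 0 \<and> - t = 0" by (rule QF_facts(4))
      then show False using False by simp
    qed
    \<comment> \<open>Inverts the change of basis; the coefficient at \<open>D2\<close> is non-zero
      because \<open>t\<close> is.\<close>
    have a': "a' = (t2 / d) *k (H ** J ** transpose H) + (- t / d) *k (H ** D2 ** transpose H)"
    proof -
      have "a' = (1 / d) *k (d *k a')" using d by (simp add: mat_scale_mult)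
      then show ?thesis unfolding d_a[symmetric] by (simp add: mat_scale_mult)
    qed
    have b': "b' + (s / t) *k a' = (1 / t) *k (H ** J ** transpose H)"
      unfolding st using False by (simp add: mat_scale_def vec_eq_iff field_simps)
    have "pr (s / t) = s / t"
      by (rule ratio_fixed[OF pr_add pr_S form b' _ a']) (use False d in auto)
    then show ?thesis using False b'
      by (intro that[of "s / t" 1 "1 / t"]) (simp_all add: mat_scale_mult add.commute)
  qed
qed

theorem theorem9p1:
  fixes A B A' B' :: "'k::field ^ 4 ^ 4"
    and E :: "('k alg_closure ^ 3) set set" and T :: "('k alg_closure ^ 3) set"
    and \<psi> :: "('k alg_closure ^ 4) set \<Rightarrow> ('k alg_closure ^ 3) set"
    and \<phi> :: "('k alg_closure ^ 4) set \<Rightarrow> ('k alg_closure ^ 4) set"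
    and \<Phi> :: "'k alg_closure ^ 4 ^ 4 \<Rightarrow> 'k alg_closure ^ 4 ^ 4"
    and Q :: "nat \<Rightarrow> 'k alg_closure ^ 4 ^ 4" and P :: "nat \<Rightarrow> ('k alg_closure ^ 4) set"
    and \<aa> :: "nat \<Rightarrow> ('k alg_closure ^ 4) set \<Rightarrow> int"
    and L :: "'k alg_closure set" and \<sigma> :: "'k alg_closure \<Rightarrow> 'k alg_closure"
    and C :: "('k alg_closure ^ 4) set set" and Y :: "('k alg_closure ^ 4) set set"
  assumes char: "(2 :: 'k) \<noteq> 0"
    and E: "elliptic_curve E" and T: "rational_two_torsion_pt E T"
    and comp: "companions E T A B \<psi> A' B' \<phi> \<Phi>"
    and C: "C = qi_curve A B"
    and singular: "\<And>i. i \<in> {1..4} \<Longrightarrow> Q i \<in> pencil (ac_mat A) (ac_mat B) \<and> det (Q i) = 0"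
    and distinct: "\<And>i j c. i \<in> {1..4} \<Longrightarrow> j \<in> {1..4} \<Longrightarrow> i \<noteq> j \<Longrightarrow> Q i \<noteq> c *k Q j"
    and fibres: "\<And>i. i \<in> {1..4} \<Longrightarrow> P i \<in> base_conic (Q i) \<and> \<aa> i = fibre C (Q i) (P i)"
    and order1: "lin_equiv C (\<lambda>p. \<aa> 1 p - \<aa> 2 p) (\<lambda>p. \<aa> 3 p - \<aa> 4 p)"
    and order2: "represents C E \<psi> (\<lambda>p. \<aa> 1 p - \<aa> 2 p) T"
    and L: "quadratic_extension L" and \<sigma>: "galois_conjugation L \<sigma>"
    and over_L: "\<And>i j. Q 1 $ i $ j \<in> L" and conj: "Q 2 = map_matrix \<sigma> (Q 1)"
    and Y: "Y = natural_map A B \<Phi> (Q 1) (Q 2) ` weil_res_conic \<sigma> (Q 1)"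
  shows "(\<exists>R :: 'k ^ 4 ^ 4. transpose R = R \<and> det R \<noteq> 0 \<and> Y = quadric (ac_mat R)) \<and>
         (\<exists>Q' \<in> pencil A' B'. det Q' \<noteq> 0 \<and> Y = dual_quadric (ac_mat Q'))"
proof -
  let ?W = "two_uple_space A B" and ?W' = "two_uple_space A' B'"
  have two: "(2 :: 'k alg_closure) \<noteq> 0"
    using char to_ac_eq_0_iff[of "2 :: 'k"] by simp
  note comp' = comp[unfolded companions_def Let_def, folded C]
  have ns: "nonsingular_qi A B" and ns': "nonsingular_qi A' B'" and jac: "has_jacobian C E \<psi>"
    and iso: "iso_over (range to_ac) C (qi_curve A' B') \<phi>" and \<Phi>_bij: "bij_betw \<Phi> ?W ?W'"
    and \<Phi>_scale': "\<forall>c. \<forall>S\<in>?W. \<Phi> (c *k S) = c *k \<Phi> S"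
    and \<Phi>_rat: "\<forall>S. ac_mat S \<in> ?W \<longrightarrow> \<Phi> (ac_mat S) \<in> range ac_mat"
    and \<Phi>_pts: "\<forall>p\<in>C. \<forall>x\<in>p. \<forall>y\<in>\<phi> p. \<exists>c. c \<noteq> 0 \<and> \<Phi> (outer x x) = c *k outer y y"
    and \<Phi>_sq: "\<forall>\<xi>. \<xi> \<noteq> 0 \<longrightarrow> (\<exists>M. pushout_form C E \<psi> T M \<and> corresponds A B \<Phi> M (outer \<xi> \<xi>))"
    using comp' by - ((elim conjE, assumption)+)
  have \<Phi>_scale: "\<Phi> (c *k S) = c *k \<Phi> S" if "S \<in> ?W" for c S
    using \<Phi>_scale' that by blast
  have sym: "transpose (ac_mat A) = ac_mat A" "transpose (ac_mat B) = ac_mat B"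
    and sym': "transpose (ac_mat A') = ac_mat A'" "transpose (ac_mat B') = ac_mat B'"
    using ns[unfolded nonsingular_qi_def, THEN conjunct1] ns'[unfolded nonsingular_qi_def, THEN conjunct1]
      ns[unfolded nonsingular_qi_def, THEN conjunct2, THEN conjunct1]
      ns'[unfolded nonsingular_qi_def, THEN conjunct2, THEN conjunct1]
    by (simp_all only: transpose_ac_mat)
  note smooth = ns[unfolded nonsingular_qi_def, THEN conjunct2, THEN conjunct2, rule_format]
    and smooth' = ns'[unfolded nonsingular_qi_def, THEN conjunct2, THEN conjunct2, rule_format]
  obtain \<alpha> \<beta> cX cY cZ cW ex ey ez ew k1 k2 where
    bq: "biquadratic \<alpha> \<beta> cX cY cZ cW ex ey ez ew (Q 1) (Q 2) k1 k2"
    by (rule normal_form_exists[OF two sym smooth singular distinct])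
  interpret bq: biquadratic \<alpha> \<beta> cX cY cZ cW ex ey ez ew "Q 1" "Q 2" k1 k2 by (rule bq)
  obtain s1 t1 where st1: "(s1, t1) \<noteq> (0, 0)" "Q 1 = s1 *k ac_mat A + t1 *k ac_mat B"
    using singular[of 1] unfolding pencil_def by auto
  obtain s2 t2 where st2: "(s2, t2) \<noteq> (0, 0)" "Q 2 = s2 *k ac_mat A + t2 *k ac_mat B"
    using singular[of 2] unfolding pencil_def by auto
  \<comment> \<open>The first two singular members form a basis of the pencil, so they can replace
    the two given equations throughout.\<close>
  have \<delta>: "s1 * t2 - s2 * t1 \<noteq> 0"
    using pencil_independent[OF st1(1) st2(1)] distinct[of 1 2] unfolding st1(2) st2(2) by auto
  have CC: "C = bq.C"
  proof -
    have "x \<in> bq.V \<longleftrightarrow> x \<noteq> 0 \<and> qform (ac_mat A) x = 0 \<and> qform (ac_mat B) x = 0" for x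
    proof -
      have "x \<in> bq.V \<longleftrightarrow> x \<noteq> 0 \<and> qform (Q 1) x = 0 \<and> qform (Q 2) x = 0"
        unfolding bq.V_def bq.c1.qform_eq bq.c2.qform_eq bq.q_def bq.u1_def bq.v1_def
        using two bq.k1 bq.k2 by auto
      then show ?thesis unfolding st1(2) st2(2) qform_pencil using two_equations[OF \<delta>] by auto
    qed
    then have "bq.V = {x. x \<noteq> 0 \<and> qform (ac_mat A) x = 0 \<and> qform (ac_mat B) x = 0}" by blast
    then show ?thesis unfolding C qi_curve_def quadric_Int bq.C_def by simp
  qed
  have W: "S \<in> ?W \<longleftrightarrow> transpose S = S \<and> pairing (Q 1) S = 0 \<and> pairing (Q 2) S = 0" for S
    unfolding two_uple_space_def st1(2) st2(2) pairing_linear using two_equations[OF \<delta>] by auto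
  have points: "\<exists>y c. c \<noteq> 0 \<and> \<Phi> (outer r r) = c *k outer y y"
    and point': "\<exists>y. y \<noteq> 0 \<and> qform (ac_mat A') y = 0 \<and> qform (ac_mat B') y = 0" if r: "r \<in> bq.V" for r
  proof -
    have rC: "proj r \<in> C" using r by (simp add: CC bq.proj_in_C)
    then have "\<phi> (proj r) \<in> qi_curve A' B'" using iso unfolding iso_over_def bij_betw_def by blast
    then obtain y where y: "\<phi> (proj r) = proj y" "y \<noteq> 0" "qform (ac_mat A') y = 0" "qform (ac_mat B') y = 0"
      unfolding qi_curve_def quadric_Int by blast
    then show "\<exists>y. y \<noteq> 0 \<and> qform (ac_mat A') y = 0 \<and> qform (ac_mat B') y = 0" by blast
    show "\<exists>y c. c \<noteq> 0 \<and> \<Phi> (outer r r) = c *k outer y y"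
      using \<Phi>_pts[rule_format, OF rC proj_self, of y] y(1) proj_self by metis
  qed
  have iso\<psi>: "iso_over UNIV bq.C E \<psi>" using jac unfolding has_jacobian_def CC by blast
  have P: "P 1 \<in> base_conic (Q 1)" "P 2 \<in> base_conic (Q 2)"
    and \<aa>: "\<aa> 1 = fibre bq.C (Q 1) (P 1)" "\<aa> 2 = fibre bq.C (Q 2) (P 2)"
    using fibres[of 1] fibres[of 2] by (auto simp: CC)
  have squares: "\<exists>m. (\<forall>S\<in>?W. pairing m S = pairing (outer \<xi> \<xi>) (\<Phi> S)) \<and> bq.nv (qform m) \<and>
       (\<exists>N. hform UNIV 2 N \<and> (\<forall>r\<in>bq.V. qform m r * (bq.u1 r * cZ r) = N r ^ 2))" if "\<xi> \<noteq> 0" for \<xi>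
  proof -
    obtain M where M: "pushout_form C E \<psi> T M" "corresponds A B \<Phi> M (outer \<xi> \<xi>)" using \<Phi>_sq[rule_format, OF \<open>\<xi> \<noteq> 0\<close>] by blast
    obtain b where b: "\<And>p. form_div bq.C (qform M) p - 2 * form_div bq.C (\<lambda>x. x $ 1) p = 2 * b p"
      "represents bq.C E \<psi> b T" and nvM: "\<not> vanishes_on (qform M) bq.C"
      using M(1) unfolding pushout_form_def CC by blast
    obtain c where c: "c \<noteq> 0" "\<And>S. S \<in> ?W \<Longrightarrow> pairing M S = c * pairing (outer \<xi> \<xi>) (\<Phi> S)"
      using M(2) unfolding corresponds_def by blast
    have "bq.nv (qform M) \<and> (\<exists>N. hform UNIV 2 N \<and> (\<forall>r\<in>bq.V. qform M r * (bq.u1 r * cZ r) = N r ^ 2))"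
      by (rule bq.pushout_sqrt[OF iso\<psi> elliptic_curve_points[OF E] P _ nvM b(1)])
        (use order2 b(2) in \<open>simp_all only: represents_def CC \<aa>\<close>)
    then obtain N where N: "bq.nv (qform M)" "hform UNIV 2 N" "\<And>r. r \<in> bq.V \<Longrightarrow> qform M r * (bq.u1 r * cZ r) = N r ^ 2" by blast
    obtain d where d: "d ^ 2 = 1 / c" using bq.sqrt_exists by blast
    have q: "qform ((1 / c) *k M) r = 1 / c * qform M r" for r unfolding qform_pairing pairing_linear ..
    show ?thesis
    proof (intro exI[of _ "(1 / c) *k M"] conjI exI[of _ "\<lambda>r. d * N r"] ballI)
      show "pairing ((1 / c) *k M) S = pairing (outer \<xi> \<xi>) (\<Phi> S)" if "S \<in> ?W" for S
        using c(1) c(2)[OF that] by (simp add: pairing_linear)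
      show "bq.nv (qform ((1 / c) *k M))" using N(1) c(1) unfolding bq.nv_def q by simp
      show "hform UNIV 2 (\<lambda>r. d * N r)" by (rule hform_scale[OF N(2)])
      show "qform ((1 / c) *k M) r * (bq.u1 r * cZ r) = (d * N r) ^ 2" if "r \<in> bq.V" for r
        unfolding q mult.assoc N(3)[OF that] power_mult_distrib d ..
    qed
  qed
  interpret cp: companion \<alpha> \<beta> cX cY cZ cW ex ey ez ew "Q 1" "Q 2" k1 k2 ?W ?W' \<Phi>
    by unfold_locales (rule W, rule \<Phi>_bij, simp add: two_uple_space_def, erule points, erule squares)
  have YI: "Y = cp.image"
  proof -
    have "corresponds A B \<Phi> = cp.corr" by (intro ext) (simp add: corresponds_def cp.corr_def)
    then show ?thesis unfolding Y natural_map_def weil_res_conic_def conj[symmetric] cp.image_eq[symmetric] by simp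
  qed
  \<comment> \<open>A point of the second curve exists because the first one is not empty; a
    vanishing combination would contradict the Jacobian criterion there.\<close>
  have indep: "s = 0 \<and> t = 0" if 0: "s *k ac_mat A' + t *k ac_mat B' = 0" for s t
  proof -
    obtain r where "r \<in> bq.V" using bq.V_nonempty_over[of 1 0] by auto
    then obtain y where y: "y \<noteq> 0" "qform (ac_mat A') y = 0" "qform (ac_mat B') y = 0" using point' by blast
    have "s *s (ac_mat A' *v y) + t *s (ac_mat B' *v y) = 0"
      using arg_cong[OF 0, of "\<lambda>M. M *v y"] by (simp add: matrix_vector_mult_add_rdistrib mat_scale_vector)
    then show ?thesis using smooth'[OF y] by simp
  qed
  have exk: "ex \<noteq> 0" "Q 1 *v ex = 0" and eyk: "ey \<noteq> 0"
    using bq.c1.kernel_iff bq.c1.vertex bq.basis_vectors bq.coords_zero by (metis zero_neq_one)+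
  obtain e e' S where e: "e \<noteq> 0" "e' \<noteq> 0" "Q 1 *v e = 0" "Q 2 *v e' = 0" "outer e e' + outer e' e = ac_mat S"
    using conjugate_kernel_vectors[OF L \<sigma> over_L exk] unfolding conj by metis
  \<comment> \<open>The kernels are lines, so the conjugate vectors found over \<open>L\<close> are
    multiples of the vertices of the normal form, and the rational matrix \<open>S\<close> is a
    multiple of \<open>cp.S0\<close>.\<close>
  obtain c where c: "e = c *s ex" using bq.c1.kernel e(3) bq.c1.kernel_iff by metis
  obtain c' where c': "e' = c' *s ey" using bq.c2.kernel e(4) bq.c2.kernel_iff by metis
  have cc: "c * c' \<noteq> 0" using e(1,2) c c' by auto
  have S: "ac_mat S = (c * c') *k cp.S0"
    unfolding e(5)[symmetric] c c' cp.outer_linear cp.S0_def mat_scale_mult by (simp add: mult.commute)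
  have "(c * c') *k cp.S0 \<in> ?W"
    using cp.S0_in_Ws unfolding W mat_scale_transpose pairing_linear by simp
  then have "\<Phi> (ac_mat S) \<in> range ac_mat" using \<Phi>_rat[rule_format, of S] S by simp
  then obtain \<Sigma> where "\<Phi> (ac_mat S) = ac_mat \<Sigma>" by blast
  then have \<Sigma>: "ac_mat \<Sigma> = (c * c') *k \<Phi> cp.S0" unfolding S \<Phi>_scale[OF cp.S0_in_Ws] by simp
  have form: "transpose cp.H ** ac_mat \<Sigma> ** cp.H = (c * c') *k cp.Jp"
    unfolding \<Sigma> mat_scale_mult cp.S0_form ..
  obtain \<pi> :: "'k alg_closure \<Rightarrow> 'k" where
    \<pi>: "\<And>x y. \<pi> (x + y) = \<pi> x + \<pi> y" "\<And>a x. \<pi> (to_ac a * x) = a * \<pi> x" "\<pi> 1 = 1"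
    by (rule rational_projection) blast
  have \<pi>_mult: "to_ac (\<pi> (x * to_ac a)) = to_ac (\<pi> x) * to_ac a" for x a
    using \<pi>(2)[of a x] by (simp add: mult.commute)
  have \<pi>_K: "to_ac (\<pi> (to_ac a)) = to_ac a" for a
    using \<pi>(2)[of a 1] \<pi>(3) by simp
  obtain s t u where st: "(s, t) \<noteq> (0, 0)" "u \<noteq> 0"
    "s *k ac_mat A' + t *k ac_mat B' = u *k (cp.H ** cp.J ** transpose cp.H)" "to_ac (\<pi> s) = s \<and> t = 1 \<or> s = 1 \<and> t = 0"
  \<comment> \<open>The retraction followed by the inclusion plays the part of \<open>pr\<close>: it
    is additive, and rational entries pass through it.\<close>
  proof (rule cp.rational_member[OF sym' indep _ _ _ _ _ form cc, of "\<lambda>x. to_ac (\<pi> x)"])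
    show "S \<in> ?W' \<longleftrightarrow> transpose S = S \<and> pairing (ac_mat A') S = 0 \<and> pairing (ac_mat B') S = 0" for S
      by (simp add: two_uple_space_def)
    show "to_ac (\<pi> (x + y)) = to_ac (\<pi> x) + to_ac (\<pi> y)" for x y by (simp add: \<pi>)
  qed (unfold ac_mat_mult[symmetric] ac_mat_add[symmetric] ac_mat_entry, assumption, rule \<pi>_mult, rule \<pi>_mult, rule \<pi>_K, blast)
  \<comment> \<open>The retraction names the ground-field element behind the fixed coefficient; if
    \<open>t = 0\<close> the member is \<open>A'\<close> itself.\<close>
  define Q' where "Q' = (if t = 0 then 1 *k A' + 0 *k B' else \<pi> s *k A' + 1 *k B')"
  have Q'p: "Q' \<in> pencil A' B'" unfolding Q'_def pencil_def by (cases "t = 0") (auto, metis zero_neq_one, metis zero_neq_one)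
  have Q'ac: "ac_mat Q' = u *k (cp.H ** cp.J ** transpose cp.H)"
    unfolding st(3)[symmetric] Q'_def using st(4) by (auto simp: ac_mat_add ac_mat_scale)
  have det: "det Q' \<noteq> 0"
  proof
    assume "det Q' = 0"
    then have "det (ac_mat Q') = 0" by (simp add: det_ac_mat)
    then obtain x where x: "x \<noteq> 0" "ac_mat Q' *v x = 0" by (rule kernel_vector)
    then have "(cp.H ** cp.J ** transpose cp.H) *v x = 0" using st(2) unfolding Q'ac mat_scale_vector by simp
    moreover have "invertible (cp.H ** cp.J ** transpose cp.H)" using cp.QF_facts(3) by (simp add: invertible_det_nz)
    ultimately show False using x(1) matrix_inv_mult(4) by (metis matrix_vector_mult_0_right)
  qed
  have Yd: "Y = dual_quadric (ac_mat Q')"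
    unfolding YI cp.image_dual Q'ac dual_quadric_scale[OF st(2)] ..
  have symQ: "transpose Q' = Q'"
    using ns' unfolding Q'_def nonsingular_qi_def by (auto intro: transpose_pencil)
  have inv: "invertible Q'" using det by (simp add: invertible_det_nz)
  have i: "matrix_inv Q' ** Q' = mat 1" by (rule matrix_inv_mult[OF inv])
  \<comment> \<open>The inverse of the rational member supplies a matrix over the ground field for
    the image itself.\<close>
  have "transpose (matrix_inv Q') = matrix_inv Q'"
  proof -
    have "transpose (matrix_inv Q') ** Q' = transpose (Q' ** matrix_inv Q')" by (simp add: matrix_transpose_mul symQ)
    also have "\<dots> = mat 1" using matrix_inv_mult(1)[OF inv] by (simp add: transpose_mat)
    finally show ?thesis using matrix_inv_unique by metis
  qed
  moreover have "det (matrix_inv Q') \<noteq> 0" using arg_cong[OF i, of det] by (auto simp: det_mul)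
  moreover have "Y = quadric (ac_mat (matrix_inv Q'))"
  proof -
    have "matrix_inv (ac_mat Q') = ac_mat (matrix_inv Q')"
      by (rule matrix_inv_unique) (simp add: ac_mat_mult[symmetric] i ac_mat_1)
    moreover have "transpose (ac_mat Q') = ac_mat Q'" by (simp add: transpose_ac_mat symQ)
    moreover have "invertible (ac_mat Q')" using det by (simp add: invertible_det_nz det_ac_mat)
    ultimately show ?thesis unfolding Yd using dual_quadric_eq_quadric_inverse by metis
  qed
  ultimately show ?thesis using Q'p det Yd by blast
qed

end
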